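(* Let $0<r<\tfrac14$. Let $f$ be a non-vanishing continuous function on the closed disc $|z|\le (r+1/4)/2$ that is holomorphic in the open disc $|z|<(r+1/4)/2$. Let $\omega:\mathbb R\to\mathbb R$ be a continuously differentiable function with compact support. Then, as $T\to\infty$, $$\frac1T\int_T^{2T}\omega\Big(\max_{|z|\le r}\big|\zeta(\tfrac34+it+z)-f(z)\big|\Big)\,dt=\mathbb E\Big(\omega\Big(\max_{|z|\le r}\big|\zeta(\tfrac34+z,X)-f(z)\big|\Big)\Big)+O\Big((\log T)^{-\frac{(3/4-r)}{11}+o(1)}\Big),$$ where the implied constant depends on $f$, $\omega$ and $r$.
   Context: $\zeta$ denotes the Riemann zeta function. Let $\{X(p)\}_p$, indexed by the primes $p$, be a sequence of independent random variables each uniformly distributed on the unit circle of $\mathbb C$. The random Euler product $\zeta(s,X)=\prod_p(1-X(p)p^{-s})^{-1}$ converges almost surely for $\mathrm{Re}(s)>1/2$ and almost surely defines a holomorphic function on $\mathrm{Re}(s)>\sigma_0$ for every $\sigma_0>1/2$. $\mathbb E$ denotes expectation with respect to $\{X(p)\}$. *)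

theory Defs
  imports "HOL-Probability.Probability" "HOL-Complex_Analysis.Complex_Analysis"
begin

section \<open>The Riemann zeta function\<close>

text \<open>
  The analytic continuation of the Dirichlet series to the punctured plane. Existence is
  proved below (\<open>riemann_zeta_holomorphic\<close>, \<open>riemann_zeta_sums\<close>), as is uniqueness away from
  \<open>1\<close> (\<open>riemann_zeta_unique\<close>). The value at the pole \<open>1\<close> is unspecified.
\<close>

definition is_zeta :: "(complex \<Rightarrow> complex) \<Rightarrow> bool" where
  "is_zeta Z \<longleftrightarrow> Z holomorphic_on - {1} \<and>
     (\<forall>s. Re s > 1 \<longrightarrow> (\<lambda>n. 1 / of_nat (Suc n) powr s) sums Z s)"

definition riemann_zeta :: "complex \<Rightarrow> complex" where
  "riemann_zeta = (SOME Z. is_zeta Z)"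

lemma is_zeta_unique:
  assumes "is_zeta F" "is_zeta G" "s \<noteq> 1"
  shows "F s = G s"
proof (rule analytic_continuation_open[where s = "{s. Re s > 1}" and s' = "- {1}"
      and f = F and g = G and z = s])
  show "open {s. Re s > 1}" by (rule open_halfspace_Re_gt)
  show "{s. Re s > 1} \<noteq> {}" by (auto intro: exI[of _ 2])
  show "connected (- {1 :: complex})"
    using connected_punctured_universe[of "1::complex"] by simp
  show "F z = G z" if "z \<in> {s. Re s > 1}" for z
    using that assms unfolding is_zeta_def by (blast intro: sums_unique2)
qed (use assms in \<open>auto simp: is_zeta_def\<close>)

text \<open>
  Iterated forward differences of \<open>x \<mapsto> x powr (-s)\<close>; they accelerate the alternating
  series \<open>(1 - 2 powr (1 - s)) \<zeta>(s)\<close>, which continues it to the whole plane.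
\<close>

primrec fdiff :: "nat \<Rightarrow> complex \<Rightarrow> real \<Rightarrow> complex" where
  "fdiff 0 s x = of_real x powr (-s)"
| "fdiff (Suc k) s x = fdiff k s x - fdiff k s (x + 1)"

lemma fdiff_deriv:
  assumes "x > 0"
  shows "(fdiff k s has_vector_derivative (- s * fdiff k (s + 1) x)) (at x)"
  using assms
proof (induction k arbitrary: x)
  case 0
  have "((\<lambda>z. z powr (-s)) has_field_derivative (- s * of_real x powr (-s - 1))) (at (of_real x))"
    using 0 by (auto intro!: derivative_eq_intros)
  from has_vector_derivative_real_field[OF this] show ?case
    by (simp add: minus_diff_commute)
next
  case (Suc k)
  have "((\<lambda>y. fdiff k s (y + 1)) has_vector_derivative (- s * fdiff k (s + 1) (x + 1))) (at x)"
  proof -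
    have "((\<lambda>y. y + 1) has_vector_derivative 1) (at x)"
      by (auto intro!: derivative_eq_intros)
    from vector_diff_chain_at[OF this Suc.IH[of "x + 1"]] Suc.prems show ?thesis
      by (simp add: o_def)
  qed
  from has_vector_derivative_diff[OF Suc.IH[OF Suc.prems] this] show ?case
    by (simp add: algebra_simps)
qed

lemma fdiff_bound:
  assumes "x > 0" "Re s + real k \<ge> 0"
  shows "norm (fdiff k s x) \<le> (norm s + real k) ^ k * x powr (- Re s - real k)"
  using assms
proof (induction k arbitrary: x s)
  case 0
  thus ?case by (simp add: norm_powr_real_powr)
next
  case (Suc k)
  define B where "B = norm s * ((norm s + 1 + real k) ^ k * x powr (- Re s - real (Suc k)))"
  have "norm (fdiff k s (x + 1) - fdiff k s x) \<le> B * norm (x + 1 - x)"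
  proof (rule differentiable_bound[where S = "{x..x+1}"])
    fix y assume y: "y \<in> {x..x+1}"
    hence "y > 0" using Suc.prems by auto
    show "(fdiff k s has_derivative (\<lambda>h. h *\<^sub>R (- s * fdiff k (s + 1) y))) (at y within {x..x+1})"
      using fdiff_deriv[OF \<open>y > 0\<close>, of k s] unfolding has_vector_derivative_def
      by (rule has_derivative_at_withinI)
    have "norm (fdiff k (s + 1) y)
            \<le> (norm (s + 1) + real k) ^ k * y powr (- Re (s + 1) - real k)"
      using Suc.prems \<open>y > 0\<close> by (intro Suc.IH) auto
    also have "\<dots> \<le> (norm s + 1 + real k) ^ k * x powr (- Re s - real (Suc k))"
    proof (intro mult_mono power_mono)
      show "norm (s + 1) + real k \<le> norm s + 1 + real k"
        using norm_triangle_ineq[of s 1] by simp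
      have "y powr (- Re (s + 1) - real k) \<le> x powr (- Re (s + 1) - real k)"
        using y Suc.prems by (intro powr_mono2') auto
      moreover have "- Re (s + 1) - real k = - Re s - real (Suc k)" by simp
      ultimately show "y powr (- Re (s + 1) - real k) \<le> x powr (- Re s - real (Suc k))"
        by (simp only:)
    qed auto
    finally have *: "norm s * norm (fdiff k (s + 1) y) \<le> B"
      unfolding B_def by (intro mult_left_mono) auto
    have "onorm (\<lambda>h. h *\<^sub>R (- s * fdiff k (s + 1) y)) \<le> norm (- s * fdiff k (s + 1) y)"
      by (rule onorm_le) (simp add: mult.commute)
    with * show "onorm (\<lambda>h. h *\<^sub>R (- s * fdiff k (s + 1) y)) \<le> B"
      by (simp add: norm_mult)
  qed auto
  hence "norm (fdiff (Suc k) s x) \<le> B" by (simp add: norm_minus_commute)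
  also have "B \<le> (norm s + 1 + real k) * ((norm s + 1 + real k) ^ k * x powr (- Re s - real (Suc k)))"
    unfolding B_def by (intro mult_right_mono) auto
  finally show ?case by (simp add: algebra_simps)
qed

lemma fdiff_holomorphic [holomorphic_intros]:
  assumes "x > 0" shows "(\<lambda>s. fdiff k s x) holomorphic_on A"
  using assms by (induction k arbitrary: x) (auto intro!: holomorphic_intros)

lemma summable_Suc_powr:
  assumes "a < -1" shows "summable (\<lambda>n. real (Suc n) powr a)"
  using assms summable_real_powr_iff[of a] summable_Suc_iff[of "\<lambda>n. real n powr a"] by simp

lemma holomorphic_suminf:
  fixes g :: "nat \<Rightarrow> complex \<Rightarrow> complex"
  assumes "open S" "\<And>n. g n holomorphic_on S"
    and "\<And>z. z \<in> S \<Longrightarrow> \<exists>d>0. cball z d \<subseteq> S \<and>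
          (\<exists>m. summable m \<and> (\<forall>n. \<forall>w\<in>cball z d. norm (g n w) \<le> m n))"
  shows "(\<lambda>s. \<Sum>n. g n s) holomorphic_on S"
proof (rule holomorphic_uniform_sequence[OF assms(1), of "\<lambda>N s. \<Sum>n<N. g n s"])
  show "(\<lambda>s. \<Sum>n<N. g n s) holomorphic_on S" for N
    by (intro holomorphic_intros assms)
  fix z assume "z \<in> S"
  from assms(3)[OF this] obtain d m where
    "d > 0" "cball z d \<subseteq> S" "summable m" "\<And>n w. w \<in> cball z d \<Longrightarrow> norm (g n w) \<le> m n"
    by blast
  thus "\<exists>d>0. cball z d \<subseteq> S \<and>
          uniform_limit (cball z d) (\<lambda>N s. \<Sum>n<N. g n s) (\<lambda>s. \<Sum>n. g n s) sequentially"
    by (intro exI[of _ d] conjI Weierstrass_m_test[of _ _ m]) auto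
qed

text \<open>The shape of majorant used twice below.\<close>

lemma powr_majorant:
  fixes g :: "nat \<Rightarrow> complex \<Rightarrow> complex"
  assumes "Re z + real k > 1"
    and bd: "\<And>n s. Re s + real k > 1 \<Longrightarrow>
          norm (g n s) \<le> (norm s + real k) ^ k * real (Suc n) powr (- Re s - real k)"
  shows "\<exists>d>0. cball z d \<subseteq> {s. Re s + real k > 1} \<and>
          (\<exists>m. summable m \<and> (\<forall>n. \<forall>w\<in>cball z d. norm (g n w) \<le> m n))"
proof -
  define d where "d = (Re z + real k - 1) / 2"
  define m where "m n = (norm z + d + real k) ^ k * real (Suc n) powr (d - Re z - real k)" for n
  have d: "d > 0" "Re z + real k = 2 * d + 1" using assms(1) by (auto simp: d_def field_simps)
  have Re: "\<bar>Re w - Re z\<bar> \<le> d" if "w \<in> cball z d" for w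
    using that abs_Re_le_cmod[of "w - z"] by (simp add: dist_norm norm_minus_commute)
  have sub: "cball z d \<subseteq> {s. Re s + real k > 1}"
  proof
    fix w assume "w \<in> cball z d"
    from Re[OF this] d show "w \<in> {s. Re s + real k > 1}" by auto
  qed
  have "summable m" unfolding m_def using d by (intro summable_mult summable_Suc_powr) auto
  moreover have "norm (g n w) \<le> m n" if w: "w \<in> cball z d" for n w
  proof -
    have "norm (g n w) \<le> (norm w + real k) ^ k * real (Suc n) powr (- Re w - real k)"
      using bd sub w by blast
    also have "\<dots> \<le> m n"
      unfolding m_def
    proof (intro mult_mono power_mono powr_mono)
      show "norm w + real k \<le> norm z + d + real k"
        using w norm_triangle_ineq2[of w z] by (simp add: dist_norm norm_minus_commute)
      show "- Re w - real k \<le> d - Re z - real k" using Re[OF w] by auto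
    qed (use d in auto)
    finally show ?thesis .
  qed
  ultimately show ?thesis using d sub by blast
qed

definition alt_rem :: "nat \<Rightarrow> complex \<Rightarrow> complex" where
  "alt_rem k s = (\<Sum>n. (-1) ^ n * fdiff k s (real (Suc n)))"

definition eta_acc :: "nat \<Rightarrow> complex \<Rightarrow> complex" where
  "eta_acc k s = (\<Sum>j<k. fdiff j s 1 / 2 ^ Suc j) + alt_rem k s / 2 ^ k"

lemma fdiff_bound':
  assumes "Re s + real k > 1"
  shows "norm ((-1) ^ n * fdiff k s (real (Suc n)))
           \<le> (norm s + real k) ^ k * real (Suc n) powr (- Re s - real k)"
  using fdiff_bound[of "real (Suc n)" s k] assms by (simp add: norm_mult norm_power)

lemma alt_rem_summable:
  assumes "Re s + real k > 1"
  shows "summable (\<lambda>n. (-1) ^ n * fdiff k s (real (Suc n)))"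
proof (rule summable_comparison_test')
  show "summable (\<lambda>n. (norm s + real k) ^ k * real (Suc n) powr (- Re s - real k))"
    using assms by (intro summable_mult summable_Suc_powr) auto
qed (use fdiff_bound'[OF assms] in blast)

lemma open_halfspace_shift: "open {s. Re s + c > a}"
  using open_halfspace_Re_gt[of "a - c"] by (simp add: algebra_simps)

lemma eta_acc_holomorphic: "eta_acc k holomorphic_on {s. Re s + real k > 1}"
proof -
  have "alt_rem k holomorphic_on {s. Re s + real k > 1}"
    unfolding alt_rem_def
  proof (rule holomorphic_suminf)
    show "\<exists>d>0. cball z d \<subseteq> {s. Re s + real k > 1} \<and>
          (\<exists>m. summable m \<and> (\<forall>n. \<forall>w\<in>cball z d. norm ((-1) ^ n * fdiff k w (real (Suc n))) \<le> m n))"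
      if "z \<in> {s. Re s + real k > 1}" for z
      using that by (intro powr_majorant fdiff_bound') auto
  qed (auto intro!: holomorphic_intros open_halfspace_shift)
  thus ?thesis unfolding eta_acc_def by (intro holomorphic_intros) auto
qed

lemma eta_acc_Suc:
  assumes "Re s + real k > 1"
  shows "eta_acc (Suc k) s = eta_acc k s"
proof -
  let ?a = "\<lambda>n. fdiff k s (real (Suc n))"
  have S: "(\<lambda>n. (-1) ^ n * ?a n) sums alt_rem k s"
    unfolding alt_rem_def using alt_rem_summable[OF assms] by (rule summable_sums)
  hence "(\<lambda>n. (-1) ^ Suc n * ?a (Suc n)) sums (alt_rem k s - ?a 0)"
    by (subst sums_Suc_iff) simp
  from sums_add[OF S this]
  have "(\<lambda>n. (-1) ^ n * fdiff (Suc k) s (real (Suc n))) sums (2 * alt_rem k s - ?a 0)"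
    by (simp add: algebra_simps)
  hence "alt_rem (Suc k) s = 2 * alt_rem k s - fdiff k s 1"
    unfolding alt_rem_def by (simp add: sums_iff)
  hence "alt_rem (Suc k) s / 2 ^ Suc k = alt_rem k s / 2 ^ k - fdiff k s 1 / 2 ^ Suc k"
    by (simp add: diff_divide_distrib)
  thus ?thesis unfolding eta_acc_def by simp
qed

lemma eta_acc_mono:
  assumes "Re s + real k > 1" "k \<le> l"
  shows "eta_acc l s = eta_acc k s"
  using assms(2) by (induction l rule: dec_induct) (use assms(1) in \<open>auto simp: eta_acc_Suc\<close>)

definition eta_fun :: "complex \<Rightarrow> complex" where
  "eta_fun s = eta_acc (nat (\<lceil>1 - Re s\<rceil> + 1)) s"

lemma eta_fun_eq:
  assumes "Re s + real k > 1"
  shows "eta_fun s = eta_acc k s"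
proof -
  let ?l = "nat (\<lceil>1 - Re s\<rceil> + 1)"
  have "Re s + real ?l > 1" by linarith
  thus ?thesis unfolding eta_fun_def
    using assms eta_acc_mono[of s k ?l] eta_acc_mono[of s ?l k] by (metis linear)
qed

lemma eta_fun_holomorphic: "eta_fun holomorphic_on A"
proof -
  have "eta_fun holomorphic_on (\<Union>k. {s. Re s + real k > 1})"
  proof (rule holomorphic_on_UN_open)
    show "eta_fun holomorphic_on {s. Re s + real k > 1}" for k
      using eta_acc_holomorphic by (rule holomorphic_transform) (simp add: eta_fun_eq)
  qed (rule open_halfspace_shift)
  moreover have "s \<in> (\<Union>k. {s. Re s + real k > 1})" for s
    using reals_Archimedean2[of "1 - Re s"] by (auto simp: algebra_simps)
  ultimately show ?thesis by (meson holomorphic_on_subset subsetI)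
qed

lemma dirichlet_summable:
  assumes "Re s > 1" shows "summable (\<lambda>n. of_nat (Suc n) powr (-s) :: complex)"
proof (rule summable_norm_cancel)
  have "(\<lambda>n. norm (of_nat (Suc n) powr (-s) :: complex)) = (\<lambda>n. real (Suc n) powr (- Re s))"
    by (intro ext, subst norm_powr_real_powr) auto
  thus "summable (\<lambda>n. norm (of_nat (Suc n) powr (-s) :: complex))"
    using assms summable_Suc_powr[of "- Re s"] by simp
qed

lemma eta_fun_eq_zeta:
  assumes "Re s > 1"
  shows "eta_fun s = (1 - 2 powr (1 - s)) * (\<Sum>n. of_nat (Suc n) powr (-s))"
proof -
  define a where "a n = (of_nat (Suc n) powr (-s) :: complex)" for n
  define S where "S = (\<Sum>n. a n)"
  have S: "a sums S" unfolding S_def a_def using dirichlet_summable[OF assms] by (rule summable_sums)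
  have ev: "(\<lambda>n. if odd n then a n else 0) sums (2 powr (-s) * S)"
  proof -
    have "a (2 * n + 1) = 2 powr (-s) * a n" for n
    proof -
      have "a (2 * n + 1) = (of_real 2 * of_real (real (Suc n))) powr (-s)"
        unfolding a_def by (rule arg_cong[of _ _ "\<lambda>z. z powr (-s)"]) simp
      also have "\<dots> = of_real 2 powr (-s) * of_real (real (Suc n)) powr (-s)"
        by (rule powr_times_real) auto
      finally show ?thesis unfolding a_def by simp
    qed
    hence "(\<lambda>n. a (2 * n + 1)) sums (2 powr (-s) * S)" using S by (simp add: sums_mult)
    moreover have "(\<lambda>n. a (2 * n + 1)) = (\<lambda>n. (\<lambda>n. if odd n then a n else 0) (2 * n + 1))" by simp
    ultimately have "(\<lambda>n. (\<lambda>n. if odd n then a n else 0) (2 * n + 1)) sums (2 powr (-s) * S)" by simp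
    thus ?thesis
      by (subst (asm) sums_mono_reindex[of "\<lambda>n. 2 * n + 1"])
         (auto simp: strict_mono_def elim: oddE)
  qed
  have "(\<lambda>n. a n - 2 * (if odd n then a n else 0)) sums (S - 2 * (2 powr (-s) * S))"
    by (intro sums_diff sums_mult S ev)
  also have "(\<lambda>n. a n - 2 * (if odd n then a n else 0)) = (\<lambda>n. (-1) ^ n * a n)" by auto
  also have "S - 2 * (2 powr (-s) * S) = (1 - 2 powr (1 - s)) * S"
    by (simp add: powr_diff powr_minus field_simps)
  finally have "alt_rem 0 s = (1 - 2 powr (1 - s)) * S"
    unfolding alt_rem_def a_def by (simp add: sums_iff)
  moreover have "eta_fun s = eta_acc 0 s" using assms by (intro eta_fun_eq) auto
  ultimately show ?thesis unfolding S_def a_def eta_acc_def by simp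
qed

text \<open>
  In \<open>Re s > 0\<close> the factor \<open>1 - 2 powr (1 - s)\<close> has zeros other than \<open>1\<close>, so there the
  continuation is obtained by comparing the series with an integral.
\<close>

definition zeta_term :: "nat \<Rightarrow> complex \<Rightarrow> complex" where
  "zeta_term n s = of_nat (Suc n) powr (-s)
     - (of_nat (Suc n) powr (1 - s) - of_nat (Suc (Suc n)) powr (1 - s)) / (s - 1)"

definition zeta_pos :: "complex \<Rightarrow> complex" where
  "zeta_pos s = 1 / (s - 1) + (\<Sum>n. zeta_term n s)"

lemma zeta_term_bound:
  assumes "Re s > 0" "s \<noteq> 1"
  shows "norm (zeta_term n s) \<le> norm s * real (Suc n) powr (- Re s - 1)"
proof -
  define x where "x = real (Suc n)"
  have x: "x > 0" by (simp add: x_def)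
  define B where "B = norm s * x powr (- Re s - 1)"
  define \<phi> where "\<phi> u = of_real u * of_real x powr (-s) + of_real (x + u) powr (1 - s) / (s - 1)" for u
  have diff: "norm (of_real (x + u) powr (-s) - of_real x powr (-s)) \<le> B" if u: "u \<in> {0..1}" for u
  proof -
    have "norm (fdiff 0 s (x + u) - fdiff 0 s x) \<le> B * norm (x + u - x)"
    proof (rule differentiable_bound[where S = "{x..x+1}"])
      fix y assume y: "y \<in> {x..x+1}"
      hence "y > 0" using x by auto
      show "(fdiff 0 s has_derivative (\<lambda>h. h *\<^sub>R (- s * fdiff 0 (s + 1) y))) (at y within {x..x+1})"
        using fdiff_deriv[OF \<open>y > 0\<close>, of 0 s] unfolding has_vector_derivative_def
        by (rule has_derivative_at_withinI)
      have "norm (fdiff 0 (s + 1) y) = y powr (- Re s - 1)"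
        using \<open>y > 0\<close> by (simp add: norm_powr_real_powr)
      also have "\<dots> \<le> x powr (- Re s - 1)"
        using y x assms by (intro powr_mono2') auto
      finally have *: "norm s * norm (fdiff 0 (s + 1) y) \<le> B"
        unfolding B_def by (intro mult_left_mono) auto
      have "onorm (\<lambda>h. h *\<^sub>R (- s * fdiff 0 (s + 1) y)) \<le> norm (- s * fdiff 0 (s + 1) y)"
        by (rule onorm_le) (simp add: mult.commute)
      also have "\<dots> \<le> B" using * by (simp only: norm_mult norm_minus_cancel)
      finally show "onorm (\<lambda>h. h *\<^sub>R (- s * fdiff 0 (s + 1) y)) \<le> B" .
    qed (use u in auto)
    also have "\<dots> \<le> B * 1" using u by (intro mult_left_mono) (auto simp: B_def)
    finally show ?thesis by simp
  qed
  have "norm (\<phi> 1 - \<phi> 0) \<le> B * norm (1 - 0 :: real)"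
  proof (rule differentiable_bound[where S = "{0..1}"])
    fix u :: real assume u: "u \<in> {0..1}"
    hence xu: "x + u > 0" using x by auto
    have d: "((\<lambda>z. z * of_real x powr (-s) + (of_real x + z) powr (1 - s) / (s - 1)) has_field_derivative
            (of_real x powr (-s) - of_real (x + u) powr (-s))) (at (of_real u))"
    proof -
      have "of_real x + of_real u \<notin> (\<real>\<^sub>\<le>\<^sub>0 :: complex set)"
        using xu by (simp flip: of_real_add)
      thus ?thesis using assms
        by (auto intro!: derivative_eq_intros simp: divide_simps) (simp add: algebra_simps)
    qed
    from has_vector_derivative_real_field[OF this]
    have "(\<phi> has_vector_derivative (of_real x powr (-s) - of_real (x + u) powr (-s))) (at u)"
      unfolding \<phi>_def by simp
    thus "(\<phi> has_derivative (\<lambda>h. h *\<^sub>R (of_real x powr (-s) - of_real (x + u) powr (-s))))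
            (at u within {0..1})"
      unfolding has_vector_derivative_def by (rule has_derivative_at_withinI)
    have "onorm (\<lambda>h. h *\<^sub>R (of_real x powr (-s) - of_real (x + u) powr (-s)))
            \<le> norm (of_real x powr (-s) - of_real (x + u) powr (-s))"
      by (rule onorm_le) (simp add: mult.commute)
    also have "\<dots> \<le> B" using diff[OF u] by (simp add: norm_minus_commute)
    finally show "onorm (\<lambda>h. h *\<^sub>R (of_real x powr (-s) - of_real (x + u) powr (-s))) \<le> B" .
  qed auto
  moreover have "\<phi> 1 - \<phi> 0 = zeta_term n s"
    unfolding \<phi>_def zeta_term_def x_def by (simp add: diff_divide_distrib add_ac)
  ultimately show ?thesis unfolding B_def x_def by simp
qed

lemma zeta_pos_holomorphic: "zeta_pos holomorphic_on ({s. Re s > 0} - {1})"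
proof -
  have op: "open ({s. Re s > 0} - {1})" by (intro open_Diff open_halfspace_Re_gt) auto
  have "(\<lambda>s. \<Sum>n. zeta_term n s) holomorphic_on ({s. Re s > 0} - {1})"
  proof (rule holomorphic_suminf[OF op])
    show "zeta_term n holomorphic_on {s. Re s > 0} - {1}" for n
      unfolding zeta_term_def by (intro holomorphic_intros) auto
    fix z :: complex assume z: "z \<in> {s. Re s > 0} - {1}"
    define g where "g n s = (if s = 1 then 0 else zeta_term n s)" for n s
    obtain d1 m where 1: "d1 > 0" "cball z d1 \<subseteq> {s. Re s + real 1 > 1}" "summable m"
      "\<And>n w. w \<in> cball z d1 \<Longrightarrow> norm (g n w) \<le> m n"
    proof -
      have "norm (g n s) \<le> (norm s + real 1) ^ 1 * real (Suc n) powr (- Re s - real 1)"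
        if "Re s + real 1 > 1" for n s
      proof (cases "s = 1")
        case False
        hence "norm (g n s) \<le> norm s * real (Suc n) powr (- Re s - 1)"
          using zeta_term_bound[of s n] that by (simp add: g_def)
        also have "\<dots> \<le> (norm s + 1) * real (Suc n) powr (- Re s - 1)"
          by (intro mult_right_mono) auto
        finally show ?thesis by simp
      qed (auto simp: g_def)
      from powr_majorant[of z 1 g, OF _ this] z that show ?thesis by force
    qed
    obtain d2 where 2: "d2 > 0" "cball z d2 \<subseteq> {s. Re s > 0} - {1}"
      using op z open_contains_cball by blast
    have "norm (zeta_term n w) \<le> m n" if w: "w \<in> cball z (min d1 d2)" for n w
    proof -
      have "w \<noteq> 1" using w 2 by auto
      thus ?thesis using 1(4)[of w n] w by (auto simp: g_def)
    qed
    thus "\<exists>d>0. cball z d \<subseteq> {s. Re s > 0} - {1} \<and>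
            (\<exists>m. summable m \<and> (\<forall>n. \<forall>w\<in>cball z d. norm (zeta_term n w) \<le> m n))"
      using 1 2 by (intro exI[of _ "min d1 d2"]) (auto intro!: exI[of _ m])
  qed
  thus ?thesis unfolding zeta_pos_def by (intro holomorphic_intros) auto
qed

lemma zeta_pos_sums:
  assumes "Re s > 1"
  shows "(\<lambda>n. of_nat (Suc n) powr (-s)) sums zeta_pos s"
proof -
  have s1: "s \<noteq> 1" using assms by auto
  have "(\<lambda>n. norm (of_nat (Suc n) powr (1 - s) :: complex)) = (\<lambda>n. real (Suc n) powr (1 - Re s))"
    by (intro ext, subst norm_powr_real_powr) auto
  moreover have "(\<lambda>n. real (Suc n) powr (1 - Re s)) \<longlonglongrightarrow> 0"
    using assms
    by (intro LIMSEQ_Suc[of "\<lambda>n. real n powr (1 - Re s)"] tendsto_neg_powr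
          filterlim_real_sequentially) auto
  ultimately have lim: "(\<lambda>n. of_nat (Suc n) powr (1 - s) :: complex) \<longlonglongrightarrow> 0"
    by (metis tendsto_norm_zero_cancel)
  have tel: "(\<lambda>n. of_nat (Suc n) powr (1 - s) - of_nat (Suc (Suc n)) powr (1 - s) :: complex)
          sums (1 - 0)"
    using telescope_sums'[OF lim] by simp
  have "(\<lambda>n. of_nat (Suc n) powr (-s) -
          (of_nat (Suc n) powr (1 - s) - of_nat (Suc (Suc n)) powr (1 - s)) / (s - 1)) sums
        ((\<Sum>n. of_nat (Suc n) powr (-s)) - (1 - 0) / (s - 1))"
    using sums_diff[OF summable_sums[OF dirichlet_summable[OF assms]] sums_divide[OF tel]] .
  hence "(\<Sum>n. zeta_term n s) = (\<Sum>n. of_nat (Suc n) powr (-s)) - 1 / (s - 1)"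
    unfolding zeta_term_def by (simp add: sums_iff)
  thus ?thesis
    unfolding zeta_pos_def using summable_sums[OF dirichlet_summable[OF assms]] by simp
qed

lemma eta_fun_eq_zeta_pos:
  assumes "Re s > 0" "s \<noteq> 1"
  shows "eta_fun s = (1 - 2 powr (1 - s)) * zeta_pos s"
proof (rule analytic_continuation_open[where s = "{s. Re s > 1}" and s' = "{s. Re s > 0} - {1}"
      and f = eta_fun and g = "\<lambda>s. (1 - 2 powr (1 - s)) * zeta_pos s" and z = s])
  show "connected ({s. Re s > 0} - {1})"
    by (intro connected_open_delete open_halfspace_Re_gt convex_connected convex_halfspace_Re_gt) auto
  show "open ({s. Re s > 0} - {1})" by (intro open_Diff open_halfspace_Re_gt) auto
  show "(\<lambda>s. (1 - 2 powr (1 - s)) * zeta_pos s) holomorphic_on {s. Re s > 0} - {1}"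
    by (intro holomorphic_intros zeta_pos_holomorphic) auto
  show "eta_fun z = (1 - 2 powr (1 - z)) * zeta_pos z" if "z \<in> {s. Re s > 1}" for z
    using that eta_fun_eq_zeta[of z] zeta_pos_sums[of z] by (simp add: sums_iff)
  show "{s. Re s > 1} \<noteq> {}" by (auto intro: exI[of _ 2])
qed (use assms in \<open>auto intro!: open_halfspace_Re_gt eta_fun_holomorphic\<close>)

lemma two_powr_neq_1:
  assumes "Re s < 1" shows "2 powr (1 - s) \<noteq> 1"
proof
  assume "2 powr (1 - s) = 1"
  hence "norm (of_real 2 powr (1 - s)) = 1" by simp
  hence "2 powr (1 - Re s) = 1" by (subst (asm) norm_powr_real_powr) auto
  thus False using assms by (simp add: powr_eq_one_iff_gen)
qed

lemma is_zeta_exists: "\<exists>Z. is_zeta Z"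
proof -
  define Z where "Z s = (if Re s > 0 then zeta_pos s else eta_fun s / (1 - 2 powr (1 - s)))" for s
  have "Z holomorphic_on ({s. Re s > 0} - {1})"
    using zeta_pos_holomorphic by (rule holomorphic_transform) (simp add: Z_def)
  moreover have "Z holomorphic_on {s. Re s < 1}"
  proof (rule holomorphic_transform)
    show "(\<lambda>s. eta_fun s / (1 - 2 powr (1 - s))) holomorphic_on {s. Re s < 1}"
      using two_powr_neq_1 by (auto intro!: holomorphic_intros eta_fun_holomorphic)
    show "eta_fun s / (1 - 2 powr (1 - s)) = Z s" if "s \<in> {s. Re s < 1}" for s
    proof (cases "Re s > 0")
      case True
      moreover from that have "s \<noteq> 1" by auto
      ultimately show ?thesis
        using two_powr_neq_1[of s] that eta_fun_eq_zeta_pos[of s] by (simp add: Z_def)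
    qed (simp add: Z_def)
  qed
  ultimately have "Z holomorphic_on ({s. Re s > 0} - {1}) \<union> {s. Re s < 1}"
    by (intro holomorphic_on_Un open_Diff open_halfspace_Re_gt open_halfspace_Re_lt) auto
  hence "Z holomorphic_on - {1}"
    by (rule holomorphic_on_subset) auto
  moreover have "(\<lambda>n. 1 / of_nat (Suc n) powr s) sums Z s" if "Re s > 1" for s
    using zeta_pos_sums[OF that] that by (simp add: Z_def powr_minus field_simps)
  ultimately show ?thesis unfolding is_zeta_def by blast
qed

lemma is_zeta_riemann_zeta: "is_zeta riemann_zeta"
  unfolding riemann_zeta_def using is_zeta_exists by (rule someI_ex)

lemma riemann_zeta_holomorphic: "riemann_zeta holomorphic_on - {1}"
  and riemann_zeta_sums: "Re s > 1 \<Longrightarrow> (\<lambda>n. 1 / of_nat (Suc n) powr s) sums riemann_zeta s"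
  using is_zeta_riemann_zeta unfolding is_zeta_def by blast+

lemma riemann_zeta_unique: "is_zeta Z \<Longrightarrow> s \<noteq> 1 \<Longrightarrow> Z s = riemann_zeta s"
  using is_zeta_unique is_zeta_riemann_zeta by blast


section \<open>The random Euler product\<close>

definition uniform_circle :: "complex measure" where
  "uniform_circle = distr (uniform_measure lborel {0..<2 * pi}) borel cis"

text \<open>
  In the strip \<open>1/2 < Re s \<le> 1\<close> the product over the primes converges only conditionally;
  the library's infinite product takes the factors in increasing order. Where it diverges
  (a null event) the value is arbitrary. Since a supremum of \<open>random_zeta X x s\<close> over
  uncountably many \<open>s\<close> might for this reason fail to be measurable on that null event,
  expectations involving it are taken with respect to the completion of the measure.
\<close>

definition random_zeta :: "(nat \<Rightarrow> 'a \<Rightarrow> complex) \<Rightarrow> 'a \<Rightarrow> complex \<Rightarrow> complex" where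
  "random_zeta X x s = (\<Prod>p. if prime p then 1 / (1 - X p x * of_nat p powr (-s)) else 1)"

end

theory Submission
  imports Defs "HOL-Number_Theory.Number_Theory" "HOL-Real_Asymp.Real_Asymp"
begin

text \<open>
  Both \<open>\<zeta>(3/4 + it + z)\<close> on \<open>[T, 2T]\<close> and \<open>\<zeta>(3/4 + z, X)\<close> are close in mean square, uniformly in
  \<open>|z| \<le> r\<close>, to \<open>exp Q\<close>, where \<open>Q(z) = \<Sum>n\<le>Y. \<kappa>(n) \<chi>(n) n powr (-3/4 - z)\<close> is the truncated series of
  \<open>log \<zeta>\<close>, twisted by the character \<open>\<chi>(n) = n powr (-it)\<close> or \<open>\<chi>(n) = X(n)\<close>. For \<open>\<zeta>\<close> itself this
  rests on the mean value theorem for Dirichlet polynomials, applied to the difference of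
  \<open>\<eta>(s) = (1 - 2 powr (1 - s)) \<zeta>(s)\<close> and \<open>(1 - 2 powr (1 - s)) exp Q\<close>: the Taylor polynomial of \<open>exp Q\<close>
  has coefficients in \<open>[0, 1]\<close>, equal to \<open>1\<close> up to \<open>Y\<close>. By the maximum principle the supremum is a
  function of the values of \<open>Q\<close> on the circle, and \<open>m\<close> points suffice. Fejer interpolation turns the
  functional into a trigonometric sum in these values, and the expectation of each term is expanded in
  moments of \<open>Q\<close> of order below \<open>2k\<close>. Such moments agree for the two characters up to \<open>O(Y^(2k) / T)\<close>,
  because both are (almost) orthogonal. With \<open>u = (log T) powr (1/50)\<close> and \<open>Y\<close>, \<open>m\<close>, \<open>k\<close> powers of \<open>u\<close>, all
  errors are \<open>O(1 / u^4)\<close>.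
\<close>

section \<open>Dirichlet convolution powers\<close>

text \<open>A logarithm of \<zeta> need not exist near \<open>3/4 + it\<close>, since \<zeta> might
  vanish there; hence \<zeta> itself, not its logarithm, is compared with \<open>exp Q\<close>. The
  detour through \<eta> supplies a Dirichlet polynomial of length a little above \<open>T\<close>
  with a negligible remainder, and the factor \<open>1 - 2 powr (1 - s)\<close> stays away from 0 as
  long as \<open>Re s\<close> stays below 1 by a fixed amount. The second obstacle is that
  \<open>exp\<close> is not Lipschitz. The compact support of \<omega> confines the functional to
  bounded values of \<open>exp Q\<close>, and every event on which \<open>Q\<close> is large is paid
  for by its mean square. The rate is limited by the correlations on \<open>[T, 2T]\<close>:
  comparing moments below order \<open>2k\<close> costs \<open>Y ^ (2k) / T\<close>, up to further
  powers of \<open>u\<close> with exponents of order \<open>k\<close>. With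
  \<open>k = u ^ 45\<close> this forces \<open>ln T\<close> to exceed a constant times
  \<open>u ^ 45 * ln u\<close>, and the exponent 50 in the definition of \<open>u\<close> leaves
  room for that. Since \<open>(3/4 - r) / 11 < 3/44 < 4/50\<close>, an error
  \<open>1 / u ^ 4\<close> is enough for every \<open>r\<close>, so the exponents can be chosen
  generously.\<close>

definition dconv :: "(nat \<Rightarrow> 'a :: comm_semiring_1) \<Rightarrow> (nat \<Rightarrow> 'a) \<Rightarrow> nat \<Rightarrow> 'a" where
  "dconv a b n = (\<Sum>d | d dvd n. a d * b (n div d))"

primrec dpow :: "(nat \<Rightarrow> 'a :: comm_semiring_1) \<Rightarrow> nat \<Rightarrow> nat \<Rightarrow> 'a" where
  "dpow a 0 = (\<lambda>n. if n = 1 then 1 else 0)"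
| "dpow a (Suc k) = dconv a (dpow a k)"

text \<open>Every number divides 0, so the sum ranges over an infinite set and takes its default
  value. The index 0 thereby drops out of all convolution powers.\<close>

lemma dconv_0 [simp]: "dconv a b 0 = 0"
  by (simp add: dconv_def)

lemma dpow_0 [simp]: "dpow a k 0 = 0"
  by (cases k) auto

lemma dconv_support:
  assumes "\<And>n. n \<notin> {1..M} \<Longrightarrow> a n = 0" "\<And>n. n \<notin> {1..N} \<Longrightarrow> b n = 0" "n \<notin> {1..M * N}"
  shows "dconv a b n = 0"
proof (cases "n = 0")
  case False
  have "a d * b (n div d) = 0" if "d dvd n" for d
  proof (rule ccontr)
    assume "a d * b (n div d) \<noteq> 0"
    hence "a d \<noteq> 0" "b (n div d) \<noteq> 0" by auto
    hence "d \<in> {1..M}" "n div d \<in> {1..N}" using assms(1,2) by blast+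
    hence "d * (n div d) \<in> {1..M * N}" using mult_le_mono[of d M "n div d" N] by auto
    moreover have "d * (n div d) = n" using that by simp
    ultimately show False using assms(3) by simp
  qed
  thus ?thesis by (simp add: dconv_def)
qed auto

lemma dpow_support:
  assumes "\<And>n. n \<notin> {1..M} \<Longrightarrow> a n = 0" "n \<notin> {1..M ^ k}"
  shows "dpow a k n = 0"
  using assms(2)
proof (induction k arbitrary: n)
  case (Suc k)
  show ?case unfolding dpow.simps
    by (rule dconv_support[OF assms(1) Suc.IH]) (use Suc.prems in auto)
qed auto

text \<open>For completely multiplicative \<open>w\<close>, Dirichlet polynomials multiply by
  convolving their coefficients. The pairs \<open>(n, d)\<close> with \<open>d\<close> dividing
  \<open>n\<close> are the images \<open>(m * k, m)\<close> of pairs \<open>(m, k)\<close>, up to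
  terms that vanish because of the supports.\<close>

lemma dconv_eval:
  fixes a b w :: "nat \<Rightarrow> 'a :: comm_semiring_1"
  assumes a: "\<And>n. n \<notin> {1..M} \<Longrightarrow> a n = 0" and b: "\<And>n. n \<notin> {1..N} \<Longrightarrow> b n = 0"
    and mult: "\<And>m n. m > 0 \<Longrightarrow> n > 0 \<Longrightarrow> w (m * n) = w m * w n"
  shows "(\<Sum>m\<in>{1..M}. a m * w m) * (\<Sum>n\<in>{1..N}. b n * w n) =
         (\<Sum>n\<in>{1..M * N}. dconv a b n * w n)"
proof -
  define T where "T = Sigma {1..M * N} (\<lambda>n. {d. d dvd n})"
  have finT: "finite T" unfolding T_def by (rule finite_SigmaI) auto
  have "(\<Sum>n\<in>{1..M * N}. dconv a b n * w n)
      = (\<Sum>n\<in>{1..M * N}. \<Sum>d | d dvd n. a d * b (n div d) * w n)"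
    by (simp add: dconv_def sum_distrib_right)
  also have "\<dots> = (\<Sum>(n, d)\<in>T. a d * b (n div d) * w n)"
    unfolding T_def by (subst sum.Sigma) auto
  also have "\<dots> = (\<Sum>(n, d)\<in>(\<lambda>(m, k). (m * k, m)) ` ({1..M} \<times> {1..N}). a d * b (n div d) * w n)"
  proof (rule sum.mono_neutral_right[OF finT])
    show "(\<lambda>(m, k). (m * k, m)) ` ({1..M} \<times> {1..N}) \<subseteq> T"
      by (auto simp: T_def mult_le_mono)
    show "\<forall>i\<in>T - (\<lambda>(m, k). (m * k, m)) ` ({1..M} \<times> {1..N}).
            (case i of (n, d) \<Rightarrow> a d * b (n div d) * w n) = 0"
    proof
      fix i assume i: "i \<in> T - (\<lambda>(m, k). (m * k, m)) ` ({1..M} \<times> {1..N})"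
      obtain n d where nd: "i = (n, d)" by force
      have "d dvd n" using i nd by (auto simp: T_def)
      hence "(n, d) = (\<lambda>(m, k). (m * k, m)) (d, n div d)" by simp
      hence "(d, n div d) \<notin> {1..M} \<times> {1..N}" using i nd by blast
      hence "d \<notin> {1..M} \<or> n div d \<notin> {1..N}" by blast
      thus "(case i of (n, d) \<Rightarrow> a d * b (n div d) * w n) = 0"
        using a b nd by auto
    qed
  qed
  also have "\<dots> = (\<Sum>(m, k)\<in>{1..M} \<times> {1..N}. a m * b k * w (m * k))"
    by (subst sum.reindex) (auto simp: inj_on_def case_prod_unfold intro!: sum.cong)
  also have "\<dots> = (\<Sum>(m, k)\<in>{1..M} \<times> {1..N}. (a m * w m) * (b k * w k))"
    by (intro sum.cong) (auto simp: mult mult_ac)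
  also have "\<dots> = (\<Sum>m\<in>{1..M}. a m * w m) * (\<Sum>n\<in>{1..N}. b n * w n)"
    by (simp add: sum_product sum.cartesian_product)
  finally show ?thesis ..
qed

text \<open>Used with several weights: a character turns powers of a random polynomial into
  polynomials, \<open>w = 1\<close> bounds sums of coefficients, and a real power of
  \<open>n\<close> evaluates the variance in the moment bound.\<close>

lemma dpow_eval:
  fixes a w :: "nat \<Rightarrow> 'a :: comm_semiring_1"
  assumes a: "\<And>n. n \<notin> {1..M} \<Longrightarrow> a n = 0"
    and mult: "\<And>m n. m > 0 \<Longrightarrow> n > 0 \<Longrightarrow> w (m * n) = w m * w n" and one: "w 1 = 1"
  shows "(\<Sum>n\<in>{1..M}. a n * w n) ^ k = (\<Sum>n\<in>{1..M ^ k}. dpow a k n * w n)"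
proof (induction k)
  case (Suc k)
  have "(\<Sum>n\<in>{1..M}. a n * w n) ^ Suc k
      = (\<Sum>n\<in>{1..M}. a n * w n) * (\<Sum>n\<in>{1..M ^ k}. dpow a k n * w n)"
    by (simp only: power_Suc Suc.IH)
  also have "\<dots> = (\<Sum>n\<in>{1..M * M ^ k}. dconv a (dpow a k) n * w n)"
    by (rule dconv_eval[OF a dpow_support[OF a] mult])
  finally show ?case by simp
qed (use one in auto)

text \<open>Both sides sum over the pairs \<open>(d, e)\<close> with \<open>d * e\<close> dividing
  \<open>n\<close>, and exchanging \<open>d\<close> and \<open>e\<close> identifies them. This law
  does the work of associativity and commutativity in the power rule below.\<close>

lemma dconv_left_commute: "dconv a (dconv b c) n = dconv b (dconv a c) n"
proof (cases "n = 0")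
  case False
  have eq: "dconv a (dconv b c) n
      = (\<Sum>(d, e)\<in>Sigma {d. d dvd n} (\<lambda>d. {e. e dvd n div d}). a d * b e * c (n div d div e))" for a b
    using False
    by (subst sum.Sigma[symmetric])
       (auto simp: dconv_def sum_distrib_left mult_ac dvd_div_eq_0_iff intro!: sum.cong)
  have iff: "(d dvd n \<and> e dvd n div d) \<longleftrightarrow> d * e dvd n" for d e
    using False by (metis dvd_div_iff_mult dvd_mult_left dvd_0_left_iff mult.commute)
  have iff': "(d dvd n \<and> e dvd n div d) \<longleftrightarrow> (e dvd n \<and> d dvd n div e)" for d e
    unfolding iff by (simp add: mult.commute)
  have div: "n div d div e = n div e div d" for d e
    by (simp add: div_mult2_eq[symmetric] mult.commute)
  show ?thesis unfolding eq
    by (rule sum.reindex_bij_witness[of _ prod.swap prod.swap])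
       (auto simp: iff' mult_ac div)
qed auto

text \<open>Since \<open>ln n = ln d + ln (n div d)\<close>, multiplication by \<open>ln\<close> is
  a derivation for convolution; on Dirichlet series it is minus the derivative in
  \<open>s\<close>.\<close>

lemma ln_mult_dconv:
  fixes a b :: "nat \<Rightarrow> real"
  shows "ln (real n) * dconv a b n =
    dconv (\<lambda>n. ln (real n) * a n) b n + dconv a (\<lambda>n. ln (real n) * b n) n"
proof (cases "n = 0")
  case False
  have "ln (real n) = ln (real d) + ln (real (n div d))" if "d dvd n" for d
  proof -
    have "d > 0" "n div d > 0" using that False by (auto simp: dvd_div_eq_0_iff intro: Nat.gr0I)
    hence "ln (real d * real (n div d)) = ln (real d) + ln (real (n div d))"
      by (intro ln_mult_pos) auto
    also have "real d * real (n div d) = real n"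
      using that by (simp flip: of_nat_mult)
    finally show ?thesis .
  qed
  thus ?thesis
    by (auto simp: dconv_def sum_distrib_left sum.distrib[symmetric] algebra_simps intro!: sum.cong)
qed auto

lemma dconv_sum_right: "dconv a (\<lambda>n. \<Sum>i\<in>I. f i n) n = (\<Sum>i\<in>I. dconv a (f i) n)"
  unfolding dconv_def by (subst sum.swap) (simp add: sum_distrib_left)

lemma dconv_cmult_right: "dconv a (\<lambda>n. c * b n) n = c * dconv a b n"
  by (simp add: dconv_def sum_distrib_left mult_ac)

text \<open>The power rule for this derivation. It turns the Taylor polynomial of an exponential
  into a recursion that involves \<open>mangoldt\<close>.\<close>

lemma ln_mult_dpow:
  fixes a :: "nat \<Rightarrow> real"
  shows "ln (real n) * dpow a (Suc k) n =
    real (Suc k) * dconv (\<lambda>n. ln (real n) * a n) (dpow a k) n"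
proof (induction k arbitrary: n)
  case 0
  have "dconv a (\<lambda>n. ln (real n) * dpow a 0 n) n = 0"
    unfolding dconv_def by (intro sum.neutral) auto
  thus ?case by (simp add: ln_mult_dconv del: dpow.simps(1))
next
  case (Suc k)
  let ?L = "\<lambda>n. ln (real n) * a n"
  have "ln (real n) * dpow a (Suc (Suc k)) n
      = dconv ?L (dpow a (Suc k)) n + dconv a (\<lambda>n. ln (real n) * dpow a (Suc k) n) n"
    by (simp only: dpow.simps(2)[of a "Suc k"] ln_mult_dconv)
  also have "(\<lambda>n. ln (real n) * dpow a (Suc k) n) = (\<lambda>n. real (Suc k) * dconv ?L (dpow a k) n)"
    by (simp only: Suc.IH)
  also have "dconv a \<dots> n = real (Suc k) * dconv ?L (dpow a (Suc k)) n"
    by (subst dconv_cmult_right, subst dconv_left_commute) simp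
  finally show ?case by (simp add: algebra_simps)
qed

lemma dpow_nonneg:
  fixes a :: "nat \<Rightarrow> real"
  assumes "\<And>n. a n \<ge> 0"
  shows "dpow a k n \<ge> 0"
  by (induction k arbitrary: n) (auto simp: dconv_def assms intro!: sum_nonneg mult_nonneg_nonneg)

lemma norm_dpow_le:
  fixes a :: "nat \<Rightarrow> 'a :: {real_normed_algebra_1, comm_semiring_1}"
  assumes "\<And>n. norm (a n) \<le> b n"
  shows "norm (dpow a k n) \<le> dpow b k n"
proof (induction k arbitrary: n)
  case (Suc k)
  have "norm (dpow a (Suc k) n) \<le> (\<Sum>d | d dvd n. norm (a d) * norm (dpow a k (n div d)))"
    unfolding dpow.simps dconv_def by (intro order.trans[OF norm_sum] sum_mono norm_mult_ineq)
  also have "\<dots> \<le> (\<Sum>d | d dvd n. b d * dpow b k (n div d))"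
    by (intro sum_mono mult_mono assms Suc.IH) (auto intro: order.trans[OF norm_ge_zero assms])
  finally show ?case by (simp add: dconv_def)
qed auto

lemma dpow_mult_cong:
  fixes a g :: "nat \<Rightarrow> 'a :: comm_semiring_1"
  assumes mult: "\<And>m n. m > 0 \<Longrightarrow> n > 0 \<Longrightarrow> g (m * n) = g m * g n" and "g 1 = 1"
  shows "dpow (\<lambda>n. c * (a n * g n)) k n = c ^ k * (dpow a k n * g n)"
proof (induction k arbitrary: n)
  case 0
  show ?case using assms(2) by auto
next
  case (Suc k)
  show ?case
  proof (cases "n = 0")
    case False
    have "dpow (\<lambda>n. c * (a n * g n)) (Suc k) n =
      (\<Sum>d | d dvd n. c * (a d * g d) * (c ^ k * (dpow a k (n div d) * g (n div d))))"
      by (simp add: dconv_def Suc.IH)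
    also have "\<dots> = (\<Sum>d | d dvd n. c ^ Suc k * (a d * dpow a k (n div d) * g n))"
    proof (intro sum.cong refl)
      fix d assume d: "d \<in> {d. d dvd n}"
      have "g (d * (n div d)) = g d * g (n div d)"
        using d False by (intro mult) (auto simp: dvd_div_eq_0_iff intro: Nat.gr0I)
      hence "g n = g d * g (n div d)" using d by simp
      thus "c * (a d * g d) * (c ^ k * (dpow a k (n div d) * g (n div d)))
          = c ^ Suc k * (a d * dpow a k (n div d) * g n)"
        by (simp add: mult_ac)
    qed
    finally show ?thesis by (simp add: dconv_def sum_distrib_left sum_distrib_right mult_ac)
  qed auto
qed

section \<open>The coefficients of the logarithm of zeta\<close>

text \<open>\<open>1 / a\<close> at a prime power \<open>p ^ a\<close>, and \<open>0\<close> elsewhere; at \<open>n = 1\<close> this uses \<open>0 / 0 = 0\<close>.\<close>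

definition kap :: "nat \<Rightarrow> real" where
  "kap n = mangoldt n / ln (real n)"

definition kapon :: "nat set \<Rightarrow> nat \<Rightarrow> real" where
  "kapon A n = (if n \<in> A then kap n else 0)"

lemma kap_nonneg: "kap n \<ge> 0"
  by (cases "n = 0") (auto simp: kap_def mangoldt_nonneg)

lemma kap_le_1: "kap n \<le> 1"
proof (cases "n \<le> 1")
  case True
  hence "n = 0 \<or> n = 1" by auto
  thus ?thesis by (auto simp: kap_def)
next
  case False
  thus ?thesis using mangoldt_le[of n] by (simp add: kap_def)
qed

lemma kap_0 [simp]: "kap 0 = 0" and kap_1 [simp]: "kap (Suc 0) = 0"
  by (auto simp: kap_def)

lemma kapon_nonneg: "kapon A n \<ge> 0" and kapon_le: "kapon A n \<le> kap n"
  and kapon_le_1: "kapon A n \<le> 1"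
  using kap_nonneg kap_le_1 by (auto simp: kapon_def)

lemma kapon_0 [simp]: "kapon A 0 = 0" and kapon_1 [simp]: "kapon A (Suc 0) = 0"
  by (auto simp: kapon_def)

lemma ln_mult_kapon: "ln (real n) * kapon A n = (if n \<in> A then mangoldt n else 0)"
proof (cases "n \<le> 1")
  case True
  hence "n = 0 \<or> n = 1" by auto
  thus ?thesis by (auto simp: kapon_def)
qed (auto simp: kapon_def kap_def)

text \<open>
  The coefficients of the Taylor polynomial of degree \<open>K\<close> of \<open>exp (\<Sum>n\<in>A. kap n * n powr (-s))\<close>. Without
  truncation of \<open>A\<close> and \<open>K\<close> this is \<open>\<zeta>(s)\<close> with all coefficients \<open>1\<close>; the truncations only decrease them.
\<close>

definition expco :: "nat set \<Rightarrow> nat \<Rightarrow> nat \<Rightarrow> real" where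
  "expco A K n = (\<Sum>j\<le>K. dpow (kapon A) j n / fact j)"

lemma expco_nonneg: "expco A K n \<ge> 0"
  unfolding expco_def by (intro sum_nonneg divide_nonneg_nonneg dpow_nonneg kapon_nonneg) auto

lemma expco_0 [simp]: "expco A K 0 = 0"
  by (simp add: expco_def)

lemma dpow_kapon_1: "dpow (kapon A) (Suc j) (Suc 0) = 0"
  by (simp add: dconv_def)

lemma expco_1 [simp]: "expco A K (Suc 0) = 1"
proof -
  have "expco A K (Suc 0) = (\<Sum>j\<le>K. if j = 0 then 1 else 0)"
    unfolding expco_def by (intro sum.cong refl) (auto simp: dpow_kapon_1 gr0_conv_Suc simp del: dpow.simps(2))
  thus ?thesis by simp
qed

text \<open>The coefficient form of \<open>E' = L' * E\<close> for \<open>E = exp L\<close>.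
  Differentiation lowers the degree of a Taylor polynomial by one, hence \<open>Suc K\<close> on the
  left and \<open>K\<close> on the right.\<close>

lemma ln_mult_expco:
  "ln (real n) * expco A (Suc K) n = (\<Sum>d | d dvd n. (if d \<in> A then mangoldt d else 0) * expco A K (n div d))"
proof -
  let ?L = "\<lambda>n. ln (real n) * kapon A n"
  have "ln (real n) * expco A (Suc K) n
      = ln (real n) * dpow (kapon A) 0 n + (\<Sum>j\<le>K. ln (real n) * dpow (kapon A) (Suc j) n / fact (Suc j))"
    unfolding expco_def
    by (subst sum.atMost_Suc_shift) (simp add: sum_distrib_left distrib_left del: dpow.simps)
  also have "ln (real n) * dpow (kapon A) 0 n = 0" by simp
  also have "(\<Sum>j\<le>K. ln (real n) * dpow (kapon A) (Suc j) n / fact (Suc j))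
      = (\<Sum>j\<le>K. (1 / fact j) * dconv ?L (dpow (kapon A) j) n)"
    unfolding ln_mult_dpow by (intro sum.cong refl) (simp add: divide_simps del: of_nat_Suc)
  also have "\<dots> = dconv ?L (expco A K) n"
    by (simp add: expco_def[abs_def] dconv_sum_right dconv_cmult_right[symmetric])
  finally show ?thesis by (simp add: dconv_def ln_mult_kapon)
qed

text \<open>Induction on \<open>n\<close> through \<open>ln_mult_expco\<close>: the factors at
  \<open>n div d\<close> are at most 1, so the right-hand side is at most the sum of
  \<open>mangoldt\<close> over all divisors, which is \<open>ln n\<close>. The divisor
  \<open>d = 1\<close> is out of reach of the induction hypothesis, but
  \<open>mangoldt 1 = 0\<close>.\<close>

lemma expco_le_1: "expco A K n \<le> 1"
proof (induction n arbitrary: K rule: less_induct)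
  case (less n)
  consider "n = 0" | "n = 1" | "n > 1" "K = 0" | K' where "n > 1" "K = Suc K'"
    using not0_implies_Suc[of K] by (metis One_nat_def less_one linorder_neqE_nat)
  thus ?case
  proof cases
    case (4 K')
    have "ln (real n) * expco A K n = (\<Sum>d | d dvd n. (if d \<in> A then mangoldt d else 0) * expco A K' (n div d))"
      using 4 by (simp only: ln_mult_expco)
    also have "\<dots> \<le> (\<Sum>d | d dvd n. mangoldt d)"
    proof (rule sum_mono)
      fix d assume d: "d \<in> {d. d dvd n}"
      show "(if d \<in> A then mangoldt d else 0) * expco A K' (n div d) \<le> mangoldt d"
      proof (cases "d = 1")
        case False
        have "d > 0" using d 4 by (auto intro: Nat.gr0I)
        hence "n div d < n" using False 4 by (intro div_less_dividend) auto
        from less.IH[OF this] have "expco A K' (n div d) \<le> 1" .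
        thus ?thesis using mangoldt_nonneg[of d] by (auto intro: mult_left_le)
      qed auto
    qed
    also have "\<dots> = ln (real n)" using mangoldt_sum[of n, where ?'a = real] 4 by simp
    finally show ?thesis using 4 by simp
  next
    case 2
    thus ?thesis by simp
  qed (auto simp: expco_def)
qed

text \<open>A number \<open>n \<le> 2 ^ K\<close> has at most \<open>K\<close> prime factors with
  multiplicity, so terms of the exponential series beyond degree \<open>K\<close> do not reach it.
  In the induction a divisor \<open>d \<ge> 2\<close> at least halves \<open>n\<close>, which pays
  for the loss of one degree.\<close>

lemma expco_eq_1:
  assumes "n \<in> {1..Y}" "n \<le> 2 ^ K"
  shows "expco {..Y} K n = 1"
  using assms
proof (induction n arbitrary: K rule: less_induct)
  case (less n)
  show ?case
  proof (cases "n = 1")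
    case False
    hence n: "n > 1" using less.prems by auto
    then obtain K' where K: "K = Suc K'" using less.prems(2) by (cases K) auto
    have "ln (real n) * expco {..Y} K n
        = (\<Sum>d | d dvd n. (if d \<in> {..Y} then mangoldt d else 0) * expco {..Y} K' (n div d))"
      using K by (simp only: ln_mult_expco)
    also have "\<dots> = (\<Sum>d | d dvd n. mangoldt d)"
    proof (rule sum.cong)
      fix d assume d: "d \<in> {d. d dvd n}"
      show "(if d \<in> {..Y} then mangoldt d else 0) * expco {..Y} K' (n div d) = mangoldt d"
      proof (cases "d = 1")
        case False
        have d0: "d > 0" using d n by (auto intro: Nat.gr0I)
        have lt: "n div d < n" using False n d0 by (intro div_less_dividend) auto
        have dn: "d \<le> n" using d n by (auto intro: dvd_imp_le)
        have ge: "n div d \<ge> 1" using d n by (auto simp: dvd_div_eq_0_iff Suc_le_eq intro: Nat.gr0I)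
        have "n div d \<le> n div 2" using False d0 by (intro div_le_mono2) auto
        also have "\<dots> \<le> 2 ^ K'" using less.prems(2) K by simp
        finally have "expco {..Y} K' (n div d) = 1"
          using lt ge less.prems by (intro less.IH) auto
        thus ?thesis using dn less.prems by auto
      qed auto
    qed auto
    also have "\<dots> = ln (real n)" using mangoldt_sum[of n, where ?'a = real] n by simp
    finally show ?thesis using n by simp
  qed auto
qed

text \<open>A single term of the nonnegative sum \<open>expco\<close>, which is at most 1. This
  bound, uniform in \<open>n\<close>, is what keeps the moment of order \<open>2k\<close> of
  \<open>Q\<close> at the size \<open>fact k\<close> times a \<open>k\<close>-th power.\<close>

lemma dpow_kapon_le: "dpow (kapon A) j n \<le> fact j"
proof -
  have "dpow (kapon A) j n / fact j \<le> expco A j n"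
    unfolding expco_def
    by (rule member_le_sum) (auto intro!: divide_nonneg_nonneg dpow_nonneg kapon_nonneg)
  also have "\<dots> \<le> 1" by (rule expco_le_1)
  finally show ?thesis by (simp add: divide_simps)
qed

section \<open>Random multiplicative characters\<close>

lemma borel_measurable_cnj [measurable (raw)]:
  "f \<in> borel_measurable M \<Longrightarrow> (\<lambda>x. cnj (f x)) \<in> borel_measurable M"
  by (rule borel_measurable_continuous_on[OF continuous_on_cnj[OF continuous_on_id]])

text \<open>The common frame for \<open>t \<mapsto> n powr (-it)\<close> on \<open>[T, 2T]\<close> and for the completely multiplicative \<open>X(n)\<close>.\<close>

locale rand_char = prob_space M for M :: "'a measure" +
  fixes ch :: "nat \<Rightarrow> 'a \<Rightarrow> complex"
  assumes ch_meas [measurable]: "\<And>n. ch n \<in> borel_measurable M"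
    and norm_ch [simp]: "\<And>n x. norm (ch n x) = 1"
    and ch_mult: "\<And>m n x. m > 0 \<Longrightarrow> n > 0 \<Longrightarrow> ch (m * n) x = ch m x * ch n x"
begin

lemma ch_1 [simp]: "ch (Suc 0) x = 1"
proof -
  have "ch 1 x * 1 = ch 1 x * ch 1 x" using ch_mult[of 1 1 x] by simp
  moreover have "ch 1 x \<noteq> 0" by (metis norm_ch norm_zero zero_neq_one)
  ultimately show ?thesis by (simp del: norm_ch)
qed

definition dpoly :: "nat set \<Rightarrow> (nat \<Rightarrow> complex) \<Rightarrow> 'a \<Rightarrow> complex" where
  "dpoly A c x = (\<Sum>n\<in>A. c n * ch n x)"

lemma dpoly_meas [measurable]: "dpoly A c \<in> borel_measurable M"
  unfolding dpoly_def by measurable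

lemma norm_dpoly_le: "norm (dpoly A c x) \<le> (\<Sum>n\<in>A. norm (c n))"
  unfolding dpoly_def by (rule order.trans[OF norm_sum]) (simp add: norm_mult)

lemma integrable_bdd:
  fixes f :: "'a \<Rightarrow> 'c :: {banach, second_countable_topology}"
  assumes "f \<in> borel_measurable M" "\<And>x. norm (f x) \<le> B"
  shows "integrable M f"
  using assms by (intro integrable_const_bound[of _ B]) auto

definition corr :: "nat \<Rightarrow> nat \<Rightarrow> complex" where
  "corr m n = expectation (\<lambda>x. ch m x * cnj (ch n x))"

lemma corr_same [simp]: "corr n n = 1"
  by (simp add: corr_def complex_norm_square[symmetric] prob_space)

lemma ch_cnj_integrable: "integrable M (\<lambda>x. c * (ch m x * cnj (ch n x)))"
  by (rule integrable_bdd[of _ "norm c"]) (auto simp: norm_mult)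

lemma expectation_cross:
  assumes "finite A" "finite B"
  shows "expectation (\<lambda>x. dpoly A a x * cnj (dpoly B b x)) =
    (\<Sum>m\<in>A. \<Sum>n\<in>B. a m * cnj (b n) * corr m n)"
proof -
  have "(\<lambda>x. dpoly A a x * cnj (dpoly B b x)) =
     (\<lambda>x. \<Sum>m\<in>A. \<Sum>n\<in>B. (a m * cnj (b n)) * (ch m x * cnj (ch n x)))"
    by (simp add: dpoly_def sum_product mult_ac)
  hence "expectation (\<lambda>x. dpoly A a x * cnj (dpoly B b x)) =
     expectation (\<lambda>x. \<Sum>m\<in>A. \<Sum>n\<in>B. (a m * cnj (b n)) * (ch m x * cnj (ch n x)))" by (rule arg_cong)
  also have "\<dots> = (\<Sum>m\<in>A. \<Sum>n\<in>B. a m * cnj (b n) * corr m n)"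
    unfolding corr_def
    by (subst Bochner_Integration.integral_sum, intro Bochner_Integration.integrable_sum ch_cnj_integrable,
        intro sum.cong refl, subst Bochner_Integration.integral_sum, rule ch_cnj_integrable) simp
  finally show ?thesis .
qed

lemma expectation_norm_square:
  "complex_of_real (expectation (\<lambda>x. (norm (dpoly A a x))\<^sup>2)) = expectation (\<lambda>x. dpoly A a x * cnj (dpoly A a x))"
  by (subst integral_complex_of_real[symmetric]) (simp only: complex_norm_square)

text \<open>The bound \<open>g\<close> may depend on the pair. For polynomials longer than
  \<open>T\<close> the decay of the correlations with the distance of \<open>m\<close> and
  \<open>n\<close> has to be kept.\<close>

lemma mean_square:
  assumes "finite A" "\<And>m n. m \<in> A \<Longrightarrow> n \<in> A \<Longrightarrow> m \<noteq> n \<Longrightarrow> norm (corr m n) \<le> g m n"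
  shows "expectation (\<lambda>x. (norm (dpoly A a x))\<^sup>2) \<le>
    (\<Sum>n\<in>A. (norm (a n))\<^sup>2) + (\<Sum>m\<in>A. \<Sum>n\<in>A - {m}. norm (a m) * norm (a n) * g m n)"
proof -
  have "complex_of_real (expectation (\<lambda>x. (norm (dpoly A a x))\<^sup>2)) = (\<Sum>m\<in>A. \<Sum>n\<in>A. a m * cnj (a n) * corr m n)"
    unfolding expectation_norm_square by (rule expectation_cross[OF assms(1,1)])
  also have "\<dots> = (\<Sum>m\<in>A. a m * cnj (a m) + (\<Sum>n\<in>A - {m}. a m * cnj (a n) * corr m n))"
    by (intro sum.cong refl, subst sum.remove[OF assms(1)]) auto
  finally have eq: "complex_of_real (expectation (\<lambda>x. (norm (dpoly A a x))\<^sup>2)) = \<dots>" .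
  have "expectation (\<lambda>x. (norm (dpoly A a x))\<^sup>2) \<le> norm (complex_of_real (expectation (\<lambda>x. (norm (dpoly A a x))\<^sup>2)))"
    by simp
  also have "\<dots> \<le> (\<Sum>m\<in>A. (norm (a m))\<^sup>2 + (\<Sum>n\<in>A - {m}. norm (a m) * norm (a n) * g m n))"
    unfolding eq
  proof (intro order.trans[OF norm_sum] sum_mono order.trans[OF norm_triangle_ineq] add_mono)
    fix m n assume "m \<in> A" "n \<in> A - {m}"
    thus "norm (a m * cnj (a n) * corr m n) \<le> norm (a m) * norm (a n) * g m n"
      by (auto simp: norm_mult intro!: mult_left_mono assms(2))
  qed (auto simp: norm_mult power2_eq_square)
  finally show ?thesis by (simp add: sum.distrib)
qed

end

text \<open>Both characters are instances: \<open>multchar X\<close> with \<open>eta = 0\<close> and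
  \<open>tch\<close> on \<open>[T, 2T]\<close> with \<open>eta = 2 * W / T\<close>. In the
  comparison of moments \<open>T\<close> enters through \<open>eta\<close> alone.\<close>

locale quasi_char = rand_char +
  fixes W :: nat and eta :: real
  assumes corr_le: "\<And>m n. m \<in> {1..W} \<Longrightarrow> n \<in> {1..W} \<Longrightarrow> m \<noteq> n \<Longrightarrow> norm (corr m n) \<le> eta"
    and eta_nonneg: "eta \<ge> 0"
begin

lemma cross_approx:
  assumes A: "A \<subseteq> {1..W}"
  shows "norm (expectation (\<lambda>x. dpoly A a x * cnj (dpoly A b x)) - (\<Sum>n\<in>A. a n * cnj (b n)))
     \<le> eta * (\<Sum>n\<in>A. norm (a n)) * (\<Sum>n\<in>A. norm (b n))"
proof -
  have fin: "finite A" using A by (rule finite_subset) auto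
  have "expectation (\<lambda>x. dpoly A a x * cnj (dpoly A b x)) - (\<Sum>n\<in>A. a n * cnj (b n))
     = (\<Sum>m\<in>A. \<Sum>n\<in>A. a m * cnj (b n) * corr m n) - (\<Sum>m\<in>A. \<Sum>n\<in>A. if n = m then a m * cnj (b n) else 0)"
    using fin by (simp add: expectation_cross sum.delta)
  also have "\<dots> = (\<Sum>m\<in>A. \<Sum>n\<in>A. if n = m then 0 else a m * cnj (b n) * corr m n)"
    unfolding sum_subtractf[symmetric] by (intro sum.cong refl) auto
  also have "norm \<dots> \<le> (\<Sum>m\<in>A. \<Sum>n\<in>A. eta * (norm (a m) * norm (b n)))"
  proof (intro order.trans[OF norm_sum] sum_mono)
    fix m n assume mn: "m \<in> A" "n \<in> A"
    show "norm (if n = m then 0 else a m * cnj (b n) * corr m n) \<le> eta * (norm (a m) * norm (b n))"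
    proof (cases "n = m")
      case False
      hence "norm (corr m n) \<le> eta" using mn A by (intro corr_le) auto
      hence "(norm (a m) * norm (b n)) * norm (corr m n) \<le> (norm (a m) * norm (b n)) * eta"
        by (intro mult_left_mono) auto
      thus ?thesis using False by (simp add: norm_mult mult_ac)
    qed (use eta_nonneg in auto)
  qed
  also have "\<dots> = eta * (\<Sum>n\<in>A. norm (a n)) * (\<Sum>n\<in>A. norm (b n))"
    by (simp add: sum_product sum_distrib_left mult_ac)
  finally show ?thesis .
qed

lemma mean_square_quasi:
  assumes A: "A \<subseteq> {1..W}"
  shows "expectation (\<lambda>x. (norm (dpoly A a x))\<^sup>2) \<le> (\<Sum>n\<in>A. (norm (a n))\<^sup>2) + eta * (\<Sum>n\<in>A. norm (a n))\<^sup>2"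
proof -
  have e: "(\<Sum>n\<in>A. a n * cnj (a n)) = of_real (\<Sum>n\<in>A. (norm (a n))\<^sup>2)"
    unfolding of_real_sum by (simp only: complex_norm_square)
  have "norm (complex_of_real (expectation (\<lambda>x. (norm (dpoly A a x))\<^sup>2)) - of_real (\<Sum>n\<in>A. (norm (a n))\<^sup>2))
     \<le> eta * (\<Sum>n\<in>A. norm (a n)) * (\<Sum>n\<in>A. norm (a n))"
    using cross_approx[OF A, of a a] unfolding expectation_norm_square e .
  hence "\<bar>expectation (\<lambda>x. (norm (dpoly A a x))\<^sup>2) - (\<Sum>n\<in>A. (norm (a n))\<^sup>2)\<bar> \<le> eta * (\<Sum>n\<in>A. norm (a n)) * (\<Sum>n\<in>A. norm (a n))"
    by (simp only: of_real_diff[symmetric] norm_of_real)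
  thus ?thesis by (simp add: power2_eq_square)
qed

end

text \<open>
  The \<open>j\<close>-th moment of \<open>Re (\<Sum>n\<le>Y. b n * ch n)\<close> if all correlations \<open>corr m n\<close> with \<open>m \<noteq> n\<close> vanish, and
  the resulting truncated characteristic function; neither depends on the character.
\<close>

definition ideal_moment :: "(nat \<Rightarrow> complex) \<Rightarrow> nat \<Rightarrow> nat \<Rightarrow> complex" where
  "ideal_moment b Y j = (1 / 2) ^ j *
     (\<Sum>l\<le>j. of_nat (j choose l) * (\<Sum>n\<in>{1..Y ^ j}. dpow b l n * cnj (dpow b (j - l) n)))"

definition ideal_char :: "(nat \<Rightarrow> complex) \<Rightarrow> nat \<Rightarrow> nat \<Rightarrow> complex" where
  "ideal_char b Y k = (\<Sum>j<2*k. \<i> ^ j / fact j * ideal_moment b Y j)"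

lemma sum_norm_dpow_le:
  fixes b :: "nat \<Rightarrow> complex"
  assumes supp: "\<And>n. n \<notin> {1..Y} \<Longrightarrow> b n = 0" and "Y \<ge> 1" "l \<le> j"
  shows "(\<Sum>n\<in>{1..Y ^ j}. norm (dpow b l n)) \<le> (\<Sum>n\<in>{1..Y}. norm (b n)) ^ l"
proof -
  have sub: "{1..Y ^ l} \<subseteq> {1..Y ^ j}" using assms by (auto intro: order.trans power_increasing)
  have "(\<Sum>n\<in>{1..Y ^ j}. norm (dpow b l n)) = (\<Sum>n\<in>{1..Y ^ l}. norm (dpow b l n))"
    using sub by (intro sum.mono_neutral_right ballI) (auto simp: dpow_support[OF supp] simp del: atLeastAtMost_iff One_nat_def)
  also have "\<dots> \<le> (\<Sum>n\<in>{1..Y ^ l}. dpow (\<lambda>n. norm (b n)) l n)"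
    by (intro sum_mono norm_dpow_le) auto
  also have "\<dots> = (\<Sum>n\<in>{1..Y}. norm (b n)) ^ l"
    using dpow_eval[of Y "\<lambda>n. norm (b n)" "\<lambda>_. 1" l] supp by simp
  finally show ?thesis .
qed

context rand_char begin

lemma dpoly_power:
  assumes supp: "\<And>n. n \<notin> {1..Y} \<Longrightarrow> b n = 0" and "Y \<ge> 1" "l \<le> j"
  shows "dpoly {1..Y} b x ^ l = dpoly {1..Y ^ j} (dpow b l) x"
proof -
  have sub: "{1..Y ^ l} \<subseteq> {1..Y ^ j}" using assms by (auto intro: order.trans power_increasing)
  have "dpoly {1..Y} b x ^ l = dpoly {1..Y ^ l} (dpow b l) x"
    unfolding dpoly_def by (rule dpow_eval[OF supp]) (auto simp: ch_mult)
  also have "\<dots> = dpoly {1..Y ^ j} (dpow b l) x"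
    unfolding dpoly_def using sub
    by (intro sum.mono_neutral_left ballI) (auto simp: dpow_support[OF supp] simp del: atLeastAtMost_iff One_nat_def)
  finally show ?thesis .
qed

end

context quasi_char begin

text \<open>The real part is half the sum of the polynomial and its conjugate. In the binomial
  expansion each product is a cross term of two powers, evaluated by \<open>cross_approx\<close>;
  the binomial coefficients add up to \<open>2 ^ j\<close> and cancel
  \<open>(1 / 2) ^ j\<close>.\<close>

lemma moment_approx:
  assumes supp: "\<And>n. n \<notin> {1..Y} \<Longrightarrow> b n = 0" and "Y \<ge> 1" "Y ^ j \<le> W"
  shows "norm (expectation (\<lambda>x. complex_of_real (Re (dpoly {1..Y} b x)) ^ j) - ideal_moment b Y j)
     \<le> eta * (\<Sum>n\<in>{1..Y}. norm (b n)) ^ j"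
proof -
  define H where "H = (\<Sum>n\<in>{1..Y}. norm (b n))"
  define S where "S l = dpoly {1..Y ^ j} (dpow b l)" for l
  have H0: "H \<ge> 0" unfolding H_def by (intro sum_nonneg) auto
  have sub: "{1..Y ^ j} \<subseteq> {1..W}" using assms by auto
  have int: "integrable M (\<lambda>x. S l x * cnj (S l' x))" for l l'
    unfolding S_def
    by (rule integrable_bdd[of _ "(\<Sum>n\<in>{1..Y ^ j}. norm (dpow b l n)) * (\<Sum>n\<in>{1..Y ^ j}. norm (dpow b l' n))"])
       (auto simp: norm_mult simp del: One_nat_def intro!: mult_mono norm_dpoly_le sum_nonneg)
  have "(\<lambda>x. complex_of_real (Re (dpoly {1..Y} b x)) ^ j)
     = (\<lambda>x. \<Sum>l\<le>j. (1/2)^j * of_nat (j choose l) * (S l x * cnj (S (j - l) x)))"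
  proof
    fix x
    let ?A = "dpoly {1..Y} b x"
    have "complex_of_real (Re ?A) = (1/2) * (?A + cnj ?A)"
      by (simp add: complex_eq_iff)
    hence "complex_of_real (Re ?A) ^ j = (1/2)^j * (?A + cnj ?A) ^ j"
      by (simp only: power_mult_distrib)
    also have "\<dots> = (\<Sum>l\<le>j. (1/2)^j * of_nat (j choose l) * (?A ^ l * cnj ?A ^ (j - l)))"
      by (simp add: binomial_ring sum_distrib_left mult_ac)
    also have "\<dots> = (\<Sum>l\<le>j. (1/2)^j * of_nat (j choose l) * (S l x * cnj (S (j - l) x)))"
      unfolding S_def
      by (intro sum.cong refl) (use dpoly_power[OF supp assms(2)] in \<open>simp flip: complex_cnj_power\<close>)
    finally show "complex_of_real (Re ?A) ^ j = \<dots>" .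
  qed
  hence "expectation (\<lambda>x. complex_of_real (Re (dpoly {1..Y} b x)) ^ j)
     = (\<Sum>l\<le>j. (1/2)^j * of_nat (j choose l) * expectation (\<lambda>x. S l x * cnj (S (j - l) x)))"
    by (simp only:) (subst Bochner_Integration.integral_sum, auto intro!: integrable_mult_right int)
  hence "expectation (\<lambda>x. complex_of_real (Re (dpoly {1..Y} b x)) ^ j) - ideal_moment b Y j
     = (\<Sum>l\<le>j. (1/2)^j * of_nat (j choose l) * (expectation (\<lambda>x. S l x * cnj (S (j - l) x))
           - (\<Sum>n\<in>{1..Y ^ j}. dpow b l n * cnj (dpow b (j - l) n))))"
    by (simp add: ideal_moment_def sum_distrib_left sum_subtractf algebra_simps)
  also have "norm \<dots> \<le> (\<Sum>l\<le>j. (1/2)^j * real (j choose l) * (eta * H ^ j))"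
  proof (intro order.trans[OF norm_sum] sum_mono)
    fix l assume l: "l \<in> {..j}"
    have "norm (expectation (\<lambda>x. S l x * cnj (S (j - l) x)) - (\<Sum>n\<in>{1..Y ^ j}. dpow b l n * cnj (dpow b (j - l) n)))
       \<le> eta * (\<Sum>n\<in>{1..Y ^ j}. norm (dpow b l n)) * (\<Sum>n\<in>{1..Y ^ j}. norm (dpow b (j - l) n))"
      unfolding S_def by (rule cross_approx[OF sub])
    also have "\<dots> \<le> eta * H ^ l * H ^ (j - l)"
      unfolding H_def using l eta_nonneg assms(2)
      by (intro mult_mono mult_left_mono sum_norm_dpow_le supp) (auto intro!: sum_nonneg mult_nonneg_nonneg zero_le_power)
    also have "\<dots> = eta * H ^ j" using l by (simp flip: power_add)
    finally show "norm ((1/2)^j * of_nat (j choose l) * (expectation (\<lambda>x. S l x * cnj (S (j - l) x))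
           - (\<Sum>n\<in>{1..Y ^ j}. dpow b l n * cnj (dpow b (j - l) n)))) \<le> (1/2)^j * real (j choose l) * (eta * H ^ j)"
      by (simp add: norm_mult norm_power mult_left_mono norm_divide)
  qed
  also have "\<dots> = (1/2)^j * (eta * H ^ j) * real (\<Sum>l\<le>j. j choose l)"
    by (simp add: sum_distrib_left mult_ac)
  also have "\<dots> = eta * H ^ j"
    by (simp add: choose_row_sum field_simps)
  finally show ?thesis unfolding H_def .
qed

text \<open>The moment of order \<open>2k\<close> is the mean square of the \<open>k\<close>-th
  power, which is itself a Dirichlet polynomial of length \<open>Y ^ k\<close>.\<close>

lemma even_moment_le:
  assumes supp: "\<And>n. n \<notin> {1..Y} \<Longrightarrow> b n = 0" and "Y \<ge> 1" "Y ^ k \<le> W"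
  shows "expectation (\<lambda>x. norm (dpoly {1..Y} b x) ^ (2 * k)) \<le>
     (\<Sum>n\<in>{1..Y ^ k}. (norm (dpow b k n))\<^sup>2) + eta * (\<Sum>n\<in>{1..Y}. norm (b n)) ^ (2 * k)"
proof -
  have "norm (dpoly {1..Y} b x) ^ (2 * k) = (norm (dpoly {1..Y ^ k} (dpow b k) x))\<^sup>2" for x
  proof -
    have "dpoly {1..Y ^ k} (dpow b k) x = dpoly {1..Y} b x ^ k"
      by (rule dpoly_power[symmetric]) (use supp assms(2) in auto)
    thus ?thesis by (simp only: norm_power power_mult[symmetric] mult.commute)
  qed
  hence "expectation (\<lambda>x. norm (dpoly {1..Y} b x) ^ (2 * k))
     = expectation (\<lambda>x. (norm (dpoly {1..Y ^ k} (dpow b k) x))\<^sup>2)"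
    by presburger
  also have "\<dots> \<le> (\<Sum>n\<in>{1..Y ^ k}. (norm (dpow b k n))\<^sup>2) + eta * (\<Sum>n\<in>{1..Y ^ k}. norm (dpow b k n))\<^sup>2"
    using assms by (intro mean_square_quasi) auto
  also have "\<dots> \<le> (\<Sum>n\<in>{1..Y ^ k}. (norm (dpow b k n))\<^sup>2) + eta * ((\<Sum>n\<in>{1..Y}. norm (b n)) ^ k)\<^sup>2"
    using eta_nonneg assms
    by (intro add_left_mono mult_left_mono power_mono sum_norm_dpow_le supp) (auto intro!: sum_nonneg)
  finally show ?thesis by (simp add: power_mult[symmetric] mult.commute)
qed

text \<open>Taylor expansion of the characteristic function below degree \<open>2k\<close>: each
  moment is replaced by the ideal one at a cost proportional to \<open>eta\<close>, and the
  remainder is bounded by the absolute moment of order \<open>2k\<close>. The factor 4 is made of 3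
  from the Taylor coefficients, whose sum is at most e, and 1 from the remainder.\<close>

lemma char_approx:
  assumes supp: "\<And>n. n \<notin> {1..Y} \<Longrightarrow> b n = 0" and "Y \<ge> 1" "Y ^ (2 * k) \<le> W" "k \<ge> 1"
    and H: "(\<Sum>n\<in>{1..Y}. norm (b n)) \<le> H" "H \<ge> 1"
    and V: "(\<Sum>n\<in>{1..Y ^ k}. (norm (dpow b k n))\<^sup>2) \<le> V"
  shows "norm (expectation (\<lambda>x. iexp (Re (dpoly {1..Y} b x))) - ideal_char b Y k)
     \<le> 4 * eta * H ^ (2 * k) + V / fact (2 * k)"
proof -
  define B where "B x = Re (dpoly {1..Y} b x)" for x
  have [measurable]: "B \<in> borel_measurable M" unfolding B_def by measurable
  have S0: "(\<Sum>n\<in>{1..Y}. norm (b n)) \<ge> 0" by (intro sum_nonneg) auto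
  have nB: "\<bar>B x\<bar> \<le> H" for x
    unfolding B_def using norm_dpoly_le[of "{1..Y}" b x] abs_Re_le_cmod[of "dpoly {1..Y} b x"] H by linarith
  have intB: "integrable M (\<lambda>x. complex_of_real (B x) ^ j)" for j
    by (rule integrable_bdd[of _ "H ^ j"]) (auto simp: norm_power intro!: power_mono nB)
  define P where "P x = (\<Sum>j<2*k. (\<i> * complex_of_real (B x)) ^ j / fact j)" for x
  have P_eq: "P x = (\<Sum>j<2*k. \<i> ^ j / fact j * complex_of_real (B x) ^ j)" for x
    unfolding P_def by (simp add: power_mult_distrib)
  have EP: "expectation P = (\<Sum>j<2*k. \<i> ^ j / fact j * expectation (\<lambda>x. complex_of_real (B x) ^ j))"
    unfolding P_eq by (subst Bochner_Integration.integral_sum) (auto intro!: integrable_mult_right intB)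
  have intP: "integrable M P"
    unfolding P_eq by (intro Bochner_Integration.integrable_sum integrable_mult_right intB)
  have intE: "integrable M (\<lambda>x. iexp (B x))"
    by (rule integrable_bdd[of _ 1]) auto
  have fs: "(\<Sum>j<2*k. 1 / fact j) \<le> (3 :: real)"
  proof -
    have "(\<Sum>j<2*k. 1 / fact j) \<le> (exp 1 :: real)"
      using sum_le_suminf[of "\<lambda>j. 1 ^ j /\<^sub>R fact j :: real" "{..<2*k}"] summable_exp[of "1::real"]
      by (simp add: exp_def summable_exp_generic divide_inverse)
    also have "\<dots> \<le> 3" using exp_le by simp
    finally show ?thesis .
  qed
  have "norm (expectation P - ideal_char b Y k)
     = norm (\<Sum>j<2*k. \<i> ^ j / fact j * (expectation (\<lambda>x. complex_of_real (B x) ^ j) - ideal_moment b Y j))"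
    unfolding EP ideal_char_def by (simp add: sum_subtractf right_diff_distrib)
  also have "\<dots> \<le> (\<Sum>j<2*k. 1 / fact j * (eta * H ^ (2 * k)))"
  proof (intro order.trans[OF norm_sum] sum_mono)
    fix j assume j: "j \<in> {..<2*k}"
    have "norm (expectation (\<lambda>x. complex_of_real (B x) ^ j) - ideal_moment b Y j)
       \<le> eta * (\<Sum>n\<in>{1..Y}. norm (b n)) ^ j"
      unfolding B_def using j assms(2,3)
      by (intro moment_approx supp order.trans[OF power_increasing[of j "2*k" Y]]) auto
    also have "\<dots> \<le> eta * H ^ (2 * k)"
      using j H S0 eta_nonneg
      by (intro mult_left_mono order.trans[OF power_mono power_increasing[of j "2*k" H]]) auto
    finally show "norm (\<i> ^ j / fact j * (expectation (\<lambda>x. complex_of_real (B x) ^ j) - ideal_moment b Y j))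
      \<le> 1 / fact j * (eta * H ^ (2 * k))"
      by (simp add: norm_mult norm_divide norm_power divide_right_mono)
  qed
  also have "\<dots> = (\<Sum>j<2*k. 1 / fact j) * (eta * H ^ (2 * k))" by (simp only: sum_distrib_right)
  also have "\<dots> \<le> 3 * (eta * H ^ (2 * k))"
    using eta_nonneg H by (intro mult_right_mono fs) auto
  finally have 1: "norm (expectation P - ideal_char b Y k) \<le> 3 * (eta * H ^ (2 * k))" .

  have pt: "norm (iexp (B x) - P x) \<le> norm (dpoly {1..Y} b x) ^ (2 * k) / fact (2 * k)" for x
  proof -
    \<comment> \<open>\<open>iexp_approx1\<close> includes the term of its index in the sum, so
      index \<open>2 * k - 1\<close> leaves a remainder of degree \<open>2 * k\<close>.\<close>
    have "{..2 * k - 1} = {..<2 * k}" "Suc (2 * k - 1) = 2 * k" using \<open>k \<ge> 1\<close> by auto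
    hence "norm (iexp (B x) - P x) \<le> \<bar>B x\<bar> ^ (2 * k) / fact (2 * k)"
      using iexp_approx1[of "B x" "2 * k - 1"] by (simp add: P_def)
    also have "\<dots> \<le> norm (dpoly {1..Y} b x) ^ (2 * k) / fact (2 * k)"
      unfolding B_def by (intro divide_right_mono power_mono abs_Re_le_cmod) auto
    finally show ?thesis .
  qed
  have "norm (expectation (\<lambda>x. iexp (B x)) - expectation P) = norm (expectation (\<lambda>x. iexp (B x) - P x))"
    by (subst Bochner_Integration.integral_diff[OF intE intP]) auto
  also have "\<dots> \<le> expectation (\<lambda>x. norm (iexp (B x) - P x))"
    by (rule integral_norm_bound)
  also have "\<dots> \<le> expectation (\<lambda>x. norm (dpoly {1..Y} b x) ^ (2 * k) / fact (2 * k))"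
  proof (intro integral_mono pt)
    show "integrable M (\<lambda>x. norm (iexp (B x) - P x))"
      by (intro integrable_norm Bochner_Integration.integrable_diff intE intP)
    show "integrable M (\<lambda>x. norm (dpoly {1..Y} b x) ^ (2 * k) / fact (2 * k))"
      by (rule integrable_bdd[of _ "H ^ (2 * k) / fact (2 * k)"])
         (auto intro!: divide_right_mono power_mono order.trans[OF norm_dpoly_le H(1)] simp del: One_nat_def)
  qed
  also have "\<dots> = expectation (\<lambda>x. norm (dpoly {1..Y} b x) ^ (2 * k)) / fact (2 * k)" by simp
  also have "\<dots> \<le> (V + eta * H ^ (2 * k)) / fact (2 * k)"
  proof (intro divide_right_mono order.trans[OF even_moment_le] add_mono mult_left_mono power_mono H V)
    show "Y ^ k \<le> W" using assms(2,3) by (intro order.trans[OF power_increasing[of k "2*k" Y]]) auto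
  qed (use supp assms(2) eta_nonneg S0 in auto)
  also have "\<dots> \<le> V / fact (2 * k) + eta * H ^ (2 * k)"
  proof -
    have "eta * H ^ (2 * k) / fact (2 * k) \<le> eta * H ^ (2 * k) / 1"
      using eta_nonneg H by (intro divide_left_mono) auto
    thus ?thesis by (simp add: add_divide_distrib)
  qed
  finally have 2: "norm (expectation (\<lambda>x. iexp (B x)) - expectation P) \<le> V / fact (2 * k) + eta * H ^ (2 * k)" .
  have "norm (expectation (\<lambda>x. iexp (B x)) - ideal_char b Y k)
      \<le> norm (expectation (\<lambda>x. iexp (B x)) - expectation P) + norm (expectation P - ideal_char b Y k)"
    using norm_triangle_ineq[of "expectation (\<lambda>x. iexp (B x)) - expectation P" "expectation P - ideal_char b Y k"] by simp
  with 1 2 show ?thesis unfolding B_def by simp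
qed

end

text \<open>One of the two factors \<open>dpow\<close> in the square is bounded by
  \<open>fact k\<close>; the other is kept, and its weighted sum is exactly the \<open>k\<close>-th
  power of a sum. The outcome is the moment of order \<open>2k\<close> of a complex Gaussian of
  variance \<open>G^2 * Z\<close>.\<close>

lemma sum_dpow_square_le:
  fixes b :: "nat \<Rightarrow> complex"
  assumes b: "\<And>n. norm (b n) \<le> G * (kapon A n * real n powr (-s))" and supp: "A \<subseteq> {1..Y}"
    and Z: "(\<Sum>n\<in>A. kap n * real n powr (-2 * s)) \<le> Z" and "G \<ge> 0"
  shows "(\<Sum>n\<in>{1..Y ^ k}. (norm (dpow b k n))\<^sup>2) \<le> fact k * (G\<^sup>2 * Z) ^ k"
proof -
  have A0: "n \<notin> {1..Y} \<Longrightarrow> kapon A n = 0" for n using supp by (auto simp: kapon_def)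
  have "(norm (dpow b k n))\<^sup>2 \<le> (G ^ (2 * k) * fact k) * (dpow (kapon A) k n * real n powr (-2 * s))" for n
  proof -
    have d0: "dpow (kapon A) k n \<ge> 0" by (intro dpow_nonneg kapon_nonneg)
    have "norm (dpow b k n) \<le> dpow (\<lambda>n. G * (kapon A n * real n powr (-s))) k n"
      by (intro norm_dpow_le b)
    also have "\<dots> = G ^ k * (dpow (kapon A) k n * real n powr (-s))"
      by (rule dpow_mult_cong) (auto simp: powr_mult)
    finally have "(norm (dpow b k n))\<^sup>2 \<le> (G ^ k * (dpow (kapon A) k n * real n powr (-s)))\<^sup>2"
      by (intro power_mono) auto
    also have "\<dots> = G ^ (2 * k) * (real n powr (-s))\<^sup>2 * (dpow (kapon A) k n * dpow (kapon A) k n)"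
      by (simp add: power_mult_distrib power2_eq_square power_add mult_2 mult_2_right mult_ac)
    also have "\<dots> \<le> G ^ (2 * k) * (real n powr (-s))\<^sup>2 * (dpow (kapon A) k n * fact k)"
      using \<open>G \<ge> 0\<close> d0 by (intro mult_left_mono dpow_kapon_le) auto
    also have "(real n powr (-s))\<^sup>2 = real n powr (-2 * s)"
      by (cases "n = 0") (auto simp: powr_power)
    finally show ?thesis by (simp add: mult_ac)
  qed
  hence "(\<Sum>n\<in>{1..Y ^ k}. (norm (dpow b k n))\<^sup>2)
     \<le> (\<Sum>n\<in>{1..Y ^ k}. (G ^ (2 * k) * fact k) * (dpow (kapon A) k n * real n powr (-2 * s)))"
    by (intro sum_mono)
  also have "\<dots> = (G ^ (2 * k) * fact k) * (\<Sum>n\<in>{1..Y}. kapon A n * real n powr (-2 * s)) ^ k"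
    by (subst dpow_eval[of Y "kapon A"]) (auto simp: A0 powr_mult sum_distrib_left)
  also have "(\<Sum>n\<in>{1..Y}. kapon A n * real n powr (-2 * s)) = (\<Sum>n\<in>A. kap n * real n powr (-2 * s))"
    using supp by (intro sum.mono_neutral_cong_right) (auto simp: kapon_def)
  also have "(G ^ (2 * k) * fact k) * \<dots> ^ k \<le> (G ^ (2 * k) * fact k) * Z ^ k"
    using \<open>G \<ge> 0\<close> Z by (intro mult_left_mono power_mono sum_nonneg) (auto simp: kap_nonneg)
  also have "\<dots> = fact k * (G\<^sup>2 * Z) ^ k"
    by (simp add: power_mult_distrib power_mult)
  finally show ?thesis .
qed

section \<open>Suprema of random holomorphic functions\<close>

lemma bdd_above_continuous_image:
  fixes h :: "'a :: topological_space \<Rightarrow> real"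
  assumes "compact K" "continuous_on K h"
  shows "bdd_above (h ` K)"
  by (intro bounded_imp_bdd_above compact_imp_bounded compact_continuous_image assms)

text \<open>By continuity the supremum may be taken over a countable dense subset, where
  measurability is automatic.\<close>

lemma borel_measurable_SUP_compact:
  fixes h :: "'a \<Rightarrow> complex \<Rightarrow> real"
  assumes K: "compact K" "K \<noteq> {}" and cont: "\<And>x. x \<in> space M \<Longrightarrow> continuous_on K (h x)"
    and meas: "\<And>z. z \<in> K \<Longrightarrow> (\<lambda>x. h x z) \<in> borel_measurable M"
  shows "(\<lambda>x. SUP z\<in>K. h x z) \<in> borel_measurable M"
proof -
  obtain D where D: "countable D" "D \<subseteq> K" "K \<subseteq> closure D"
    using separable[of K] by blast
  have cl: "closure D = K" using D K(1) closure_minimal[of D K] compact_imp_closed by blast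
  have D0: "D \<noteq> {}" using D K(2) by auto
  have bdd: "bdd_above (h x ` K)" if "x \<in> space M" for x
    by (rule bdd_above_continuous_image[OF K(1) cont[OF that]])
  have bddD: "bdd_above (h x ` D)" if "x \<in> space M" for x
    using bdd[OF that] D(2) by (meson bdd_above_mono image_mono)
  have "(SUP z\<in>K. h x z) = (SUP z\<in>D. h x z)" if x: "x \<in> space M" for x
  proof (rule antisym)
    show "(SUP z\<in>K. h x z) \<le> (SUP z\<in>D. h x z)"
    proof (rule cSUP_least[OF K(2)])
      fix z assume z: "z \<in> K"
      show "h x z \<le> (SUP z\<in>D. h x z)"
        by (rule continuous_le_on_closure[of D "h x"])
           (use cl cont[OF x] z bddD[OF x] in \<open>auto intro: cSUP_upper\<close>)
    qed
    show "(SUP z\<in>D. h x z) \<le> (SUP z\<in>K. h x z)"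
      by (rule cSUP_subset_mono[OF D0 bdd[OF x] D(2)]) auto
  qed
  moreover have "(\<lambda>x. SUP z\<in>D. h x z) \<in> borel_measurable M"
    using D by (intro borel_measurable_cSUP meas bddD) auto
  ultimately show ?thesis by (subst measurable_cong) auto
qed

text \<open>Parametrised over \<open>[0, 1]\<close>, to agree with
  \<open>circlepath 0 R\<close>.\<close>

definition circ :: "real \<Rightarrow> real \<Rightarrow> complex" where
  "circ R t = of_real R * exp (2 * of_real pi * \<i> * of_real t)"

lemma norm_circ [simp]: "R \<ge> 0 \<Longrightarrow> norm (circ R t) = R"
  by (simp add: circ_def norm_mult)

lemma continuous_on_circ [continuous_intros]: "continuous_on A (circ R)"
  unfolding circ_def by (intro continuous_intros)

lemma circ_meas [measurable]: "circ R \<in> borel_measurable borel"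
  by (intro borel_measurable_continuous_onI continuous_on_circ)

text \<open>Cauchy's formula for \<open>g^2\<close> instead of \<open>g\<close> yields the squared
  norm directly, and the Cauchy kernel on the circle is at most \<open>R / (R - r)\<close> after
  division by \<open>2 * pi\<close>.\<close>

lemma norm_square_le_circle_mean:
  assumes cont: "continuous_on (cball 0 R) g" and holo: "g holomorphic_on ball 0 R"
    and r: "r < R" and w: "norm w \<le> r" and R: "R > 0"
  shows "ennreal ((norm (g w))\<^sup>2) \<le>
     ennreal (R / (R - r)) * (\<integral>\<^sup>+t. ennreal ((norm (g (circ R t)))\<^sup>2) * indicator {0..1} t \<partial>lborel)"
proof -
  define u where "u t = (norm (g (circ R t)))\<^sup>2" for t
  define I where "I = integral {0..1} u"
  have circ_in: "circ R t \<in> cball 0 R" for t using R by simp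
  have contc: "continuous_on {0..1} (\<lambda>t. g (circ R t))"
    by (rule continuous_on_compose2[OF cont continuous_on_circ]) (use circ_in in auto)
  have contu: "continuous_on {0..1} u"
    unfolding u_def by (intro continuous_intros contc)
  have Iu: "(u has_integral I) {0..1}"
    unfolding I_def using integrable_continuous_interval[OF contu] by blast
  have "((\<lambda>x. (g x)\<^sup>2 / (x - w)) has_contour_integral 2 * of_real pi * \<i> * (g w)\<^sup>2) (circlepath 0 R)"
    by (rule Cauchy_integral_circlepath) (use w r in \<open>auto intro!: continuous_intros holomorphic_intros cont holo\<close>)
  hence "((\<lambda>x. (g (circ R x))\<^sup>2 / (circ R x - w) * vector_derivative (circlepath 0 R) (at x within {0..1}))
     has_integral 2 * of_real pi * \<i> * (g w)\<^sup>2) {0..1}"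
    unfolding has_contour_integral_def by (simp add: circlepath circ_def)
  hence J: "((\<lambda>x. (g (circ R x))\<^sup>2 / (circ R x - w) * (2 * pi * \<i> * circ R x))
     has_integral 2 * of_real pi * \<i> * (g w)\<^sup>2) {0..1}"
    by (rule has_integral_eq[rotated]) (simp add: vector_derivative_circlepath01 circ_def)
  have "norm (2 * of_real pi * \<i> * (g w)\<^sup>2) \<le> integral {0..1} (\<lambda>t. 2 * pi * R / (R - r) * u t)"
  proof (subst integral_unique[OF J, symmetric], rule integral_norm_bound_integral)
    show "(\<lambda>t. 2 * pi * R / (R - r) * u t) integrable_on {0..1}"
      using integrable_continuous_interval[OF contu] by (rule integrable_on_mult_right)
    fix t :: real
    have "R - r \<le> norm (circ R t) - norm w" using w R by simp
    also have "\<dots> \<le> norm (circ R t - w)" by (rule norm_triangle_ineq2)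
    finally have "norm (circ R t - w) \<ge> R - r" .
    hence "u t * (2 * pi * R) / norm (circ R t - w) \<le> u t * (2 * pi * R) / (R - r)"
      using r R by (intro divide_left_mono mult_pos_pos mult_nonneg_nonneg) (auto simp: u_def)
    thus "norm ((g (circ R t))\<^sup>2 / (circ R t - w) * (2 * pi * \<i> * circ R t)) \<le> 2 * pi * R / (R - r) * u t"
      using R by (simp add: norm_mult norm_divide norm_power u_def mult_ac)
  qed (use J in blast)
  also have "\<dots> = 2 * pi * R / (R - r) * I" unfolding I_def by simp
  finally have "(norm (g w))\<^sup>2 \<le> R / (R - r) * I"
  proof -
    assume "norm (2 * of_real pi * \<i> * (g w)\<^sup>2) \<le> 2 * pi * R / (R - r) * I"
    hence "(2 * pi) * (norm (g w))\<^sup>2 \<le> (2 * pi) * (R / (R - r) * I)"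
      by (simp add: norm_mult norm_power)
    thus ?thesis by (rule mult_left_le_imp_le) simp
  qed
  hence "ennreal ((norm (g w))\<^sup>2) \<le> ennreal (R / (R - r) * I)" by (rule ennreal_leI)
  also have "\<dots> = ennreal (R / (R - r)) * ennreal I"
    using r R Iu by (intro ennreal_mult) (auto intro!: has_integral_nonneg[OF Iu] simp: u_def)
  also have "ennreal I = (\<integral>\<^sup>+t. ennreal (u t) * indicator {0..1} t \<partial>lborel)"
    by (rule nn_integral_has_integral_lebesgue'[OF _ Iu, symmetric]) (simp add: u_def)
  finally show ?thesis unfolding u_def .
qed

text \<open>The point where the supremum is attained varies with \<open>x\<close>, but the circle
  mean that bounds the value there does not depend on that point, so no measurable choice has to be
  made. Fubini then exchanges the circle mean with the expectation, and \<open>bnd\<close> applies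
  on the circle.\<close>

lemma (in prob_space) sup_mean_square:
  fixes h :: "'a \<Rightarrow> complex \<Rightarrow> complex"
  assumes cont: "\<And>x. x \<in> space M \<Longrightarrow> continuous_on (cball 0 R) (h x)"
    and holo: "\<And>x. x \<in> space M \<Longrightarrow> h x holomorphic_on ball 0 R"
    and r: "0 \<le> r" "r < R"
    and meas: "\<And>z. z \<in> cball 0 r \<Longrightarrow> (\<lambda>x. h x z) \<in> borel_measurable M"
    and joint: "(\<lambda>(x, t). h x (circ R t)) \<in> borel_measurable (M \<Otimes>\<^sub>M lborel)"
    and bnd: "\<And>z. norm z = R \<Longrightarrow> (\<integral>\<^sup>+x. ennreal ((norm (h x z))\<^sup>2) \<partial>M) \<le> ennreal B"
    and B: "B \<ge> 0"
  shows "integrable M (\<lambda>x. (SUP z\<in>cball 0 r. norm (h x z))\<^sup>2)"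
    and "expectation (\<lambda>x. (SUP z\<in>cball 0 r. norm (h x z))\<^sup>2) \<le> R / (R - r) * B"
    and "(\<lambda>x. SUP z\<in>cball 0 r. norm (h x z)) \<in> borel_measurable M"
proof -
  have R: "R > 0" using r by simp
  interpret pair_sigma_finite M lborel ..
  define S where "S x = (SUP z\<in>cball 0 r. norm (h x z))" for x
  have ne: "cball 0 r \<noteq> ({} :: complex set)" using r by simp
  have contr: "continuous_on (cball 0 r) (h x)" if "x \<in> space M" for x
    using cont[OF that] by (rule continuous_on_subset) (use r in auto)
  show Sm: "(\<lambda>x. SUP z\<in>cball 0 r. norm (h x z)) \<in> borel_measurable M"
    using r meas by (intro borel_measurable_SUP_compact continuous_on_norm contr borel_measurable_norm) auto
  hence [measurable]: "S \<in> borel_measurable M" unfolding S_def .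
  have [measurable]: "(\<lambda>(x, t). ennreal ((norm (h x (circ R t)))\<^sup>2) * indicator {0..1} t) \<in> borel_measurable (M \<Otimes>\<^sub>M lborel)"
    using joint unfolding case_prod_unfold by measurable
  have S0: "S x \<ge> 0" if "x \<in> space M" for x
  proof -
    have "norm (h x 0) \<le> S x" unfolding S_def
      by (rule cSUP_upper[OF _ bdd_above_continuous_image]) (use r contr[OF that] in \<open>auto intro: continuous_intros\<close>)
    thus ?thesis by (rule order.trans[OF norm_ge_zero])
  qed
  have pt: "ennreal ((S x)\<^sup>2) \<le> ennreal (R / (R - r)) * (\<integral>\<^sup>+t. ennreal ((norm (h x (circ R t)))\<^sup>2) * indicator {0..1} t \<partial>lborel)"
    if x: "x \<in> space M" for x
  proof -
    have "compact (cball 0 r :: complex set)" by simp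
    from continuous_attains_sup[OF this ne continuous_on_norm[OF contr[OF x]]]
    obtain w where w: "w \<in> cball 0 r" "\<And>z. z \<in> cball 0 r \<Longrightarrow> norm (h x z) \<le> norm (h x w)" by auto
    have "S x \<le> norm (h x w)" unfolding S_def by (rule cSUP_least[OF ne]) (rule w(2))
    hence "(S x)\<^sup>2 \<le> (norm (h x w))\<^sup>2" using S0[OF x] by (intro power_mono)
    hence "ennreal ((S x)\<^sup>2) \<le> ennreal ((norm (h x w))\<^sup>2)" by (rule ennreal_leI)
    also have "\<dots> \<le> ennreal (R / (R - r)) * (\<integral>\<^sup>+t. ennreal ((norm (h x (circ R t)))\<^sup>2) * indicator {0..1} t \<partial>lborel)"
      by (rule norm_square_le_circle_mean[OF cont[OF x] holo[OF x]]) (use r w R in auto)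
    finally show ?thesis .
  qed
  have "(\<integral>\<^sup>+x. ennreal ((S x)\<^sup>2) \<partial>M)
     \<le> (\<integral>\<^sup>+x. ennreal (R / (R - r)) * (\<integral>\<^sup>+t. ennreal ((norm (h x (circ R t)))\<^sup>2) * indicator {0..1} t \<partial>lborel) \<partial>M)"
    by (rule nn_integral_mono) (rule pt)
  also have "\<dots> = ennreal (R / (R - r)) * (\<integral>\<^sup>+x. (\<integral>\<^sup>+t. ennreal ((norm (h x (circ R t)))\<^sup>2) * indicator {0..1} t \<partial>lborel) \<partial>M)"
    by (rule nn_integral_cmult) measurable
  also have "(\<integral>\<^sup>+x. (\<integral>\<^sup>+t. ennreal ((norm (h x (circ R t)))\<^sup>2) * indicator {0..1} t \<partial>lborel) \<partial>M)
     = (\<integral>\<^sup>+t. (\<integral>\<^sup>+x. ennreal ((norm (h x (circ R t)))\<^sup>2) * indicator {0..1} t \<partial>M) \<partial>lborel)"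
    by (rule Fubini'[symmetric]) measurable
  also have "\<dots> \<le> (\<integral>\<^sup>+t. ennreal B * indicator {0..1} t \<partial>(lborel :: real measure))"
  proof (rule nn_integral_mono)
    fix t :: real
    show "(\<integral>\<^sup>+x. ennreal ((norm (h x (circ R t)))\<^sup>2) * indicator {0..1} t \<partial>M) \<le> ennreal B * indicator {0..1} t"
      by (cases "t \<in> {0..1}") (use bnd[of "circ R t"] R in auto)
  qed
  also have "\<dots> = ennreal B" by (subst nn_integral_cmult_indicator) auto
  finally have "(\<integral>\<^sup>+x. ennreal ((S x)\<^sup>2) \<partial>M) \<le> ennreal (R / (R - r)) * ennreal B"
    by (simp add: mult_left_mono)
  also have "\<dots> = ennreal (R / (R - r) * B)" using R r B by (intro ennreal_mult[symmetric]) auto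
  finally have fin: "(\<integral>\<^sup>+x. ennreal ((S x)\<^sup>2) \<partial>M) \<le> ennreal (R / (R - r) * B)" .
  show int: "integrable M (\<lambda>x. (SUP z\<in>cball 0 r. norm (h x z))\<^sup>2)"
    unfolding S_def[symmetric] using fin
    by (intro integrableI_nonneg) (auto simp: le_less_trans)
  have "ennreal (expectation (\<lambda>x. (S x)\<^sup>2)) = (\<integral>\<^sup>+x. ennreal ((S x)\<^sup>2) \<partial>M)"
    by (rule nn_integral_eq_integral[symmetric]) (use int in \<open>auto simp: S_def\<close>)
  with fin have "ennreal (expectation (\<lambda>x. (S x)\<^sup>2)) \<le> ennreal (R / (R - r) * B)" by simp
  thus "expectation (\<lambda>x. (SUP z\<in>cball 0 r. norm (h x z))\<^sup>2) \<le> R / (R - r) * B"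
    unfolding S_def using R r B by (subst (asm) ennreal_le_iff) auto
qed

text \<open>Nonnegativity of the variance; integrability follows from
  \<open>\<bar>y\<bar> \<le> 1 + y^2\<close>.\<close>

lemma (in prob_space) expectation_le_sqrt:
  fixes Z :: "'a \<Rightarrow> real"
  assumes [measurable]: "Z \<in> borel_measurable M" and sq: "integrable M (\<lambda>x. (Z x)\<^sup>2)"
  shows "integrable M Z" "expectation Z \<le> sqrt (expectation (\<lambda>x. (Z x)\<^sup>2))"
proof -
  show int: "integrable M Z"
  proof (rule Bochner_Integration.integrable_bound)
    show "integrable M (\<lambda>x. 1 + (Z x)\<^sup>2)" using sq by auto
    have "\<bar>y\<bar> \<le> 1 + y\<^sup>2" for y :: real
      using sum_squares_bound[of "\<bar>y\<bar>" 1] zero_le_power2[of y] by (auto simp: power2_eq_square) 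
    thus "AE x in M. norm (Z x) \<le> norm (1 + (Z x)\<^sup>2)" by auto
  qed measurable
  have "0 \<le> variance Z" by (rule variance_positive)
  also have "\<dots> = expectation (\<lambda>x. (Z x)\<^sup>2) - (expectation Z)\<^sup>2" by (rule variance_eq[OF int sq])
  finally show "expectation Z \<le> sqrt (expectation (\<lambda>x. (Z x)\<^sup>2))" by (intro real_le_rsqrt) simp
qed

text \<open>Cauchy's inequality on discs of radius \<open>R - r\<close> around the points of the
  smaller disc bounds the derivative, and that disc is convex.\<close>

lemma Lipschitz_from_bound:
  assumes holo: "g holomorphic_on ball 0 R" and cont: "continuous_on (cball 0 R) g"
    and bnd: "\<And>z. norm z \<le> R \<Longrightarrow> norm (g z) \<le> B"
    and r: "r < R" and zw: "norm z \<le> r" "norm w \<le> r"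
  shows "norm (g z - g w) \<le> B / (R - r) * norm (z - w)"
proof (rule differentiable_bound[where S = "cball 0 r"])
  fix u :: complex assume u: "u \<in> cball 0 r"
  hence "u \<in> ball 0 R" using r by auto
  hence d: "(g has_field_derivative deriv g u) (at u)"
    using holomorphic_derivI[OF holo open_ball] by blast
  thus "(g has_derivative (\<lambda>h. deriv g u * h)) (at u within cball 0 r)"
    unfolding has_field_derivative_def by (rule has_derivative_at_withinI)
  have sub: "cball u (R - r) \<subseteq> cball 0 R"
  proof
    fix v assume "v \<in> cball u (R - r)"
    hence "norm (v - u) \<le> R - r" by (simp add: dist_norm norm_minus_commute)
    thus "v \<in> cball 0 R" using u norm_triangle_sub[of v u] by simp
  qed
  have sub': "ball u (R - r) \<subseteq> ball 0 R"
  proof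
    fix v assume "v \<in> ball u (R - r)"
    hence "norm (v - u) < R - r" by (simp add: dist_norm norm_minus_commute)
    thus "v \<in> ball 0 R" using u norm_triangle_sub[of v u] by simp
  qed
  have "norm ((deriv ^^ 1) g u) \<le> fact 1 * B / (R - r) ^ 1"
  proof (rule Cauchy_inequality)
    show "norm (g x) \<le> B" if "norm (u - x) = R - r" for x
    proof (rule bnd)
      have "x \<in> cball u (R - r)" using that by (simp add: dist_norm)
      with sub have "x \<in> cball 0 R" by blast
      thus "norm x \<le> R" by simp
    qed
  qed (use holomorphic_on_subset[OF holo sub'] continuous_on_subset[OF cont sub] r in auto)
  hence "norm (deriv g u) \<le> B / (R - r)" by simp
  thus "onorm (\<lambda>h. deriv g u * h) \<le> B / (R - r)"
    by (intro onorm_le) (unfold norm_mult, rule mult_right_mono, auto)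
qed (use zw in auto)

section \<open>Lipschitz functionals of a holomorphic function\<close>

lemma norm_exp_minus_1_le: "norm (z :: complex) \<le> 1 \<Longrightarrow> norm (exp z - 1) \<le> 3 * norm z"
proof -
  assume z: "norm z \<le> 1"
  have "norm (exp z - 1) \<le> exp \<bar>Re z\<bar> * norm z" using Taylor_exp[of z 0] by simp
  also have "\<dots> \<le> exp 1 * norm z" using abs_Re_le_cmod[of z] z by (intro mult_right_mono) auto
  also have "\<dots> \<le> 3 * norm z" using exp_le by (intro mult_right_mono) auto
  finally show ?thesis .
qed

text \<open>With \<open>a = norm q\<close>, splitting \<open>2 ^ K\<close> off the remainder leaves
  \<open>(2 * a) ^ K / fact K \<le> exp (2 * a)\<close> and in total
  \<open>exp (4 * a) / 2 ^ K\<close>. The threshold \<open>K / 16\<close> makes the numerator at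
  most \<open>exp (K / 4)\<close>, while \<open>2 ^ K \<ge> exp (K / 2)\<close>.\<close>

lemma exp_Taylor_tail:
  assumes "norm (q :: complex) \<le> real K / 16"
  shows "norm (exp q - (\<Sum>j\<le>K. q ^ j / fact j)) \<le> exp (- real K / 4)"
proof -
  define a where "a = norm q"
  have a: "a \<ge> 0" "16 * a \<le> real K" using assms by (auto simp: a_def)
  have "norm (exp q - (\<Sum>j\<le>K. q ^ j / fact j)) \<le> exp \<bar>Re q\<bar> * a ^ Suc K / fact K"
    unfolding a_def by (rule Taylor_exp)
  also have "\<dots> \<le> exp a * a ^ Suc K / fact K"
    using abs_Re_le_cmod[of q] unfolding a_def by (intro divide_right_mono mult_right_mono) auto
  also have "\<dots> = exp a * a * (2 * a) ^ K / fact K / 2 ^ K" by (simp add: power_mult_distrib)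
  also have "\<dots> \<le> exp a * exp a * exp (2 * a) / 2 ^ K"
  proof -
    have "(2 * a) ^ K / fact K \<le> exp (2 * a)"
    proof -
      have "(2 * a) ^ K / fact K = (2 * a) ^ K /\<^sub>R fact K" by (simp add: divide_inverse mult.commute)
      also have "\<dots> \<le> (\<Sum>n\<in>{K}. (2 * a) ^ n /\<^sub>R fact n)" by simp
      also have "\<dots> \<le> exp (2 * a)" unfolding exp_def
        by (rule sum_le_suminf[OF summable_exp_generic]) (use a in auto)
      finally show ?thesis .
    qed
    moreover have "a \<le> exp a" using exp_ge_add_one_self[of a] by linarith
    ultimately have "exp a * a * ((2 * a) ^ K / fact K) \<le> exp a * exp a * exp (2 * a)"
      using a by (intro mult_mono) auto
    hence "exp a * a * ((2 * a) ^ K / fact K) / 2 ^ K \<le> exp a * exp a * exp (2 * a) / 2 ^ K"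
      by (rule divide_right_mono) simp
    thus ?thesis by (simp only: times_divide_eq_right)
  qed
  also have "\<dots> = exp (4 * a) / 2 ^ K" by (simp flip: exp_add)
  also have "\<dots> \<le> exp (4 * a) / exp (real K / 2)"
  proof (rule divide_left_mono)
    have "exp (1/2) \<le> (2 :: real)" using exp_half_le2 by simp
    hence "exp (1/2) ^ K \<le> (2 :: real) ^ K" by (intro power_mono) auto
    thus "exp (real K / 2) \<le> 2 ^ K" by (simp add: exp_of_nat_mult[symmetric] mult.commute)
  qed auto
  also have "\<dots> = exp (4 * a - real K / 2)" by (simp add: exp_diff)
  also have "\<dots> \<le> exp (- real K / 4)" using a by simp
  finally show ?thesis .
qed

text \<open>Written as a functional of the logarithm \<open>q\<close>, since it is \<open>Q\<close>
  whose moments are accessible.\<close>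

definition Phi :: "(real \<Rightarrow> real) \<Rightarrow> (complex \<Rightarrow> complex) \<Rightarrow> complex set \<Rightarrow> (complex \<Rightarrow> complex) \<Rightarrow> real" where
  "Phi \<omega> f I q = \<omega> (SUP z\<in>I. cmod (exp (q z) - f z))"

locale test_functional =
  fixes \<omega> :: "real \<Rightarrow> real" and W0 \<Lambda> A :: real
  assumes bnd: "\<And>x. \<bar>\<omega> x\<bar> \<le> W0" and lip: "\<And>x y. \<bar>\<omega> x - \<omega> y\<bar> \<le> \<Lambda> * \<bar>x - y\<bar>"
    and supp: "\<And>x. x \<ge> A \<Longrightarrow> \<omega> x = 0" and A0: "A \<ge> 0" and Lam0: "\<Lambda> \<ge> 0"
begin

lemma W0_nonneg: "W0 \<ge> 0"
  using bnd[of 0] by linarith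

text \<open>From \<open>exp q1 = exp q2 * exp (q1 - q2)\<close>, where \<open>exp q2\<close> is at
  most \<open>A + F\<close> because the second supremum is at most \<open>A\<close>. The two index
  sets may differ, so that one estimate covers both a change of \<open>q\<close> and a change of the
  set of points.\<close>

lemma sup_exp_le:
  assumes ne: "I1 \<noteq> {}" and bdd: "bdd_above ((\<lambda>z. cmod (exp (q2 z) - f z)) ` I2)"
    and F: "\<And>z. z \<in> I2 \<Longrightarrow> norm (f z) \<le> F"
    and close: "\<And>i. i \<in> I1 \<Longrightarrow> \<exists>j\<in>I2. norm (q1 i - q2 j) \<le> \<delta> \<and> norm (f i - f j) \<le> \<delta>2"
    and \<delta>: "\<delta> \<le> 1" and small: "(SUP z\<in>I2. cmod (exp (q2 z) - f z)) \<le> A"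
  shows "(SUP z\<in>I1. cmod (exp (q1 z) - f z)) \<le> (SUP z\<in>I2. cmod (exp (q2 z) - f z)) + (3 * (A + F) * \<delta> + \<delta>2)"
proof (rule cSUP_least[OF ne])
  fix i assume "i \<in> I1"
  then obtain j where j: "j \<in> I2" "norm (q1 i - q2 j) \<le> \<delta>" "norm (f i - f j) \<le> \<delta>2" using close by blast
  have 1: "norm (exp (q2 j) - f j) \<le> (SUP z\<in>I2. cmod (exp (q2 z) - f z))"
    by (rule cSUP_upper[OF j(1) bdd])
  have "norm (exp (q2 j)) \<le> norm (exp (q2 j) - f j) + norm (f j)" using norm_triangle_ineq[of "exp (q2 j) - f j" "f j"] by simp
  also have "\<dots> \<le> A + F" using 1 small F[OF j(1)] by linarith
  finally have 2: "norm (exp (q2 j)) \<le> A + F" .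
  hence AF: "A + F \<ge> 0" using norm_ge_zero by (rule order.trans[rotated])
  have 3: "norm (exp (q1 i - q2 j) - 1) \<le> 3 * \<delta>"
    using norm_exp_minus_1_le[of "q1 i - q2 j"] j(2) \<delta> by linarith
  have "exp (q1 i) - f i = (exp (q2 j) - f j) + exp (q2 j) * (exp (q1 i - q2 j) - 1) - (f i - f j)"
    by (simp add: algebra_simps flip: exp_add)
  also have "norm \<dots> \<le> norm (exp (q2 j) - f j) + norm (exp (q2 j)) * norm (exp (q1 i - q2 j) - 1) + norm (f i - f j)"
    by (intro order.trans[OF norm_triangle_ineq4] add_right_mono order.trans[OF norm_triangle_ineq]) (simp add: norm_mult)
  also have "\<dots> \<le> (SUP z\<in>I2. cmod (exp (q2 z) - f z)) + (A + F) * (3 * \<delta>) + \<delta>2"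
    using AF 3 by (intro add_mono 1 mult_mono 2 j) auto
  finally show "cmod (exp (q1 i) - f i) \<le> (SUP z\<in>I2. cmod (exp (q2 z) - f z)) + (3 * (A + F) * \<delta> + \<delta>2)"
    by (simp add: algebra_simps)
qed

text \<open>\<open>exp\<close> has no global Lipschitz constant; the support of \<omega>
  compensates. If both suprema are at least \<open>A\<close>, both values vanish; otherwise the
  smaller one controls the exponential. For \<open>\<delta> > 1\<close> the trivial bound
  \<open>2 * W0\<close> is good enough.\<close>

lemma Phi_lipschitz:
  assumes ne: "I1 \<noteq> {}" "I2 \<noteq> {}"
    and bdd: "bdd_above ((\<lambda>z. cmod (exp (q1 z) - f z)) ` I1)" "bdd_above ((\<lambda>z. cmod (exp (q2 z) - f z)) ` I2)"
    and F: "\<And>z. z \<in> I1 \<union> I2 \<Longrightarrow> norm (f z) \<le> F" "F \<ge> 0"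
    and c1: "\<And>i. i \<in> I1 \<Longrightarrow> \<exists>j\<in>I2. norm (q1 i - q2 j) \<le> \<delta> \<and> norm (f i - f j) \<le> \<delta>2"
    and c2: "\<And>i. i \<in> I2 \<Longrightarrow> \<exists>j\<in>I1. norm (q2 i - q1 j) \<le> \<delta> \<and> norm (f i - f j) \<le> \<delta>2"
    and d: "\<delta> \<ge> 0" "\<delta>2 \<ge> 0"
  shows "\<bar>Phi \<omega> f I1 q1 - Phi \<omega> f I2 q2\<bar> \<le> (2 * W0 + 3 * \<Lambda> * (A + F)) * \<delta> + \<Lambda> * \<delta>2"
proof -
  define m1 where "m1 = (SUP z\<in>I1. cmod (exp (q1 z) - f z))"
  define m2 where "m2 = (SUP z\<in>I2. cmod (exp (q2 z) - f z))"
  define c where "c = 3 * (A + F) * \<delta> + \<delta>2"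
  have nn: "0 \<le> 3 * \<Lambda> * (A + F) * \<delta>" "0 \<le> \<Lambda> * \<delta>2" "0 \<le> 2 * W0 * \<delta>" "0 \<le> \<Lambda> * c"
    using A0 F(2) d Lam0 W0_nonneg by (auto simp: c_def)
  have P: "Phi \<omega> f I1 q1 = \<omega> m1" "Phi \<omega> f I2 q2 = \<omega> m2" by (auto simp: Phi_def m1_def m2_def)
  consider "\<delta> > 1" | "m1 \<ge> A" "m2 \<ge> A" | "\<delta> \<le> 1" "m1 < A \<or> m2 < A" by linarith
  thus ?thesis
  proof cases
    case 1
    have "\<bar>\<omega> m1 - \<omega> m2\<bar> \<le> 2 * W0 * 1" using bnd[of m1] bnd[of m2] by linarith
    also have "\<dots> \<le> 2 * W0 * \<delta>" using 1 W0_nonneg by (intro mult_left_mono) auto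
    finally show ?thesis using nn by (simp add: P algebra_simps)
  next
    case 2
    thus ?thesis using nn supp[of m1] supp[of m2] by (simp add: P algebra_simps)
  next
    case 3
    have a: "m1 \<le> m2 + c" if "m2 \<le> A"
      unfolding m1_def m2_def c_def by (rule sup_exp_le) (use ne bdd F c1 3 that in \<open>auto simp: m2_def\<close>)
    have b: "m2 \<le> m1 + c" if "m1 \<le> A"
      unfolding m1_def m2_def c_def by (rule sup_exp_le) (use ne bdd F c2 3 that in \<open>auto simp: m1_def\<close>)
    have "c \<ge> 0" using A0 F(2) d by (auto simp: c_def)
    hence "\<bar>m1 - m2\<bar> \<le> c" using a b 3(2) by linarith
    hence "\<bar>\<omega> m1 - \<omega> m2\<bar> \<le> \<Lambda> * c" using lip[of m1 m2] Lam0 by (meson mult_left_mono order.trans)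
    thus ?thesis using nn by (simp add: P c_def algebra_simps)
  qed
qed

lemma Phi_bound: "\<bar>Phi \<omega> f I q\<bar> \<le> W0"
  by (simp add: Phi_def bnd)

end

section \<open>A discrete Fejer kernel\<close>

text \<open>The sine is concave, so it lies above its chord over \<open>[0, 3 * pi / 4]\<close>.
  Three quarters of a period are needed because a point with
  \<open>\<bar>x\<bar> \<le> P / 4\<close> can be as far as \<open>3 / 4 * P\<close> from a
  node.\<close>

lemma sin_pi_lower:
  assumes "0 \<le> u" "u \<le> 3 / 4"
  shows "sin (pi * u) \<ge> 2 / 3 * u"
proof -
  have conv: "convex_on {0..pi} (\<lambda>x. - sin x)"
  proof (rule f''_ge0_imp_convex)
    show "((\<lambda>x. - sin x) has_real_derivative - cos x) (at x)" for x
      by (auto intro!: derivative_eq_intros)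
    show "((\<lambda>x. - cos x) has_real_derivative sin x) (at x)" for x
      by (auto intro!: derivative_eq_intros)
    show "0 \<le> sin x" if "x \<in> {0..pi}" for x using that by (auto intro: sin_ge_zero)
  qed auto
  define t where "t = u / (3 / 4)"
  have t: "0 \<le> t" "t \<le> 1" using assms by (auto simp: t_def)
  have e: "(1 - t) *\<^sub>R 0 + t *\<^sub>R (3 / 4 * pi) = pi * u" by (simp add: t_def)
  have "- sin ((1 - t) *\<^sub>R 0 + t *\<^sub>R (3 / 4 * pi)) \<le> (1 - t) * (- sin 0) + t * (- sin (3 / 4 * pi))"
    using t by (intro convex_onD[OF conv]) auto
  hence "t * sin (3 / 4 * pi) \<le> sin (pi * u)" unfolding e by simp
  moreover have "sin (3 / 4 * pi) = sqrt 2 / 2"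
  proof -
    have "sin (3 / 4 * pi) = sin (pi - pi / 4)" by (rule arg_cong[of _ _ sin]) simp
    also have "\<dots> = sqrt 2 / 2" by (simp only: sin_pi_minus sin_45)
    finally show ?thesis .
  qed
  ultimately have "sin (pi * u) \<ge> t * (sqrt 2 / 2)" by (simp only:)
  moreover have "t * (sqrt 2 / 2) \<ge> t * (1 / 2)" using t by (intro mult_left_mono) auto
  ultimately show ?thesis by (simp add: t_def)
qed

lemma norm_cis_minus_1_ge:
  assumes "\<bar>u\<bar> \<le> 3 / 4"
  shows "u\<^sup>2 \<le> (norm (cis (2 * pi * u) - 1))\<^sup>2"
proof -
  have s: "2 / 3 * \<bar>u\<bar> \<le> sin (pi * \<bar>u\<bar>)" using assms by (intro sin_pi_lower) auto
  have c: "cos (2 * (pi * u)) = 1 - 2 * (sin (pi * u))\<^sup>2" by (rule cos_double_sin)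
  have "(norm (cis (2 * pi * u) - 1))\<^sup>2 = (cos (2 * (pi * u)) - 1)\<^sup>2 + (sin (2 * (pi * u)))\<^sup>2"
    by (simp add: cmod_power2 mult.assoc)
  also have "\<dots> = 2 - 2 * cos (2 * (pi * u))"
    using sin_cos_squared_add[of "2 * (pi * u)"] by (simp add: power2_eq_square algebra_simps)
  also have "\<dots> = (2 * sin (pi * u))\<^sup>2" unfolding c by (simp add: power2_eq_square)
  also have "\<dots> = (2 * sin (pi * \<bar>u\<bar>))\<^sup>2" by (simp add: abs_if power2_eq_square)
  also have "\<dots> \<ge> \<bar>u\<bar>\<^sup>2" using s assms by (intro power_mono) auto
  finally show ?thesis by simp
qed

text \<open>
  A \<open>P\<close>-periodic kernel, normalised so that its translates by the \<open>N\<close> nodes sum to \<open>1\<close> exactly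
  (\<open>fej_sum\<close>).
\<close>

definition fej :: "nat \<Rightarrow> real \<Rightarrow> real \<Rightarrow> real" where
  "fej N P x = (norm (\<Sum>j<N. cis (2 * pi * real j * x / P)))\<^sup>2 / (real N)\<^sup>2"

definition node :: "nat \<Rightarrow> real \<Rightarrow> nat \<Rightarrow> real" where
  "node N P a = P * real a / real N - P / 2"

lemma fej_nonneg: "fej N P x \<ge> 0"
  by (simp add: fej_def)

lemma fej_expand:
  "complex_of_real (fej N P x) =
    (\<Sum>(j, j')\<in>{..<N} \<times> {..<N}. cis (2 * pi * (real j - real j') * x / P)) / (of_nat N)\<^sup>2"
proof -
  let ?s = "\<Sum>j<N. cis (2 * pi * real j * x / P)"
  have "complex_of_real ((norm ?s)\<^sup>2) = ?s * cnj ?s" by (simp only: complex_norm_square)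
  also have "\<dots> = (\<Sum>j<N. \<Sum>j'<N. cis (2 * pi * real j * x / P) * cnj (cis (2 * pi * real j' * x / P)))"
    by (simp add: sum_product)
  also have "\<dots> = (\<Sum>j<N. \<Sum>j'<N. cis (2 * pi * (real j - real j') * x / P))"
    by (intro sum.cong refl)
       (simp add: cis_cnj cis_mult diff_divide_distrib algebra_simps)
  finally show ?thesis by (simp add: fej_def sum.cartesian_product)
qed

text \<open>A geometric sum over roots of unity. The condition \<open>\<bar>m\<bar> < N\<close>
  prevents a nonzero \<open>m\<close> from being a multiple of \<open>N\<close>, that is, the ratio
  from being 1.\<close>

lemma sum_cis_period:
  fixes m :: int
  assumes "\<bar>m\<bar> < int N"
  shows "(\<Sum>a<N. cis (2 * pi * of_int m * real a / real N)) = (if m = 0 then of_nat N else 0)"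
proof (cases "m = 0")
  case False
  define w where "w = cis (2 * pi * of_int m / real N)"
  have N: "N > 0" using assms by auto
  have w1: "w \<noteq> 1"
  proof
    assume "w = 1"
    hence "cos (2 * pi * of_int m / real N) = 1" by (auto simp: w_def complex_eq_iff)
    then obtain k :: int where "2 * pi * of_int m / real N = of_int k * 2 * pi"
      using cos_one_2pi_int by blast
    hence "of_int m = of_int k * real N" using N by (simp add: field_simps)
    hence mk: "m = k * int N" by (metis of_int_eq_iff of_int_mult of_int_of_nat_eq)
    hence "k \<noteq> 0" using False by auto
    hence "\<bar>k\<bar> \<ge> 1" by auto
    hence "\<bar>k\<bar> * int N \<ge> 1 * int N" by (intro mult_right_mono) auto
    thus False using mk assms by (simp add: abs_mult)
  qed
  have wN: "w ^ N = 1"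
  proof -
    have "w ^ N = cis (real N * (2 * pi * of_int m / real N))" unfolding w_def Complex.DeMoivre ..
    also have "\<dots> = cis (2 * pi * of_int m)" using N by simp
    also have "\<dots> = 1" by (simp add: complex_eq_iff)
    finally show ?thesis .
  qed
  have "(\<Sum>a<N. cis (2 * pi * of_int m * real a / real N)) = (\<Sum>a<N. w ^ a)"
    unfolding w_def Complex.DeMoivre by (intro sum.cong refl arg_cong[of _ _ cis]) simp
  also have "\<dots> = 0" using geometric_sum[OF w1, of N] wN by simp
  finally show ?thesis using False by simp
qed simp

text \<open>Summed over the nodes only the \<open>N\<close> diagonal pairs \<open>j = j'\<close>
  survive, each with weight \<open>N\<close>, which explains the division by \<open>N^2\<close> in
  \<open>fej\<close>. As the identity is exact, interpolation with these weights reproduces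
  constants.\<close>

lemma fej_sum:
  assumes "N > 0" "P > 0"
  shows "(\<Sum>a<N. fej N P (x - node N P a)) = 1"
proof -
  have "complex_of_real (\<Sum>a<N. fej N P (x - node N P a))
     = (\<Sum>a<N. (\<Sum>(j, j')\<in>{..<N} \<times> {..<N}. cis (2 * pi * (real j - real j') * (x - node N P a) / P)) / (of_nat N)\<^sup>2)"
    by (simp add: fej_expand)
  also have "\<dots> = (\<Sum>a<N. \<Sum>(j, j')\<in>{..<N} \<times> {..<N}. cis (2 * pi * (real j - real j') * (x - node N P a) / P)) / (of_nat N)\<^sup>2"
    by (simp add: sum_divide_distrib)
  also have "(\<Sum>a<N. \<Sum>(j, j')\<in>{..<N} \<times> {..<N}. cis (2 * pi * (real j - real j') * (x - node N P a) / P))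
     = (\<Sum>(j, j')\<in>{..<N} \<times> {..<N}. \<Sum>a<N. cis (2 * pi * (real j - real j') * (x - node N P a) / P))"
    by (subst sum.swap) (simp add: case_prod_unfold)
  also have "\<dots> = (\<Sum>(j, j')\<in>{..<N} \<times> {..<N}. if j = j' then of_nat N else 0)"
  proof -
    have *: "(\<Sum>a<N. cis (2 * pi * (real j - real j') * (x - node N P a) / P)) = (if j = j' then of_nat N else 0)"
      if jj: "j \<in> {..<N}" "j' \<in> {..<N}" for j j'
    proof -
    define m where "m = int j' - int j"
    have "(\<Sum>a<N. cis (2 * pi * (real j - real j') * (x - node N P a) / P))
       = (\<Sum>a<N. cis (2 * pi * (real j - real j') * (x + P / 2) / P) * cis (2 * pi * of_int m * real a / real N))"
      unfolding cis_mult using assms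
      by (intro sum.cong refl arg_cong[of _ _ cis]) (simp add: node_def m_def field_simps)
    also have "\<dots> = cis (2 * pi * (real j - real j') * (x + P / 2) / P) * (if m = 0 then of_nat N else 0)"
      unfolding sum_distrib_left[symmetric]
      by (subst sum_cis_period) (use jj in \<open>auto simp: m_def\<close>)
    also have "\<dots> = (if j = j' then of_nat N else 0)" by (simp add: m_def)
    finally show ?thesis .
    qed
    show ?thesis by (intro sum.cong refl) (clarsimp simp only: split_beta mem_Times_iff *)
  qed
  also have "\<dots> = (of_nat N)\<^sup>2"
    unfolding sum.cartesian_product[symmetric] by (simp add: power2_eq_square)
  finally have "complex_of_real (\<Sum>a<N. fej N P (x - node N P a)) = 1" using assms by simp
  thus ?thesis by (simp only: of_real_eq_1_iff)
qed

text \<open>The kernel is the square of a geometric sum with ratio \<open>w\<close>: multiplied by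
  \<open>norm (w - 1)\<close> squared it becomes \<open>norm (w ^ N - 1)\<close> squared, at most 4,
  and \<open>norm (w - 1)\<close> dominates \<open>\<bar>x\<bar> / P\<close>.\<close>

lemma fej_second_moment_term:
  assumes "N > 0" "P > 0" "\<bar>x\<bar> \<le> 3 / 4 * P"
  shows "fej N P x * x\<^sup>2 \<le> 4 * P\<^sup>2 / (real N)\<^sup>2"
proof -
  define w where "w = cis (2 * pi * (x / P))"
  have s: "(\<Sum>j<N. cis (2 * pi * real j * x / P)) = (\<Sum>j<N. w ^ j)"
    unfolding w_def Complex.DeMoivre by (intro sum.cong refl arg_cong[of _ _ cis]) simp
  have "(x / P)\<^sup>2 \<le> (norm (w - 1))\<^sup>2"
    unfolding w_def using assms by (intro norm_cis_minus_1_ge) (auto simp: abs_if field_simps)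
  hence "fej N P x * (x / P)\<^sup>2 \<le> fej N P x * (norm (w - 1))\<^sup>2"
    by (intro mult_left_mono fej_nonneg)
  also have "\<dots> = (norm ((w - 1) * (\<Sum>j<N. w ^ j)))\<^sup>2 / (real N)\<^sup>2"
    by (simp add: fej_def s norm_mult power_mult_distrib)
  also have "(w - 1) * (\<Sum>j<N. w ^ j) = w ^ N - 1" by (rule power_diff_1_eq[symmetric])
  also have "(norm (w ^ N - 1))\<^sup>2 / (real N)\<^sup>2 \<le> 2\<^sup>2 / (real N)\<^sup>2"
  proof (intro divide_right_mono power_mono)
    have "norm (w ^ N - 1) \<le> norm (w ^ N) + norm (1 :: complex)" by (rule norm_triangle_ineq4)
    thus "norm (w ^ N - 1) \<le> 2" by (simp add: w_def norm_power)
  qed auto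
  finally have "fej N P x * x\<^sup>2 / P\<^sup>2 \<le> 4 / (real N)\<^sup>2" by (simp add: power_divide)
  thus ?thesis using assms by (simp add: field_simps)
qed

lemma fej_second_moment:
  assumes "N > 0" "P > 0" "\<bar>x\<bar> \<le> P / 4"
  shows "(\<Sum>a<N. fej N P (x - node N P a) * (x - node N P a)\<^sup>2) \<le> 4 * P\<^sup>2 / real N"
proof -
  have "(\<Sum>a<N. fej N P (x - node N P a) * (x - node N P a)\<^sup>2) \<le> (\<Sum>a<N. 4 * P\<^sup>2 / (real N)\<^sup>2)"
  proof (intro sum_mono fej_second_moment_term assms)
    fix a assume a: "a \<in> {..<N}"
    have "0 \<le> P * real a / real N" "P * real a / real N \<le> P"
      using a assms by (auto simp: field_simps)
    thus "\<bar>x - node N P a\<bar> \<le> 3 / 4 * P" using assms(3) unfolding node_def by linarith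
  qed
  also have "\<dots> = 4 * P\<^sup>2 / real N" using assms by (simp add: power2_eq_square)
  finally show ?thesis .
qed

section \<open>The product kernel on the complex plane\<close>

definition cfej :: "nat \<Rightarrow> real \<Rightarrow> complex \<Rightarrow> real" where
  "cfej N P w = fej N P (Re w) * fej N P (Im w)"

definition cnode :: "nat \<Rightarrow> real \<Rightarrow> nat \<times> nat \<Rightarrow> complex" where
  "cnode N P = (\<lambda>(a, b). Complex (node N P a) (node N P b))"

abbreviation cidx :: "nat \<Rightarrow> (nat \<times> nat) set" where
  "cidx N \<equiv> {..<N} \<times> {..<N}"

text \<open>The sign of the imaginary part makes \<open>Re (freq P g * w)\<close> a sum of real multiples of \<open>Re w\<close> and \<open>Im w\<close>
  with coefficients \<open>2 * pi / P * (j - j')\<close> and \<open>2 * pi / P * (l - l')\<close>.\<close>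

definition freq :: "real \<Rightarrow> (nat \<times> nat) \<times> (nat \<times> nat) \<Rightarrow> complex" where
  "freq P = (\<lambda>((j, j'), (l, l')). Complex (2 * pi / P * (real j - real j')) (- (2 * pi / P * (real l - real l'))))"

lemma cfej_nonneg: "cfej N P w \<ge> 0"
  by (simp add: cfej_def fej_nonneg)

lemma cfej_sum:
  assumes "N > 0" "P > 0"
  shows "(\<Sum>a\<in>cidx N. cfej N P (w - cnode N P a)) = 1"
proof -
  have "(\<Sum>a\<in>cidx N. cfej N P (w - cnode N P a)) =
     (\<Sum>a<N. fej N P (Re w - node N P a)) * (\<Sum>b<N. fej N P (Im w - node N P b))"
    by (simp add: sum_product sum.cartesian_product cfej_def cnode_def case_prod_unfold)
  thus ?thesis by (simp add: fej_sum[OF assms])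
qed

lemma cfej_second_moment:
  assumes "N > 0" "P > 0" "norm w \<le> P / 4"
  shows "(\<Sum>a\<in>cidx N. cfej N P (w - cnode N P a) * (norm (w - cnode N P a))\<^sup>2) \<le> 8 * P\<^sup>2 / real N"
proof -
  let ?x = "Re w" and ?y = "Im w"
  have "(\<Sum>a\<in>cidx N. cfej N P (w - cnode N P a) * (norm (w - cnode N P a))\<^sup>2) =
     (\<Sum>a<N. fej N P (?x - node N P a) * (?x - node N P a)\<^sup>2) * (\<Sum>b<N. fej N P (?y - node N P b))
     + (\<Sum>a<N. fej N P (?x - node N P a)) * (\<Sum>b<N. fej N P (?y - node N P b) * (?y - node N P b)\<^sup>2)"
    unfolding sum_product sum.cartesian_product sum.distrib[symmetric]
    by (intro sum.cong refl) (auto simp: cfej_def cnode_def cmod_power2 algebra_simps)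
  also have "\<dots> = (\<Sum>a<N. fej N P (?x - node N P a) * (?x - node N P a)\<^sup>2)
     + (\<Sum>b<N. fej N P (?y - node N P b) * (?y - node N P b)\<^sup>2)"
    by (simp add: fej_sum[OF assms(1,2)])
  also have "\<dots> \<le> 4 * P\<^sup>2 / real N + 4 * P\<^sup>2 / real N"
    using assms abs_Re_le_cmod[of w] abs_Im_le_cmod[of w] by (intro add_mono fej_second_moment) auto
  finally show ?thesis by simp
qed

lemma cfej_expand:
  "complex_of_real (cfej N P w) = (\<Sum>g\<in>cidx N \<times> cidx N. cis (Re (freq P g * w))) / (of_nat N) ^ 4"
proof -
  have "complex_of_real (cfej N P w) =
     (\<Sum>(g, h)\<in>cidx N \<times> cidx N.
        cis (2 * pi * (real (fst g) - real (snd g)) * Re w / P) * cis (2 * pi * (real (fst h) - real (snd h)) * Im w / P)) / (of_nat N) ^ 4"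
    by (simp add: cfej_def fej_expand sum_product sum.cartesian_product case_prod_unfold power_add[symmetric])
  also have "\<dots> = (\<Sum>g\<in>cidx N \<times> cidx N. cis (Re (freq P g * w))) / (of_nat N) ^ 4"
    unfolding cis_mult
    by (intro arg_cong2[of _ _ _ _ "(/)"] sum.cong refl)
       (auto simp: freq_def intro!: arg_cong[of _ _ cis])
  finally show ?thesis .
qed

lemma norm_freq_le:
  assumes "g \<in> cidx N \<times> cidx N" "P > 0"
  shows "norm (freq P g) \<le> 4 * pi * real N / P"
proof -
  obtain j j' l l' where g: "g = ((j, j'), (l, l'))" by (metis surj_pair)
  have "\<bar>real j - real j'\<bar> \<le> real N" "\<bar>real l - real l'\<bar> \<le> real N"
    using assms g by auto
  hence "2 * pi / P * \<bar>real j - real j'\<bar> \<le> 2 * pi / P * real N"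
        "2 * pi / P * \<bar>real l - real l'\<bar> \<le> 2 * pi / P * real N"
    using assms by (intro mult_left_mono; simp)+
  moreover have "norm (freq P g) \<le> \<bar>Re (freq P g)\<bar> + \<bar>Im (freq P g)\<bar>" by (rule cmod_le)
  moreover have "\<bar>Re (freq P g)\<bar> + \<bar>Im (freq P g)\<bar> = 2 * pi / P * \<bar>real j - real j'\<bar> + 2 * pi / P * \<bar>real l - real l'\<bar>"
    using assms by (simp add: g freq_def abs_mult)
  ultimately show ?thesis by simp
qed

section \<open>Interpolation of a functional of finitely many values\<close>

definition nodes :: "nat \<Rightarrow> complex set \<Rightarrow> (complex \<Rightarrow> nat \<times> nat) set" where
  "nodes N S = PiE S (\<lambda>_. cidx N)"

definition freqs :: "nat \<Rightarrow> complex set \<Rightarrow> (complex \<Rightarrow> (nat \<times> nat) \<times> (nat \<times> nat)) set" where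
  "freqs N S = PiE S (\<lambda>_. cidx N \<times> cidx N)"

definition smooth :: "nat \<Rightarrow> real \<Rightarrow> complex set \<Rightarrow> ((complex \<Rightarrow> complex) \<Rightarrow> real) \<Rightarrow> (complex \<Rightarrow> complex) \<Rightarrow> real" where
  "smooth N P S \<Psi> q = (\<Sum>\<alpha>\<in>nodes N S. \<Psi> (\<lambda>z. cnode N P (\<alpha> z)) * (\<Prod>z\<in>S. cfej N P (q z - cnode N P (\<alpha> z))))"

lemma card_nodes: "finite S \<Longrightarrow> card (nodes N S) = (N ^ 2) ^ card S"
  and card_freqs: "finite S \<Longrightarrow> card (freqs N S) = (N ^ 4) ^ card S"
  unfolding nodes_def freqs_def by (auto simp: card_PiE power2_eq_square power4_eq_xxxx mult_ac)

lemma nodes_prod_sum: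
  assumes "finite S" "N > 0" "P > 0"
  shows "(\<Sum>\<alpha>\<in>nodes N S. \<Prod>z\<in>S. cfej N P (q z - cnode N P (\<alpha> z))) = 1"
proof -
  have "(\<Sum>\<alpha>\<in>nodes N S. \<Prod>z\<in>S. cfej N P (q z - cnode N P (\<alpha> z))) = (\<Prod>z\<in>S. \<Sum>a\<in>cidx N. cfej N P (q z - cnode N P a))"
    unfolding nodes_def by (rule prod_sum_PiE[symmetric]) (use assms in auto)
  thus ?thesis by (simp add: cfej_sum[OF assms(2,3)])
qed

text \<open>The squared distance is absorbed into the factor belonging to \<open>z\<close>, which
  contributes its second moment; each of the other factors sums to 1.\<close>

lemma nodes_second_moment:
  assumes "finite S" "N > 0" "P > 0" "z \<in> S" "norm (q z) \<le> P / 4"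
  shows "(\<Sum>\<alpha>\<in>nodes N S. (\<Prod>z\<in>S. cfej N P (q z - cnode N P (\<alpha> z))) * (norm (q z - cnode N P (\<alpha> z)))\<^sup>2) \<le> 8 * P\<^sup>2 / real N"
proof -
  define k where "k y a = cfej N P (q y - cnode N P a) * (if y = z then (norm (q z - cnode N P a))\<^sup>2 else 1)" for y a
  have "(\<Prod>y\<in>S. cfej N P (q y - cnode N P (\<alpha> y))) * (norm (q z - cnode N P (\<alpha> z)))\<^sup>2 = (\<Prod>y\<in>S. k y (\<alpha> y))" for \<alpha>
    unfolding k_def prod.distrib using assms(1,4) by (simp add: prod.delta)
  hence "(\<Sum>\<alpha>\<in>nodes N S. (\<Prod>z\<in>S. cfej N P (q z - cnode N P (\<alpha> z))) * (norm (q z - cnode N P (\<alpha> z)))\<^sup>2)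
     = (\<Prod>y\<in>S. \<Sum>a\<in>cidx N. k y a)"
    unfolding nodes_def by (subst prod_sum_PiE) (use assms in auto)
  also have "\<dots> = (\<Sum>a\<in>cidx N. k z a) * (\<Prod>y\<in>S - {z}. \<Sum>a\<in>cidx N. k y a)"
    by (rule prod.remove) (use assms in auto)
  also have "(\<Prod>y\<in>S - {z}. \<Sum>a\<in>cidx N. k y a) = 1"
    by (intro prod.neutral ballI) (simp add: k_def cfej_sum[OF assms(2,3)])
  also have "(\<Sum>a\<in>cidx N. k z a) * 1 \<le> 8 * P\<^sup>2 / real N"
    using cfej_second_moment[OF assms(2,3,5)] by (simp add: k_def)
  finally show ?thesis .
qed

text \<open>\<open>smooth\<close> averages \<Psi> over the nodes with weights that are nonnegative
  and sum to 1, so the error is an average of Lipschitz differences. The inequality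
  \<open>u \<le> \<epsilon> + u^2 / \<epsilon>\<close> replaces distances by their squares, whose
  averages are the second moments of the kernel.\<close>

lemma smooth_approx:
  assumes S: "finite S" and "N > 0" "P > 0" "\<epsilon> > 0" "L \<ge> 0"
    and q: "\<And>z. z \<in> S \<Longrightarrow> norm (q z) \<le> P / 4"
    and lip: "\<And>q' \<delta>. \<delta> \<ge> 0 \<Longrightarrow> (\<And>z. z \<in> S \<Longrightarrow> norm (q z - q' z) \<le> \<delta>) \<Longrightarrow> \<bar>\<Psi> q - \<Psi> q'\<bar> \<le> L * \<delta>"
  shows "\<bar>\<Psi> q - smooth N P S \<Psi> q\<bar> \<le> L * (\<epsilon> + 8 * real (card S) * P\<^sup>2 / (real N * \<epsilon>))"
proof -
  define K where "K \<alpha> = (\<Prod>z\<in>S. cfej N P (q z - cnode N P (\<alpha> z)))" for \<alpha>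
  define D where "D \<alpha> z = (norm (q z - cnode N P (\<alpha> z)))\<^sup>2" for \<alpha> z
  have K0: "K \<alpha> \<ge> 0" for \<alpha> unfolding K_def by (intro prod_nonneg) (auto simp: cfej_nonneg)
  have K1: "(\<Sum>\<alpha>\<in>nodes N S. K \<alpha>) = 1" unfolding K_def by (rule nodes_prod_sum[OF assms(1-3)])
  have close: "\<bar>\<Psi> q - \<Psi> (\<lambda>z. cnode N P (\<alpha> z))\<bar> \<le> L * (\<epsilon> + (\<Sum>z\<in>S. D \<alpha> z) / \<epsilon>)" for \<alpha>
  proof (rule lip)
    have "(\<Sum>z\<in>S. D \<alpha> z) \<ge> 0" by (intro sum_nonneg) (auto simp: D_def)
    thus "\<epsilon> + (\<Sum>z\<in>S. D \<alpha> z) / \<epsilon> \<ge> 0" using \<open>\<epsilon> > 0\<close> by auto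
    fix z assume z: "z \<in> S"
    define u where "u = norm (q z - cnode N P (\<alpha> z))"
    have "D \<alpha> z \<le> (\<Sum>z\<in>S. D \<alpha> z)" using z S by (intro member_le_sum) (auto simp: D_def)
    hence "u\<^sup>2 / \<epsilon> \<le> (\<Sum>z\<in>S. D \<alpha> z) / \<epsilon>" using \<open>\<epsilon> > 0\<close> by (intro divide_right_mono) (auto simp: D_def u_def)
    moreover have "u \<le> \<epsilon> + u\<^sup>2 / \<epsilon>"
    proof (cases "u \<le> \<epsilon>")
      case True
      moreover have "u\<^sup>2 / \<epsilon> \<ge> 0" using \<open>\<epsilon> > 0\<close> by auto
      ultimately show ?thesis by linarith
    next
      case False
      hence "u * \<epsilon> \<le> u * u" by (intro mult_left_mono) (auto simp: u_def)
      hence "u \<le> u\<^sup>2 / \<epsilon>" using \<open>\<epsilon> > 0\<close> by (simp add: field_simps power2_eq_square)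
      thus ?thesis using \<open>\<epsilon> > 0\<close> by linarith
    qed
    ultimately show "norm (q z - cnode N P (\<alpha> z)) \<le> \<epsilon> + (\<Sum>z\<in>S. D \<alpha> z) / \<epsilon>"
      unfolding u_def by linarith
  qed
  have "\<Psi> q - smooth N P S \<Psi> q = (\<Sum>\<alpha>\<in>nodes N S. K \<alpha> * (\<Psi> q - \<Psi> (\<lambda>z. cnode N P (\<alpha> z))))"
  proof -
    have "\<Psi> q = (\<Sum>\<alpha>\<in>nodes N S. K \<alpha>) * \<Psi> q" using K1 by simp
    also have "\<dots> = (\<Sum>\<alpha>\<in>nodes N S. K \<alpha> * \<Psi> q)" by (rule sum_distrib_right)
    finally show ?thesis
      by (simp add: smooth_def K_def[symmetric] right_diff_distrib sum_subtractf mult.commute)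
  qed
  also have "\<bar>\<dots>\<bar> \<le> (\<Sum>\<alpha>\<in>nodes N S. K \<alpha> * (L * (\<epsilon> + (\<Sum>z\<in>S. D \<alpha> z) / \<epsilon>)))"
    by (intro order.trans[OF sum_abs] sum_mono) (auto simp: abs_mult K0 intro!: mult_left_mono close)
  also have "\<dots> = L * (\<epsilon> * (\<Sum>\<alpha>\<in>nodes N S. K \<alpha>) + (\<Sum>z\<in>S. \<Sum>\<alpha>\<in>nodes N S. K \<alpha> * D \<alpha> z) / \<epsilon>)"
  proof -
    have "(\<Sum>z\<in>S. \<Sum>\<alpha>\<in>nodes N S. K \<alpha> * D \<alpha> z) = (\<Sum>\<alpha>\<in>nodes N S. K \<alpha> * (\<Sum>z\<in>S. D \<alpha> z))"
      by (subst sum.swap) (simp add: sum_distrib_left)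
    thus ?thesis
      by (simp add: sum_distrib_left sum_divide_distrib sum.distrib[symmetric] algebra_simps)
  qed
  also have "\<dots> \<le> L * (\<epsilon> * 1 + (\<Sum>z\<in>S. 8 * P\<^sup>2 / real N) / \<epsilon>)"
  proof -
    have "(\<Sum>\<alpha>\<in>nodes N S. K \<alpha> * D \<alpha> z) \<le> 8 * P\<^sup>2 / real N" if "z \<in> S" for z
      unfolding K_def D_def using assms that by (intro nodes_second_moment) auto
    thus ?thesis unfolding K1 using \<open>\<epsilon> > 0\<close> \<open>L \<ge> 0\<close>
      by (intro mult_left_mono add_left_mono divide_right_mono sum_mono) auto
  qed
  also have "\<dots> = L * (\<epsilon> + 8 * real (card S) * P\<^sup>2 / (real N * \<epsilon>))" by (simp add: field_simps)
  finally show ?thesis .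
qed

lemma smooth_bound:
  assumes "finite S" "N > 0" "P > 0" "\<And>q. \<bar>\<Psi> q\<bar> \<le> B"
  shows "\<bar>smooth N P S \<Psi> q\<bar> \<le> B"
proof -
  define K where "K \<alpha> = (\<Prod>z\<in>S. cfej N P (q z - cnode N P (\<alpha> z)))" for \<alpha>
  have K0: "K \<alpha> \<ge> 0" for \<alpha> unfolding K_def by (intro prod_nonneg) (auto simp: cfej_nonneg)
  have K1: "(\<Sum>\<alpha>\<in>nodes N S. K \<alpha>) = 1" unfolding K_def by (rule nodes_prod_sum[OF assms(1-3)])
  have "\<bar>smooth N P S \<Psi> q\<bar> \<le> (\<Sum>\<alpha>\<in>nodes N S. B * K \<alpha>)"
    unfolding smooth_def K_def[symmetric]
    by (intro order.trans[OF sum_abs] sum_mono) (auto simp: abs_mult K0 assms intro!: mult_right_mono)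
  also have "\<dots> = B" using K1 by (simp add: sum_distrib_left[symmetric])
  finally show ?thesis .
qed

text \<open>A trigonometric sum as a linear expression in \<open>I\<close>, where \<open>I c\<close>
  stands in for the exponential with frequencies \<open>c\<close>. With \<open>I\<close> abstract,
  the same expression accommodates the exponentials, their expectations and
  \<open>ideal_char\<close>.\<close>

definition ideal_smooth ::
  "nat \<Rightarrow> real \<Rightarrow> complex set \<Rightarrow> ((complex \<Rightarrow> complex) \<Rightarrow> real) \<Rightarrow> ((complex \<Rightarrow> complex) \<Rightarrow> complex) \<Rightarrow> complex" where
  "ideal_smooth N P S \<Psi> I = (\<Sum>\<alpha>\<in>nodes N S. \<Sum>g\<in>freqs N S.
     of_real (\<Psi> (\<lambda>z. cnode N P (\<alpha> z))) * cis (- Re (\<Sum>z\<in>S. freq P (g z) * cnode N P (\<alpha> z)))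
       * I (\<lambda>z. freq P (g z)) / of_nat N ^ (4 * card S))"

lemma smooth_expand:
  assumes "finite S"
  shows "complex_of_real (smooth N P S \<Psi> q) = ideal_smooth N P S \<Psi> (\<lambda>c. cis (Re (\<Sum>z\<in>S. c z * q z)))"
proof -
  have "complex_of_real (\<Prod>z\<in>S. cfej N P (q z - cnode N P (\<alpha> z))) =
     (\<Sum>g\<in>freqs N S. cis (- Re (\<Sum>z\<in>S. freq P (g z) * cnode N P (\<alpha> z))) * cis (Re (\<Sum>z\<in>S. freq P (g z) * q z))) / of_nat N ^ (4 * card S)" for \<alpha>
  proof -
    have cis_prod: "(\<Prod>z\<in>S. cis (h z)) = cis (\<Sum>z\<in>S. h z)" for h
      using assms by (induction S rule: finite_induct) (auto simp: cis_mult)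
    have "complex_of_real (\<Prod>z\<in>S. cfej N P (q z - cnode N P (\<alpha> z)))
       = (\<Prod>z\<in>S. (\<Sum>g\<in>cidx N \<times> cidx N. cis (Re (freq P g * (q z - cnode N P (\<alpha> z))))) / (of_nat N) ^ 4)"
      by (simp add: cfej_expand)
    also have "\<dots> = (\<Prod>z\<in>S. \<Sum>g\<in>cidx N \<times> cidx N. cis (Re (freq P g * (q z - cnode N P (\<alpha> z))))) / of_nat N ^ (4 * card S)"
      by (simp add: prod_dividef power_mult)
    also have "(\<Prod>z\<in>S. \<Sum>g\<in>cidx N \<times> cidx N. cis (Re (freq P g * (q z - cnode N P (\<alpha> z)))))
       = (\<Sum>g\<in>freqs N S. \<Prod>z\<in>S. cis (Re (freq P (g z) * (q z - cnode N P (\<alpha> z)))))"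
      unfolding freqs_def by (rule prod_sum_PiE) (use assms in auto)
    also have "\<dots> = (\<Sum>g\<in>freqs N S. cis (- Re (\<Sum>z\<in>S. freq P (g z) * cnode N P (\<alpha> z))) * cis (Re (\<Sum>z\<in>S. freq P (g z) * q z)))"
      unfolding cis_prod cis_mult Re_sum[symmetric] right_diff_distrib sum_subtractf minus_complex.sel
      by (simp only: add.commute add_uminus_conv_diff diff_conv_add_uminus[symmetric])
    finally show ?thesis .
  qed
  thus ?thesis unfolding smooth_def ideal_smooth_def
    by (simp add: sum_distrib_left sum_divide_distrib mult_ac)
qed

text \<open>There are \<open>N ^ (2 * card S)\<close> choices of nodes and
  \<open>N ^ (4 * card S)\<close> choices of frequencies; the latter number cancels against the
  normalisation.\<close>

lemma ideal_smooth_diff: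
  assumes S: "finite S" and "N > 0" and Psi: "\<And>q. \<bar>\<Psi> q\<bar> \<le> B"
    and D: "\<And>g. g \<in> freqs N S \<Longrightarrow> norm (I1 (\<lambda>z. freq P (g z)) - I2 (\<lambda>z. freq P (g z))) \<le> \<Delta>"
  shows "norm (ideal_smooth N P S \<Psi> I1 - ideal_smooth N P S \<Psi> I2) \<le> B * real N ^ (2 * card S) * \<Delta>"
proof -
  have B0: "B \<ge> 0" using Psi[of undefined] by linarith
  have "norm (ideal_smooth N P S \<Psi> I1 - ideal_smooth N P S \<Psi> I2) \<le>
     (\<Sum>\<alpha>\<in>nodes N S. \<Sum>g\<in>freqs N S. B * \<Delta> / real N ^ (4 * card S))"
    unfolding ideal_smooth_def sum_subtractf[symmetric]
  proof (intro order.trans[OF norm_sum] sum_mono)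
    fix \<alpha> g assume "g \<in> freqs N S"
    let ?a = "complex_of_real (\<Psi> (\<lambda>z. cnode N P (\<alpha> z)))" and ?c = "cis (- Re (\<Sum>z\<in>S. freq P (g z) * cnode N P (\<alpha> z)))"
    let ?I1 = "I1 (\<lambda>z. freq P (g z))" and ?I2 = "I2 (\<lambda>z. freq P (g z))"
    have "?a * ?c * ?I1 / of_nat N ^ (4 * card S) - ?a * ?c * ?I2 / of_nat N ^ (4 * card S)
      = ?a * ?c * (?I1 - ?I2) / of_nat N ^ (4 * card S)"
      by (simp add: diff_divide_distrib algebra_simps)
    also have "norm \<dots> = \<bar>\<Psi> (\<lambda>z. cnode N P (\<alpha> z))\<bar> * norm (?I1 - ?I2) / real N ^ (4 * card S)"
      by (simp add: norm_mult norm_divide norm_power)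
    also have "\<dots> \<le> B * \<Delta> / real N ^ (4 * card S)"
      using B0 by (intro divide_right_mono mult_mono Psi D \<open>g \<in> freqs N S\<close>) auto
    finally show "norm (?a * ?c * ?I1 / of_nat N ^ (4 * card S) - ?a * ?c * ?I2 / of_nat N ^ (4 * card S))
        \<le> B * \<Delta> / real N ^ (4 * card S)" .
  qed
  also have "\<dots> = B * real N ^ (2 * card S) * \<Delta>"
    using \<open>N > 0\<close> by (simp add: card_nodes[OF S] card_freqs[OF S] power_mult[symmetric])
  finally show ?thesis .
qed

lemma (in prob_space) expectation_smooth:
  assumes S: "finite S" and meas: "\<And>z. z \<in> S \<Longrightarrow> (\<lambda>x. Q x z) \<in> borel_measurable M"
  shows "complex_of_real (expectation (\<lambda>x. smooth N P S \<Psi> (Q x)))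
    = ideal_smooth N P S \<Psi> (\<lambda>c. expectation (\<lambda>x. cis (Re (\<Sum>z\<in>S. c z * Q x z))))"
proof -
  have cm: "(\<lambda>x. cis (Re (\<Sum>z\<in>S. c z * Q x z))) \<in> borel_measurable M" for c
    unfolding cis_conv_exp using meas by measurable
  have int: "integrable M (\<lambda>x. cis (Re (\<Sum>z\<in>S. c z * Q x z)))" for c
    by (rule integrable_const_bound[of _ 1]) (use cm in auto)
  have "complex_of_real (expectation (\<lambda>x. smooth N P S \<Psi> (Q x))) = expectation (\<lambda>x. complex_of_real (smooth N P S \<Psi> (Q x)))"
    by (rule integral_complex_of_real[symmetric])
  also have "\<dots> = ideal_smooth N P S \<Psi> (\<lambda>c. expectation (\<lambda>x. cis (Re (\<Sum>z\<in>S. c z * Q x z))))"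
    unfolding smooth_expand[OF S] ideal_smooth_def
    by (subst Bochner_Integration.integral_sum,
        intro Bochner_Integration.integrable_sum integrable_divide_zero integrable_mult_right int,
        intro sum.cong refl, subst Bochner_Integration.integral_sum,
        intro integrable_divide_zero integrable_mult_right int) simp
  finally show ?thesis .
qed

section \<open>The random Dirichlet polynomials\<close>

definition zc :: "nat \<Rightarrow> complex \<Rightarrow> complex" where
  "zc n z = exp (- (3 / 4 + z) * of_real (ln (real n)))"

lemma zc_powr: "n > 0 \<Longrightarrow> zc n z = of_nat n powr (- (3 / 4 + z))"
  unfolding zc_def powr_def by (auto simp: Ln_of_nat)

lemma zc_mult: "m > 0 \<Longrightarrow> n > 0 \<Longrightarrow> zc (m * n) z = zc m z * zc n z"
  by (simp add: zc_def ln_mult_pos algebra_simps flip: exp_add)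

lemma zc_1 [simp]: "zc (Suc 0) z = 1"
  by (simp add: zc_def)

lemma norm_zc: "n > 0 \<Longrightarrow> norm (zc n z) = real n powr (- (3 / 4 + Re z))"
  by (simp add: zc_def powr_def)

lemma norm_zc_le:
  assumes "n > 0" "norm z \<le> \<rho>"
  shows "norm (zc n z) \<le> real n powr (- (3 / 4 - \<rho>))"
  unfolding norm_zc[OF assms(1)] using assms abs_Re_le_cmod[of z] by (intro powr_mono) auto

lemma zc_holomorphic [holomorphic_intros]: "zc n holomorphic_on A"
  unfolding zc_def by (intro holomorphic_intros)

lemma zc_continuous [continuous_intros]: "continuous_on A (zc n)"
  by (intro holomorphic_on_imp_continuous_on zc_holomorphic)

lemma zc_meas [measurable]: "zc n \<in> borel_measurable borel"
  by (intro borel_measurable_continuous_onI zc_continuous)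

text \<open>
  For \<open>norm z \<le> \<rho>\<close> the squares of the terms \<open>n powr (-3/4 - z)\<close> are at most \<open>n powr (-1 - 2 * bet \<rho>)\<close>; half
  of the excess over \<open>1\<close> gives the constant \<open>Zb\<close>, the other half the decay of tails.
\<close>

definition bet :: "real \<Rightarrow> real" where "bet \<rho> = 1 / 4 - \<rho>"

definition Zb :: "real \<Rightarrow> real" where
  "Zb \<rho> = (\<Sum>n. real (Suc n) powr (- (1 + bet \<rho>)))"

lemma Zb_sum_le:
  assumes "\<rho> < 1 / 4" "finite A" "0 \<notin> A"
  shows "(\<Sum>n\<in>A. real n powr (- (1 + bet \<rho>))) \<le> Zb \<rho>"
proof -
  have s: "summable (\<lambda>n. real (Suc n) powr (- (1 + bet \<rho>)))"
    using assms by (intro summable_Suc_powr) (simp add: bet_def)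
  have inj: "inj_on (\<lambda>n :: nat. n - 1) A"
  proof (rule inj_onI)
    fix m n assume "m \<in> A" "n \<in> A" "m - 1 = n - 1"
    moreover from this have "m \<noteq> 0" "n \<noteq> 0" using assms(3) by metis+
    ultimately show "m = n" by linarith
  qed
  have "(\<Sum>n\<in>A. real n powr (- (1 + bet \<rho>))) = (\<Sum>n\<in>A. real (Suc (n - 1)) powr (- (1 + bet \<rho>)))"
  proof (intro sum.cong refl)
    fix n assume "n \<in> A"
    hence "n \<noteq> 0" using assms(3) by metis
    thus "real n powr (- (1 + bet \<rho>)) = real (Suc (n - 1)) powr (- (1 + bet \<rho>))" by simp
  qed
  also have "\<dots> = (\<Sum>n\<in>(\<lambda>n. n - 1) ` A. real (Suc n) powr (- (1 + bet \<rho>)))"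
    by (subst sum.reindex[OF inj]) simp
  also have "\<dots> \<le> Zb \<rho>"
    unfolding Zb_def by (rule sum_le_suminf[OF s]) (use assms in auto)
  finally show ?thesis .
qed

lemma Zb_nonneg: "\<rho> < 1 / 4 \<Longrightarrow> Zb \<rho> \<ge> 0"
  using Zb_sum_le[of \<rho> "{}"] by simp

lemma tail_sum_le:
  assumes "\<rho> < 1 / 4" "finite A" "\<And>n. n \<in> A \<Longrightarrow> y \<le> n" "y \<ge> 1"
  shows "(\<Sum>n\<in>A. real n powr (-2 * (3 / 4 - \<rho>))) \<le> real y powr (- bet \<rho>) * Zb \<rho>"
proof -
  have "(\<Sum>n\<in>A. real n powr (-2 * (3 / 4 - \<rho>))) = (\<Sum>n\<in>A. real n powr (- bet \<rho>) * real n powr (- (1 + bet \<rho>)))"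
    by (simp add: bet_def flip: powr_add)
  also have "\<dots> \<le> (\<Sum>n\<in>A. real y powr (- bet \<rho>) * real n powr (- (1 + bet \<rho>)))"
    using assms by (intro sum_mono mult_right_mono powr_mono2') (auto simp: bet_def)
  also have "\<dots> = real y powr (- bet \<rho>) * (\<Sum>n\<in>A. real n powr (- (1 + bet \<rho>)))"
    by (rule sum_distrib_left[symmetric])
  also have "\<dots> \<le> real y powr (- bet \<rho>) * Zb \<rho>"
    using assms(1,2,4) assms(3)[of 0] by (intro mult_left_mono Zb_sum_le) (auto simp: not_less_eq_eq)
  finally show ?thesis .
qed

lemma tail_sum_kap_le:
  assumes "\<rho> < 1 / 4" "finite A" "\<And>n. n \<in> A \<Longrightarrow> y \<le> n" "y \<ge> 1"
  shows "(\<Sum>n\<in>A. kap n * real n powr (-2 * (3 / 4 - \<rho>))) \<le> real y powr (- bet \<rho>) * Zb \<rho>"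
  by (rule order.trans[OF sum_mono tail_sum_le[OF assms]])
     (auto intro!: mult_left_le_one_le kap_le_1 kap_nonneg)

text \<open>Zero outside \<open>A\<close>, so that polynomials over different subsets of
  \<open>{1..Y}\<close> share the index set that the moment lemmas expect.\<close>

definition qco :: "nat set \<Rightarrow> complex \<Rightarrow> nat \<Rightarrow> complex" where
  "qco A z n = of_real (kapon A n) * zc n z"

lemma norm_qco_le:
  assumes "norm z \<le> \<rho>"
  shows "norm (qco A z n) \<le> kapon A n * real n powr (- (3 / 4 - \<rho>))"
  using norm_zc_le[OF _ assms, of n]
  by (cases "n = 0") (auto simp: qco_def norm_mult kapon_nonneg intro!: mult_left_mono)

lemma qco_support: "A \<subseteq> {1..Y} \<Longrightarrow> n \<notin> {1..Y} \<Longrightarrow> qco A z n = 0"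
  by (auto simp: qco_def kapon_def)

context rand_char begin

definition Q :: "nat set \<Rightarrow> 'a \<Rightarrow> complex \<Rightarrow> complex" where
  "Q A x z = dpoly A (\<lambda>n. of_real (kap n) * zc n z) x"

lemma Q_holomorphic: "Q A x holomorphic_on B"
  unfolding Q_def dpoly_def by (intro holomorphic_intros)

lemma Q_continuous: "continuous_on B (Q A x)"
  by (intro holomorphic_on_imp_continuous_on Q_holomorphic)

lemma Q_meas [measurable]: "(\<lambda>x. Q A x z) \<in> borel_measurable M"
  unfolding Q_def by measurable

lemma Q_joint: "(\<lambda>(x, t). Q A x (circ R t)) \<in> borel_measurable (M \<Otimes>\<^sub>M lborel)"
  unfolding Q_def dpoly_def by measurable

lemma Q_eq_dpoly:
  assumes "A \<subseteq> {1..Y}"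
  shows "Q A x z = dpoly {1..Y} (qco A z) x"
  unfolding Q_def dpoly_def qco_def kapon_def using assms
  by (intro sum.mono_neutral_cong_left) auto

lemma norm_Q_le:
  assumes "A \<subseteq> {1..Y}" "norm z \<le> \<rho>" "\<rho> \<le> 1 / 4"
  shows "norm (Q A x z) \<le> real Y"
proof -
  have "norm (Q A x z) \<le> (\<Sum>n\<in>{1..Y}. norm (qco A z n))"
    unfolding Q_eq_dpoly[OF assms(1)] by (rule norm_dpoly_le)
  also have "\<dots> \<le> (\<Sum>n\<in>{1..Y}. 1 * 1)"
  proof (intro sum_mono order.trans[OF norm_qco_le[OF assms(2)]] mult_mono kapon_le_1)
    fix n assume "n \<in> {1..Y}"
    thus "real n powr (- (3 / 4 - \<rho>)) \<le> 1" using assms powr_mono[of "- (3 / 4 - \<rho>)" 0 "real n"] by auto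
  qed auto
  finally show ?thesis by simp
qed

end

lemma sum_norm_qco_le:
  assumes "norm z \<le> \<rho>" "\<rho> \<le> 1 / 4"
  shows "(\<Sum>n\<in>{1..Y}. norm (qco A z n)) \<le> real Y"
proof -
  have "(\<Sum>n\<in>{1..Y}. norm (qco A z n)) \<le> (\<Sum>n\<in>{1..Y}. 1 * 1)"
  proof (intro sum_mono order.trans[OF norm_qco_le[OF assms(1)]] mult_mono kapon_le_1)
    fix n assume "n \<in> {1..Y}"
    thus "real n powr (- (3 / 4 - \<rho>)) \<le> 1" using assms powr_mono[of "- (3 / 4 - \<rho>)" 0 "real n"] by auto
  qed auto
  thus ?thesis by simp
qed

context quasi_char begin

text \<open>For \<open>A\<close> in \<open>{y..Y}\<close> the variance is at most
  \<open>y powr (- bet \<rho>) * Zb \<rho>\<close>. Its \<open>k\<close>-th power makes tails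
  summable for almost sure convergence, while \<open>y = 1\<close> gives boundedness of the full
  polynomial.\<close>

lemma Q_moment:
  assumes A: "A \<subseteq> {y..Y}" "y \<ge> 1" "Y \<ge> 1" "Y ^ k \<le> W" and \<rho>: "\<rho> < 1 / 4" and z: "norm z \<le> \<rho>"
  shows "expectation (\<lambda>x. norm (Q A x z) ^ (2 * k)) \<le>
    fact k * (real y powr (- bet \<rho>) * Zb \<rho>) ^ k + eta * real Y ^ (2 * k)"
proof -
  have A1: "A \<subseteq> {1..Y}" using A by auto
  have fin: "finite A" using A1 by (rule finite_subset) auto
  have "expectation (\<lambda>x. norm (Q A x z) ^ (2 * k)) \<le>
     (\<Sum>n\<in>{1..Y ^ k}. (norm (dpow (qco A z) k n))\<^sup>2) + eta * (\<Sum>n\<in>{1..Y}. norm (qco A z n)) ^ (2 * k)"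
    unfolding Q_eq_dpoly[OF A1] by (rule even_moment_le[OF qco_support[OF A1]]) (use A in auto)
  also have "\<dots> \<le> fact k * (1\<^sup>2 * (real y powr (- bet \<rho>) * Zb \<rho>)) ^ k + eta * real Y ^ (2 * k)"
  proof (intro add_mono mult_left_mono power_mono sum_norm_qco_le[OF z] eta_nonneg)
    show "(\<Sum>n\<in>{1..Y ^ k}. (norm (dpow (qco A z) k n))\<^sup>2) \<le> fact k * (1\<^sup>2 * (real y powr (- bet \<rho>) * Zb \<rho>)) ^ k"
    proof (rule sum_dpow_square_le[OF _ A1])
      show "norm (qco A z n) \<le> 1 * (kapon A n * real n powr - (3 / 4 - \<rho>))" for n
        using norm_qco_le[OF z] by simp
      show "(\<Sum>n\<in>A. kap n * real n powr (- 2 * (3 / 4 - \<rho>))) \<le> real y powr - bet \<rho> * Zb \<rho>"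
        by (rule tail_sum_kap_le[OF \<rho> fin]) (use A in auto)
    qed auto
  qed (use \<rho> in \<open>auto intro!: sum_nonneg\<close>)
  finally show ?thesis by simp
qed

text \<open>The passage from a circle to a supremum is applied to the holomorphic function
  \<open>Q ^ k\<close>, so that high moments of the supremum come at the price of a mean
  square.\<close>

lemma Q_sup_moment:
  assumes A: "A \<subseteq> {y..Y}" "y \<ge> 1" "Y \<ge> 1" "Y ^ k \<le> W" and r: "0 \<le> r" "r < \<rho>" "\<rho> < 1 / 4"
  shows "integrable M (\<lambda>x. (SUP z\<in>cball 0 r. norm (Q A x z ^ k))\<^sup>2)"
    and "expectation (\<lambda>x. (SUP z\<in>cball 0 r. norm (Q A x z ^ k))\<^sup>2) \<le>
      \<rho> / (\<rho> - r) * (fact k * (real y powr (- bet \<rho>) * Zb \<rho>) ^ k + eta * real Y ^ (2 * k))"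
    and "(\<lambda>x. SUP z\<in>cball 0 r. norm (Q A x z ^ k)) \<in> borel_measurable M"
proof -
  define B where "B = fact k * (real y powr (- bet \<rho>) * Zb \<rho>) ^ k + eta * real Y ^ (2 * k)"
  have A1: "A \<subseteq> {1..Y}" using A by auto
  have bnd: "(\<integral>\<^sup>+x. ennreal ((norm (Q A x z ^ k))\<^sup>2) \<partial>M) \<le> ennreal B" if z: "norm z = \<rho>" for z
  proof -
    have eq: "(norm (Q A x z ^ k))\<^sup>2 = norm (Q A x z) ^ (2 * k)" for x
      by (simp add: norm_power power_mult[symmetric] mult.commute)
    have "(\<integral>\<^sup>+x. ennreal ((norm (Q A x z ^ k))\<^sup>2) \<partial>M) = ennreal (expectation (\<lambda>x. norm (Q A x z) ^ (2 * k)))"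
      unfolding eq
    proof (rule nn_integral_eq_integral)
      show "integrable M (\<lambda>x. norm (Q A x z) ^ (2 * k))"
        by (rule integrable_bdd[of _ "real Y ^ (2 * k)"])
           (use r z in \<open>auto simp: norm_power intro!: power_mono norm_Q_le[OF A1, of z \<rho>]\<close>)
    qed auto
    also have "\<dots> \<le> ennreal B"
      unfolding B_def by (intro ennreal_leI Q_moment A r) (use z in auto)
    finally show ?thesis .
  qed
  have B0: "B \<ge> 0" unfolding B_def using r eta_nonneg Zb_nonneg[of \<rho>] by (intro add_nonneg_nonneg mult_nonneg_nonneg zero_le_power) auto
  have joint: "(\<lambda>(x, t). Q A x (circ \<rho> t) ^ k) \<in> borel_measurable (M \<Otimes>\<^sub>M lborel)"
    using Q_joint[of A \<rho>] unfolding case_prod_unfold by measurable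
  note * = sup_mean_square[of \<rho> "\<lambda>x z. Q A x z ^ k" r B, OF continuous_on_power[OF Q_continuous]
      holomorphic_on_power[OF Q_holomorphic] r(1,2) _ joint bnd B0]
  show "integrable M (\<lambda>x. (SUP z\<in>cball 0 r. norm (Q A x z ^ k))\<^sup>2)" by (rule *(1)) auto
  show "expectation (\<lambda>x. (SUP z\<in>cball 0 r. norm (Q A x z ^ k))\<^sup>2) \<le>
      \<rho> / (\<rho> - r) * (fact k * (real y powr (- bet \<rho>) * Zb \<rho>) ^ k + eta * real Y ^ (2 * k))"
    unfolding B_def[symmetric] by (rule *(2)) auto
  show "(\<lambda>x. SUP z\<in>cball 0 r. norm (Q A x z ^ k)) \<in> borel_measurable M" by (rule *(3)) auto
qed

end

section \<open>Approximation by a finite trigonometric expression\<close>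

locale universality = test_functional +
  fixes r \<rho> F :: real and f :: "complex \<Rightarrow> complex"
  assumes r: "0 < r" "r < \<rho>" "\<rho> < 1 / 4"
    and f_holo: "f holomorphic_on ball 0 \<rho>" and f_cont: "continuous_on (cball 0 \<rho>) f"
    and f_bnd: "\<And>z. norm z \<le> \<rho> \<Longrightarrow> norm (f z) \<le> F"
begin

text \<open>An intermediate radius: one part of the margin between \<open>r\<close> and \<rho> is
  spent on bounding the supremum of \<open>Q\<close> by means over the circle of radius \<rho>, the
  other on bounding the derivative of \<open>Q\<close> by that supremum.\<close>

definition r1 :: real where "r1 = (r + \<rho>) / 2"
text \<open>The Lipschitz constant of \<open>Phi\<close> in \<open>q\<close>, as
  \<open>Phi_lipschitz\<close> provides it.\<close>

definition L0 :: real where "L0 = 2 * W0 + 3 * \<Lambda> * (A + F)"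

lemma r1: "r < r1" "r1 < \<rho>" "0 < r1"
  using r by (auto simp: r1_def)

lemma F0: "F \<ge> 0"
  using f_bnd[of 0] r by (auto intro: order.trans[OF norm_ge_zero])

lemma L0: "L0 \<ge> 0"
  using F0 A0 Lam0 W0_nonneg by (simp add: L0_def)

lemma f_cont': "continuous_on (cball 0 r) f"
  using f_cont by (rule continuous_on_subset) (use r in auto)

lemma bdd_exp:
  assumes "continuous_on (cball 0 r) q" "I \<subseteq> cball 0 r"
  shows "bdd_above ((\<lambda>z. cmod (exp (q z) - f z)) ` I)"
proof -
  have "bdd_above ((\<lambda>z. cmod (exp (q z) - f z)) ` cball 0 r)"
    by (intro bdd_above_continuous_image continuous_intros assms f_cont' compact_cball)
  thus ?thesis using assms(2) by (meson bdd_above_mono image_mono)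
qed

lemma Phi_sphere:
  assumes q: "q holomorphic_on UNIV"
  shows "Phi \<omega> f (cball 0 r) q = Phi \<omega> f (sphere 0 r) q"
proof -
  have qc: "continuous_on B q" for B
    using holomorphic_on_imp_continuous_on[OF q] by (rule continuous_on_subset) auto
  have ne: "sphere 0 r \<noteq> ({} :: complex set)" "cball 0 r \<noteq> ({} :: complex set)"
    using r by auto
  have sub: "sphere 0 r \<subseteq> (cball 0 r :: complex set)" by auto
  have "(SUP z\<in>cball 0 r. cmod (exp (q z) - f z)) = (SUP z\<in>sphere 0 r. cmod (exp (q z) - f z))"
  proof (rule antisym)
    show "(SUP z\<in>cball 0 r. cmod (exp (q z) - f z)) \<le> (SUP z\<in>sphere 0 r. cmod (exp (q z) - f z))"
    proof (rule cSUP_least[OF ne(2)])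
      fix z :: complex assume z: "z \<in> cball 0 r"
      show "cmod (exp (q z) - f z) \<le> (SUP z\<in>sphere 0 r. cmod (exp (q z) - f z))"
      proof (rule maximum_modulus_frontier[of "\<lambda>z. exp (q z) - f z" "cball 0 r"])
        have "q holomorphic_on ball 0 r" using q by (rule holomorphic_on_subset) auto
        moreover have "f holomorphic_on ball 0 r" using f_holo by (rule holomorphic_on_subset) (use r in auto)
        ultimately show "(\<lambda>z. exp (q z) - f z) holomorphic_on interior (cball 0 r)"
          unfolding interior_cball by (intro holomorphic_intros)
        show "continuous_on (closure (cball 0 r)) (\<lambda>z. exp (q z) - f z)"
          using f_cont' by (auto intro!: continuous_intros qc)
        fix w :: complex assume "w \<in> frontier (cball 0 r)"
        hence "w \<in> sphere 0 r" using r by (simp add: frontier_cball)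
        thus "cmod (exp (q w) - f w) \<le> (SUP z\<in>sphere 0 r. cmod (exp (q z) - f z))"
          by (rule cSUP_upper) (rule bdd_exp[OF qc sub])
      qed (use z in auto)
    qed
    show "(SUP z\<in>sphere 0 r. cmod (exp (q z) - f z)) \<le> (SUP z\<in>cball 0 r. cmod (exp (q z) - f z))"
      by (rule cSUP_subset_mono[OF ne(1) bdd_exp[OF qc order.refl] sub]) auto
  qed
  thus ?thesis by (simp add: Phi_def)
qed

section \<open>Discretisation of the circle\<close>

definition pts :: "nat \<Rightarrow> complex set" where
  "pts m = (\<lambda>j. of_real r * cis (2 * pi * real j / real m)) ` {..<m}"

lemma finite_pts [simp]: "finite (pts m)" and card_pts: "card (pts m) \<le> m"
  and pts_subset: "pts m \<subseteq> sphere 0 r" and pts_ne: "m > 0 \<Longrightarrow> pts m \<noteq> {}"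
  using r card_image_le[of "{..<m}" "\<lambda>j. of_real r * cis (2 * pi * real j / real m)"]
  by (auto simp: pts_def norm_mult)

lemma norm_pts: "z \<in> pts m \<Longrightarrow> norm z = r"
  using pts_subset[of m] by auto

lemma norm_cis_diff_le: "norm (cis a - cis b) \<le> \<bar>a - b\<bar>"
proof -
  have "norm (cis (a - b) - 1) \<le> \<bar>a - b\<bar>"
    using iexp_approx1[of "a - b" 0] by (simp add: cis_conv_exp)
  moreover have "cis a - cis b = cis b * (cis (a - b) - 1)"
    by (simp add: right_diff_distrib cis_mult)
  ultimately show ?thesis by (simp add: norm_mult)
qed

text \<open>The angle is rounded down to a multiple of \<open>2 * pi / m\<close>; at radius below
  \<open>1 / 4\<close> an arc of that angle has length at most \<open>2 / m\<close>.\<close>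

lemma pts_close:
  assumes w: "w \<in> sphere 0 r" and m: "m > 0"
  shows "\<exists>z\<in>pts m. norm (w - z) \<le> 2 / real m"
proof -
  define \<theta> where "\<theta> = Arg2pi w"
  have \<theta>: "0 \<le> \<theta>" "\<theta> < 2 * pi" unfolding \<theta>_def by (auto simp: Arg2pi_ge_0 Arg2pi_lt_2pi)
  have w_eq: "w = of_real r * cis \<theta>"
    using Arg2pi_eq[of w] w by (simp add: \<theta>_def cis_conv_exp)
  define j where "j = nat \<lfloor>\<theta> * real m / (2 * pi)\<rfloor>"
  have j: "real j \<le> \<theta> * real m / (2 * pi)" "\<theta> * real m / (2 * pi) < real j + 1"
    using \<theta> unfolding j_def by (auto simp: of_nat_nat)
  have "\<theta> * real m / (2 * pi) < real m" using \<theta> m by (simp add: field_simps)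
  hence "j < m" using j by linarith
  hence 1: "of_real r * cis (2 * pi * real j / real m) \<in> pts m" by (auto simp: pts_def)
  have "\<bar>\<theta> - 2 * pi * real j / real m\<bar> \<le> 2 * pi / real m"
  proof -
    have "\<theta> - 2 * pi * real j / real m = (\<theta> * real m / (2 * pi) - real j) * (2 * pi / real m)"
      using m by (simp add: field_simps)
    also have "\<bar>\<dots>\<bar> \<le> 1 * (2 * pi / real m)"
      unfolding abs_mult using j by (intro mult_mono) auto
    finally show ?thesis by simp
  qed
  hence "norm (cis \<theta> - cis (2 * pi * real j / real m)) \<le> 2 * pi / real m"
    using norm_cis_diff_le order.trans by blast
  hence "r * norm (cis \<theta> - cis (2 * pi * real j / real m)) \<le> 1 / 4 * (2 * pi / real m)"
    using r by (intro mult_mono) auto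
  also have "\<dots> \<le> 2 / real m" using pi_less_4 m by (simp add: divide_simps)
  also have "r * norm (cis \<theta> - cis (2 * pi * real j / real m)) = norm (w - of_real r * cis (2 * pi * real j / real m))"
    unfolding w_eq right_diff_distrib[symmetric] using r by (simp add: norm_mult)
  finally show ?thesis using 1 by blast
qed

text \<open>Cauchy estimates make \<open>q\<close> and \<open>f\<close> Lipschitz on the disc of
  radius \<open>r\<close>. Each point of the circle is therefore matched by a point of
  \<open>pts m\<close>, and \<open>Phi_lipschitz\<close> compares the two index sets.\<close>

lemma Phi_discretize:
  assumes q: "q holomorphic_on UNIV" and X: "\<And>z. norm z \<le> r1 \<Longrightarrow> norm (q z) \<le> X" and m: "m > 0"
  shows "\<bar>Phi \<omega> f (cball 0 r) q - Phi \<omega> f (pts m) q\<bar> \<le>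
    L0 * (X / (r1 - r) * (2 / real m)) + \<Lambda> * (F / (\<rho> - r) * (2 / real m))"
proof -
  have qc: "continuous_on B q" for B
    using holomorphic_on_imp_continuous_on[OF q] by (rule continuous_on_subset) auto
  have X0: "X \<ge> 0" using X[of 0] r1 by (auto intro: order.trans[OF norm_ge_zero])
  have sp: "sphere 0 r \<subseteq> (cball 0 r :: complex set)" by auto
  have qL: "norm (q z - q w) \<le> X / (r1 - r) * norm (z - w)" if "norm z \<le> r" "norm w \<le> r" for z w
    by (rule Lipschitz_from_bound[OF _ qc X r1(1) that])
       (use holomorphic_on_subset[OF q] in auto)
  have fL: "norm (f z - f w) \<le> F / (\<rho> - r) * norm (z - w)" if "norm z \<le> r" "norm w \<le> r" for z w
    by (rule Lipschitz_from_bound[OF f_holo f_cont f_bnd r(2) that])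
  have close: "norm (q z - q w) \<le> X / (r1 - r) * (2 / real m) \<and> norm (f z - f w) \<le> F / (\<rho> - r) * (2 / real m)"
    if "norm z \<le> r" "norm w \<le> r" "norm (z - w) \<le> 2 / real m" for z w
  proof
    show "norm (q z - q w) \<le> X / (r1 - r) * (2 / real m)"
      by (rule order.trans[OF qL[OF that(1,2)] mult_left_mono]) (use that(3) X0 r1 in auto)
    show "norm (f z - f w) \<le> F / (\<rho> - r) * (2 / real m)"
      by (rule order.trans[OF fL[OF that(1,2)] mult_left_mono]) (use that(3) F0 r in auto)
  qed
  have "\<bar>Phi \<omega> f (sphere 0 r) q - Phi \<omega> f (pts m) q\<bar> \<le>
    L0 * (X / (r1 - r) * (2 / real m)) + \<Lambda> * (F / (\<rho> - r) * (2 / real m))"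
    unfolding L0_def
  proof (rule Phi_lipschitz)
    show "\<exists>j\<in>pts m. cmod (q i - q j) \<le> X / (r1 - r) * (2 / real m) \<and> cmod (f i - f j) \<le> F / (\<rho> - r) * (2 / real m)"
      if "i \<in> sphere 0 r" for i
    proof -
      obtain z where z: "z \<in> pts m" "norm (i - z) \<le> 2 / real m" using pts_close[OF \<open>i \<in> sphere 0 r\<close> m] by blast
      have "norm z = r" using z(1) by (rule norm_pts)
      hence "norm (q i - q z) \<le> X / (r1 - r) * (2 / real m) \<and> norm (f i - f z) \<le> F / (\<rho> - r) * (2 / real m)"
        using that z(2) by (intro close) auto
      thus ?thesis using z(1) by blast
    qed
    show "\<exists>j\<in>sphere 0 r. cmod (q i - q j) \<le> X / (r1 - r) * (2 / real m) \<and> cmod (f i - f j) \<le> F / (\<rho> - r) * (2 / real m)"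
      if "i \<in> pts m" for i
    proof (rule bexI[of _ i])
      show "i \<in> sphere 0 r" using norm_pts[OF that] by simp
      thus "cmod (q i - q i) \<le> X / (r1 - r) * (2 / real m) \<and> cmod (f i - f i) \<le> F / (\<rho> - r) * (2 / real m)"
        by (intro close) auto
    qed
    show "norm (f z) \<le> F" if "z \<in> sphere 0 r \<union> pts m" for z
      by (rule f_bnd) (use that norm_pts[of z m] r in auto)
    show "bdd_above ((\<lambda>z. cmod (exp (q z) - f z)) ` sphere 0 r)" by (rule bdd_exp[OF qc sp])
    show "bdd_above ((\<lambda>z. cmod (exp (q z) - f z)) ` pts m)"
      by (rule bdd_exp[OF qc order.trans[OF pts_subset sp]])
  qed (use pts_ne[OF m] X0 F0 r r1 in auto)
  thus ?thesis by (simp add: Phi_sphere[OF q])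
qed

text \<open>Interpolation is accurate while \<open>X \<le> P / 4\<close>, the window of the periodic
  kernel. Beyond it the trivial bound \<open>2 * W0\<close> is multiplied by
  \<open>(4 * X / P)^2 \<ge> 1\<close>, Chebyshev's inequality in pointwise form: the error is
  quadratic in \<open>X\<close> and can be averaged.\<close>

lemma Phi_smooth:
  assumes X: "\<And>z. z \<in> pts m \<Longrightarrow> norm (q z) \<le> X" and m: "m > 0" and pos: "N > 0" "P > 0" "\<epsilon> > 0"
  shows "\<bar>Phi \<omega> f (pts m) q - smooth N P (pts m) (Phi \<omega> f (pts m)) q\<bar>
    \<le> L0 * (\<epsilon> + 8 * real m * P\<^sup>2 / (real N * \<epsilon>)) + 32 * W0 * X\<^sup>2 / P\<^sup>2"
proof -
  have X0: "X \<ge> 0" using X pts_ne[OF m] by (metis ex_in_conv norm_ge_zero order.trans)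
  have n1: "L0 * (\<epsilon> + 8 * real m * P\<^sup>2 / (real N * \<epsilon>)) \<ge> 0" using L0 pos by auto
  have n2: "32 * W0 * X\<^sup>2 / P\<^sup>2 \<ge> 0" using W0_nonneg by auto
  show ?thesis
  proof (cases "X \<le> P / 4")
    case True
    have "\<bar>Phi \<omega> f (pts m) q - smooth N P (pts m) (Phi \<omega> f (pts m)) q\<bar>
        \<le> L0 * (\<epsilon> + 8 * real (card (pts m)) * P\<^sup>2 / (real N * \<epsilon>))"
    proof (rule smooth_approx[OF finite_pts pos L0])
      show "norm (q z) \<le> P / 4" if "z \<in> pts m" for z using X[OF that] True by linarith
      show "\<bar>Phi \<omega> f (pts m) q - Phi \<omega> f (pts m) q'\<bar> \<le> L0 * \<delta>"
        if "\<delta> \<ge> 0" "\<And>z. z \<in> pts m \<Longrightarrow> norm (q z - q' z) \<le> \<delta>" for q' \<delta>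
      proof -
        have "\<bar>Phi \<omega> f (pts m) q - Phi \<omega> f (pts m) q'\<bar> \<le> L0 * \<delta> + \<Lambda> * 0"
          unfolding L0_def
        proof (rule Phi_lipschitz)
          show "norm (f z) \<le> F" if "z \<in> pts m \<union> pts m" for z
            by (rule f_bnd) (use that norm_pts[of z m] r in auto)
          show "\<exists>j\<in>pts m. cmod (q i - q' j) \<le> \<delta> \<and> cmod (f i - f j) \<le> 0" if "i \<in> pts m" for i
            using that \<open>\<And>z. z \<in> pts m \<Longrightarrow> norm (q z - q' z) \<le> \<delta>\<close> by auto
          show "\<exists>j\<in>pts m. cmod (q' i - q j) \<le> \<delta> \<and> cmod (f i - f j) \<le> 0" if "i \<in> pts m" for i
            using that \<open>\<And>z. z \<in> pts m \<Longrightarrow> norm (q z - q' z) \<le> \<delta>\<close> by (auto simp: norm_minus_commute)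
        qed (use pts_ne[OF m] F0 that in \<open>auto intro!: bdd_above_finite\<close>)
        thus ?thesis by simp
      qed
    qed
    also have "\<dots> \<le> L0 * (\<epsilon> + 8 * real m * P\<^sup>2 / (real N * \<epsilon>))"
      using card_pts[of m] pos L0 by (intro mult_left_mono add_left_mono divide_right_mono mult_right_mono) auto
    finally show ?thesis using n2 by linarith
  next
    case False
    have "\<bar>Phi \<omega> f (pts m) q - smooth N P (pts m) (Phi \<omega> f (pts m)) q\<bar> \<le> W0 + W0"
      by (intro order.trans[OF abs_triangle_ineq4] add_mono Phi_bound smooth_bound finite_pts pos)
    also have "\<dots> \<le> 2 * W0 * (4 * X / P)\<^sup>2"
    proof -
      have "1 \<le> 4 * X / P" using False pos by (simp add: field_simps)
      hence "1\<^sup>2 \<le> (4 * X / P)\<^sup>2" by (intro power_mono) auto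
      hence "2 * W0 * 1 \<le> 2 * W0 * (4 * X / P)\<^sup>2" using W0_nonneg by (intro mult_left_mono) auto
      thus ?thesis by simp
    qed
    also have "\<dots> = 32 * W0 * X\<^sup>2 / P\<^sup>2" by (simp add: power_divide power_mult_distrib)
    finally show ?thesis using n1 by linarith
  qed
qed

text \<open>A linear combination of the values of \<open>Q\<close> at the points of
  \<open>pts m\<close> is a single Dirichlet polynomial; these are its coefficients.\<close>

definition lin_coeff :: "nat \<Rightarrow> nat \<Rightarrow> (complex \<Rightarrow> complex) \<Rightarrow> nat \<Rightarrow> complex" where
  "lin_coeff m Y c n = (\<Sum>z\<in>pts m. c z * qco {1..Y} z n)"

text \<open>Involves neither a measure nor a character: it is the common reference value for the
  average over \<open>t\<close> and for the expectation over \<open>X\<close>.\<close>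

definition ideal :: "nat \<Rightarrow> nat \<Rightarrow> nat \<Rightarrow> real \<Rightarrow> nat \<Rightarrow> complex" where
  "ideal m Y N P k = ideal_smooth N P (pts m) (Phi \<omega> f (pts m)) (\<lambda>c. ideal_char (lin_coeff m Y c) Y k)"

lemma norm_lin_coeff_le:
  assumes "\<And>z. z \<in> pts m \<Longrightarrow> norm (c z) \<le> C" "C \<ge> 0"
  shows "norm (lin_coeff m Y c n) \<le> (real m * C) * (kapon {1..Y} n * real n powr (- (3 / 4 - \<rho>)))"
proof -
  have "norm (lin_coeff m Y c n) \<le> (\<Sum>z\<in>pts m. C * (kapon {1..Y} n * real n powr (- (3 / 4 - \<rho>))))"
    unfolding lin_coeff_def
  proof (intro order.trans[OF norm_sum] sum_mono)
    fix z assume z: "z \<in> pts m"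
    hence "norm z \<le> \<rho>" using norm_pts r by fastforce
    thus "norm (c z * qco {1..Y} z n) \<le> C * (kapon {1..Y} n * real n powr (- (3 / 4 - \<rho>)))"
      unfolding norm_mult using z assms by (intro mult_mono norm_qco_le) auto
  qed
  also have "\<dots> = real (card (pts m)) * (C * (kapon {1..Y} n * real n powr (- (3 / 4 - \<rho>))))" by simp
  also have "\<dots> \<le> real m * (C * (kapon {1..Y} n * real n powr (- (3 / 4 - \<rho>))))"
    using card_pts assms by (intro mult_right_mono mult_nonneg_nonneg) (auto simp: kapon_nonneg)
  finally show ?thesis by (simp add: mult_ac)
qed

lemma Phi_meas:
  assumes w: "\<omega> \<in> borel_measurable borel" and qm: "\<And>z. (\<lambda>x. q x z) \<in> borel_measurable M"
    and qc: "\<And>x. continuous_on (cball 0 r) (q x)"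
  shows "(\<lambda>x. Phi \<omega> f (cball 0 r) (q x)) \<in> borel_measurable M"
proof -
  have "(\<lambda>x. SUP z\<in>cball 0 r. cmod (exp (q x z) - f z)) \<in> borel_measurable M"
  proof (rule borel_measurable_SUP_compact)
    show "(\<lambda>x. cmod (exp (q x z) - f z)) \<in> borel_measurable M" for z
      using qm[of z] by measurable
  qed (use r in \<open>auto intro!: continuous_intros qc f_cont'\<close>)
  from measurable_compose[OF this w] show ?thesis unfolding Phi_def .
qed

lemma omega_meas: "\<omega> \<in> borel_measurable borel"
proof (rule borel_measurable_continuous_onI)
  have "\<Lambda>-lipschitz_on UNIV \<omega>"
    using lip Lam0 by (intro lipschitz_onI) (auto simp: dist_real_def)
  thus "continuous_on UNIV \<omega>" by (rule lipschitz_on_continuous_on)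
qed

text \<open>The error terms come in turn from discretising the circle for \<open>q\<close> and for
  \<open>f\<close>, from interpolation, from values of \<open>Q\<close> outside the window of the
  kernel, and from replacing characteristic functions by \<open>ideal_char\<close> in each of the
  terms of the sum. \<open>G\<close> bounds the coefficients of the linear combinations relative to
  those of \<open>Q\<close>, and \<open>H\<close> bounds the sum of their norms.\<close>

lemma Phi_ideal_approx:
  fixes M :: "'b measure"
  assumes qc: "quasi_char M ch W eta" and pos: "m > 0" "N > 0" "P > 0" "\<epsilon> > 0" "k \<ge> 1" "Y \<ge> 1"
    and YW: "Y ^ (2 * k) \<le> W" and G: "G = real m * (4 * pi * real N / P)"
    and H: "H \<ge> 1" "H \<ge> G * real Y" and V2: "V2 = \<rho> / (\<rho> - r1) * (Zb \<rho> + eta * real Y ^ 2)"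
  shows "norm (complex_of_real (\<integral>x. Phi \<omega> f (cball 0 r) (rand_char.Q ch {1..Y} x) \<partial>M) - ideal m Y N P k) \<le>
    L0 * ((1 + V2) / (r1 - r) * (2 / real m)) + \<Lambda> * (F / (\<rho> - r) * (2 / real m))
    + (L0 * (\<epsilon> + 8 * real m * P\<^sup>2 / (real N * \<epsilon>)) + 32 * W0 * V2 / P\<^sup>2)
    + W0 * real N ^ (2 * m) * (4 * eta * H ^ (2 * k) + fact k * (G\<^sup>2 * Zb \<rho>) ^ k / fact (2 * k))"
proof -
  interpret quasi_char M ch W eta by (rule qc)
  define S where "S = pts m"
  define X where "X x = (SUP z\<in>cball 0 r1. norm (Q {1..Y} x z ^ 1))" for x
  have Y1: "Y ^ 1 \<le> W" using YW pos power_increasing[of 1 "2 * k" Y] by auto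
  note Xm = Q_sup_moment[of "{1..Y}" 1 Y 1 r1 \<rho>, folded X_def, OF order.refl order.refl pos(6) Y1 less_imp_le[OF r1(3)] r1(2) r(3)]
  have [measurable]: "X \<in> borel_measurable M" by (rule Xm)
  have X2int: "integrable M (\<lambda>x. (X x)\<^sup>2)" by (rule Xm)
  have EX2: "expectation (\<lambda>x. (X x)\<^sup>2) \<le> V2" using Xm(2) by (simp add: V2)
  have Xb: "norm (Q {1..Y} x z) \<le> X x" if "norm z \<le> r1" for x z
  proof -
    have "norm (Q {1..Y} x z ^ 1) \<le> X x" unfolding X_def
      by (rule cSUP_upper) (use that in \<open>auto intro!: bdd_above_continuous_image continuous_intros Q_continuous\<close>)
    thus ?thesis by simp
  qed
  define err where "err x = L0 * ((1 + (X x)\<^sup>2) / (r1 - r) * (2 / real m)) + \<Lambda> * (F / (\<rho> - r) * (2 / real m))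
    + (L0 * (\<epsilon> + 8 * real m * P\<^sup>2 / (real N * \<epsilon>)) + 32 * W0 * (X x)\<^sup>2 / P\<^sup>2)" for x
  have pt: "\<bar>Phi \<omega> f (cball 0 r) (Q {1..Y} x) - smooth N P S (Phi \<omega> f S) (Q {1..Y} x)\<bar> \<le> err x" for x
  proof -
    have "X x \<le> 1 + (X x)\<^sup>2"
      using zero_le_power2[of "X x - 1 / 2"] by (simp add: power2_eq_square algebra_simps)
    hence "L0 * (X x / (r1 - r) * (2 / real m)) \<le> L0 * ((1 + (X x)\<^sup>2) / (r1 - r) * (2 / real m))"
      using L0 r1 by (intro mult_left_mono mult_right_mono divide_right_mono) auto
    moreover have "\<bar>Phi \<omega> f (cball 0 r) (Q {1..Y} x) - Phi \<omega> f S (Q {1..Y} x)\<bar> \<le>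
      L0 * (X x / (r1 - r) * (2 / real m)) + \<Lambda> * (F / (\<rho> - r) * (2 / real m))"
      unfolding S_def by (rule Phi_discretize[OF Q_holomorphic Xb pos(1)])
    moreover have "\<bar>Phi \<omega> f S (Q {1..Y} x) - smooth N P S (Phi \<omega> f S) (Q {1..Y} x)\<bar>
      \<le> L0 * (\<epsilon> + 8 * real m * P\<^sup>2 / (real N * \<epsilon>)) + 32 * W0 * (X x)\<^sup>2 / P\<^sup>2"
      unfolding S_def
    proof (rule Phi_smooth)
      show "norm (Q {1..Y} x z) \<le> X x" if "z \<in> pts m" for z
        by (rule Xb) (use that pts_subset[of m] r1 in auto)
    qed (use pos in auto)
    ultimately show ?thesis unfolding err_def by linarith
  qed
  have err_int: "integrable M err"
    unfolding err_def using X2int by (intro Bochner_Integration.integrable_add integrable_mult_right integrable_mult_left integrable_divide_zero) auto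
  have Eerr: "expectation err = L0 * ((1 + expectation (\<lambda>x. (X x)\<^sup>2)) / (r1 - r) * (2 / real m)) + \<Lambda> * (F / (\<rho> - r) * (2 / real m))
    + (L0 * (\<epsilon> + 8 * real m * P\<^sup>2 / (real N * \<epsilon>)) + 32 * W0 * expectation (\<lambda>x. (X x)\<^sup>2) / P\<^sup>2)"
    unfolding err_def using X2int by (simp add: prob_space)
  have Eerr_le: "expectation err \<le> L0 * ((1 + V2) / (r1 - r) * (2 / real m)) + \<Lambda> * (F / (\<rho> - r) * (2 / real m))
    + (L0 * (\<epsilon> + 8 * real m * P\<^sup>2 / (real N * \<epsilon>)) + 32 * W0 * V2 / P\<^sup>2)"
    unfolding Eerr using EX2 L0 r1 W0_nonneg
    by (intro add_mono mult_left_mono mult_right_mono divide_right_mono order.refl) auto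
  have int1: "integrable M (\<lambda>x. Phi \<omega> f (cball 0 r) (Q {1..Y} x))"
    by (rule integrable_bdd[of _ W0]) (auto intro!: Phi_meas omega_meas Q_continuous Phi_bound)
  have sm_meas: "(\<lambda>x. smooth N P S (Phi \<omega> f S) (Q {1..Y} x)) \<in> borel_measurable M"
    unfolding smooth_def cfej_def fej_def cis_conv_exp by measurable
  have int2: "integrable M (\<lambda>x. smooth N P S (Phi \<omega> f S) (Q {1..Y} x))"
    by (rule integrable_bdd[of _ W0]) (use sm_meas pos in \<open>auto intro!: smooth_bound Phi_bound simp: S_def\<close>)
  have "\<bar>expectation (\<lambda>x. Phi \<omega> f (cball 0 r) (Q {1..Y} x)) - expectation (\<lambda>x. smooth N P S (Phi \<omega> f S) (Q {1..Y} x))\<bar>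
      = \<bar>expectation (\<lambda>x. Phi \<omega> f (cball 0 r) (Q {1..Y} x) - smooth N P S (Phi \<omega> f S) (Q {1..Y} x))\<bar>"
    by (subst Bochner_Integration.integral_diff[OF int1 int2]) simp
  also have "\<dots> \<le> expectation (\<lambda>x. \<bar>Phi \<omega> f (cball 0 r) (Q {1..Y} x) - smooth N P S (Phi \<omega> f S) (Q {1..Y} x)\<bar>)"
    by (rule integral_abs_bound)
  also have "\<dots> \<le> expectation err"
    by (intro integral_mono integrable_abs Bochner_Integration.integrable_diff int1 int2 err_int pt)
  finally have part1: "\<bar>expectation (\<lambda>x. Phi \<omega> f (cball 0 r) (Q {1..Y} x)) - expectation (\<lambda>x. smooth N P S (Phi \<omega> f S) (Q {1..Y} x))\<bar>
      \<le> expectation err" .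
  have part2: "norm (complex_of_real (expectation (\<lambda>x. smooth N P S (Phi \<omega> f S) (Q {1..Y} x))) - ideal m Y N P k)
     \<le> W0 * real N ^ (2 * card S) * (4 * eta * H ^ (2 * k) + fact k * (G\<^sup>2 * Zb \<rho>) ^ k / fact (2 * k))"
    unfolding ideal_def S_def
  proof (subst expectation_smooth, simp, simp, rule ideal_smooth_diff[OF finite_pts pos(2) Phi_bound])
    fix g assume g: "g \<in> freqs N (pts m)"
    define c where "c = (\<lambda>z. freq P (g z))"
    define b where "b = lin_coeff m Y c"
    have cb: "norm (c z) \<le> 4 * pi * real N / P" if "z \<in> pts m" for z
      unfolding c_def using g that pos by (intro norm_freq_le) (auto simp: freqs_def)
    have bsupp: "b n = 0" if "n \<notin> {1..Y}" for n
      using qco_support[OF order.refl that] by (simp add: b_def lin_coeff_def)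
    have bn: "norm (b n) \<le> G * (kapon {1..Y} n * real n powr (- (3 / 4 - \<rho>)))" for n
      unfolding b_def G by (rule norm_lin_coeff_le[OF cb]) (use pos in auto)
    have G0: "G \<ge> 0" using pos by (simp add: G)
    have bsum: "(\<Sum>n\<in>{1..Y}. norm (b n)) \<le> H"
    proof -
      have "(\<Sum>n\<in>{1..Y}. norm (b n)) \<le> (\<Sum>n\<in>{1..Y}. G * (1 * 1))"
      proof (intro sum_mono order.trans[OF bn] mult_left_mono mult_mono kapon_le_1 G0)
        fix n assume "n \<in> {1..Y}"
        thus "real n powr (- (3 / 4 - \<rho>)) \<le> 1" using r powr_mono[of "- (3 / 4 - \<rho>)" 0 "real n"] by auto
      qed auto
      also have "\<dots> \<le> H" using H(2) by (simp add: mult.commute)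
      finally show ?thesis .
    qed
    have "norm (expectation (\<lambda>x. iexp (Re (dpoly {1..Y} b x))) - ideal_char b Y k)
        \<le> 4 * eta * H ^ (2 * k) + (fact k * (G\<^sup>2 * Zb \<rho>) ^ k) / fact (2 * k)"
    proof (rule char_approx[OF bsupp pos(6) YW pos(5) bsum H(1)])
      show "(\<Sum>n\<in>{1..Y ^ k}. (norm (dpow b k n))\<^sup>2) \<le> fact k * (G\<^sup>2 * Zb \<rho>) ^ k"
        by (rule sum_dpow_square_le[OF bn order.refl _ G0])
           (use tail_sum_kap_le[OF r(3), of "{1..Y}" 1] in simp)
    qed
    moreover have "dpoly {1..Y} b x = (\<Sum>z\<in>pts m. c z * Q {1..Y} x z)" for x
    proof -
      have "dpoly {1..Y} b x = (\<Sum>n\<in>{1..Y}. \<Sum>z\<in>pts m. c z * (qco {1..Y} z n * ch n x))"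
        by (simp only: dpoly_def b_def lin_coeff_def sum_distrib_right mult.assoc)
      also have "\<dots> = (\<Sum>z\<in>pts m. \<Sum>n\<in>{1..Y}. c z * (qco {1..Y} z n * ch n x))" by (rule sum.swap)
      also have "\<dots> = (\<Sum>z\<in>pts m. c z * Q {1..Y} x z)"
        unfolding Q_eq_dpoly[OF order.refl] by (simp add: dpoly_def sum_distrib_left)
      finally show ?thesis .
    qed
    ultimately show "norm (expectation (\<lambda>x. cis (Re (\<Sum>z\<in>pts m. freq P (g z) * Q {1..Y} x z)))
       - ideal_char (lin_coeff m Y (\<lambda>z. freq P (g z))) Y k) \<le> 4 * eta * H ^ (2 * k) + fact k * (G\<^sup>2 * Zb \<rho>) ^ k / fact (2 * k)"
      by (simp add: cis_conv_exp b_def c_def)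
  qed
  define D where "D = 4 * eta * H ^ (2 * k) + fact k * (G\<^sup>2 * Zb \<rho>) ^ k / fact (2 * k)"
  have D0: "D \<ge> 0" unfolding D_def using eta_nonneg H Zb_nonneg[OF r(3)] by auto
  have "W0 * real N ^ (2 * card S) * D \<le> W0 * real N ^ (2 * m) * D"
    using D0 W0_nonneg pos card_pts[of m]
    by (intro mult_right_mono mult_left_mono power_increasing) (auto simp: S_def)
  moreover have "norm (complex_of_real (expectation (\<lambda>x. Phi \<omega> f (cball 0 r) (Q {1..Y} x))) - ideal m Y N P k) \<le>
     norm (complex_of_real (expectation (\<lambda>x. Phi \<omega> f (cball 0 r) (Q {1..Y} x))) - complex_of_real (expectation (\<lambda>x. smooth N P S (Phi \<omega> f S) (Q {1..Y} x))))
     + norm (complex_of_real (expectation (\<lambda>x. smooth N P S (Phi \<omega> f S) (Q {1..Y} x))) - ideal m Y N P k)"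
    using norm_triangle_ineq[of "complex_of_real (expectation (\<lambda>x. Phi \<omega> f (cball 0 r) (Q {1..Y} x))) - complex_of_real (expectation (\<lambda>x. smooth N P S (Phi \<omega> f S) (Q {1..Y} x)))"
      "complex_of_real (expectation (\<lambda>x. smooth N P S (Phi \<omega> f S) (Q {1..Y} x))) - ideal m Y N P k"] by simp
  moreover have "norm (complex_of_real (expectation (\<lambda>x. Phi \<omega> f (cball 0 r) (Q {1..Y} x))) - complex_of_real (expectation (\<lambda>x. smooth N P S (Phi \<omega> f S) (Q {1..Y} x))))
     = \<bar>expectation (\<lambda>x. Phi \<omega> f (cball 0 r) (Q {1..Y} x)) - expectation (\<lambda>x. smooth N P S (Phi \<omega> f S) (Q {1..Y} x))\<bar>"
    by (simp only: of_real_diff[symmetric] norm_of_real)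
  ultimately show ?thesis using part1 part2 Eerr_le unfolding D_def[symmetric] by linarith
qed

end

section \<open>Almost sure convergence\<close>

text \<open>The index \<open>M\<close> is reached from \<open>2 ^ J\<close> through the powers of 2
  in between, and the errors of the steps are dominated by a geometric series.\<close>

lemma dyadic_uniformly_Cauchy:
  fixes q :: "nat \<Rightarrow> complex \<Rightarrow> complex"
  assumes \<theta>: "0 < \<theta>" "\<theta> < 1"
    and step: "\<And>j M z. j \<ge> j0 \<Longrightarrow> 2 ^ j < M \<Longrightarrow> M \<le> 2 ^ Suc j \<Longrightarrow> z \<in> K \<Longrightarrow> norm (q M z - q (2 ^ j) z) \<le> \<theta> ^ j"
  shows "uniformly_convergent_on K q"
proof -
  have close: "norm (q M z - q (2 ^ J) z) \<le> (\<Sum>i\<in>{J..<j}. \<theta> ^ i)"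
    if "J \<ge> j0" "z \<in> K" "J \<le> j" "2 ^ J \<le> M" "M \<le> 2 ^ j" for J j M z
    using that(3-)
  proof (induction j arbitrary: M rule: dec_induct)
    case base
    thus ?case by simp
  next
    case (step j)
    show ?case
    proof (cases "M \<le> 2 ^ j")
      case True
      have "norm (q M z - q (2 ^ J) z) \<le> (\<Sum>i\<in>{J..<j}. \<theta> ^ i)" by (rule step.IH[OF step.prems(1) True])
      also have "\<dots> \<le> (\<Sum>i\<in>{J..<Suc j}. \<theta> ^ i)" using step \<theta> by simp
      finally show ?thesis .
    next
      case False
      have "norm (q M z - q (2 ^ J) z) \<le> norm (q M z - q (2 ^ j) z) + norm (q (2 ^ j) z - q (2 ^ J) z)"
        using norm_triangle_ineq[of "q M z - q (2 ^ j) z" "q (2 ^ j) z - q (2 ^ J) z"] by simp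
      also have "\<dots> \<le> \<theta> ^ j + (\<Sum>i\<in>{J..<j}. \<theta> ^ i)"
        using step that False by (intro add_mono assms(3) step.IH) auto
      finally show ?thesis using step by simp
    qed
  qed
  have geo: "(\<Sum>i\<in>{J..<j}. \<theta> ^ i) \<le> \<theta> ^ J / (1 - \<theta>)" for J j
  proof -
    have s: "summable (\<lambda>i. \<theta> ^ J * \<theta> ^ i)" using \<theta> by (intro summable_mult summable_geometric) auto
    have "(\<Sum>i\<in>{J..<j}. \<theta> ^ i) = (\<Sum>i<j - J. \<theta> ^ J * \<theta> ^ i)"
      by (rule sum.reindex_bij_witness[of _ "\<lambda>i. i + J" "\<lambda>i. i - J"]) (auto simp flip: power_add)
    also have "\<dots> \<le> (\<Sum>i. \<theta> ^ J * \<theta> ^ i)" using \<theta> by (intro sum_le_suminf[OF s]) auto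
    also have "\<dots> = \<theta> ^ J / (1 - \<theta>)" using \<theta> by (simp add: suminf_mult suminf_geometric summable_geometric)
    finally show ?thesis .
  qed
  have close2: "norm (q M z - q (2 ^ J) z) \<le> \<theta> ^ J / (1 - \<theta>)" if "J \<ge> j0" "z \<in> K" "2 ^ J \<le> M" for J M z
  proof (rule order.trans[OF close geo])
    have "M \<le> 2 ^ M" by (rule less_imp_le[OF less_exp])
    also have "\<dots> \<le> 2 ^ max J M" by (intro power_increasing) auto
    finally show "M \<le> 2 ^ max J M" .
  qed (use that in auto)
  have "uniformly_Cauchy_on K q"
  proof (rule uniformly_Cauchy_onI)
    fix e :: real assume e: "e > 0"
    have "(\<lambda>J. 2 * (\<theta> ^ J / (1 - \<theta>))) \<longlonglongrightarrow> 2 * (0 / (1 - \<theta>))"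
      using \<theta> by (intro tendsto_intros LIMSEQ_power_zero) auto
    hence "eventually (\<lambda>J. 2 * (\<theta> ^ J / (1 - \<theta>)) < e) sequentially"
      using e by (auto dest: order_tendstoD(2))
    hence "eventually (\<lambda>J. 2 * (\<theta> ^ J / (1 - \<theta>)) < e \<and> J \<ge> j0) sequentially"
      using eventually_ge_at_top by (rule eventually_conj)
    then obtain J where J: "2 * (\<theta> ^ J / (1 - \<theta>)) < e" "J \<ge> j0"
      by (auto dest: eventually_happens)
    show "\<exists>L. \<forall>z\<in>K. \<forall>m\<ge>L. \<forall>n\<ge>L. dist (q m z) (q n z) < e"
    proof (intro exI ballI allI impI)
      fix z and m n :: nat assume z: "z \<in> K" and m: "m \<ge> 2 ^ J" and n: "n \<ge> 2 ^ J"
      have "dist (q m z) (q n z) \<le> norm (q m z - q (2 ^ J) z) + norm (q n z - q (2 ^ J) z)"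
        using norm_triangle_ineq4[of "q m z - q (2 ^ J) z" "q n z - q (2 ^ J) z"] by (simp add: dist_norm)
      also have "\<dots> \<le> \<theta> ^ J / (1 - \<theta>) + \<theta> ^ J / (1 - \<theta>)"
        using J z m n by (intro add_mono close2) auto
      finally show "dist (q m z) (q n z) < e" using J by simp
    qed
  qed
  thus ?thesis by (rule Cauchy_uniformly_convergent)
qed

lemma dyadic_cover:
  assumes "M \<ge> 2"
  obtains j where "2 ^ j < M" "M \<le> (2 :: nat) ^ Suc j"
proof -
  define i where "i = (LEAST i. M \<le> (2 :: nat) ^ i)"
  have ex: "M \<le> 2 ^ M" by (rule less_imp_le[OF less_exp])
  have 1: "M \<le> 2 ^ i" unfolding i_def using ex by (rule LeastI)
  have "i \<noteq> 0" using 1 assms by (cases i) auto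
  then obtain j where j: "i = Suc j" by (cases i) auto
  have "\<not> M \<le> 2 ^ j" using not_less_Least[of j "\<lambda>i. M \<le> (2 :: nat) ^ i"] j by (auto simp: i_def)
  with 1 j show ?thesis by (intro that[of j]) auto
qed

definition dyadic_index :: "nat \<Rightarrow> nat" where
  "dyadic_index M = (SOME j. 2 ^ j < M \<and> M \<le> (2 :: nat) ^ Suc j)"

lemma dyadic_index: "M \<ge> 2 \<Longrightarrow> 2 ^ dyadic_index M < M \<and> M \<le> 2 ^ Suc (dyadic_index M)"
  unfolding dyadic_index_def by (rule someI_ex) (metis dyadic_cover)

lemma dyadic_index_unique:
  assumes "2 ^ j < M" "M \<le> (2 :: nat) ^ Suc j"
  shows "dyadic_index M = j"
proof -
  have "(1 :: nat) \<le> 2 ^ j" by simp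
  hence "M \<ge> 2" using assms by linarith
  note d = dyadic_index[OF this]
  have "(2 :: nat) ^ j < 2 ^ Suc (dyadic_index M)" "(2 :: nat) ^ dyadic_index M < 2 ^ Suc j" using d assms by linarith+
  hence "j < Suc (dyadic_index M)" "dyadic_index M < Suc j" by (auto dest: power_less_imp_less_exp[rotated] simp del: power_Suc)
  thus ?thesis by simp
qed

locale orth_char = rand_char +
  assumes orth: "\<And>m n. m > 0 \<Longrightarrow> n > 0 \<Longrightarrow> m \<noteq> n \<Longrightarrow> corr m n = 0"
begin

lemma quasi: "quasi_char M ch W 0"
  by unfold_locales (auto intro: orth)

lemma Q_diff: "N \<le> M' \<Longrightarrow> Q {1..M'} x z - Q {1..N} x z = Q {Suc N..M'} x z"
proof -
  assume N: "N \<le> M'"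
  have "{1..M'} = {1..N} \<union> {Suc N..M'}" "{1..N} \<inter> {Suc N..M'} = {}" using N by auto
  hence "Q {1..M'} x z = Q {1..N} x z + Q {Suc N..M'} x z"
    unfolding Q_def dpoly_def by (simp add: sum.union_disjoint)
  thus ?thesis by simp
qed

text \<open>Borel-Cantelli in summed form. \<open>D M'\<close> is the supremum, raised to the power
  \<open>k\<close>, of the difference between \<open>M'\<close> and the preceding power of 2. High
  moments make its expected square of order \<open>M' powr (-4)\<close>, small enough to sum over
  all \<open>M'\<close> individually, without a maximal inequality.\<close>

lemma AE_uniformly_convergent:
  assumes r: "0 < r" "r < \<rho>" "\<rho> < 1 / 4"
  shows "AE x in M. uniformly_convergent_on (cball 0 r) (\<lambda>N. Q {1..N} x)"
proof -
  have b: "bet \<rho> > 0" using r by (simp add: bet_def)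
  \<comment> \<open>The gain \<open>y powr (- bet \<rho>)\<close> of a tail may be tiny; its
    \<open>k\<close>-th power is at most \<open>y powr (-4)\<close>.\<close>
  obtain k :: nat where k: "real k * bet \<rho> \<ge> 4" using reals_Archimedean3[OF b] by (meson less_imp_le)
  have k0: "k > 0" using k by (cases k) auto
  define C where "C = \<rho> / (\<rho> - r) * (fact k * Zb \<rho> ^ k)"
  have C0: "C \<ge> 0" unfolding C_def using r Zb_nonneg[of \<rho>] by (intro mult_nonneg_nonneg) auto
  define D where "D M' x = (SUP z\<in>cball 0 r. norm (Q {Suc (2 ^ dyadic_index M')..M'} x z ^ k))" for M' x
  have D: "integrable M (\<lambda>x. (D M' x)\<^sup>2)" "expectation (\<lambda>x. (D M' x)\<^sup>2) \<le> C * 16 * real M' powr (-4)"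
    "D M' \<in> borel_measurable M" if M': "M' \<ge> 2" for M'
  proof -
    define y where "y = Suc (2 ^ dyadic_index M')"
    have y: "y \<ge> 1" "2 * y \<ge> M'" using dyadic_index[OF M'] by (auto simp: y_def)
    interpret qc: quasi_char M ch "M' ^ k" 0 by (rule quasi)
    note * = qc.Q_sup_moment[of "{y..M'}" y M' k r \<rho>, OF order.refl y(1) _ order.refl _ r(2,3)]
    show "integrable M (\<lambda>x. (D M' x)\<^sup>2)" "D M' \<in> borel_measurable M"
      using *(1,3) M' r unfolding D_def y_def by auto
    have "expectation (\<lambda>x. (D M' x)\<^sup>2) \<le> \<rho> / (\<rho> - r) * (fact k * (real y powr (- bet \<rho>) * Zb \<rho>) ^ k + 0 * real M' ^ (2 * k))"
      using *(2) M' r unfolding D_def y_def by auto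
    also have "\<dots> = C * (real y powr (- bet \<rho>)) ^ k" by (simp add: C_def power_mult_distrib)
    also have "(real y powr (- bet \<rho>)) ^ k = real y powr (- (real k * bet \<rho>))"
      using y by (simp add: powr_realpow[symmetric] powr_powr mult.commute)
    also have "C * real y powr (- (real k * bet \<rho>)) \<le> C * real y powr (-4)"
      using k y C0 by (intro mult_left_mono powr_mono) auto
    also have "\<dots> \<le> C * (real M' / 2) powr (-4)"
      using y M' C0 by (intro mult_left_mono powr_mono2') auto
    also have "(real M' / 2) powr (-4) = 16 * real M' powr (-4)"
      using M' by (simp add: powr_divide powr_minus field_simps)
    finally show "expectation (\<lambda>x. (D M' x)\<^sup>2) \<le> C * 16 * real M' powr (-4)" by (simp add: mult_ac)
  qed
  \<comment> \<open>The weight \<open>n + 2\<close> still leaves a summable expectation of order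
    \<open>(n + 2) powr (-2)\<close>, and its convergence to 0 yields \<open>D M' x < 1 / M'\<close>
    eventually.\<close>
  define E where "E n x = (real (n + 2) * D (n + 2) x)\<^sup>2" for n x
  have Em [measurable]: "E n \<in> borel_measurable M" for n
    using D(3)[of "n + 2"] unfolding E_def by measurable
  have sumC: "summable (\<lambda>n. C * 16 * real (n + 2) powr (-2))"
  proof -
    have "summable (\<lambda>n. real (Suc (Suc n)) powr (-2))"
      using summable_Suc_powr[of "-2"] by (subst summable_Suc_iff[where f = "\<lambda>n. real (Suc n) powr (-2)"]) auto
    hence "summable (\<lambda>n. C * 16 * real (Suc (Suc n)) powr (-2))" by (rule summable_mult)
    thus ?thesis by simp
  qed
  have EE: "(\<integral>\<^sup>+x. ennreal (E n x) \<partial>M) \<le> ennreal (C * 16 * real (n + 2) powr (-2))" for n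
  proof -
    have "(\<integral>\<^sup>+x. ennreal (E n x) \<partial>M) = ennreal (expectation (E n))"
      using D(1)[of "n + 2"] unfolding E_def power_mult_distrib
      by (intro nn_integral_eq_integral) auto
    also have "expectation (E n) = (real (n + 2))\<^sup>2 * expectation (\<lambda>x. (D (n + 2) x)\<^sup>2)"
      unfolding E_def power_mult_distrib by simp
    also have "\<dots> \<le> (real (n + 2))\<^sup>2 * (C * 16 * real (n + 2) powr (-4))"
      by (intro mult_left_mono D(2)) auto
    also have "\<dots> = C * 16 * (real (n + 2) powr 2 * real (n + 2) powr (-4))"
      by (simp add: powr_realpow)
    also have "\<dots> = C * 16 * real (n + 2) powr (-2)" by (simp only: powr_add[symmetric]) simp
    finally show ?thesis by (simp add: ennreal_leI)
  qed
  have "(\<integral>\<^sup>+x. (\<Sum>n. ennreal (E n x)) \<partial>M) = (\<Sum>n. \<integral>\<^sup>+x. ennreal (E n x) \<partial>M)"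
    by (rule nn_integral_suminf) measurable
  also have "\<dots> \<le> (\<Sum>n. ennreal (C * 16 * real (n + 2) powr (-2)))"
    by (intro suminf_le EE) auto
  also have "\<dots> = ennreal (\<Sum>n. C * 16 * real (n + 2) powr (-2))"
    using C0 by (intro suminf_ennreal_eq summable_sums sumC) auto
  also have "\<dots> < \<top>" by simp
  finally have "(\<integral>\<^sup>+x. (\<Sum>n. ennreal (E n x)) \<partial>M) \<noteq> \<infinity>" by simp
  hence "AE x in M. (\<Sum>n. ennreal (E n x)) \<noteq> \<infinity>"
    by (intro nn_integral_PInf_AE) measurable
  thus ?thesis
  proof eventually_elim
    fix x assume "(\<Sum>n. ennreal (E n x)) \<noteq> \<infinity>"
    hence "summable (\<lambda>n. E n x)" by (intro summable_suminf_not_top) (auto simp: E_def)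
    hence "(\<lambda>n. E n x) \<longlonglongrightarrow> 0" by (rule summable_LIMSEQ_zero)
    hence "eventually (\<lambda>n. E n x < 1) sequentially" by (rule order_tendstoD(2)) simp
    then obtain n0 where n0: "\<And>n. n \<ge> n0 \<Longrightarrow> E n x < 1" by (auto simp: eventually_sequentially)
    \<comment> \<open>Here \<open>\<theta> ^ k = 1 / 2\<close>, which undoes the \<open>k\<close>-th
      power in \<open>D\<close>.\<close>
    define \<theta> where "\<theta> = 2 powr (- 1 / real k)"
    have \<theta>: "0 < \<theta>" "\<theta> < 1" using k0 by (auto simp: \<theta>_def powr_less_one)
    show "uniformly_convergent_on (cball 0 r) (\<lambda>N. Q {1..N} x)"
    proof (rule dyadic_uniformly_Cauchy[OF \<theta>])
      fix j M' :: nat and z :: complex assume j: "j \<ge> n0 + 2" and M': "2 ^ j < M'" "M' \<le> 2 ^ Suc j" and z: "z \<in> cball 0 r"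
      have dj: "dyadic_index M' = j" by (rule dyadic_index_unique[OF M'])
      have "j < 2 ^ j" by (rule less_exp)
      hence M'n: "M' \<ge> n0 + 2" using M'(1) j by linarith
      define w where "w = norm (Q {1..M'} x z - Q {1..2 ^ j} x z)"
      have "w ^ k = norm (Q {Suc (2 ^ dyadic_index M')..M'} x z ^ k)"
        using M' Q_diff[of "2 ^ j" M' x z] by (simp add: w_def dj norm_power)
      also have "\<dots> \<le> D M' x" unfolding D_def
        by (rule cSUP_upper) (use z in \<open>auto intro!: bdd_above_continuous_image continuous_intros Q_continuous\<close>)
      finally have 1: "w ^ k \<le> D M' x" .
      have "E (M' - 2) x < 1" using M'n by (intro n0) auto
      moreover have "M' - 2 + 2 = M'" using M'n by simp
      ultimately have "(real M' * D M' x)\<^sup>2 < 1" by (simp add: E_def)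
      hence "real M' * D M' x < 1" using power2_less_imp_less[of "real M' * D M' x" 1] by simp
      hence "D M' x < 1 / real M'" using M'n by (simp add: field_simps)
      also have "\<dots> \<le> 1 / 2 ^ j" proof (rule divide_left_mono)
        have "real (2 ^ j) \<le> real M'" using M'(1) by (intro of_nat_mono) simp
        thus "2 ^ j \<le> real M'" by simp
      qed (use M'n in auto)
      also have "\<dots> = (\<theta> ^ j) ^ k"
      proof -
        have "(\<theta> ^ j) ^ k = (\<theta> ^ k) ^ j" by (simp add: power_mult[symmetric] mult.commute)
        also have "\<theta> ^ k = 2 powr (-1)"
          using k0 by (simp add: \<theta>_def powr_realpow[symmetric] powr_powr del: powr_neg_one)
        finally show ?thesis by (simp add: power_one_over)
      qed
      finally have "w ^ k \<le> (\<theta> ^ j) ^ k" using 1 by linarith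
      thus "norm (Q {1..M'} x z - Q {1..2 ^ j} x z) \<le> \<theta> ^ j"
        unfolding w_def[symmetric] using k0 \<theta> by (subst (asm) power_mono_iff) (auto simp: w_def)
    qed
  qed
qed

end

section \<open>The Euler product\<close>

lemma Ln_tail_bound:
  assumes u: "norm (u :: complex) \<le> \<eta>" "\<eta> < 1" and L: "L \<ge> 1"
  shows "norm (- Ln (1 - u) - (\<Sum>m\<in>{1..<L}. u ^ m / of_nat m)) \<le> norm u ^ L / (1 - \<eta>)"
proof -
  have s: "(\<lambda>n. (-1) ^ Suc n / of_nat n * (- u) ^ n) sums Ln (1 + (- u))"
    using u by (intro Ln_series) auto
  have eq: "(\<lambda>n. u ^ n / of_nat n) = (\<lambda>n. - ((-1) ^ Suc n / of_nat n * (- u) ^ n))"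
  proof
    fix n show "u ^ n / of_nat n = - ((-1) ^ Suc n / of_nat n * (- u) ^ n)"
      by (cases "even n") auto
  qed
  have "(\<lambda>n. - ((-1) ^ Suc n / of_nat n * (- u) ^ n)) sums (- Ln (1 - u))"
    using sums_minus[OF s] by simp
  hence s': "(\<lambda>n. u ^ n / of_nat n) sums (- Ln (1 - u))" unfolding eq .
  have "(\<lambda>n. u ^ (n + L) / of_nat (n + L)) sums (- Ln (1 - u) - (\<Sum>m<L. u ^ m / of_nat m))"
    using s' by (rule sums_split_initial_segment)
  moreover have "(\<Sum>m<L. u ^ m / of_nat m) = (\<Sum>m\<in>{1..<L}. u ^ m / of_nat m)"
    by (intro sum.mono_neutral_right) auto
  ultimately have t: "(\<lambda>n. u ^ (n + L) / of_nat (n + L)) sums (- Ln (1 - u) - (\<Sum>m\<in>{1..<L}. u ^ m / of_nat m))"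
    by simp
  have g: "(\<lambda>n. norm u ^ L * \<eta> ^ n) sums (norm u ^ L * (1 / (1 - \<eta>)))"
  proof -
    have "\<bar>\<eta>\<bar> < 1" using u norm_ge_zero[of u] by linarith
    thus ?thesis by (intro sums_mult geometric_sums) auto
  qed
  have "norm (\<Sum>n. u ^ (n + L) / of_nat (n + L)) \<le> (\<Sum>n. norm u ^ L * \<eta> ^ n)"
  proof (rule norm_suminf_le)
    show "norm (u ^ (n + L) / of_nat (n + L)) \<le> norm u ^ L * \<eta> ^ n" for n
    proof -
      have "norm (u ^ (n + L) / of_nat (n + L)) \<le> norm (u ^ (n + L)) / 1"
        unfolding norm_divide norm_of_nat using L by (intro divide_left_mono) auto
      also have "\<dots> = norm u ^ L * norm u ^ n" by (simp add: norm_power norm_mult power_add mult.commute)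
      also have "\<dots> \<le> norm u ^ L * \<eta> ^ n" using u by (intro mult_left_mono power_mono) auto
      finally show ?thesis .
    qed
    show "summable (\<lambda>n. norm u ^ L * \<eta> ^ n)" using g by (simp add: sums_iff)
  qed
  thus ?thesis using t g by (simp add: sums_iff)
qed


text \<open>For a prime \<open>p\<close> the exponents below \<open>plen N p\<close> are those of
  the powers of \<open>p\<close> that occur in \<open>Q {1..N}\<close>, together with 0.\<close>

definition plen :: "nat \<Rightarrow> nat \<Rightarrow> nat" where
  "plen N p = (LEAST m. N < p ^ m)"

lemma less_plen_iff:
  assumes "p \<ge> 2"
  shows "m < plen N p \<longleftrightarrow> p ^ m \<le> N"
proof
  assume "m < plen N p"
  thus "p ^ m \<le> N" unfolding plen_def using not_less_Least[of m "\<lambda>m. N < p ^ m"] by auto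
next
  assume m: "p ^ m \<le> N"
  have "N < 2 ^ N" by (rule less_exp)
  also have "\<dots> \<le> p ^ N" using assms by (intro power_mono) auto
  finally have "N < p ^ plen N p" unfolding plen_def by (rule LeastI)
  hence "p ^ m < p ^ plen N p" using m by linarith
  thus "m < plen N p" using assms by (simp add: power_strict_increasing_iff)
qed

lemma kap_prime_power: "prime p \<Longrightarrow> m > 0 \<Longrightarrow> kap (p ^ m) = 1 / real m"
  using prime_gt_1_nat[of p] by (simp add: kap_def ln_realpow)

lemma zc_power: "p > 0 \<Longrightarrow> zc (p ^ m) z = zc p z ^ m"
  by (induction m) (auto simp: zc_mult)

abbreviation primes_upto :: "nat \<Rightarrow> nat set" where
  "primes_upto N \<equiv> {p. prime p \<and> p \<le> N}"

context rand_char begin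

lemma ch_power: "p > 0 \<Longrightarrow> ch (p ^ m) x = ch p x ^ m"
  by (induction m) (auto simp: ch_mult)

lemma Q_primes:
  "Q {1..N} x z = (\<Sum>p\<in>primes_upto N. \<Sum>m\<in>{1..<plen N p}. (zc p z * ch p x) ^ m / of_nat m)"
proof -
  define S where "S = Sigma (primes_upto N) (\<lambda>p. {1..<plen N p})"
  define g where "g = (\<lambda>(p :: nat, m :: nat). p ^ m)"
  have p2: "p \<ge> 2" if "prime p" for p :: nat using prime_ge_2_nat[OF that] .
  have inj: "inj_on g S"
  proof (rule inj_onI)
    fix a b assume ab: "a \<in> S" "b \<in> S" "g a = g b"
    obtain p m q l where [simp]: "a = (p, m)" "b = (q, l)" by (metis surj_pair)
    have "p = q \<and> m = l"
      using ab prime_power_inj''[of p q m l] by (simp add: g_def S_def)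
    thus "a = b" by simp
  qed
  have img: "g ` S = {n\<in>{1..N}. primepow n}"
  proof (intro equalityI subsetI)
    fix n assume "n \<in> g ` S"
    then obtain p m where pm: "prime p" "m \<ge> 1" "m < plen N p" "n = p ^ m" by (auto simp: g_def S_def)
    have "p ^ m \<le> N" using pm less_plen_iff[OF p2] by auto
    moreover have "p ^ m > 0" using pm prime_gt_0_nat by auto
    moreover have "primepow (p ^ m)" unfolding primepow_def using pm by (intro exI[of _ p] exI[of _ m]) auto
    ultimately show "n \<in> {n\<in>{1..N}. primepow n}" using pm by (simp add: Suc_le_eq)
  next
    fix n assume n: "n \<in> {n\<in>{1..N}. primepow n}"
    then obtain p m where pm: "prime p" "m > 0" "n = p ^ m" by (auto simp: primepow_def)
    have "p ^ 1 \<le> p ^ m" using pm p2[of p] by (intro power_increasing) auto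
    hence "p \<le> N" using n pm by auto
    moreover have "m < plen N p" using n pm less_plen_iff[OF p2[OF pm(1)]] by auto
    ultimately have "(p, m) \<in> S" using pm by (auto simp: S_def)
    thus "n \<in> g ` S" using pm by (auto simp: g_def)
  qed
  have "Q {1..N} x z = (\<Sum>n\<in>{n\<in>{1..N}. primepow n}. of_real (kap n) * zc n z * ch n x)"
    unfolding Q_def dpoly_def
    by (intro sum.mono_neutral_right) (auto simp: kap_def mangoldt_def)
  also have "\<dots> = (\<Sum>(p, m)\<in>S. of_real (kap (p ^ m)) * zc (p ^ m) z * ch (p ^ m) x)"
    unfolding img[symmetric] by (subst sum.reindex[OF inj]) (simp add: g_def case_prod_unfold)
  also have "\<dots> = (\<Sum>(p, m)\<in>S. (zc p z * ch p x) ^ m / of_nat m)"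
    by (intro sum.cong refl)
       (auto simp: S_def kap_prime_power zc_power ch_power prime_gt_0_nat power_mult_distrib)
  also have "\<dots> = (\<Sum>p\<in>primes_upto N. \<Sum>m\<in>{1..<plen N p}. (zc p z * ch p x) ^ m / of_nat m)"
    unfolding S_def by (subst sum.Sigma) auto
  finally show ?thesis .
qed

lemma norm_euler_term_le:
  assumes "prime p" "norm z \<le> \<rho>" "\<rho> < 1 / 4"
  shows "norm (zc p z * ch p x) \<le> real p powr (- (3 / 4 - \<rho>))"
    and "norm (zc p z * ch p x) \<le> 1 / sqrt 2"
proof -
  have p: "real p \<ge> 2" "p > 0" using prime_ge_2_nat[OF assms(1)] by auto
  show 1: "norm (zc p z * ch p x) \<le> real p powr (- (3 / 4 - \<rho>))"
    using norm_zc_le[OF p(2) assms(2)] by (simp add: norm_mult)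
  also have "\<dots> \<le> real p powr (- 1 / 2)" using p assms by (intro powr_mono) auto
  also have "\<dots> \<le> 2 powr (- 1 / 2)" using p by (intro powr_mono2') auto
  also have "\<dots> = 1 / sqrt 2" using powr_minus_divide[of "2::real" "1 / 2"] powr_half_sqrt[of 2] by simp
  finally show "norm (zc p z * ch p x) \<le> 1 / sqrt 2" .
qed

text \<open>What \<open>Q {1..N}\<close> misses are powers \<open>p ^ m > N\<close> of primes
  \<open>p \<le> N\<close>, so the first missing exponent \<open>L\<close> is at least 2. The decay
  exponent \<open>1 / 2 + bet \<rho>\<close> is split: \<open>bet \<rho> / 2\<close> acts on
  \<open>p ^ L > N\<close> and gives the decay in \<open>N\<close>, and
  \<open>(1 + bet \<rho>) / 2\<close>, at least doubled by \<open>L\<close>, gives convergence over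
  the primes.\<close>

lemma log_product_approx:
  assumes z: "norm z \<le> \<rho>" "\<rho> < 1 / 4" and N: "N \<ge> 1"
  shows "norm ((\<Sum>p\<in>primes_upto N. - Ln (1 - zc p z * ch p x)) - Q {1..N} x z)
    \<le> Zb \<rho> / (1 - 1 / sqrt 2) * real N powr (- (bet \<rho> / 2))"
proof -
  define u where "u p = zc p z * ch p x" for p
  have s2: "1 / sqrt 2 < (1 :: real)" by simp
  have "(\<Sum>p\<in>primes_upto N. - Ln (1 - u p)) - Q {1..N} x z =
     (\<Sum>p\<in>primes_upto N. - Ln (1 - u p) - (\<Sum>m\<in>{1..<plen N p}. u p ^ m / of_nat m))"
    unfolding Q_primes u_def by (rule sum_subtractf[symmetric])
  also have "norm \<dots> \<le> (\<Sum>p\<in>primes_upto N. real N powr (- (bet \<rho> / 2)) * real p powr (- (1 + bet \<rho>)) / (1 - 1 / sqrt 2))"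
  proof (intro order.trans[OF norm_sum] sum_mono)
    fix p assume p: "p \<in> primes_upto N"
    have p2: "p \<ge> 2" using p prime_ge_2_nat by auto
    define L where "L = plen N p"
    have L2: "L \<ge> 2" using less_plen_iff[OF p2, of 1 N] p by (simp add: L_def)
    have pL: "N < p ^ L" using less_plen_iff[OF p2, of L N] by (simp add: L_def)
    have "norm (- Ln (1 - u p) - (\<Sum>m\<in>{1..<L}. u p ^ m / of_nat m)) \<le> norm (u p) ^ L / (1 - 1 / sqrt 2)"
      unfolding u_def using norm_euler_term_le(2)[of p z \<rho> x] p z L2 s2 by (intro Ln_tail_bound) auto
    also have "norm (u p) ^ L \<le> (real p powr (- (3 / 4 - \<rho>))) ^ L"
      unfolding u_def using norm_euler_term_le(1)[of p z \<rho> x] p z by (intro power_mono) auto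
    also have "\<dots> = real p powr (- (3 / 4 - \<rho>) * real L)"
      using p2 by (simp add: powr_realpow[symmetric] powr_powr)
    also have "\<dots> = real p powr (real L * (- (bet \<rho> / 2))) * real p powr (- (real L * ((1 + bet \<rho>) / 2)))"
      unfolding powr_add[symmetric] by (rule arg_cong[of _ _ "\<lambda>e. real p powr e"]) (simp add: bet_def field_simps)
    also have "\<dots> = real (p ^ L) powr (- (bet \<rho> / 2)) * real p powr (- (real L * ((1 + bet \<rho>) / 2)))"
      using p2 by (simp add: powr_realpow[symmetric] powr_powr)
    also have "\<dots> \<le> real N powr (- (bet \<rho> / 2)) * real p powr (- (1 + bet \<rho>))"
    proof (intro mult_mono)
      show "real (p ^ L) powr (- (bet \<rho> / 2)) \<le> real N powr (- (bet \<rho> / 2))"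
        using z N pL by (intro powr_mono2') (auto simp: bet_def simp flip: of_nat_power)
      have "2 * ((1 + bet \<rho>) / 2) \<le> real L * ((1 + bet \<rho>) / 2)"
        using L2 z by (intro mult_right_mono) (auto simp: bet_def)
      thus "real p powr (- (real L * ((1 + bet \<rho>) / 2))) \<le> real p powr (- (1 + bet \<rho>))"
        using p2 by (intro powr_mono) auto
    qed auto
    finally show "norm (- Ln (1 - u p) - (\<Sum>m\<in>{1..<plen N p}. u p ^ m / of_nat m)) \<le>
        real N powr (- (bet \<rho> / 2)) * real p powr (- (1 + bet \<rho>)) / (1 - 1 / sqrt 2)"
      by (simp add: L_def divide_right_mono)
  qed
  also have "\<dots> = real N powr (- (bet \<rho> / 2)) / (1 - 1 / sqrt 2) * (\<Sum>p\<in>primes_upto N. real p powr (- (1 + bet \<rho>)))"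
    by (simp add: sum_distrib_left sum_divide_distrib)
  also have "\<dots> \<le> real N powr (- (bet \<rho> / 2)) / (1 - 1 / sqrt 2) * Zb \<rho>"
    using z by (intro mult_left_mono Zb_sum_le) auto
  finally show ?thesis by (simp add: u_def mult_ac)
qed

text \<open>The partial products are exponentials of sums of \<open>- Ln (1 - u p)\<close>, and
  these sums differ from \<open>Q {1..N}\<close> by a null sequence. The limit \<open>exp h\<close>
  is nonzero, as convergence of an infinite product demands.\<close>

lemma euler_product:
  assumes z: "norm z \<le> \<rho>" "\<rho> < 1 / 4" and lim: "(\<lambda>N. Q {1..N} x z) \<longlonglongrightarrow> h"
  shows "(\<Prod>p. if prime p then 1 / (1 - ch p x * of_nat p powr (- (3 / 4 + z))) else 1) = exp h"
proof -
  define fac where "fac p = (if prime p then 1 / (1 - ch p x * of_nat p powr (- (3 / 4 + z))) else 1)" for p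
  define u where "u p = zc p z * ch p x" for p
  have fac: "fac p = exp (- Ln (1 - u p))" if "prime p" for p
  proof -
    have "norm (u p) < 1" unfolding u_def
      using norm_euler_term_le(2)[OF that z, of x] by (rule order.strict_trans1) simp
    hence u1: "1 - u p \<noteq> 0" by auto
    have p0: "p > 0" using that by (rule prime_gt_0_nat)
    have "exp (- Ln (1 - u p)) = 1 / (1 - u p)"
      unfolding exp_minus exp_Ln[OF u1] by (simp only: divide_inverse mult_1_left)
    moreover have "u p = ch p x * of_nat p powr (- (3 / 4 + z))"
      unfolding u_def zc_powr[OF p0] by (rule mult.commute)
    ultimately show ?thesis unfolding fac_def if_P[OF that] by simp
  qed
  have prod: "(\<Prod>i\<le>N. fac i) = exp (\<Sum>p\<in>primes_upto N. - Ln (1 - u p))" for N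
  proof -
    have "(\<Prod>i\<le>N. fac i) = (\<Prod>p\<in>primes_upto N. fac p)"
      by (rule prod.mono_neutral_right) (auto simp: fac_def)
    also have "\<dots> = (\<Prod>p\<in>primes_upto N. exp (- Ln (1 - u p)))" by (intro prod.cong refl fac) auto
    also have "\<dots> = exp (\<Sum>p\<in>primes_upto N. - Ln (1 - u p))" by (rule exp_sum[symmetric]) simp
    finally show ?thesis .
  qed
  have "(\<lambda>N. (\<Sum>p\<in>primes_upto N. - Ln (1 - u p)) - Q {1..N} x z) \<longlonglongrightarrow> 0"
  proof (rule Lim_null_comparison)
    show "eventually (\<lambda>N. norm ((\<Sum>p\<in>primes_upto N. - Ln (1 - u p)) - Q {1..N} x z)
       \<le> Zb \<rho> / (1 - 1 / sqrt 2) * real N powr (- (bet \<rho> / 2))) sequentially"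
      using eventually_ge_at_top[of 1] unfolding u_def
      by eventually_elim (rule log_product_approx[OF z])
    have "(\<lambda>N. real N powr (- (bet \<rho> / 2))) \<longlonglongrightarrow> 0"
      using z by (intro tendsto_neg_powr filterlim_real_sequentially) (simp add: bet_def)
    thus "(\<lambda>N. Zb \<rho> / (1 - 1 / sqrt 2) * real N powr (- (bet \<rho> / 2))) \<longlonglongrightarrow> 0"
      by (rule tendsto_mult_right_zero)
  qed
  from tendsto_add[OF this lim] have "(\<lambda>N. \<Sum>p\<in>primes_upto N. - Ln (1 - u p)) \<longlonglongrightarrow> h" by simp
  hence "(\<lambda>N. \<Prod>i\<le>N. fac i) \<longlonglongrightarrow> exp h" unfolding prod by (rule tendsto_exp)
  hence "fac has_prod exp h" by (auto simp: has_prod_def raw_has_prod_def)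
  thus ?thesis unfolding fac_def by (simp add: has_prod_unique[symmetric])
qed

end

section \<open>The random Euler product as a random character\<close>

lemma integral_uniform_measure:
  fixes f :: "'a \<Rightarrow> 'b :: {banach, second_countable_topology}"
  assumes A: "A \<in> sets N" "emeasure N A \<noteq> 0" "emeasure N A \<noteq> \<infinity>" and f: "f \<in> borel_measurable N"
  shows "integral\<^sup>L (uniform_measure N A) f = (1 / measure N A) *\<^sub>R (LINT x:A|N. f x)"
proof -
  have pos: "measure N A > 0" using A by (simp add: measure_def enn2real_positive_iff top.not_eq_extremum zero_less_iff_neq_zero)
  have eq: "indicator A x / emeasure N A = ennreal (indicator A x / measure N A)" for x
    using A pos by (simp add: emeasure_eq_ennreal_measure divide_ennreal[symmetric] ennreal_indicator)
  have "integral\<^sup>L (uniform_measure N A) f = integral\<^sup>L (density N (\<lambda>x. ennreal (indicator A x / measure N A))) f"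
    by (simp add: uniform_measure_def eq)
  also have "\<dots> = (\<integral>x. (indicator A x / measure N A) *\<^sub>R f x \<partial>N)"
    using A f pos by (intro integral_density) auto
  also have "\<dots> = (\<integral>x. (1 / measure N A) *\<^sub>R (indicator A x *\<^sub>R f x) \<partial>N)" by simp
  also have "\<dots> = (1 / measure N A) *\<^sub>R (LINT x:A|N. f x)"
    unfolding set_lebesgue_integral_def by (rule integral_scaleR_right) 
  finally show ?thesis .
qed

lemma uniform_circle_moment:
  assumes "a \<noteq> b"
  shows "(\<integral>w. w ^ a * cnj w ^ b \<partial>uniform_circle) = 0"
proof -
  define k where "k = real a - real b"
  have k: "k \<noteq> 0" using assms by (simp add: k_def)
  have em: "emeasure lborel {0..<2 * pi} = ennreal (2 * pi)" by simp
  have cm: "cis \<in> borel_measurable borel" unfolding cis_conv_exp[abs_def] by measurable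
  have "(\<integral>w. w ^ a * cnj w ^ b \<partial>uniform_circle) = (\<integral>t. cis t ^ a * cnj (cis t) ^ b \<partial>uniform_measure lborel {0..<2 * pi})"
    unfolding uniform_circle_def using cm by (intro integral_distr) auto
  also have "\<dots> = (\<integral>t. cis (k * t) \<partial>uniform_measure lborel {0..<2 * pi})"
    by (intro Bochner_Integration.integral_cong refl)
       (simp add: cis_cnj Complex.DeMoivre cis_mult k_def algebra_simps)
  also have "\<dots> = (1 / (2 * pi)) *\<^sub>R (LBINT t:{0..<2 * pi}. cis (k * t))"
    by (subst integral_uniform_measure) (use cm in auto)
  \<comment> \<open>The endpoint is a null set; the fundamental theorem of calculus is applied on
    the closed interval.\<close>
  also have "(LBINT t:{0..<2 * pi}. cis (k * t)) = (LBINT t:{0..2 * pi}. cis (k * t))"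
  proof (rule set_integral_cong_set)
    show "AE x in lborel. (x \<in> {0..2 * pi}) = (x \<in> {0..<2 * pi})"
      using AE_lborel_singleton[of "2 * pi"] by eventually_elim auto
  qed (use cm in \<open>auto simp: set_borel_measurable_def\<close>)
  also have "\<dots> = cis (k * (2 * pi)) / (\<i> * k) - cis (k * 0) / (\<i> * k)"
    unfolding set_lebesgue_integral_def
  proof (rule integral_FTC_atLeastAtMost)
    fix x :: real
    have "((\<lambda>z. exp (\<i> * (of_real k * z)) / (\<i> * k)) has_field_derivative exp (\<i> * (of_real k * of_real x))) (at (of_real x))"
      using k by (auto intro!: derivative_eq_intros simp: mult.commute[of _ \<i>])
    from has_vector_derivative_real_field[OF this]
    show "((\<lambda>x. cis (k * x) / (\<i> * k)) has_vector_derivative cis (k * x)) (at x within {0..2 * pi})"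
      by (simp add: cis_conv_exp)
  qed (auto simp: cis_conv_exp intro!: continuous_intros)
  also have "cis (k * (2 * pi)) = 1"
    using cis_multiple_2pi[of k] by (simp add: k_def mult.commute)
  finally show ?thesis by simp
qed

lemma AE_uniform_circle: "AE w in uniform_circle. norm w = 1"
proof -
  have cm: "cis \<in> borel_measurable borel" unfolding cis_conv_exp[abs_def] by measurable
  show ?thesis unfolding uniform_circle_def
    using cm by (subst AE_distr_iff) auto
qed

text \<open>\<open>X p\<close> lies on the circle only almost surely; this makes \<open>multchar X\<close> unimodular everywhere.\<close>

definition unit_part :: "complex \<Rightarrow> complex" where
  "unit_part w = (if norm w = 1 then w else 1)"

lemma norm_unit_part [simp]: "norm (unit_part w) = 1"
  by (simp add: unit_part_def)

lemma unit_part_meas [measurable]: "unit_part \<in> borel_measurable borel"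
  unfolding unit_part_def by measurable

definition multchar :: "(nat \<Rightarrow> 'a \<Rightarrow> complex) \<Rightarrow> nat \<Rightarrow> 'a \<Rightarrow> complex" where
  "multchar X n x = (\<Prod>p\<in>#prime_factorization n. unit_part (X p x))"

text \<open>\<open>P\<close> may be larger than the set of prime factors of \<open>n\<close>, so
  that two numbers can be expanded over one common set of primes when independence is
  applied.\<close>

lemma multchar_prod:
  assumes "finite P" "\<And>p. p \<in> P \<Longrightarrow> prime p" "prime_factors n \<subseteq> P"
  shows "multchar X n x = (\<Prod>p\<in>P. unit_part (X p x) ^ multiplicity p n)"
proof -
  have "multchar X n x = (\<Prod>p\<in>prime_factors n. unit_part (X p x) ^ count (prime_factorization n) p)"
    unfolding multchar_def by (rule image_prod_mset_multiplicity)
  also have "\<dots> = (\<Prod>p\<in>P. unit_part (X p x) ^ count (prime_factorization n) p)"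
    using assms by (intro prod.mono_neutral_left) (auto simp: not_in_iff)
  also have "\<dots> = (\<Prod>p\<in>P. unit_part (X p x) ^ multiplicity p n)"
    using assms by (intro prod.cong refl) (simp add: count_prime_factorization_prime)
  finally show ?thesis .
qed

lemma multchar_prime: "prime p \<Longrightarrow> multchar X p x = unit_part (X p x)"
  by (simp add: multchar_def prime_factorization_prime)

locale random_euler = prob_space M for M :: "'a measure" +
  fixes X :: "nat \<Rightarrow> 'a \<Rightarrow> complex"
  assumes ind: "indep_vars (\<lambda>_. borel) X {p. prime p}"
    and unif: "\<And>p. prime p \<Longrightarrow> distr M borel (X p) = uniform_circle"
begin

lemma X_meas: "prime p \<Longrightarrow> X p \<in> borel_measurable M"
  using ind by (auto simp: indep_vars_def)

lemma X_moment:
  assumes "prime p" "a \<noteq> b"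
  shows "expectation (\<lambda>x. unit_part (X p x) ^ a * cnj (unit_part (X p x)) ^ b) = 0"
proof -
  have "expectation (\<lambda>x. unit_part (X p x) ^ a * cnj (unit_part (X p x)) ^ b)
     = (\<integral>w. unit_part w ^ a * cnj (unit_part w) ^ b \<partial>distr M borel (X p))"
    using X_meas[OF assms(1)] by (subst integral_distr) auto
  also have "\<dots> = (\<integral>w. unit_part w ^ a * cnj (unit_part w) ^ b \<partial>uniform_circle)"
    by (simp add: unif[OF assms(1)])
  also have "\<dots> = (\<integral>w. w ^ a * cnj w ^ b \<partial>uniform_circle)"
    using AE_uniform_circle
    by (intro integral_cong_AE) (auto simp: uniform_circle_def unit_part_def elim: eventually_mono)
  finally show ?thesis using uniform_circle_moment[OF assms(2)] by simp
qed

lemma multchar_meas: "multchar X n \<in> borel_measurable M"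
proof -
  have "(\<lambda>x. \<Prod>p\<in>prime_factors n. unit_part (X p x) ^ multiplicity p n) \<in> borel_measurable M"
    by (intro borel_measurable_prod borel_measurable_power measurable_compose[OF X_meas unit_part_meas]) auto
  thus ?thesis by (subst measurable_cong[OF multchar_prod[of "prime_factors n"]]) auto
qed

sublocale rand_char M "multchar X"
proof
  show "multchar X n \<in> borel_measurable M" for n by (rule multchar_meas)
  show "norm (multchar X n x) = 1" for n x
    by (subst multchar_prod[of "prime_factors n"]) (auto simp: prod_norm[symmetric] norm_power)
  show "multchar X (m * n) x = multchar X m x * multchar X n x" if "m > 0" "n > 0" for m n x
    using that by (simp add: multchar_def prime_factorization_mult)
qed

text \<open>Independence factors the correlation over the primes. Distinct numbers differ in the
  multiplicity of some prime, and the factor of that prime is a vanishing moment of the uniform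
  distribution.\<close>

sublocale orth_char M "multchar X"
proof
  fix m n :: nat assume mn: "m > 0" "n > 0" "m \<noteq> n"
  define P where "P = prime_factors m \<union> prime_factors n"
  define Z where "Z p x = unit_part (X p x) ^ multiplicity p m * cnj (unit_part (X p x)) ^ multiplicity p n" for p x
  have P: "finite P" "\<And>p. p \<in> P \<Longrightarrow> prime p" by (auto simp: P_def)
  have "multchar X m x * cnj (multchar X n x) = (\<Prod>p\<in>P. Z p x)" for x
    unfolding Z_def prod.distrib
    by (subst (1 2) multchar_prod[of P]) (auto simp: P_def cnj_prod)
  hence "corr m n = expectation (\<lambda>x. \<Prod>p\<in>P. Z p x)" by (simp add: corr_def)
  also have "\<dots> = (\<Prod>p\<in>P. expectation (Z p))"
  proof (rule indep_vars_lebesgue_integral[OF P(1)])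
    have "indep_vars (\<lambda>_. borel) (\<lambda>p. (\<lambda>w. unit_part w ^ multiplicity p m * cnj (unit_part w) ^ multiplicity p n) \<circ> X p) P"
    proof (rule indep_vars_compose[OF indep_vars_subset[OF ind]])
      show "P \<subseteq> {p. prime p}" using P by auto
    qed measurable
    thus "indep_vars (\<lambda>_. borel) Z P" by (simp add: o_def Z_def[abs_def])
    show "integrable M (Z p)" if "p \<in> P" for p
    proof (rule integrable_bdd[of _ 1])
      have [measurable]: "X p \<in> borel_measurable M" by (rule X_meas[OF P(2)[OF that]])
      show "Z p \<in> borel_measurable M" unfolding Z_def by measurable
    qed (auto simp: Z_def norm_mult norm_power)
  qed
  also have "\<dots> = 0"
  proof -
    obtain p where p: "prime p" "multiplicity p m \<noteq> multiplicity p n"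
      using mn multiplicity_eq_nat[of m n] by auto
    have "p dvd m \<or> p dvd n" using p(2) not_dvd_imp_multiplicity_0 by metis
    hence "p \<in> P" using p(1) mn by (auto simp: P_def prime_factors_dvd)
    moreover have "expectation (Z p) = 0" unfolding Z_def by (rule X_moment[OF p])
    ultimately show ?thesis using P(1) by (auto simp: prod_zero_iff)
  qed
  finally show "corr m n = 0" .
qed

lemma AE_unit: "AE x in M. \<forall>p. prime p \<longrightarrow> unit_part (X p x) = X p x"
proof -
  have "AE x in M. prime p \<longrightarrow> unit_part (X p x) = X p x" for p
  proof (cases "prime p")
    case True
    have "AE w in distr M borel (X p). norm w = 1"
      unfolding unif[OF True] by (rule AE_uniform_circle)
    hence "AE x in M. norm (X p x) = 1"
      using X_meas[OF True] by (subst (asm) AE_distr_iff) auto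
    thus ?thesis by eventually_elim (simp add: unit_part_def)
  qed auto
  thus ?thesis by (simp add: AE_all_countable)
qed

lemma random_zeta_eq:
  assumes x: "\<forall>p. prime p \<longrightarrow> unit_part (X p x) = X p x"
    and z: "norm z \<le> \<rho>" "\<rho> < 1 / 4" and lim: "(\<lambda>N. Q {1..N} x z) \<longlonglongrightarrow> h"
  shows "random_zeta X x (3 / 4 + z) = exp h"
proof -
  have "(\<lambda>p. if prime p then 1 / (1 - X p x * of_nat p powr (- (3 / 4 + z))) else 1)
     = (\<lambda>p. if prime p then 1 / (1 - multchar X p x * of_nat p powr (- (3 / 4 + z))) else 1)"
    using x by (auto simp: multchar_prime)
  thus ?thesis unfolding random_zeta_def using euler_product[OF z lim] by simp
qed

end

section \<open>The functional of the random Euler product\<close>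

lemma borel_measurable_completion_AE:
  fixes F :: "'a \<Rightarrow> real"
  assumes g: "g \<in> borel_measurable M" and ae: "AE x in M. F x = g x"
  shows "F \<in> borel_measurable (completion M)"
proof (rule measurableI)
  fix A :: "real set" assume A: "A \<in> sets borel"
  have g': "g \<in> borel_measurable (completion M)" by (rule measurable_completion[OF g])
  show "F -` A \<inter> space (completion M) \<in> sets (completion M)"
  proof (rule completion.in_sets_AE)
    show "g -` A \<inter> space (completion M) \<in> sets (completion M)"
      using g' A by (rule measurable_sets)
    have "AE x in completion M. F x = g x" using ae by (rule AE_completion)
    thus "AE x in completion M. (x \<in> g -` A \<inter> space (completion M)) = (x \<in> F -` A \<inter> space (completion M))"
      by eventually_elim auto
  qed auto
qed auto

text \<open>The random functional is the almost sure limit of \<open>G N\<close>, and dominated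
  convergence reduces the claim to comparing \<open>G N\<close> with \<open>G Y\<close>, uniformly
  in \<open>N \<ge> Y\<close>. That comparison involves only \<open>Q {Suc Y..N}\<close>, whose
  supremum is small in mean square.\<close>

lemma (in universality) random_zeta_functional_approx:
  fixes M :: "'b measure"
  assumes re: "random_euler M X" and Y: "Y \<ge> 1"
  shows "\<bar>(\<integral>x. \<omega> (SUP z\<in>cball 0 r. cmod (random_zeta X x (3 / 4 + z) - f z)) \<partial>completion M)
     - (\<integral>x. Phi \<omega> f (cball 0 r) (rand_char.Q (multchar X) {1..Y} x) \<partial>M)\<bar>
     \<le> L0 * sqrt (\<rho> / (\<rho> - r) * (real Y powr (- bet \<rho>) * Zb \<rho>))"
proof -
  interpret random_euler M X by (rule re)
  define B where "B = sqrt (\<rho> / (\<rho> - r) * (real Y powr (- bet \<rho>) * Zb \<rho>))"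
  define Fz where "Fz x = \<omega> (SUP z\<in>cball 0 r. cmod (random_zeta X x (3 / 4 + z) - f z))" for x
  define G where "G N x = Phi \<omega> f (cball 0 r) (Q {1..N} x)" for N x
  have Gm [measurable]: "G N \<in> borel_measurable M" for N
    unfolding G_def by (intro Phi_meas omega_meas Q_meas Q_continuous)
  have ae: "AE x in M. (\<lambda>N. G N x) \<longlonglongrightarrow> Fz x"
    using AE_uniformly_convergent[OF r] AE_unit
  proof eventually_elim
    case (elim x)
    then obtain h where h: "uniform_limit (cball 0 r) (\<lambda>N. Q {1..N} x) h sequentially"
      by (auto simp: uniformly_convergent_on_def)
    have hc: "continuous_on (cball 0 r) h"
      by (rule uniform_limit_theorem[OF _ h]) (auto intro!: always_eventually Q_continuous)
    have "random_zeta X x (3 / 4 + z) = exp (h z)" if "z \<in> cball 0 r" for z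
      by (rule random_zeta_eq[OF elim(2) _ r(3)]) (use that r tendsto_uniform_limitI[OF h that] in auto)
    hence Fx: "Fz x = Phi \<omega> f (cball 0 r) h"
      by (simp add: Fz_def Phi_def)
    show "(\<lambda>N. G N x) \<longlonglongrightarrow> Fz x"
    proof (rule tendstoI)
      fix e :: real assume e: "e > 0"
      define d where "d = e / (L0 + 1)"
      have d: "d > 0" "L0 * d < e" using e L0 by (auto simp: d_def field_simps)
      have "eventually (\<lambda>N. \<forall>z\<in>cball 0 r. dist (Q {1..N} x z) (h z) < d) sequentially"
        using uniform_limitD[OF h d(1)] .
      thus "eventually (\<lambda>N. dist (G N x) (Fz x) < e) sequentially"
      proof eventually_elim
        case (elim N)
        have "\<bar>Phi \<omega> f (cball 0 r) (Q {1..N} x) - Phi \<omega> f (cball 0 r) h\<bar> \<le> L0 * d + \<Lambda> * 0"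
          unfolding L0_def
        proof (rule Phi_lipschitz)
          show "norm (f z) \<le> F" if "z \<in> cball 0 r \<union> cball 0 r" for z
            by (rule f_bnd) (use that r in auto)
          show "\<exists>j\<in>cball 0 r. cmod (Q {1..N} x i - h j) \<le> d \<and> cmod (f i - f j) \<le> 0" if "i \<in> cball 0 r" for i
            using that elim by (intro bexI[of _ i]) (auto simp: dist_norm less_imp_le)
          show "\<exists>j\<in>cball 0 r. cmod (h i - Q {1..N} x j) \<le> d \<and> cmod (f i - f j) \<le> 0" if "i \<in> cball 0 r" for i
            using that elim by (intro bexI[of _ i]) (auto simp: dist_norm norm_minus_commute less_imp_le)
        qed (use r F0 d in \<open>auto intro!: bdd_exp hc Q_continuous\<close>)
        thus ?case using d by (simp add: G_def Fx dist_real_def)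
      qed
    qed
  qed
  \<comment> \<open>A version of \<open>Fz\<close> that is measurable for \<open>M\<close> itself;
    agreement almost everywhere carries measurability and the integral over to the
    completion.\<close>
  define g where "g x = lim (\<lambda>N. G N x)" for x
  have gm: "g \<in> borel_measurable M" unfolding g_def by measurable
  have Fg: "AE x in M. Fz x = g x" using ae by eventually_elim (simp add: g_def limI)
  have Fm: "Fz \<in> borel_measurable (completion M)" by (rule borel_measurable_completion_AE[OF gm Fg])
  have "integral\<^sup>L (completion M) Fz = integral\<^sup>L (completion M) g"
    by (rule integral_cong_AE[OF Fm measurable_completion[OF gm] AE_completion[OF Fg]])
  also have "\<dots> = integral\<^sup>L M g" by (rule integral_completion[OF gm])
  finally have EF: "integral\<^sup>L (completion M) Fz = expectation g" .
  have lim: "(\<lambda>N. expectation (G N)) \<longlonglongrightarrow> expectation g"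
  proof (rule integral_dominated_convergence[of _ _ _ "\<lambda>_. W0"])
    show "AE x in M. (\<lambda>N. G N x) \<longlonglongrightarrow> g x" using ae Fg by eventually_elim simp
  qed (use gm in \<open>auto simp: G_def Phi_bound\<close>)
  have intG: "integrable M (G N)" for N
    by (rule integrable_bdd[of _ W0]) (auto simp: G_def Phi_bound)
  have close: "\<bar>expectation (G N) - expectation (G Y)\<bar> \<le> L0 * B" if N: "N \<ge> Y" for N
  proof -
    define S where "S x = (SUP z\<in>cball 0 r. norm (Q {Suc Y..N} x z ^ 1))" for x
    interpret qc: quasi_char M "multchar X" N 0 by (rule quasi)
    note * = qc.Q_sup_moment[of "{Suc Y..N}" "Suc Y" N 1 r \<rho>, folded S_def]
    have Si: "integrable M (\<lambda>x. (S x)\<^sup>2)" and Sm: "S \<in> borel_measurable M"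
      and S2: "expectation (\<lambda>x. (S x)\<^sup>2) \<le> \<rho> / (\<rho> - r) * (fact 1 * (real (Suc Y) powr (- bet \<rho>) * Zb \<rho>) ^ 1 + 0 * real N ^ (2 * 1))"
      using * N Y r by auto
    note S2
    also have "\<rho> / (\<rho> - r) * (fact 1 * (real (Suc Y) powr (- bet \<rho>) * Zb \<rho>) ^ 1 + 0 * real N ^ (2 * 1))
       \<le> \<rho> / (\<rho> - r) * (real Y powr (- bet \<rho>) * Zb \<rho>)"
      using r Y Zb_nonneg[OF r(3)] 
      by (simp, intro mult_left_mono divide_right_mono mult_right_mono powr_mono2') (auto simp: bet_def)
    finally have S2': "expectation (\<lambda>x. (S x)\<^sup>2) \<le> \<rho> / (\<rho> - r) * (real Y powr (- bet \<rho>) * Zb \<rho>)" .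
    have ES: "integrable M S" "expectation S \<le> B"
      using expectation_le_sqrt[OF Sm Si] S2' unfolding B_def by (auto intro: order.trans real_sqrt_le_mono)
    have "\<bar>expectation (G N) - expectation (G Y)\<bar> = \<bar>expectation (\<lambda>x. G N x - G Y x)\<bar>"
      by (simp add: Bochner_Integration.integral_diff intG)
    also have "\<dots> \<le> expectation (\<lambda>x. \<bar>G N x - G Y x\<bar>)" by (rule integral_abs_bound)
    also have "\<dots> \<le> expectation (\<lambda>x. L0 * S x)"
    proof (intro integral_mono integrable_abs Bochner_Integration.integrable_diff intG integrable_mult_right ES)
      fix x
      have Sx: "norm (Q {1..N} x z - Q {1..Y} x z) \<le> S x" if "z \<in> cball 0 r" for z
      proof -
        have "norm (Q {Suc Y..N} x z ^ 1) \<le> S x" unfolding S_def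
          by (rule cSUP_upper) (use that in \<open>auto intro!: bdd_above_continuous_image continuous_intros Q_continuous\<close>)
        thus ?thesis by (simp only: Q_diff[OF N] power_one_right)
      qed
      have "\<bar>Phi \<omega> f (cball 0 r) (Q {1..N} x) - Phi \<omega> f (cball 0 r) (Q {1..Y} x)\<bar> \<le> L0 * S x + \<Lambda> * 0"
        unfolding L0_def
      proof (rule Phi_lipschitz)
        show "norm (f z) \<le> F" if "z \<in> cball 0 r \<union> cball 0 r" for z
          by (rule f_bnd) (use that r in auto)
        show "\<exists>j\<in>cball 0 r. cmod (Q {1..N} x i - Q {1..Y} x j) \<le> S x \<and> cmod (f i - f j) \<le> 0" if "i \<in> cball 0 r" for i
          using Sx[OF that] that by (intro bexI[of _ i]) auto
        show "\<exists>j\<in>cball 0 r. cmod (Q {1..Y} x i - Q {1..N} x j) \<le> S x \<and> cmod (f i - f j) \<le> 0" if "i \<in> cball 0 r" for i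
          using Sx[OF that] that by (intro bexI[of _ i]) (auto simp: norm_minus_commute)
        show "0 \<le> S x" using Sx[of 0] r by (auto intro: order.trans[OF norm_ge_zero])
      qed (use r F0 in \<open>auto intro!: bdd_exp Q_continuous\<close>)
      thus "\<bar>G N x - G Y x\<bar> \<le> L0 * S x" by (simp add: G_def)
    qed
    also have "\<dots> = L0 * expectation S" by simp
    also have "\<dots> \<le> L0 * B" using ES L0 by (intro mult_left_mono) auto
    finally show ?thesis .
  qed
  have "(\<lambda>N. \<bar>expectation (G N) - expectation (G Y)\<bar>) \<longlonglongrightarrow> \<bar>expectation g - expectation (G Y)\<bar>"
    by (intro tendsto_intros lim)
  hence "\<bar>expectation g - expectation (G Y)\<bar> \<le> L0 * B"
    using close by (intro LIMSEQ_le_const2) auto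
  thus ?thesis unfolding B_def EF[symmetric] Fz_def G_def .
qed

section \<open>The characters \<open>n\<^sup>-\<^sup>i\<^sup>t\<close>\<close>

definition tmeas :: "real \<Rightarrow> real measure" where
  "tmeas T = uniform_measure lborel {T..2 * T}"

definition tch :: "nat \<Rightarrow> real \<Rightarrow> complex" where
  "tch n t = exp (- (\<i> * of_real (t * ln (real n))))"

lemma space_tmeas [simp]: "space (tmeas T) = UNIV" and sets_tmeas [measurable_cong, simp]: "sets (tmeas T) = sets borel"
  by (simp_all add: tmeas_def)

lemma tmeas_integral:
  fixes f :: "real \<Rightarrow> 'b :: {banach, second_countable_topology}"
  assumes "T > 0" "f \<in> borel_measurable borel"
  shows "integral\<^sup>L (tmeas T) f = (1 / T) *\<^sub>R (LBINT t:{T..2 * T}. f t)"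
  unfolding tmeas_def using assms by (subst integral_uniform_measure) auto

lemma AE_tmeas: "AE t in tmeas T. t \<in> {T..2 * T}"
  unfolding tmeas_def by (rule AE_uniform_measureI) auto

lemma prob_space_tmeas: "T > 0 \<Longrightarrow> prob_space (tmeas T)"
  unfolding tmeas_def by (rule prob_space_uniform_measure) auto

lemma rand_char_tch: assumes "T > 0" shows "rand_char (tmeas T) tch"
proof -
  interpret prob_space "tmeas T" by (rule prob_space_tmeas[OF assms])
  show ?thesis
  proof
    have "tch n \<in> borel_measurable borel" for n unfolding tch_def by measurable
    thus "tch n \<in> borel_measurable (tmeas T)" for n by (simp cong: measurable_cong_sets)
    show "norm (tch n t) = 1" for n t by (simp add: tch_def)
    show "tch (m * n) t = tch m t * tch n t" if "m > 0" "n > 0" for m n t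
      using that by (simp add: tch_def ln_mult_pos algebra_simps flip: exp_add)
  qed
qed

lemma norm_mean_exp_le:
  assumes "T > 0" "k \<noteq> 0"
  shows "norm (integral\<^sup>L (tmeas T) (\<lambda>t. exp (\<i> * of_real (k * t)))) \<le> 2 / (T * \<bar>k\<bar>)"
proof -
  have "integral\<^sup>L (tmeas T) (\<lambda>t. exp (\<i> * of_real (k * t))) = (1 / T) *\<^sub>R (LBINT t:{T..2 * T}. exp (\<i> * of_real (k * t)))"
    by (rule tmeas_integral[OF assms(1)]) measurable
  also have "(LBINT t:{T..2 * T}. exp (\<i> * of_real (k * t))) = exp (\<i> * of_real (k * (2 * T))) / (\<i> * k) - exp (\<i> * of_real (k * T)) / (\<i> * k)"
    unfolding set_lebesgue_integral_def
  proof (rule integral_FTC_atLeastAtMost)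
    fix x :: real
    have "((\<lambda>z. exp (\<i> * (of_real k * z)) / (\<i> * k)) has_field_derivative exp (\<i> * (of_real k * of_real x))) (at (of_real x))"
      using assms by (auto intro!: derivative_eq_intros simp: mult.commute[of _ \<i>])
    from has_vector_derivative_real_field[OF this]
    show "((\<lambda>x. exp (\<i> * of_real (k * x)) / (\<i> * k)) has_vector_derivative exp (\<i> * of_real (k * x))) (at x within {T..2 * T})"
      by simp
  qed (use assms in \<open>auto intro!: continuous_intros\<close>)
  also have "norm ((1 / T) *\<^sub>R (exp (\<i> * of_real (k * (2 * T))) / (\<i> * k) - exp (\<i> * of_real (k * T)) / (\<i> * k)))
    \<le> 1 / T * (1 / \<bar>k\<bar> + 1 / \<bar>k\<bar>)"
    unfolding norm_scaleR using assms
    by (intro mult_mono order.trans[OF norm_triangle_ineq4] add_mono) (auto simp: norm_divide norm_mult)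
  also have "\<dots> = 2 / (T * \<bar>k\<bar>)" by simp
  finally show ?thesis .
qed

lemma abs_ln_diff_ge:
  assumes "m > 0" "n > 0" "m \<noteq> n"
  shows "\<bar>ln (real m) - ln (real n)\<bar> \<ge> \<bar>real m - real n\<bar> / real (max m n)"
proof -
  have *: "ln (real n) - ln (real m) \<ge> (real n - real m) / real n" if "m > 0" "m < n" for m n :: nat
  proof -
    have "ln (real m / real n) \<le> real m / real n - 1" using that by (intro ln_le_minus_one) auto
    moreover have "ln (real m / real n) = ln (real m) - ln (real n)" using that by (simp add: ln_div)
    ultimately show ?thesis using that by (simp add: diff_divide_distrib)
  qed
  show ?thesis
  proof (cases "m < n")
    case True
    thus ?thesis using *[of m n] assms by (simp add: max_def)
  next
    case False
    thus ?thesis using *[of n m] assms by (simp add: max_def)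
  qed
qed

lemma tcorr_le:
  assumes T: "T > 0" and mn: "m > 0" "n > 0" "m \<noteq> n"
  shows "norm (rand_char.corr (tmeas T) tch m n) \<le> 2 * real (max m n) / (T * \<bar>real m - real n\<bar>)"
proof -
  interpret rand_char "tmeas T" tch by (rule rand_char_tch[OF T])
  define k where "k = ln (real n) - ln (real m)"
  have kge: "\<bar>k\<bar> \<ge> \<bar>real m - real n\<bar> / real (max m n)"
    unfolding k_def using abs_ln_diff_ge[OF mn] by (simp add: abs_minus_commute)
  have pos: "\<bar>real m - real n\<bar> / real (max m n) > 0" using mn by (intro divide_pos_pos) auto
  have k0: "k \<noteq> 0" using kge pos by auto
  have "corr m n = integral\<^sup>L (tmeas T) (\<lambda>t. exp (\<i> * of_real (k * t)))"
    unfolding corr_def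
    by (intro Bochner_Integration.integral_cong refl)
       (simp add: tch_def exp_cnj k_def algebra_simps flip: exp_add)
  also have "norm \<dots> \<le> 2 / (T * \<bar>k\<bar>)" by (rule norm_mean_exp_le[OF T k0])
  also have "\<dots> \<le> 2 / (T * (\<bar>real m - real n\<bar> / real (max m n)))"
    using kge pos T by (intro divide_left_mono mult_left_mono mult_pos_pos) auto
  also have "\<dots> = 2 * real (max m n) / (T * \<bar>real m - real n\<bar>)" by (simp add: field_simps)
  finally show ?thesis .
qed

lemma quasi_char_tch:
  assumes T: "T > 0"
  shows "quasi_char (tmeas T) tch W (2 * real W / T)"
proof -
  interpret rand_char "tmeas T" tch by (rule rand_char_tch[OF T])
  show ?thesis
  proof
    fix m n assume mn: "m \<in> {1..W}" "n \<in> {1..W}" "m \<noteq> n"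
    have "norm (corr m n) \<le> 2 * real (max m n) / (T * \<bar>real m - real n\<bar>)"
      using mn by (intro tcorr_le[OF T]) auto
    also have "\<dots> \<le> 2 * real W / (T * 1)"
      using mn T by (intro frac_le mult_left_mono) auto
    finally show "norm (corr m n) \<le> 2 * real W / T" by simp
  qed (use T in auto)
qed

section \<open>Mean squares of long Dirichlet polynomials\<close>

lemma sum_powr_le:
  assumes "0 \<le> a" "a < 1"
  shows "(\<Sum>n\<in>{1..N}. real n powr (- a)) \<le> real N powr (1 - a) / (1 - a)"
proof (induction N)
  case (Suc N)
  have step: "real (Suc N) powr (- a) \<le> (real (Suc N) powr (1 - a) - real N powr (1 - a)) / (1 - a)"
  proof (cases "N = 0")
    case True
    thus ?thesis using assms by simp
  next
    case False
    have "\<exists>z>real N. z < real (Suc N) \<and> real (Suc N) powr (1 - a) - real N powr (1 - a) = (real (Suc N) - real N) * ((1 - a) * z powr (1 - a - 1))"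
    proof (rule MVT2)
      fix x assume "real N \<le> x" "x \<le> real (Suc N)"
      hence "x > 0" using False by linarith
      thus "((\<lambda>x. x powr (1 - a)) has_real_derivative (1 - a) * x powr (1 - a - 1)) (at x)"
        by (auto intro!: derivative_eq_intros)
    qed auto
    then obtain z where z: "z > real N" "z < real (Suc N)"
      "real (Suc N) powr (1 - a) - real N powr (1 - a) = (1 - a) * z powr (- a)" by auto
    have "real (Suc N) powr (- a) \<le> z powr (- a)" using z assms by (intro powr_mono2') auto
    thus ?thesis using z assms by simp
  qed
  have "(\<Sum>n\<in>{1..Suc N}. real n powr (- a)) \<le> real N powr (1 - a) / (1 - a) + real (Suc N) powr (- a)"
    using Suc by simp
  also have "\<dots> \<le> real (Suc N) powr (1 - a) / (1 - a)"
    using step by (simp add: diff_divide_distrib)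
  finally show ?case .
qed simp

text \<open>A harmonic sum, bounded by a small power of \<open>N\<close> instead of a logarithm so
  that the later estimates remain pure powers.\<close>

lemma sum_inverse_dist_le:
  assumes "0 < \<kappa>" "\<kappa> \<le> 1" "n \<le> N"
  shows "(\<Sum>m\<in>{1..<n}. 1 / (real n - real m)) \<le> real N powr \<kappa> / \<kappa>"
proof -
  have "(\<Sum>m\<in>{1..<n}. 1 / (real n - real m)) = (\<Sum>j\<in>{1..<n}. 1 / real j)"
    by (rule sum.reindex_bij_witness[of _ "\<lambda>j. n - j" "\<lambda>j. n - j"]) (auto simp: of_nat_diff)
  also have "\<dots> \<le> (\<Sum>j\<in>{1..N}. real j powr (- (1 - \<kappa>)))"
  proof (rule order.trans[OF sum_mono sum_mono2])
    fix j assume "j \<in> {1..<n}"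
    hence "1 / real j = real j powr (- 1)" by (simp add: powr_minus divide_inverse)
    also have "\<dots> \<le> real j powr (- (1 - \<kappa>))" using \<open>j \<in> {1..<n}\<close> assms by (intro powr_mono) auto
    finally show "1 / real j \<le> real j powr (- (1 - \<kappa>))" .
  qed (use assms in auto)
  also have "\<dots> \<le> real N powr (1 - (1 - \<kappa>)) / (1 - (1 - \<kappa>))"
    using assms by (intro sum_powr_le) auto
  finally show ?thesis by simp
qed

text \<open>For \<open>m < n\<close> write \<open>n / (n - m) = 1 + m / (n - m)\<close>. The first
  summand gives a product of two sums; in the second,
  \<open>m powr (1 - s) \<le> n powr (1 - s)\<close> leaves a harmonic sum for each
  \<open>n\<close>. This takes the place of Hilbert's inequality at the price of
  \<open>N powr \<kappa>\<close>.\<close>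

lemma off_diagonal_le:
  assumes s: "1 / 2 < s" "s < 1" and \<kappa>: "0 < \<kappa>" "\<kappa> \<le> 1" and N: "N \<ge> 1"
  shows "(\<Sum>m\<in>{1..N}. \<Sum>n\<in>{1..N} - {m}. real m powr (-s) * real n powr (-s) * (real (max m n) / \<bar>real m - real n\<bar>))
    \<le> (1 / (1 - s)\<^sup>2 + 1 / ((1 - s) * \<kappa>)) * real N powr (2 - 2 * s + \<kappa>)"
proof -
  define h where "h m n = (if m < n then real n powr (1 - 2 * s) * (1 / (real n - real m)) else 0)" for m n :: nat
  have h0: "h m n \<ge> 0" for m n by (simp add: h_def)
  have key: "real m powr (-s) * real n powr (-s) * (real n / (real n - real m)) \<le> real m powr (-s) * real n powr (-s) + h m n"
    if "m \<ge> 1" "m < n" for m n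
  proof -
    have "real n / (real n - real m) = 1 + real m / (real n - real m)" using that by (simp add: field_simps)
    hence "real m powr (-s) * real n powr (-s) * (real n / (real n - real m))
       = real m powr (-s) * real n powr (-s) + (real m powr (-s) * real m) * real n powr (-s) / (real n - real m)"
      by (simp add: algebra_simps)
    also have "real m powr (-s) * real m = real m powr (1 - s)"
      using that powr_add[of "real m" "-s" 1] by simp
    also have "real m powr (1 - s) * real n powr (-s) / (real n - real m) \<le> real n powr (1 - s) * real n powr (-s) / (real n - real m)"
      using that s by (intro divide_right_mono mult_right_mono powr_mono2) auto
    also have "real n powr (1 - s) * real n powr (-s) = real n powr (1 - 2 * s)"
      by (simp flip: powr_add)
    finally show ?thesis using that by (simp add: h_def)
  qed
  have "(\<Sum>m\<in>{1..N}. \<Sum>n\<in>{1..N} - {m}. real m powr (-s) * real n powr (-s) * (real (max m n) / \<bar>real m - real n\<bar>))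
     \<le> (\<Sum>m\<in>{1..N}. \<Sum>n\<in>{1..N} - {m}. real m powr (-s) * real n powr (-s) + h m n + h n m)"
  proof (intro sum_mono)
    fix m n assume mn: "m \<in> {1..N}" "n \<in> {1..N} - {m}"
    consider "m < n" | "n < m" using mn by force
    thus "real m powr (-s) * real n powr (-s) * (real (max m n) / \<bar>real m - real n\<bar>) \<le> real m powr (-s) * real n powr (-s) + h m n + h n m"
    proof cases
      case 1
      thus ?thesis using key[of m n] mn h0[of n m] by (simp add: max_def)
    next
      case 2
      thus ?thesis using key[of n m] mn h0[of m n] by (simp add: max_def mult_ac)
    qed
  qed
  also have "\<dots> \<le> (\<Sum>m\<in>{1..N}. \<Sum>n\<in>{1..N}. real m powr (-s) * real n powr (-s) + h m n + h n m)"
    by (intro sum_mono sum_mono2) (auto simp: h0)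
  also have "\<dots> = (\<Sum>m\<in>{1..N}. real m powr (-s)) * (\<Sum>n\<in>{1..N}. real n powr (-s)) + 2 * (\<Sum>n\<in>{1..N}. \<Sum>m\<in>{1..N}. h m n)"
  proof -
    have "(\<Sum>m\<in>{1..N}. \<Sum>n\<in>{1..N}. h m n) = (\<Sum>n\<in>{1..N}. \<Sum>m\<in>{1..N}. h m n)" by (rule sum.swap)
    thus ?thesis by (simp add: sum.distrib sum_product)
  qed
  also have "\<dots> \<le> (real N powr (1 - s) / (1 - s)) * (real N powr (1 - s) / (1 - s)) + 2 * (real N powr (2 - 2 * s) / (2 - 2 * s) * (real N powr \<kappa> / \<kappa>))"
  proof (intro add_mono mult_mono mult_left_mono sum_powr_le)
    have "(\<Sum>n\<in>{1..N}. \<Sum>m\<in>{1..N}. h m n) = (\<Sum>n\<in>{1..N}. real n powr (1 - 2 * s) * (\<Sum>m\<in>{1..<n}. 1 / (real n - real m)))"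
    proof (intro sum.cong refl)
      fix n assume n: "n \<in> {1..N}"
      have "(\<Sum>m\<in>{1..N}. h m n) = (\<Sum>m\<in>{1..<n}. h m n)"
        using n by (intro sum.mono_neutral_right) (auto simp: h_def)
      also have "\<dots> = real n powr (1 - 2 * s) * (\<Sum>m\<in>{1..<n}. 1 / (real n - real m))"
        by (simp add: h_def sum_distrib_left)
      finally show "(\<Sum>m\<in>{1..N}. h m n) = \<dots>" .
    qed
    also have "\<dots> \<le> (\<Sum>n\<in>{1..N}. real n powr (1 - 2 * s) * (real N powr \<kappa> / \<kappa>))"
      using \<kappa> by (intro sum_mono mult_left_mono sum_inverse_dist_le) auto
    also have "\<dots> = (\<Sum>n\<in>{1..N}. real n powr (- (2 * s - 1))) * (real N powr \<kappa> / \<kappa>)"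
      unfolding sum_distrib_right by simp
    also have "\<dots> \<le> real N powr (1 - (2 * s - 1)) / (1 - (2 * s - 1)) * (real N powr \<kappa> / \<kappa>)"
      using s \<kappa> by (intro mult_right_mono sum_powr_le) auto
    finally show "(\<Sum>n\<in>{1..N}. \<Sum>m\<in>{1..N}. h m n) \<le> real N powr (2 - 2 * s) / (2 - 2 * s) * (real N powr \<kappa> / \<kappa>)" by simp
  qed (use s in \<open>auto intro!: sum_nonneg simp: h0\<close>)
  also have "\<dots> = 1 / (1 - s)\<^sup>2 * real N powr (2 - 2 * s) + 1 / ((1 - s) * \<kappa>) * real N powr (2 - 2 * s + \<kappa>)"
  proof -
    have "real N powr (1 - s) * real N powr (1 - s) = real N powr (2 - 2 * s)" by (simp flip: powr_add)
    hence "(real N powr (1 - s) / (1 - s)) * (real N powr (1 - s) / (1 - s)) = 1 / (1 - s)\<^sup>2 * real N powr (2 - 2 * s)"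
      by (simp add: power2_eq_square)
    moreover have "2 * (real N powr (2 - 2 * s) / (2 - 2 * s) * (real N powr \<kappa> / \<kappa>)) = 1 / ((1 - s) * \<kappa>) * real N powr (2 - 2 * s + \<kappa>)"
    proof -
      have "2 * (a / (2 * d) * (b / \<kappa>)) = 1 / (d * \<kappa>) * (a * b)" for a b d by simp
      note this[of _ "1 - s"]
      moreover have "2 * (1 - s) = 2 - 2 * s" by simp
      ultimately show ?thesis by (simp only: powr_add)
    qed
    ultimately show ?thesis by simp
  qed
  also have "\<dots> \<le> 1 / (1 - s)\<^sup>2 * real N powr (2 - 2 * s + \<kappa>) + 1 / ((1 - s) * \<kappa>) * real N powr (2 - 2 * s + \<kappa>)"
    using N \<kappa> by (intro add_right_mono mult_left_mono powr_mono) auto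
  finally show ?thesis by (simp add: algebra_simps)
qed

text \<open>For coefficients of size \<open>n powr (-s)\<close> with \<open>s > 1 / 2\<close> the
  off-diagonal part has an exponent near \<open>2 - 2 * s < 1\<close> in \<open>N\<close>, so after
  division by \<open>T\<close> it stays small even for \<open>N\<close> somewhat larger than
  \<open>T\<close>.\<close>

lemma tmean_square_le:
  assumes T: "T > 0" and N: "N \<ge> 1" and s: "1 / 2 < s" "s < 1" and \<kappa>: "0 < \<kappa>" "\<kappa> \<le> 1"
    and c: "\<And>n. n \<in> {1..N} \<Longrightarrow> norm (c n) \<le> B * real n powr (-s)"
  shows "integral\<^sup>L (tmeas T) (\<lambda>t. (norm (\<Sum>n\<in>{1..N}. c n * tch n t))\<^sup>2) \<le>
    (\<Sum>n\<in>{1..N}. (norm (c n))\<^sup>2) + 2 * B\<^sup>2 / T * ((1 / (1 - s)\<^sup>2 + 1 / ((1 - s) * \<kappa>)) * real N powr (2 - 2 * s + \<kappa>))"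
proof -
  interpret rand_char "tmeas T" tch by (rule rand_char_tch[OF T])
  have B0: "B \<ge> 0" using c[of 1] N by (auto intro: order.trans[OF norm_ge_zero])
  have "integral\<^sup>L (tmeas T) (\<lambda>t. (norm (dpoly {1..N} c t))\<^sup>2) \<le> (\<Sum>n\<in>{1..N}. (norm (c n))\<^sup>2) +
    (\<Sum>m\<in>{1..N}. \<Sum>n\<in>{1..N} - {m}. norm (c m) * norm (c n) * (2 * real (max m n) / (T * \<bar>real m - real n\<bar>)))"
    by (rule mean_square) (auto intro!: tcorr_le[OF T])
  also have "(\<Sum>m\<in>{1..N}. \<Sum>n\<in>{1..N} - {m}. norm (c m) * norm (c n) * (2 * real (max m n) / (T * \<bar>real m - real n\<bar>)))
     \<le> (\<Sum>m\<in>{1..N}. \<Sum>n\<in>{1..N} - {m}. (B * real m powr (-s)) * (B * real n powr (-s)) * (2 * real (max m n) / (T * \<bar>real m - real n\<bar>)))"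
    using T B0 by (intro sum_mono mult_right_mono mult_mono c) auto
  also have "\<dots> = 2 * B\<^sup>2 / T * (\<Sum>m\<in>{1..N}. \<Sum>n\<in>{1..N} - {m}. real m powr (-s) * real n powr (-s) * (real (max m n) / \<bar>real m - real n\<bar>))"
    by (simp add: sum_distrib_left power2_eq_square mult_ac)
  also have "\<dots> \<le> 2 * B\<^sup>2 / T * ((1 / (1 - s)\<^sup>2 + 1 / ((1 - s) * \<kappa>)) * real N powr (2 - 2 * s + \<kappa>))"
    using T by (intro mult_left_mono off_diagonal_le s \<kappa> N) auto
  finally show ?thesis by (simp add: dpoly_def)
qed

section \<open>Approximating the eta function\<close>

text \<open>The accelerated tail \<open>\<Sum>n\<ge>0. (-1) ^ n * (x + n) powr (-s)\<close> of the alternating series.\<close>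

definition eta_from :: "nat \<Rightarrow> complex \<Rightarrow> nat \<Rightarrow> complex" where
  "eta_from k s x = (\<Sum>j<k. fdiff j s (real x) / 2 ^ Suc j) + (\<Sum>n. (-1) ^ n * fdiff k s (real (x + n))) / 2 ^ k"

lemma eta_from_summable:
  assumes "Re s + real k > 1" "x > 0"
  shows "summable (\<lambda>n. (-1) ^ n * fdiff k s (real (x + n)))"
proof -
  have "summable (\<lambda>n. (-1) ^ (n + (x - 1)) * fdiff k s (real (Suc (n + (x - 1)))))"
    using alt_rem_summable[OF assms(1)] by (subst summable_iff_shift)
  hence "summable (\<lambda>n. (-1) ^ (x - 1) * ((-1) ^ (n + (x - 1)) * fdiff k s (real (Suc (n + (x - 1))))))"
    by (rule summable_mult)
  moreover have "(-1) ^ (x - 1) * ((-1) ^ (n + (x - 1)) * fdiff k s (real (Suc (n + (x - 1))))) = (-1) ^ n * fdiff k s (real (x + n))" for n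
  proof -
    have "Suc (n + (x - 1)) = x + n" using assms by simp
    moreover have "(-1 :: complex) ^ (x - 1) * (-1) ^ (n + (x - 1)) = (-1) ^ n"
      by (simp add: power_add mult.left_commute flip: power_mult_distrib)
    ultimately show ?thesis by (simp only: mult.assoc[symmetric])
  qed
  ultimately show ?thesis by (simp only:)
qed

text \<open>The acceleration is an exact rewriting, so the recursion of the alternating tail
  persists. In the finite part \<open>fdiff j s x + fdiff j s (x + 1) = 2 * fdiff j s x - fdiff (Suc
  j) s x\<close> telescopes against the weights \<open>1 / 2 ^ Suc j\<close>.\<close>

lemma eta_from_step:
  assumes "Re s + real k > 1" "x > 0"
  shows "eta_from k s x = of_nat x powr (- s) - eta_from k s (Suc x)"
proof -
  let ?g = "\<lambda>x n. (-1) ^ n * fdiff k s (real (x + n))"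
  have S: "summable (?g x)" by (rule eta_from_summable[OF assms])
  have "(\<Sum>n. ?g x n) = ?g x 0 + (\<Sum>n. ?g x (Suc n))" using suminf_split_head[OF S] by (simp only: add_diff_cancel_left' add_diff_eq)
  also have "(\<lambda>n. ?g x (Suc n)) = (\<lambda>n. - ?g (Suc x) n)" by simp
  also have "(\<Sum>n. - ?g (Suc x) n) = - (\<Sum>n. ?g (Suc x) n)"
    using eta_from_summable[OF assms(1), of "Suc x"] by (intro suminf_minus) auto
  finally have tail: "(\<Sum>n. ?g x n) + (\<Sum>n. ?g (Suc x) n) = fdiff k s (real x)" by simp
  have tele: "(\<Sum>j<k. fdiff j s (real x) / 2 ^ Suc j) + (\<Sum>j<k. fdiff j s (real (Suc x)) / 2 ^ Suc j) = of_nat x powr (- s) - fdiff k s (real x) / 2 ^ k"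
  proof (induction k)
    case (Suc k)
    have "fdiff (Suc k) s (real x) = fdiff k s (real x) - fdiff k s (real (Suc x))" by (simp add: add.commute)
    hence "(\<Sum>j<Suc k. fdiff j s (real x) / 2 ^ Suc j) + (\<Sum>j<Suc k. fdiff j s (real (Suc x)) / 2 ^ Suc j)
      = ((\<Sum>j<k. fdiff j s (real x) / 2 ^ Suc j) + (\<Sum>j<k. fdiff j s (real (Suc x)) / 2 ^ Suc j))
        + (2 * fdiff k s (real x) - fdiff (Suc k) s (real x)) / 2 ^ Suc k"
      by (simp only: sum.lessThan_Suc) (simp add: add_divide_distrib diff_divide_distrib)
    also have "\<dots> = of_nat x powr (- s) - fdiff (Suc k) s (real x) / 2 ^ Suc k"
    proof -
      have "fdiff k s (real x) / 2 ^ k = 2 * fdiff k s (real x) / 2 ^ Suc k" by simp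
      thus ?thesis unfolding Suc by (simp only: diff_divide_distrib) simp
    qed
    finally show ?case .
  qed simp
  have "eta_from k s x + eta_from k s (Suc x) =
     ((\<Sum>j<k. fdiff j s (real x) / 2 ^ Suc j) + (\<Sum>j<k. fdiff j s (real (Suc x)) / 2 ^ Suc j))
     + ((\<Sum>n. ?g x n) + (\<Sum>n. ?g (Suc x) n)) / 2 ^ k"
    by (simp add: eta_from_def add_divide_distrib)
  also have "\<dots> = of_nat x powr (- s)" unfolding tele tail by simp
  finally show ?thesis by (simp add: eq_diff_eq)
qed

lemma eta_fun_partial:
  assumes "Re s + real k > 1"
  shows "eta_fun s = (\<Sum>n\<in>{1..N}. (-1) ^ Suc n * of_nat n powr (- s)) + (-1) ^ N * eta_from k s (Suc N)"
proof (induction N)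
  case 0
  have "eta_fun s = eta_acc k s" by (rule eta_fun_eq[OF assms])
  thus ?case by (simp add: eta_acc_def alt_rem_def eta_from_def)
next
  case (Suc N)
  thus ?case using eta_from_step[OF assms, of "Suc N"] by (simp add: algebra_simps)
qed

text \<open>While \<open>norm s + k \<le> x\<close>, each difference in the finite part has size at
  most \<open>x powr (- Re s)\<close>, and the weights sum to less than 1. In the infinite part two
  of the \<open>k\<close> negative powers of \<open>x + n\<close> secure summability; the other
  \<open>k - 2\<close> provide the decay in \<open>x\<close>.\<close>

lemma norm_eta_from_le:
  assumes s: "Re s \<ge> 0" and k: "k \<ge> 2" and x: "x > 0" "norm s + real k \<le> real x"
  shows "norm (eta_from k s x) \<le> real x powr (- Re s) + (norm s + real k) ^ k / real x ^ (k - 2) * (\<Sum>n. real (Suc n) powr (-2))"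
proof -
  have "norm (\<Sum>j<k. fdiff j s (real x) / 2 ^ Suc j) \<le> (\<Sum>j<k. real x powr (- Re s) * (1 / 2) ^ Suc j)"
  proof (intro order.trans[OF norm_sum] sum_mono)
    fix j assume j: "j \<in> {..<k}"
    have "norm (fdiff j s (real x)) \<le> (norm s + real j) ^ j * real x powr (- Re s - real j)"
      using x s by (intro fdiff_bound) auto
    also have "\<dots> \<le> real x ^ j * real x powr (- Re s - real j)"
      using j x by (intro mult_right_mono power_mono) auto
    also have "\<dots> = real x powr (- Re s)"
      using x by (simp add: powr_realpow[symmetric] flip: powr_add)
    finally show "norm (fdiff j s (real x) / 2 ^ Suc j) \<le> real x powr (- Re s) * (1 / 2) ^ Suc j"
      by (simp add: norm_divide norm_power power_one_over divide_right_mono del: power_Suc)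
  qed
  also have "\<dots> = real x powr (- Re s) * (\<Sum>j<k. (1 / 2) ^ Suc j)" by (simp add: sum_distrib_left)
  also have "\<dots> \<le> real x powr (- Re s) * 1"
  proof (rule mult_left_mono)
    have "(\<Sum>j<k. (1 / 2 :: real) ^ Suc j) = 1 - (1 / 2) ^ k" by (induction k) (auto simp: field_simps)
    thus "(\<Sum>j<k. (1 / 2 :: real) ^ Suc j) \<le> 1" by simp
  qed auto
  finally have 1: "norm (\<Sum>j<k. fdiff j s (real x) / 2 ^ Suc j) \<le> real x powr (- Re s)" by simp
  define b where "b = (norm s + real k) ^ k / real x ^ (k - 2)"
  have summ: "summable (\<lambda>n. b * real (Suc n) powr (-2))" by (intro summable_mult summable_Suc_powr) auto
  have "norm (\<Sum>n. (-1) ^ n * fdiff k s (real (x + n))) \<le> (\<Sum>n. b * real (Suc n) powr (-2))"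
  proof (rule norm_suminf_le[OF _ summ])
    fix n
    have "norm (fdiff k s (real (x + n))) \<le> (norm s + real k) ^ k * real (x + n) powr (- Re s - real k)"
      using x s by (intro fdiff_bound) auto
    also have "\<dots> \<le> (norm s + real k) ^ k * real (x + n) powr (- real k)"
      using x s by (intro mult_left_mono powr_mono) auto
    also have "real (x + n) powr (- real k) = real (x + n) powr (- real (k - 2)) * real (x + n) powr (-2)"
      using k by (simp add: of_nat_diff flip: powr_add)
    also have "(norm s + real k) ^ k * (real (x + n) powr (- real (k - 2)) * real (x + n) powr (-2))
       \<le> (norm s + real k) ^ k * (real x powr (- real (k - 2)) * real (Suc n) powr (-2))"
      using x by (intro mult_left_mono mult_mono powr_mono2') auto
    also have "real x powr (- real (k - 2)) = 1 / real x ^ (k - 2)"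
      using x by (simp add: powr_minus powr_realpow divide_inverse)
    finally show "norm ((-1) ^ n * fdiff k s (real (x + n))) \<le> b * real (Suc n) powr (-2)"
      by (simp add: norm_mult norm_power b_def mult_ac)
  qed
  also have "\<dots> = b * (\<Sum>n. real (Suc n) powr (-2))" by (rule suminf_mult[OF summable_Suc_powr]) simp
  finally have 2: "norm (\<Sum>n. (-1) ^ n * fdiff k s (real (x + n))) \<le> b * (\<Sum>n. real (Suc n) powr (-2))" .
  have "norm ((\<Sum>n. (-1) ^ n * fdiff k s (real (x + n))) / 2 ^ k) \<le> norm (\<Sum>n. (-1) ^ n * fdiff k s (real (x + n))) / 1"
    unfolding norm_divide by (intro divide_left_mono) (auto simp: norm_power)
  with 1 2 show ?thesis unfolding eta_from_def b_def[symmetric]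
    by (intro order.trans[OF norm_triangle_ineq] add_mono) auto
qed

lemma eta_fun_eq_riemann_zeta:
  assumes "s \<noteq> 1"
  shows "eta_fun s = (1 - 2 powr (1 - s)) * riemann_zeta s"
proof (rule analytic_continuation_open[where s = "{s. Re s > 1}" and s' = "- {1}"
      and f = eta_fun and g = "\<lambda>s. (1 - 2 powr (1 - s)) * riemann_zeta s" and z = s])
  show "open {s. Re s > 1}" by (rule open_halfspace_Re_gt)
  show "{s. Re s > 1} \<noteq> {}" by (auto intro: exI[of _ 2])
  show "connected (- {1 :: complex})"
    using connected_punctured_universe[of "1::complex"] by simp
  show "(\<lambda>s. (1 - 2 powr (1 - s)) * riemann_zeta s) holomorphic_on - {1}"
    by (intro holomorphic_intros riemann_zeta_holomorphic) auto
  show "eta_fun z = (1 - 2 powr (1 - z)) * riemann_zeta z" if "z \<in> {s. Re s > 1}" for z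
    using that eta_fun_eq_zeta[of z] riemann_zeta_sums[of z] by (simp add: sums_iff powr_minus divide_inverse)
qed (use assms in \<open>auto intro!: eta_fun_holomorphic\<close>)

section \<open>The zeta function in mean square\<close>

lemma expco_atMost: "expco {..Y} K n = expco {1..Y} K n"
proof -
  have "kapon {..Y} = kapon {1..Y}"
    by (rule ext) (auto simp: kapon_def not_less_eq_eq)
  thus ?thesis by (simp add: expco_def)
qed

lemma expco_support:
  assumes "Y \<ge> 1" "n > Y ^ K"
  shows "expco {1..Y} K n = 0"
  unfolding expco_def
proof (rule sum.neutral, rule ballI)
  fix j assume "j \<in> {..K}"
  hence "Y ^ j \<le> Y ^ K" using assms by (intro power_increasing) auto
  hence "dpow (kapon {1..Y}) j n = 0"
    using assms by (intro dpow_support[of Y]) (auto simp: kapon_def)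
  thus "dpow (kapon {1..Y}) j n / fact j = 0" by simp
qed

text \<open>
  The coefficients of \<open>\<eta>(s) - (1 - 2 powr (1 - s)) D(s)\<close>, where \<open>D\<close> has coefficients \<open>expco {1..Y} K\<close>.
\<close>

definition eta_gap :: "nat \<Rightarrow> nat \<Rightarrow> nat \<Rightarrow> real" where
  "eta_gap Y K n = (-1) ^ Suc n - expco {1..Y} K n + (if even n then 2 * expco {1..Y} K (n div 2) else 0)"

lemma abs_eta_gap_le: "\<bar>eta_gap Y K n\<bar> \<le> 4"
proof -
  have "\<bar>(-1 :: real) ^ Suc n\<bar> = 1" by (simp add: power_abs)
  moreover have "0 \<le> expco {1..Y} K m" "expco {1..Y} K m \<le> 1" for m by (auto simp: expco_nonneg expco_le_1)
  ultimately show ?thesis unfolding eta_gap_def by (smt (verit))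
qed

text \<open>All values of \<open>expco\<close> involved are 1, so the coefficient is
  \<open>1 - 1\<close> for odd \<open>n\<close> and \<open>-1 - 1 + 2\<close> for even
  \<open>n\<close>.\<close>

lemma eta_gap_eq_0:
  assumes "n \<in> {1..Y}" "Y \<le> 2 ^ K"
  shows "eta_gap Y K n = 0"
proof -
  have e: "expco {1..Y} K m = 1" if "m \<in> {1..Y}" for m
    using expco_eq_1[OF that, of K] that assms by (simp add: expco_atMost)
  show ?thesis
  proof (cases "even n")
    case True
    hence "n div 2 \<in> {1..Y}" using assms by (auto elim!: evenE)
    thus ?thesis using e assms True by (simp add: eta_gap_def)
  qed (use e assms in \<open>simp add: eta_gap_def\<close>)
qed

definition zt :: "nat \<Rightarrow> complex \<Rightarrow> real \<Rightarrow> complex" where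
  "zt n z t = zc n z * tch n t"

lemma zt_mult: "m > 0 \<Longrightarrow> n > 0 \<Longrightarrow> zt (m * n) z t = zt m z t * zt n z t"
  by (simp add: zt_def zc_mult tch_def ln_mult_pos algebra_simps flip: exp_add)

lemma zt_powr: "n > 0 \<Longrightarrow> zt n z t = of_nat n powr (- (3 / 4 + \<i> * of_real t + z))"
  by (simp add: zt_def zc_def tch_def powr_def Ln_of_nat algebra_simps flip: exp_add)

text \<open>By \<open>Dz_eq_exp_sum\<close> this is the Taylor polynomial of degree \<open>K\<close>
  of the exponential at \<open>Q {1..Y}\<close>. The expansion in \<open>n\<close> given here is the
  form to which the mean value theorem applies.\<close>

definition Dz :: "nat \<Rightarrow> nat \<Rightarrow> complex \<Rightarrow> real \<Rightarrow> complex" where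
  "Dz Y K z t = (\<Sum>n\<in>{1..Y ^ K}. of_real (expco {1..Y} K n) * zt n z t)"

lemma eta_minus_Dz:
  assumes Y: "Y \<ge> 1" and N: "2 * Y ^ K \<le> N"
  shows "(\<Sum>n\<in>{1..N}. (-1) ^ Suc n * zt n z t) - (1 - 2 * zt 2 z t) * Dz Y K z t
    = (\<Sum>n\<in>{1..N}. of_real (eta_gap Y K n) * zt n z t)"
proof -
  let ?e = "\<lambda>n. complex_of_real (expco {1..Y} K n)"
  have e0: "?e n = 0" if "n > Y ^ K" for n using expco_support[OF Y that] by simp
  have D: "Dz Y K z t = (\<Sum>n\<in>{1..N}. ?e n * zt n z t)"
    unfolding Dz_def using N by (intro sum.mono_neutral_left) (auto simp: expco_support[OF Y] simp del: One_nat_def)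
  have "2 * zt 2 z t * Dz Y K z t = (\<Sum>n\<in>{1..Y ^ K}. 2 * ?e n * zt (2 * n) z t)"
    unfolding Dz_def sum_distrib_left by (intro sum.cong refl) (simp add: zt_mult)
  also have "\<dots> = (\<Sum>n\<in>(\<lambda>n. 2 * n) ` {1..Y ^ K}. 2 * ?e (n div 2) * zt n z t)"
    by (subst sum.reindex) (auto simp: inj_on_def)
  also have "\<dots> = (\<Sum>n\<in>(\<lambda>n. 2 * n) ` {1..Y ^ K}. (if even n then 2 * ?e (n div 2) else 0) * zt n z t)"
    by (intro sum.cong) auto
  also have "\<dots> = (\<Sum>n\<in>{1..N}. (if even n then 2 * ?e (n div 2) else 0) * zt n z t)"
  proof (rule sum.mono_neutral_left)
    show "\<forall>n\<in>{1..N} - (\<lambda>n. 2 * n) ` {1..Y ^ K}. (if even n then 2 * ?e (n div 2) else 0) * zt n z t = 0"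
    proof
      fix n assume n: "n \<in> {1..N} - (\<lambda>n. 2 * n) ` {1..Y ^ K}"
      show "(if even n then 2 * ?e (n div 2) else 0) * zt n z t = 0"
      proof (cases "even n")
        case True
        then obtain m where m: "n = 2 * m" by (auto elim: evenE)
        hence "m \<notin> {1..Y ^ K}" "m \<ge> 1" using n by auto
        hence "m > Y ^ K" by simp
        thus ?thesis using e0 m by simp
      qed auto
    qed
  qed (use N in auto)
  finally have eq: "2 * zt 2 z t * Dz Y K z t = (\<Sum>n\<in>{1..N}. (if even n then 2 * ?e (n div 2) else 0) * zt n z t)" .
  have "(1 - 2 * zt 2 z t) * Dz Y K z t = (\<Sum>n\<in>{1..N}. ?e n * zt n z t) - (\<Sum>n\<in>{1..N}. (if even n then 2 * ?e (n div 2) else 0) * zt n z t)"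
    unfolding left_diff_distrib mult_1_left eq by (subst D) (rule refl)
  hence "(\<Sum>n\<in>{1..N}. (-1) ^ Suc n * zt n z t) - (1 - 2 * zt 2 z t) * Dz Y K z t
     = (\<Sum>n\<in>{1..N}. ((-1) ^ Suc n - ?e n + (if even n then 2 * ?e (n div 2) else 0)) * zt n z t)"
    by (simp only: sum_subtractf[symmetric] sum.distrib[symmetric] diff_diff_eq2 add_diff_eq diff_add_eq left_diff_distrib distrib_right)
  also have "\<dots> = (\<Sum>n\<in>{1..N}. of_real (eta_gap Y K n) * zt n z t)"
    by (intro sum.cong refl) (auto simp: eta_gap_def)
  finally show ?thesis .
qed

text \<open>Division by \<open>1 - 2 powr (1 - s)\<close> is harmless:
  \<open>Re s \<le> 3 / 4 + \<rho> = 1 - bet \<rho>\<close>, hence \<open>2 powr (1 - s)\<close> has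
  modulus at least \<open>2 powr (bet \<rho>) > 1\<close>. The condition
  \<open>4 * T \<le> N\<close> puts the tail of \<eta> beyond \<open>norm s + k\<close>, where the
  acceleration is effective.\<close>

lemma zeta_minus_Dz:
  assumes \<rho>: "0 < \<rho>" "\<rho> < 1 / 4" and z: "norm z \<le> \<rho>" and t: "T \<le> t" "t \<le> 2 * T"
    and k: "k \<ge> 2" and T: "T \<ge> 1" "T \<ge> real k" and N: "4 * T \<le> real N" and Y: "Y \<ge> 1" "2 * Y ^ K \<le> N"
  shows "(2 powr (bet \<rho>) - 1) * norm (riemann_zeta (3 / 4 + \<i> * of_real t + z) - Dz Y K z t)
    \<le> norm (\<Sum>n\<in>{1..N}. of_real (eta_gap Y K n) * zt n z t)
      + (real N powr (- 1 / 2) + (4 * T) ^ k / real N ^ (k - 2) * (\<Sum>n. real (Suc n) powr (-2)))"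
proof -
  define s where "s = 3 / 4 + \<i> * of_real t + z"
  have Rez: "\<bar>Re z\<bar> \<le> \<rho>" using abs_Re_le_cmod[of z] z by linarith
  have Res: "Re s \<ge> 1 / 2" "Re s < 1" using Rez \<rho> by (auto simp: s_def)
  have s1: "s \<noteq> 1" using Res by auto
  have "norm s \<le> norm (3 / 4 + \<i> * of_real t :: complex) + norm z" unfolding s_def by (rule norm_triangle_ineq)
  also have "norm (3 / 4 + \<i> * of_real t :: complex) \<le> norm (3 / 4 :: complex) + norm (\<i> * of_real t :: complex)" by (rule norm_triangle_ineq)
  also have "\<dots> = 3 / 4 + \<bar>t\<bar>" by (simp add: norm_mult)
  finally have ns: "norm s + real k \<le> 4 * T" using t T z \<rho> by linarith
  have z2: "zt 2 z t = 2 powr (- s)" using zt_powr[of 2 z t] by (simp add: s_def)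
  have eta: "eta_fun s = (1 - 2 * zt 2 z t) * riemann_zeta s"
    unfolding eta_fun_eq_riemann_zeta[OF s1] z2 using powr_add[of "2 :: complex" 1 "- s"] by simp
  have part: "eta_fun s = (\<Sum>n\<in>{1..N}. (-1) ^ Suc n * zt n z t) + (-1) ^ N * eta_from k s (Suc N)"
    using eta_fun_partial[of s k N] Res k zt_powr[of _ z t, folded s_def] by simp
  have E: "(1 - 2 * zt 2 z t) * (riemann_zeta s - Dz Y K z t) = (\<Sum>n\<in>{1..N}. of_real (eta_gap Y K n) * zt n z t) + (-1) ^ N * eta_from k s (Suc N)"
    unfolding eta_minus_Dz[OF Y, symmetric] right_diff_distrib eta[symmetric] part by simp
  have low: "2 powr (bet \<rho>) - 1 \<le> norm (1 - 2 * zt 2 z t)"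
  proof -
    have "norm (zt 2 z t) = 2 powr (- (3 / 4 + Re z))"
      using norm_zc[of 2 z] by (simp add: zt_def norm_mult tch_def)
    hence "norm (2 * zt 2 z t) = 2 powr (1 + - (3 / 4 + Re z))" unfolding powr_add by (simp add: norm_mult)
    also have "\<dots> \<ge> 2 powr (bet \<rho>)" using Rez by (intro powr_mono) (auto simp: bet_def)
    finally show ?thesis using norm_triangle_ineq2[of "2 * zt 2 z t" 1] by (simp add: norm_minus_commute)
  qed
  have "(2 powr (bet \<rho>) - 1) * norm (riemann_zeta s - Dz Y K z t) \<le> norm (1 - 2 * zt 2 z t) * norm (riemann_zeta s - Dz Y K z t)"
    by (rule mult_right_mono[OF low norm_ge_zero])
  also have "\<dots> = norm ((\<Sum>n\<in>{1..N}. of_real (eta_gap Y K n) * zt n z t) + (-1) ^ N * eta_from k s (Suc N))"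
    unfolding E[symmetric] by (simp add: norm_mult)
  also have "\<dots> \<le> norm (\<Sum>n\<in>{1..N}. of_real (eta_gap Y K n) * zt n z t) + norm (eta_from k s (Suc N))"
    by (rule order.trans[OF norm_triangle_ineq]) (simp add: norm_mult norm_power)
  also have "norm (eta_from k s (Suc N)) \<le> real (Suc N) powr (- Re s) + (norm s + real k) ^ k / real (Suc N) ^ (k - 2) * (\<Sum>n. real (Suc n) powr (-2))"
  proof (rule norm_eta_from_le)
    show "norm s + real k \<le> real (Suc N)" using ns N by simp
  qed (use Res k in auto)
  also have "\<dots> \<le> real N powr (- 1 / 2) + (4 * T) ^ k / real N ^ (k - 2) * (\<Sum>n. real (Suc n) powr (-2))"
  proof (intro add_mono mult_right_mono frac_le power_mono)
    have "real (Suc N) powr (- Re s) \<le> real (Suc N) powr (- 1 / 2)" using Res by (intro powr_mono) auto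
    also have "\<dots> \<le> real N powr (- 1 / 2)" using N T by (intro powr_mono2') auto
    finally show "real (Suc N) powr (- Re s) \<le> real N powr (- 1 / 2)" .
    show "0 \<le> (\<Sum>n. real (Suc n) powr (-2))" by (intro suminf_nonneg summable_Suc_powr) auto
  qed (use ns N T in auto)
  finally show ?thesis by (simp add: s_def)
qed

text \<open>The polynomial is cut at \<open>N\<close> near \<open>T powr (1 + \<delta>)\<close>:
  long enough for the accelerated tail to be a negative power of \<open>T\<close>, short enough for
  the off-diagonal terms, of order \<open>N powr (1 - \<beta>) / T\<close>. The diagonal starts
  beyond \<open>Y\<close> because \<open>eta_gap\<close> vanishes up to \<open>Y\<close>.\<close>

lemma zeta_mean_square:
  assumes \<rho>: "0 < \<rho>" "\<rho> < 1 / 4"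
  shows "\<exists>C T0. C \<ge> 0 \<and> T0 \<ge> 1 \<and> (\<forall>T Y K z. T \<ge> T0 \<longrightarrow> Y \<ge> 1 \<longrightarrow> Y \<le> 2 ^ K \<longrightarrow> 2 * real Y ^ K \<le> T \<longrightarrow> norm z \<le> \<rho> \<longrightarrow>
    (\<integral>\<^sup>+t. ennreal ((norm (riemann_zeta (3 / 4 + \<i> * of_real t + z) - Dz Y K z t))\<^sup>2) \<partial>tmeas T)
      \<le> ennreal (C * (real Y powr (- bet \<rho>) + T powr (- bet \<rho> / 2))))"
proof -
  define \<beta> where "\<beta> = bet \<rho>"
  have \<beta>: "0 < \<beta>" "\<beta> < 1 / 4" using \<rho> by (auto simp: \<beta>_def bet_def)
  define s where "s = 3 / 4 - \<rho>"
  have s: "s = 1 / 2 + \<beta>" "1 / 2 < s" "s < 1" using \<rho> by (auto simp: s_def \<beta>_def bet_def)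
  \<comment> \<open>With this value
    \<open>(1 + \<delta>) * (1 - \<beta>) \<le> 1 - \<beta> / 2\<close>, which controls the
    off-diagonal terms.\<close>
  define \<delta> where "\<delta> = \<beta> / 2"
  have \<delta>: "\<delta> > 0" using \<beta> by (simp add: \<delta>_def)
  \<comment> \<open>Chosen to make the exponent \<open>k - (1 + \<delta>) * (k - 2)\<close> of the
    tail at most -2.\<close>
  obtain k' :: nat where k': "real k' * \<delta> \<ge> 4 + 2 * \<delta>" using reals_Archimedean3[OF \<delta>] by (meson less_imp_le)
  define k where "k = k' + 2"
  have k: "k \<ge> 2" "real k * \<delta> \<ge> 4 + 2 * \<delta>" using k' \<delta> by (auto simp: k_def algebra_simps)
  define Z2 where "Z2 = (\<Sum>n. real (Suc n) powr (-2))"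
  have Z2: "Z2 \<ge> 0" unfolding Z2_def by (intro suminf_nonneg summable_Suc_powr) auto
  define C1 where "C1 = 1 + 4 ^ k * Z2"
  have C1: "C1 \<ge> 0" using Z2 by (simp add: C1_def)
  define Co where "Co = 1 / (1 - s)\<^sup>2 + 1 / ((1 - s) * \<beta>)"
  have Co: "Co \<ge> 0" using s \<beta> by (simp add: Co_def)
  define q where "q = 2 powr \<beta> - 1"
  have q: "q > 0" using \<beta> by (simp add: q_def)
  define C where "C = 2 / q\<^sup>2 * (16 * Zb \<rho> + 64 * Co + C1\<^sup>2)"
  have C: "C \<ge> 0" using q Co Zb_nonneg[OF \<rho>(2)] by (auto simp: C_def)
  \<comment> \<open>The second entry gives \<open>4 \<le> T powr \<delta>\<close> and therefore
    \<open>4 * T \<le> N\<close>.\<close>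
  define T0 where "T0 = max (real k) (4 powr (1 / \<delta>))"
  have "T0 \<ge> 1" using k by (auto simp: T0_def)
  show ?thesis
  proof (rule exI[of _ C], rule exI[of _ T0], intro conjI C \<open>T0 \<ge> 1\<close> allI impI)
    fix T :: real and Y K :: nat and z :: complex
    assume T: "T \<ge> T0" and Y: "Y \<ge> 1" "Y \<le> 2 ^ K" "2 * real Y ^ K \<le> T" and z: "norm z \<le> \<rho>"
    have T1: "T \<ge> 1" "T \<ge> real k" using T \<open>T0 \<ge> 1\<close> by (auto simp: T0_def)
    interpret rand_char "tmeas T" tch by (rule rand_char_tch) (use T1 in auto)
    define N where "N = nat \<lceil>T powr (1 + \<delta>)\<rceil>"
    have Tp1: "T powr (1 + \<delta>) \<ge> 1" using T1 \<delta> by (intro ge_one_powr_ge_zero) auto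
    have N: "T powr (1 + \<delta>) \<le> real N" "real N \<le> 2 * T powr (1 + \<delta>)"
      using Tp1 unfolding N_def by linarith+
    have "4 \<le> T powr \<delta>"
    proof -
      have "4 = (4 powr (1 / \<delta>)) powr \<delta>" using \<delta> by (simp add: powr_powr)
      also have "\<dots> \<le> T powr \<delta>" using T \<delta> by (intro powr_mono2) (auto simp: T0_def)
      finally show ?thesis .
    qed
    hence "T * 4 \<le> T * T powr \<delta>" using T1 by (intro mult_left_mono) auto
    also have "\<dots> = T powr (1 + \<delta>)" using T1 by (simp add: powr_add)
    finally have N4: "4 * T \<le> real N" using N by linarith
    have N1: "N \<ge> 1" using N Tp1 by linarith
    have YN: "2 * Y ^ K \<le> N"
    proof -
      have "real (2 * Y ^ K) \<le> T" using Y by simp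
      also have "\<dots> \<le> real N" using N4 T1 by linarith
      finally show ?thesis by (simp only: of_nat_le_iff)
    qed
    define c where "c n = of_real (eta_gap Y K n) * zc n z" for n
    define S where "S t = (\<Sum>n\<in>{1..N}. c n * tch n t)" for t
    have Sm [measurable]: "S \<in> borel_measurable (tmeas T)"
      unfolding S_def by measurable
    have cn: "norm (c n) \<le> 4 * real n powr (- s)" if "n \<in> {1..N}" for n
      unfolding c_def norm_mult s_def using abs_eta_gap_le[of Y K n] that z by (intro mult_mono norm_zc_le) auto
    have R: "real N powr (- 1 / 2) + (4 * T) ^ k / real N ^ (k - 2) * Z2 \<le> C1 * T powr (- 1 / 2)"
    proof -
      have 1: "real N powr (- 1 / 2) \<le> T powr (- 1 / 2)" using N4 T1 by (intro powr_mono2') auto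
      have "(4 * T) ^ k / real N ^ (k - 2) \<le> (4 * T) ^ k / (T powr (1 + \<delta>)) ^ (k - 2)"
        using N Tp1 T1 N1 by (intro divide_left_mono power_mono mult_pos_pos zero_less_power) auto
      also have "\<dots> = 4 ^ k * T powr (real k - (1 + \<delta>) * real (k - 2))"
        using T1 by (simp add: power_mult_distrib powr_diff powr_realpow powr_powr[symmetric])
      also have "\<dots> \<le> 4 ^ k * T powr (- 1 / 2)"
      proof (intro mult_left_mono powr_mono)
        have "real k - (1 + \<delta>) * real (k - 2) = 2 + 2 * \<delta> - \<delta> * real k"
          using k by (simp add: of_nat_diff algebra_simps)
        also have "\<dots> \<le> - 1 / 2" using k(2) by (simp add: mult.commute)
        finally show "real k - (1 + \<delta>) * real (k - 2) \<le> - 1 / 2" .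
      qed (use T1 in auto)
      finally have "(4 * T) ^ k / real N ^ (k - 2) * Z2 \<le> 4 ^ k * T powr (- 1 / 2) * Z2"
        using Z2 by (intro mult_right_mono)
      with 1 show ?thesis by (simp add: C1_def algebra_simps)
    qed
    have pt: "(norm (riemann_zeta (3 / 4 + \<i> * of_real t + z) - Dz Y K z t))\<^sup>2 \<le> 2 / q\<^sup>2 * ((norm (S t))\<^sup>2 + C1\<^sup>2 * T powr (- 1))"
      if t: "t \<in> {T..2 * T}" for t
    proof -
      let ?x = "norm (riemann_zeta (3 / 4 + \<i> * of_real t + z) - Dz Y K z t)"
      have "q * ?x \<le> norm (S t) + C1 * T powr (- 1 / 2)"
        using zeta_minus_Dz[OF \<rho> z _ _ k(1) T1 N4 Y(1) YN, of t] t R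
        unfolding q_def \<beta>_def S_def c_def zt_def Z2_def by (simp add: mult.assoc)
      hence "(q * ?x)\<^sup>2 \<le> (norm (S t) + C1 * T powr (- 1 / 2))\<^sup>2"
        using q by (intro power_mono) auto
      also have "\<dots> \<le> 2 * (norm (S t))\<^sup>2 + 2 * (C1 * T powr (- 1 / 2))\<^sup>2"
        using sum_squares_bound[of "norm (S t)" "C1 * T powr (- 1 / 2)"] by (simp add: power2_sum)
      also have "(C1 * T powr (- 1 / 2))\<^sup>2 = C1\<^sup>2 * T powr (- 1)"
        using T1 by (simp add: power_mult_distrib powr_power)
      finally have "q\<^sup>2 * ?x\<^sup>2 \<le> 2 * ((norm (S t))\<^sup>2 + C1\<^sup>2 * T powr (- 1))" by (simp add: power_mult_distrib)
      thus ?thesis using q by (simp add: field_simps)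
    qed
    have ES: "expectation (\<lambda>t. (norm (S t))\<^sup>2) \<le> 16 * Zb \<rho> * real Y powr (- \<beta>) + 64 * Co * T powr (- \<beta> / 2)"
    proof -
      have "expectation (\<lambda>t. (norm (S t))\<^sup>2) \<le> (\<Sum>n\<in>{1..N}. (norm (c n))\<^sup>2) + 2 * 4\<^sup>2 / T * (Co * real N powr (2 - 2 * s + \<beta>))"
        unfolding S_def Co_def by (rule tmean_square_le[OF _ N1 s(2,3) _ _ cn]) (use T1 \<beta> in auto)
      also have "(\<Sum>n\<in>{1..N}. (norm (c n))\<^sup>2) \<le> 16 * (real Y powr (- \<beta>) * Zb \<rho>)"
      proof -
        have "(\<Sum>n\<in>{1..N}. (norm (c n))\<^sup>2) = (\<Sum>n\<in>{Suc Y..N}. (norm (c n))\<^sup>2)"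
          by (rule sum.mono_neutral_right) (use Y in \<open>auto simp: c_def eta_gap_eq_0\<close>)
        also have "\<dots> \<le> (\<Sum>n\<in>{Suc Y..N}. 16 * real n powr (-2 * (3 / 4 - \<rho>)))"
        proof (rule sum_mono)
          fix n assume n: "n \<in> {Suc Y..N}"
          have "(norm (c n))\<^sup>2 \<le> (4 * real n powr (- s))\<^sup>2" using n by (intro power_mono cn) auto
          also have "\<dots> = 16 * real n powr (-2 * (3 / 4 - \<rho>))" using n by (simp add: power_mult_distrib powr_power s_def)
          finally show "(norm (c n))\<^sup>2 \<le> 16 * real n powr (-2 * (3 / 4 - \<rho>))" .
        qed
        also have "\<dots> = 16 * (\<Sum>n\<in>{Suc Y..N}. real n powr (-2 * (3 / 4 - \<rho>)))" by (rule sum_distrib_left[symmetric])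
        also have "\<dots> \<le> 16 * (real Y powr (- \<beta>) * Zb \<rho>)"
          unfolding \<beta>_def using Y \<rho> by (intro mult_left_mono tail_sum_le) auto
        finally show ?thesis .
      qed
      also have "2 * 4\<^sup>2 / T * (Co * real N powr (2 - 2 * s + \<beta>)) \<le> 64 * Co * T powr (- \<beta> / 2)"
      proof -
        have "real N powr (2 - 2 * s + \<beta>) = real N powr (1 - \<beta>)" by (simp add: s)
        also have "\<dots> \<le> (2 * T powr (1 + \<delta>)) powr (1 - \<beta>)" using N \<beta> by (intro powr_mono2) auto
        also have "\<dots> = 2 powr (1 - \<beta>) * T powr ((1 + \<delta>) * (1 - \<beta>))" by (simp add: powr_mult powr_powr)
        also have "\<dots> \<le> 2 powr 1 * T powr (1 - \<beta> / 2)"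
        proof (intro mult_mono powr_mono)
          show "(1 + \<delta>) * (1 - \<beta>) \<le> 1 - \<beta> / 2" using \<beta> by (simp add: \<delta>_def algebra_simps)
        qed (use \<beta> T1 in auto)
        also have "\<dots> = 2 * (T * T powr (- \<beta> / 2))" using T1 powr_add[of T 1 "- \<beta> / 2"] by simp
        finally have "2 * 4\<^sup>2 / T * (Co * real N powr (2 - 2 * s + \<beta>)) \<le> 2 * 4\<^sup>2 / T * (Co * (2 * (T * T powr (- \<beta> / 2))))"
          using Co T1 by (intro mult_left_mono) auto
        also have "\<dots> = 64 * Co * T powr (- \<beta> / 2)" using T1 by simp
        finally show ?thesis .
      qed
      finally show ?thesis by (simp add: mult_ac)
    qed
    have Sint: "integrable (tmeas T) (\<lambda>t. (norm (S t))\<^sup>2)"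
    proof (rule integrable_bdd)
      fix t
      have "norm (S t) \<le> (\<Sum>n\<in>{1..N}. norm (c n))"
        using norm_dpoly_le[of "{1..N}" c t] by (simp only: S_def dpoly_def)
      hence "(norm (S t))\<^sup>2 \<le> (\<Sum>n\<in>{1..N}. norm (c n))\<^sup>2" by (rule power_mono) simp
      thus "norm ((norm (S t))\<^sup>2) \<le> (\<Sum>n\<in>{1..N}. norm (c n))\<^sup>2" by simp
    qed measurable
    have "(\<integral>\<^sup>+t. ennreal ((norm (riemann_zeta (3 / 4 + \<i> * of_real t + z) - Dz Y K z t))\<^sup>2) \<partial>tmeas T)
      \<le> (\<integral>\<^sup>+t. ennreal (2 / q\<^sup>2 * ((norm (S t))\<^sup>2 + C1\<^sup>2 * T powr (- 1))) \<partial>tmeas T)"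
      by (rule nn_integral_mono_AE, rule eventually_mono[OF AE_tmeas[of T]]) (intro ennreal_leI pt)
    also have "\<dots> = ennreal (expectation (\<lambda>t. 2 / q\<^sup>2 * ((norm (S t))\<^sup>2 + C1\<^sup>2 * T powr (- 1))))"
      using Sint q by (intro nn_integral_eq_integral) auto
    also have "expectation (\<lambda>t. 2 / q\<^sup>2 * ((norm (S t))\<^sup>2 + C1\<^sup>2 * T powr (- 1))) = 2 / q\<^sup>2 * (expectation (\<lambda>t. (norm (S t))\<^sup>2) + C1\<^sup>2 * T powr (- 1))"
      using Sint prob_space[unfolded space_tmeas] by simp
    also have "\<dots> \<le> 2 / q\<^sup>2 * ((16 * Zb \<rho> * real Y powr (- \<beta>) + 64 * Co * T powr (- \<beta> / 2)) + C1\<^sup>2 * T powr (- \<beta> / 2))"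
      using T1 \<beta> by (intro mult_left_mono add_mono ES powr_mono) auto
    also have "\<dots> \<le> 2 / q\<^sup>2 * ((16 * Zb \<rho> + 64 * Co + C1\<^sup>2) * (real Y powr (- \<beta>) + T powr (- \<beta> / 2)))"
    proof (rule mult_left_mono)
      have "16 * Zb \<rho> * T powr (- \<beta> / 2) \<ge> 0" "(64 * Co + C1\<^sup>2) * real Y powr (- \<beta>) \<ge> 0"
        using Zb_nonneg[OF \<rho>(2)] Co by auto
      thus "(16 * Zb \<rho> * real Y powr (- \<beta>) + 64 * Co * T powr (- \<beta> / 2)) + C1\<^sup>2 * T powr (- \<beta> / 2)
        \<le> (16 * Zb \<rho> + 64 * Co + C1\<^sup>2) * (real Y powr (- \<beta>) + T powr (- \<beta> / 2))"
        by (simp add: algebra_simps)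
    qed auto
    also have "\<dots> = C * (real Y powr (- \<beta>) + T powr (- \<beta> / 2))" by (simp add: C_def)
    finally show "(\<integral>\<^sup>+t. ennreal ((norm (riemann_zeta (3 / 4 + \<i> * of_real t + z) - Dz Y K z t))\<^sup>2) \<partial>tmeas T)
      \<le> ennreal (C * (real Y powr (- bet \<rho>) + T powr (- bet \<rho> / 2)))"
      by (simp add: \<beta>_def ennreal_leI)
  qed
qed

section \<open>Replacing zeta by a short Dirichlet polynomial\<close>

lemma dpow_of_real: "dpow (\<lambda>n. complex_of_real (a n)) k n = of_real (dpow a k n)"
  by (induction k arbitrary: n) (auto simp: dconv_def)

lemma SUP_diff_le:
  fixes g h :: "'a \<Rightarrow> real"
  assumes "S \<noteq> {}" "bdd_above (g ` S)" "bdd_above (h ` S)" "\<And>z. z \<in> S \<Longrightarrow> \<bar>g z - h z\<bar> \<le> d"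
  shows "\<bar>(SUP z\<in>S. g z) - (SUP z\<in>S. h z)\<bar> \<le> d"
proof -
  have "(SUP z\<in>S. g z) \<le> (SUP z\<in>S. h z) + d"
  proof (rule cSUP_least[OF assms(1)])
    fix z assume z: "z \<in> S"
    show "g z \<le> (SUP z\<in>S. h z) + d" using assms(4)[OF z] cSUP_upper[OF z assms(3)] by linarith
  qed
  moreover have "(SUP z\<in>S. h z) \<le> (SUP z\<in>S. g z) + d"
  proof (rule cSUP_least[OF assms(1)])
    fix z assume z: "z \<in> S"
    show "h z \<le> (SUP z\<in>S. g z) + d" using assms(4)[OF z] cSUP_upper[OF z assms(2)] by linarith
  qed
  ultimately show ?thesis by linarith
qed

lemma Dz_eq_exp_sum:
  assumes Y: "Y \<ge> 1"
  shows "Dz Y K z t = (\<Sum>j\<le>K. rand_char.Q tch {1..Y} t z ^ j / fact j)"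
proof -
  \<comment> \<open>The values of \<open>Q\<close> depend on the character only, so any positive
    \<open>T\<close> gives access to its definition.\<close>
  interpret rand_char "tmeas 1" tch by (rule rand_char_tch) simp
  have supp: "kapon {1..Y} n = 0" if "n \<notin> {1..Y}" for n unfolding kapon_def if_not_P[OF that] ..
  have Q: "Q {1..Y} t z = (\<Sum>n\<in>{1..Y}. of_real (kapon {1..Y} n) * zt n z t)"
    by (simp add: Q_def dpoly_def kapon_def zt_def mult.assoc)
  have pw: "Q {1..Y} t z ^ j = (\<Sum>n\<in>{1..Y ^ K}. of_real (dpow (kapon {1..Y}) j n) * zt n z t)" if j: "j \<le> K" for j
  proof -
    have "Q {1..Y} t z ^ j = (\<Sum>n\<in>{1..Y ^ j}. dpow (\<lambda>n. of_real (kapon {1..Y} n)) j n * zt n z t)"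
      unfolding Q
    proof (rule dpow_eval)
      show "complex_of_real (kapon {1..Y} n) = 0" if "n \<notin> {1..Y}" for n using supp[OF that] by simp
      show "zt (m * n) z t = zt m z t * zt n z t" if "m > 0" "n > 0" for m n by (rule zt_mult[OF that])
    qed (simp add: zt_def tch_def)
    also have "\<dots> = (\<Sum>n\<in>{1..Y ^ j}. of_real (dpow (kapon {1..Y}) j n) * zt n z t)"
      by (simp add: dpow_of_real)
    also have "\<dots> = (\<Sum>n\<in>{1..Y ^ K}. of_real (dpow (kapon {1..Y}) j n) * zt n z t)"
    proof (rule sum.mono_neutral_left)
      show "{1..Y ^ j} \<subseteq> {1..Y ^ K}" using Y j by (auto intro: order.trans power_increasing)
      show "\<forall>n\<in>{1..Y ^ K} - {1..Y ^ j}. complex_of_real (dpow (kapon {1..Y}) j n) * zt n z t = 0"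
        using dpow_support[of Y "kapon {1..Y}" _ j] supp by (auto simp del: atLeastAtMost_iff)
    qed auto
    finally show ?thesis .
  qed
  have "(\<Sum>j\<le>K. Q {1..Y} t z ^ j / fact j) = (\<Sum>j\<le>K. \<Sum>n\<in>{1..Y ^ K}. of_real (dpow (kapon {1..Y}) j n / fact j) * zt n z t)"
  proof (intro sum.cong refl)
    fix j assume "j \<in> {..K}"
    hence j: "j \<le> K" by simp
    show "Q {1..Y} t z ^ j / fact j = (\<Sum>n\<in>{1..Y ^ K}. of_real (dpow (kapon {1..Y}) j n / fact j) * zt n z t)"
      unfolding pw[OF j] by (simp add: sum_divide_distrib)
  qed
  also have "\<dots> = Dz Y K z t"
    unfolding Dz_def expco_def by (subst sum.swap) (simp add: sum_distrib_right)
  finally show ?thesis ..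
qed

lemma zeta_shift_holomorphic:
  "(\<lambda>z. riemann_zeta (3 / 4 + \<i> * of_real t + z)) holomorphic_on {z. Re z < 1 / 4}"
proof -
  have "riemann_zeta \<circ> (\<lambda>z. 3 / 4 + \<i> * of_real t + z) holomorphic_on {z. Re z < 1 / 4}"
    by (rule holomorphic_on_compose_gen[OF _ riemann_zeta_holomorphic]) (auto intro!: holomorphic_intros simp: complex_eq_iff)
  thus ?thesis by (simp add: o_def)
qed

lemma zeta_shift_continuous:
  "continuous_on (UNIV \<times> {z. Re z < 1 / 4}) (\<lambda>(t, z). riemann_zeta (3 / 4 + \<i> * of_real t + z))"
proof -
  have "continuous_on (- {1}) riemann_zeta"
    by (rule holomorphic_on_imp_continuous_on[OF riemann_zeta_holomorphic])
  thus ?thesis unfolding case_prod_unfold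
    by (rule continuous_on_compose2) (auto intro!: continuous_intros simp: complex_eq_iff)
qed

lemma zeta_shift_meas:
  assumes "Re z < 1 / 4"
  shows "(\<lambda>t. riemann_zeta (3 / 4 + \<i> * of_real t + z)) \<in> borel_measurable borel"
proof -
  have "continuous_on UNIV (\<lambda>t. case (t, z) of (t, z) \<Rightarrow> riemann_zeta (3 / 4 + \<i> * of_real t + z))"
    by (rule continuous_on_compose2[OF zeta_shift_continuous]) (use assms in \<open>auto intro!: continuous_intros\<close>)
  thus ?thesis by (intro borel_measurable_continuous_onI) simp
qed

lemma tch_continuous [continuous_intros]: "continuous_on A (tch n)"
  unfolding tch_def by (intro continuous_intros)

context universality
begin

lemma cball_subset_strip: "cball 0 r \<subseteq> {z. Re z < 1 / 4}"
proof
  fix z :: complex assume "z \<in> cball 0 r"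
  thus "z \<in> {z. Re z < 1 / 4}" using r abs_Re_le_cmod[of z] by simp
qed

lemma zeta_shift_cont: "continuous_on (cball 0 r) (\<lambda>z. riemann_zeta (3 / 4 + \<i> * of_real t + z))"
  by (rule holomorphic_on_imp_continuous_on[OF holomorphic_on_subset[OF zeta_shift_holomorphic cball_subset_strip]])

lemma zeta_functional_meas:
  "(\<lambda>t. \<omega> (SUP z\<in>cball 0 r. cmod (riemann_zeta (3 / 4 + \<i> * of_real t + z) - f z))) \<in> borel_measurable borel"
proof -
  have "(\<lambda>t. SUP z\<in>cball 0 r. cmod (riemann_zeta (3 / 4 + \<i> * of_real t + z) - f z)) \<in> borel_measurable borel"
  proof (rule borel_measurable_SUP_compact)
    show "(\<lambda>t. cmod (riemann_zeta (3 / 4 + \<i> * of_real t + z) - f z)) \<in> borel_measurable borel" if "z \<in> cball 0 r" for z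
    proof -
      have "Re z < 1 / 4" using cball_subset_strip that by blast
      from zeta_shift_meas[OF this] show ?thesis by measurable
    qed
  qed (use r in \<open>auto intro!: continuous_intros zeta_shift_cont f_cont'\<close>)
  from measurable_compose[OF this omega_meas] show ?thesis .
qed

text \<open>Where \<open>X t \<le> K / 16\<close> the Taylor polynomial is within
  \<open>exp (- K / 4)\<close> of \<open>exp Q\<close>; elsewhere the trivial bound
  \<open>2 * W0\<close> is at most \<open>2 * W0 * (16 * X t / K)^2\<close> and is averaged. The
  condition \<open>K \<ge> 3\<close> turns \<open>2 * Y ^ K \<le> T\<close> into
  \<open>2 * Y ^ 3 \<le> T\<close>, which bounds the mean square of \<open>X\<close> independently
  of \<open>Y\<close>.\<close>

lemma zeta_functional_approx:
  shows "\<exists>C T0. C \<ge> 0 \<and> T0 \<ge> 1 \<and> (\<forall>T Y K. T \<ge> T0 \<longrightarrow> Y \<ge> 1 \<longrightarrow> Y \<le> 2 ^ K \<longrightarrow> 2 * real Y ^ K \<le> T \<longrightarrow> K \<ge> 3 \<longrightarrow>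
    \<bar>(\<integral>t. \<omega> (SUP z\<in>cball 0 r. cmod (riemann_zeta (3 / 4 + \<i> * of_real t + z) - f z)) \<partial>tmeas T)
      - (\<integral>t. Phi \<omega> f (cball 0 r) (rand_char.Q tch {1..Y} t) \<partial>tmeas T)\<bar>
    \<le> C * (sqrt (real Y powr (- bet \<rho>) + T powr (- bet \<rho> / 2)) + exp (- real K / 4) + 1 / (real K)\<^sup>2))"
proof -
  have \<rho>: "0 < \<rho>" "\<rho> < 1 / 4" using r by auto
  obtain Cz T0 where Cz: "Cz \<ge> 0" "T0 \<ge> 1" and Cz': "\<forall>T Y K z. T \<ge> T0 \<longrightarrow> Y \<ge> 1 \<longrightarrow> Y \<le> 2 ^ K \<longrightarrow> 2 * real Y ^ K \<le> T \<longrightarrow> norm z \<le> \<rho> \<longrightarrow>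
    (\<integral>\<^sup>+t. ennreal ((norm (riemann_zeta (3 / 4 + \<i> * of_real t + z) - Dz Y K z t))\<^sup>2) \<partial>tmeas T)
      \<le> ennreal (Cz * (real Y powr (- bet \<rho>) + T powr (- bet \<rho> / 2)))"
    using zeta_mean_square[OF \<rho>] by (elim exE conjE)
  define V where "V = \<rho> / (\<rho> - r) * (Zb \<rho> + 1)"
  have V: "V \<ge> 0" using r Zb_nonneg[OF \<rho>(2)] by (simp add: V_def)
  define C where "C = \<Lambda> * sqrt (\<rho> / (\<rho> - r) * Cz) + \<Lambda> + 512 * W0 * V"
  have Cge: "C \<ge> 0" unfolding C_def using Lam0 W0_nonneg V r Cz(1) by (intro add_nonneg_nonneg mult_nonneg_nonneg) auto
  show ?thesis
  proof (rule exI[of _ C], rule exI[of _ T0], intro conjI Cge Cz(2) allI impI)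
    fix T :: real and Y K :: nat
    assume T: "T \<ge> T0" and Y: "Y \<ge> 1" "Y \<le> 2 ^ K" "2 * real Y ^ K \<le> T" and K: "K \<ge> 3"
    have T1: "T \<ge> 1" using T Cz by linarith
    interpret quasi_char "tmeas T" tch Y "2 * real Y / T" by (rule quasi_char_tch) (use T1 in auto)
    define h where "h t z = riemann_zeta (3 / 4 + \<i> * of_real t + z) - Dz Y K z t" for t z
    define err where "err = real Y powr (- bet \<rho>) + T powr (- bet \<rho> / 2)"
    have err0: "err \<ge> 0" by (simp add: err_def)
    have sub: "cball 0 \<rho> \<subseteq> {z. Re z < 1 / 4}"
    proof
      fix z :: complex assume "z \<in> cball 0 \<rho>"
      thus "z \<in> {z. Re z < 1 / 4}" using \<rho> abs_Re_le_cmod[of z] by simp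
    qed
    have Dz_cont: "continuous_on A (\<lambda>(t, z). Dz Y K z t)" for A
    proof -
      have "continuous_on UNIV (\<lambda>x. zc n (snd x))" for n
        by (rule continuous_on_compose2[OF zc_continuous[of UNIV]]) (auto intro!: continuous_intros)
      moreover have "continuous_on UNIV (\<lambda>x. tch n (fst x))" for n
        by (rule continuous_on_compose2[OF tch_continuous[of UNIV]]) (auto intro!: continuous_intros)
      ultimately have "continuous_on UNIV (\<lambda>(t, z). Dz Y K z t)"
        unfolding Dz_def zt_def case_prod_unfold by (intro continuous_intros)
      thus ?thesis by (rule continuous_on_subset) auto
    qed
    have h_cont: "continuous_on (UNIV \<times> {z. Re z < 1 / 4}) (\<lambda>(t, z). h t z)"
      using continuous_on_diff[OF zeta_shift_continuous Dz_cont] by (simp add: h_def case_prod_unfold)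
    have hm: "(\<lambda>t. h t z) \<in> borel_measurable (tmeas T)" if "norm z \<le> \<rho>" for z
    proof -
      have "Re z < 1 / 4" using that \<rho> abs_Re_le_cmod[of z] by linarith
      hence "(\<lambda>t. riemann_zeta (3 / 4 + \<i> * of_real t + z)) \<in> borel_measurable (tmeas T)"
        using zeta_shift_meas by (simp cong: measurable_cong_sets)
      thus ?thesis unfolding h_def Dz_def zt_def by measurable
    qed
    have joint: "(\<lambda>(t, u). h t (circ \<rho> u)) \<in> borel_measurable (tmeas T \<Otimes>\<^sub>M lborel)"
    proof -
      have "continuous_on UNIV (\<lambda>x. case (fst x, circ \<rho> (snd x)) of (t, z) \<Rightarrow> h t z)"
      proof (rule continuous_on_compose2[OF h_cont])
        show "continuous_on UNIV (\<lambda>x. (fst x :: real, circ \<rho> (snd x)))"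
          by (intro continuous_intros continuous_on_compose2[OF continuous_on_circ[of UNIV]]) auto
        show "range (\<lambda>x. (fst x :: real, circ \<rho> (snd x))) \<subseteq> UNIV \<times> {z. Re z < 1 / 4}"
        proof
          fix p assume "p \<in> range (\<lambda>x. (fst x :: real, circ \<rho> (snd x)))"
          then obtain x where p: "p = (fst x, circ \<rho> (snd x))" by blast
          have "circ \<rho> (snd x) \<in> cball 0 \<rho>" using \<rho> by simp
          thus "p \<in> UNIV \<times> {z. Re z < 1 / 4}" using sub p by blast
        qed
      qed
      hence "(\<lambda>(t, u). h t (circ \<rho> u)) \<in> borel_measurable borel"
        by (intro borel_measurable_continuous_onI) (simp add: case_prod_unfold)
      moreover have "sets (tmeas T \<Otimes>\<^sub>M lborel) = sets (borel :: (real \<times> real) measure)"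
        unfolding borel_prod[symmetric] by (intro sets_pair_measure_cong) auto
      ultimately show ?thesis by (simp cong: measurable_cong_sets)
    qed
    have h_holo: "h t holomorphic_on {z. Re z < 1 / 4}" for t
      unfolding h_def Dz_def zt_def by (intro holomorphic_intros zeta_shift_holomorphic)
    have Sq: "integrable (tmeas T) (\<lambda>t. (SUP z\<in>cball 0 r. norm (h t z))\<^sup>2)"
      "expectation (\<lambda>t. (SUP z\<in>cball 0 r. norm (h t z))\<^sup>2) \<le> \<rho> / (\<rho> - r) * (Cz * err)"
      "(\<lambda>t. SUP z\<in>cball 0 r. norm (h t z)) \<in> borel_measurable (tmeas T)"
    proof -
      have p1: "continuous_on (cball 0 \<rho>) (h t)" for t
        by (rule holomorphic_on_imp_continuous_on[OF holomorphic_on_subset[OF h_holo sub]])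
      have p2: "h t holomorphic_on ball 0 \<rho>" for t
        by (rule holomorphic_on_subset[OF h_holo order.trans[OF ball_subset_cball sub]])
      have p3: "(\<integral>\<^sup>+t. ennreal ((norm (h t z))\<^sup>2) \<partial>tmeas T) \<le> ennreal (Cz * err)" if "norm z = \<rho>" for z
        unfolding h_def err_def by (rule Cz'[rule_format, OF T Y]) (use that in auto)
      note * = sup_mean_square[of \<rho> h r "Cz * err", OF p1 p2 _ r(2) _ joint p3]
      show "integrable (tmeas T) (\<lambda>t. (SUP z\<in>cball 0 r. norm (h t z))\<^sup>2)"
        "expectation (\<lambda>t. (SUP z\<in>cball 0 r. norm (h t z))\<^sup>2) \<le> \<rho> / (\<rho> - r) * (Cz * err)"
        "(\<lambda>t. SUP z\<in>cball 0 r. norm (h t z)) \<in> borel_measurable (tmeas T)"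
        using r Cz(1) err0 hm by (intro *; auto)+
    qed
    have h_bdd: "bdd_above ((\<lambda>z. norm (h t z)) ` cball 0 r)" for t
      by (rule bdd_above_continuous_image[OF compact_cball continuous_on_norm[OF
            holomorphic_on_imp_continuous_on[OF holomorphic_on_subset[OF h_holo cball_subset_strip]]]])
    define H where "H t = (SUP z\<in>cball 0 r. norm (h t z))" for t
    have EH: "integrable (tmeas T) H" "expectation H \<le> sqrt (\<rho> / (\<rho> - r) * Cz) * sqrt err"
    proof -
      show "integrable (tmeas T) H" using expectation_le_sqrt(1)[OF Sq(3,1)] by (simp add: H_def[abs_def])
      have "expectation H \<le> sqrt (expectation (\<lambda>t. (H t)\<^sup>2))"
        using expectation_le_sqrt(2)[OF Sq(3,1)] unfolding H_def[symmetric] .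
      also have "\<dots> \<le> sqrt (\<rho> / (\<rho> - r) * (Cz * err))" using Sq(2) by (simp add: H_def)
      also have "\<dots> = sqrt (\<rho> / (\<rho> - r) * Cz) * sqrt err" by (simp only: real_sqrt_mult mult.assoc)
      finally show "expectation H \<le> \<dots>" .
    qed
    define X where "X t = (SUP z\<in>cball 0 r. norm (Q {1..Y} t z ^ 1))" for t
    have Xm: "integrable (tmeas T) (\<lambda>t. (X t)\<^sup>2)"
      "expectation (\<lambda>t. (X t)\<^sup>2) \<le> \<rho> / (\<rho> - r) * (fact 1 * (real 1 powr (- bet \<rho>) * Zb \<rho>) ^ 1 + 2 * real Y / T * real Y ^ (2 * 1))"
      using Q_sup_moment(1,2)[of "{1..Y}" 1 Y 1 r \<rho>, folded X_def] Y r by auto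
    have EX: "expectation (\<lambda>t. (X t)\<^sup>2) \<le> V"
    proof -
      have "2 * real Y * real Y ^ 2 = 2 * real Y ^ 3" by (simp add: power2_eq_square power3_eq_cube)
      also have "\<dots> \<le> 2 * real Y ^ K" using Y K by (intro mult_left_mono power_increasing) auto
      also have "\<dots> \<le> T" by (rule Y)
      finally have "2 * real Y / T * real Y ^ 2 \<le> 1" using T1 by (simp add: field_simps)
      hence "\<rho> / (\<rho> - r) * (Zb \<rho> + 2 * real Y / T * real Y ^ 2) \<le> V"
        unfolding V_def using r by (intro mult_left_mono) auto
      thus ?thesis using Xm(2) by simp
    qed
    have Qb: "norm (Q {1..Y} t z) \<le> X t" if "z \<in> cball 0 r" for t z
    proof -
      have "norm (Q {1..Y} t z ^ 1) \<le> X t" unfolding X_def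
        by (rule cSUP_upper) (use that in \<open>auto intro!: bdd_above_continuous_image continuous_intros Q_continuous\<close>)
      thus ?thesis by simp
    qed
    define P1 where "P1 t = \<omega> (SUP z\<in>cball 0 r. cmod (riemann_zeta (3 / 4 + \<i> * of_real t + z) - f z))" for t
    define P2 where "P2 t = Phi \<omega> f (cball 0 r) (Q {1..Y} t)" for t
    have P1m: "P1 \<in> borel_measurable (tmeas T)"
      unfolding P1_def using zeta_functional_meas by (simp cong: measurable_cong_sets)
    have int1: "integrable (tmeas T) P1"
      by (rule integrable_bdd[OF P1m, of W0]) (simp add: P1_def bnd)
    have int2: "integrable (tmeas T) P2"
      unfolding P2_def by (rule integrable_bdd[of _ W0]) (auto intro!: Phi_meas omega_meas Q_continuous Phi_bound)
    have pt: "\<bar>P1 t - P2 t\<bar> \<le> \<Lambda> * (H t + exp (- real K / 4)) + 512 * W0 * (X t)\<^sup>2 / (real K)\<^sup>2" for t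
    proof (cases "X t \<le> real K / 16")
      case True
      have "\<bar>(SUP z\<in>cball 0 r. cmod (riemann_zeta (3 / 4 + \<i> * of_real t + z) - f z)) - (SUP z\<in>cball 0 r. cmod (exp (Q {1..Y} t z) - f z))\<bar>
         \<le> H t + exp (- real K / 4)"
      proof (rule SUP_diff_le)
        show "bdd_above ((\<lambda>z. cmod (riemann_zeta (3 / 4 + \<i> * of_real t + z) - f z)) ` cball 0 r)"
          by (intro bdd_above_continuous_image compact_cball continuous_intros zeta_shift_cont f_cont')
        show "bdd_above ((\<lambda>z. cmod (exp (Q {1..Y} t z) - f z)) ` cball 0 r)"
          by (rule bdd_exp[OF Q_continuous order.refl])
        fix z :: complex assume z: "z \<in> cball 0 r"
        have 1: "norm (h t z) \<le> H t" unfolding H_def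
          by (rule cSUP_upper[OF z h_bdd])
        have 2: "norm (exp (Q {1..Y} t z) - Dz Y K z t) \<le> exp (- real K / 4)"
          unfolding Dz_eq_exp_sum[OF Y(1)]
          by (rule exp_Taylor_tail) (use Qb[OF z, of t] True in linarith)
        let ?A = "riemann_zeta (3 / 4 + \<i> * of_real t + z)" and ?B = "exp (Q {1..Y} t z)"
        have "\<bar>cmod (?A - f z) - cmod (?B - f z)\<bar> \<le> norm ((?A - f z) - (?B - f z))" by (rule norm_triangle_ineq3)
        also have "(?A - f z) - (?B - f z) = h t z - (?B - Dz Y K z t)" by (simp add: h_def)
        also have "norm \<dots> \<le> H t + exp (- real K / 4)" by (intro order.trans[OF norm_triangle_ineq4] add_mono 1 2)
        finally show "\<bar>cmod (?A - f z) - cmod (?B - f z)\<bar> \<le> H t + exp (- real K / 4)" .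
      qed (use r in auto)
      hence "\<bar>P1 t - P2 t\<bar> \<le> \<Lambda> * (H t + exp (- real K / 4))"
        unfolding P1_def P2_def Phi_def using lip Lam0 by (meson mult_left_mono order.trans)
      moreover have "512 * W0 * (X t)\<^sup>2 / (real K)\<^sup>2 \<ge> 0" using W0_nonneg by auto
      ultimately show ?thesis by linarith
    next
      case False
      have "1 \<le> 16 * X t / real K" using False K by (simp add: field_simps)
      hence "1\<^sup>2 \<le> (16 * X t / real K)\<^sup>2" by (intro power_mono) auto
      hence "2 * W0 * 1 \<le> 2 * W0 * (16 * X t / real K)\<^sup>2" using W0_nonneg by (intro mult_left_mono) auto
      also have "\<dots> = 512 * W0 * (X t)\<^sup>2 / (real K)\<^sup>2" by (simp add: power_divide power_mult_distrib)
      finally have "2 * W0 \<le> 512 * W0 * (X t)\<^sup>2 / (real K)\<^sup>2" by simp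
      moreover have "\<bar>P1 t - P2 t\<bar> \<le> W0 + W0" unfolding P1_def P2_def
        by (intro order.trans[OF abs_triangle_ineq4] add_mono Phi_bound bnd)
      moreover have "H t \<ge> 0"
      proof -
        have "norm (h t 0) \<le> H t" unfolding H_def
          by (rule cSUP_upper[OF _ h_bdd]) (use r in simp)
        thus ?thesis by (rule order.trans[OF norm_ge_zero])
      qed
      hence "\<Lambda> * (H t + exp (- real K / 4)) \<ge> 0" using Lam0 by auto
      ultimately show ?thesis by linarith
    qed
    have errint: "integrable (tmeas T) (\<lambda>t. \<Lambda> * (H t + exp (- real K / 4)) + 512 * W0 * (X t)\<^sup>2 / (real K)\<^sup>2)"
      using EH(1) Xm(1) by (intro Bochner_Integration.integrable_add integrable_mult_right integrable_divide_zero) auto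
    have "\<bar>expectation P1 - expectation P2\<bar> = \<bar>expectation (\<lambda>t. P1 t - P2 t)\<bar>"
      by (simp add: Bochner_Integration.integral_diff int1 int2)
    also have "\<dots> \<le> expectation (\<lambda>t. \<bar>P1 t - P2 t\<bar>)" by (rule integral_abs_bound)
    also have "\<dots> \<le> expectation (\<lambda>t. \<Lambda> * (H t + exp (- real K / 4)) + 512 * W0 * (X t)\<^sup>2 / (real K)\<^sup>2)"
      by (intro integral_mono integrable_abs Bochner_Integration.integrable_diff int1 int2 errint pt)
    also have "\<dots> = \<Lambda> * (expectation H + exp (- real K / 4)) + 512 * W0 * expectation (\<lambda>t. (X t)\<^sup>2) / (real K)\<^sup>2"
      using EH(1) Xm(1) prob_space[unfolded space_tmeas] by simp
    also have "\<dots> \<le> \<Lambda> * (sqrt (\<rho> / (\<rho> - r) * Cz) * sqrt err + exp (- real K / 4)) + 512 * W0 * V / (real K)\<^sup>2"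
      using EH(2) EX Lam0 W0_nonneg by (intro add_mono mult_left_mono divide_right_mono) auto
    also have "\<dots> \<le> C * (sqrt err + exp (- real K / 4) + 1 / (real K)\<^sup>2)"
    proof -
      define a where "a = \<Lambda> * sqrt (\<rho> / (\<rho> - r) * Cz)"
      define b where "b = 512 * W0 * V"
      have nn: "a \<ge> 0" "b \<ge> 0" "sqrt err \<ge> 0" "1 / (real K)\<^sup>2 \<ge> 0" "exp (- real K / 4) \<ge> 0"
        using Lam0 W0_nonneg V r Cz(1) err0 by (auto simp: a_def b_def)
      have "a * exp (- real K / 4) \<ge> 0" "a * (1 / (real K)\<^sup>2) \<ge> 0" "\<Lambda> * sqrt err \<ge> 0" "\<Lambda> * (1 / (real K)\<^sup>2) \<ge> 0"
        "b * sqrt err \<ge> 0" "b * exp (- real K / 4) \<ge> 0"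
        using nn Lam0 by (intro mult_nonneg_nonneg; simp)+
      moreover have "C = a + \<Lambda> + b" by (simp add: C_def a_def b_def)
      moreover have "\<Lambda> * (sqrt (\<rho> / (\<rho> - r) * Cz) * sqrt err + exp (- real K / 4)) + 512 * W0 * V / (real K)\<^sup>2
         = a * sqrt err + \<Lambda> * exp (- real K / 4) + b * (1 / (real K)\<^sup>2)" by (simp add: a_def b_def algebra_simps)
      ultimately show ?thesis by (simp only: distrib_right distrib_left)
    qed
    finally show "\<bar>(\<integral>t. \<omega> (SUP z\<in>cball 0 r. cmod (riemann_zeta (3 / 4 + \<i> * of_real t + z) - f z)) \<partial>tmeas T)
      - (\<integral>t. Phi \<omega> f (cball 0 r) (Q {1..Y} t) \<partial>tmeas T)\<bar>
      \<le> C * (sqrt (real Y powr (- bet \<rho>) + T powr (- bet \<rho> / 2)) + exp (- real K / 4) + 1 / (real K)\<^sup>2)"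
      unfolding P1_def P2_def err_def .
  qed
qed

end

section \<open>Choice of parameters\<close>

text \<open>At \<open>n = k\<close> it gives \<open>fact k / fact (2 * k) \<le> 1 / k ^ k\<close>,
  by which the Taylor remainder beats the Gaussian growth of the moments.\<close>

lemma fact_mult_power_le: "fact k * real k ^ n \<le> fact (k + n)"
proof (induction n)
  case (Suc n)
  have "fact k * real k ^ Suc n = (fact k * real k ^ n) * real k" by simp
  also have "\<dots> \<le> fact (k + n) * real (Suc (k + n))"
    by (intro mult_mono Suc) auto
  finally show ?case by (simp add: mult.commute)
qed simp

text \<open>
  The order of the moments must be as large as \<open>u ^ 45\<close>: with \<open>G = 4 * pi * u ^ 18\<close> bounding the
  coefficients in the trigonometric sum, \<open>G\<^sup>2 * Zb \<rho> / k \<le> u powr (-8)\<close>, whose \<open>k\<close>-th power beats the number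
  \<open>u ^ (32 * u ^ 4)\<close> of terms.
\<close>

lemma (in universality) Phi_ideal_rate:
  fixes M :: "'b measure" and u b :: nat
  defines "U \<equiv> real u" and "k \<equiv> u ^ 45" and "Y \<equiv> u ^ b"
  assumes qc: "quasi_char M ch (Y ^ (2 * k)) eta" and u: "u \<ge> 16" "U \<ge> 16 * pi\<^sup>2 * Zb \<rho>"
    and eta: "eta * real Y ^ 2 \<le> 1" "U ^ (32 * u ^ 4) * (4 * eta * U ^ ((b + 22) * (2 * k))) \<le> 1 / U ^ 4"
    and V: "V = \<rho> / (\<rho> - r1) * (Zb \<rho> + 1)"
  shows "norm (complex_of_real (\<integral>x. Phi \<omega> f (cball 0 r) (rand_char.Q ch {1..Y} x) \<partial>M)
      - ideal (u ^ 4) Y (u ^ 16) (U\<^sup>2) k)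
    \<le> (2 * L0 * (1 + V) / (r1 - r) + 2 * \<Lambda> * F / (\<rho> - r) + 9 * L0 + 32 * W0 * V + 2 * W0) / U ^ 4"
proof -
  have \<rho>: "\<rho> > 0" "\<rho> < 1 / 4" using r by auto
  have U: "U \<ge> 16" "U > 0" using u by (auto simp: U_def)
  define G where "G = 4 * pi * U ^ 18"
  define V2 where "V2 = \<rho> / (\<rho> - r1) * (Zb \<rho> + eta * real Y ^ 2)"
  have V2V: "V2 \<le> V" unfolding V2_def V using r1 \<rho> eta(1)
    by (intro mult_left_mono add_left_mono) auto
  have eta0: "eta \<ge> 0" using qc by (simp add: quasi_char_def quasi_char_axioms_def)
  have G_eq: "G = real (u ^ 4) * (4 * pi * real (u ^ 16) / U\<^sup>2)"
    using U by (simp add: G_def field_simps flip: U_def power_add)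
  have "4 * pi * U ^ 18 * real Y \<le> U ^ 4 * U ^ 18 * real Y"
  proof (intro mult_right_mono)
    have "4 * pi \<le> 16" using pi_less_4 by simp
    also have "\<dots> \<le> U ^ 1" using U by simp
    also have "\<dots> \<le> U ^ 4" using U by (intro power_increasing) auto
    finally show "4 * pi \<le> U ^ 4" .
  qed (use U in auto)
  hence H: "G * real Y \<le> U ^ (b + 22)"
    by (simp add: G_def Y_def flip: U_def power_add)  (simp add: add.commute)
  have H1: "1 \<le> U ^ (b + 22)" using U by simp
  have k: "k > 0" using u by (simp add: k_def)
  have tail: "U ^ (32 * u ^ 4) * (fact k * (G\<^sup>2 * Zb \<rho>) ^ k / fact (2 * k)) \<le> 1 / U ^ 4"
  proof -
    have Z0: "Zb \<rho> \<ge> 0" using Zb_nonneg \<rho> by simp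
    have "fact k * (G\<^sup>2 * Zb \<rho>) ^ k / fact (2 * k) \<le> fact k * (G\<^sup>2 * Zb \<rho>) ^ k / (fact k * real k ^ k)"
      using fact_mult_power_le[of k k] k Z0
      by (intro divide_left_mono mult_nonneg_nonneg mult_pos_pos) (auto simp: mult_2)
    also have "\<dots> = (G\<^sup>2 * Zb \<rho> / real k) ^ k" by (simp add: power_divide)
    also have "\<dots> \<le> (1 / U ^ 8) ^ k"
    proof (intro power_mono)
      have "G\<^sup>2 * Zb \<rho> / real k = (16 * pi\<^sup>2 * Zb \<rho>) * U ^ 36 / U ^ 45"
        by (simp add: G_def k_def power_mult_distrib flip: U_def power_mult)
      also have "\<dots> \<le> U * U ^ 36 / U ^ 45"
        using u(2) U by (intro divide_right_mono mult_right_mono) auto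
      also have "\<dots> = U ^ 37 / U ^ 45" by (simp flip: power_Suc)
      also have "\<dots> = 1 / U ^ 8"
      proof -
        have "U ^ 37 \<noteq> 0" using U by simp
        moreover have "U ^ 45 = U ^ 37 * U ^ 8" by (simp flip: power_add)
        ultimately show ?thesis by (metis nonzero_divide_mult_cancel_left)
      qed
      finally show "G\<^sup>2 * Zb \<rho> / real k \<le> 1 / U ^ 8" .
    qed (use Z0 in auto)
    finally have "U ^ (32 * u ^ 4) * (fact k * (G\<^sup>2 * Zb \<rho>) ^ k / fact (2 * k)) \<le> U ^ (32 * u ^ 4) * (1 / U ^ 8) ^ k"
      using U by (intro mult_left_mono) auto
    also have "\<dots> = U ^ (32 * u ^ 4) * U ^ 4 / U ^ (8 * k) / U ^ 4"
      using U by (simp add: power_divide power_mult)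
    also have "\<dots> = U ^ (32 * u ^ 4 + 4) / U ^ (8 * k) / U ^ 4" by (simp add: power_add)
    also have "\<dots> \<le> 1 / U ^ 4"
    proof (intro divide_right_mono)
      have "u ^ 4 * 16 ^ 1 \<le> u ^ 4 * u ^ 41"
        using u(1) power_increasing[of 1 41 u] by (intro mult_left_mono) auto
      hence "u ^ 4 * 16 \<le> k" by (simp add: k_def flip: power_add)
      moreover have "u ^ 4 \<ge> 1" using u(1) by simp
      ultimately have "32 * u ^ 4 + 4 \<le> 8 * k" by linarith
      thus "U ^ (32 * u ^ 4 + 4) / U ^ (8 * k) \<le> 1" using U by simp
    qed (use U in auto)
    finally show ?thesis .
  qed
  \<comment> \<open>At most \<open>u ^ 4\<close> points, \<open>u ^ 16\<close> nodes in each real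
    direction, period \<open>u ^ 2\<close> and \<open>\<epsilon> = 1 / u ^ 4\<close>: then
    \<open>2 / m\<close>, \<open>8 * m * P^2 / (N * \<epsilon>)\<close> and \<open>1 / P^2\<close>
    are all of order \<open>1 / u ^ 4\<close>.\<close>
  have "norm (complex_of_real (\<integral>x. Phi \<omega> f (cball 0 r) (rand_char.Q ch {1..Y} x) \<partial>M) - ideal (u ^ 4) Y (u ^ 16) (U\<^sup>2) k)
    \<le> L0 * ((1 + V2) / (r1 - r) * (2 / real (u ^ 4))) + \<Lambda> * (F / (\<rho> - r) * (2 / real (u ^ 4)))
      + (L0 * (1 / U ^ 4 + 8 * real (u ^ 4) * (U\<^sup>2)\<^sup>2 / (real (u ^ 16) * (1 / U ^ 4))) + 32 * W0 * V2 / (U\<^sup>2)\<^sup>2)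
      + W0 * real (u ^ 16) ^ (2 * u ^ 4) * (4 * eta * (U ^ (b + 22)) ^ (2 * k) + fact k * (G\<^sup>2 * Zb \<rho>) ^ k / fact (2 * k))"
    using u U k by (intro Phi_ideal_approx[OF qc] order.refl G_eq H H1 V2_def) (auto simp: Y_def)
  also have "\<dots> \<le> 2 * L0 * (1 + V) / (r1 - r) / U ^ 4 + 2 * \<Lambda> * F / (\<rho> - r) / U ^ 4 + (9 * L0 / U ^ 4 + 32 * W0 * V / U ^ 4) + 2 * W0 / U ^ 4"
  proof (intro add_mono)
    have "L0 * ((1 + V2) / (r1 - r) * (2 / real (u ^ 4))) \<le> L0 * ((1 + V) / (r1 - r) * (2 / U ^ 4))"
      unfolding U_def of_nat_power using V2V r1 L0 by (intro mult_left_mono mult_right_mono divide_right_mono) auto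
    thus "L0 * ((1 + V2) / (r1 - r) * (2 / real (u ^ 4))) \<le> 2 * L0 * (1 + V) / (r1 - r) / U ^ 4"
      by (simp add: U_def[symmetric] algebra_simps)
    show "\<Lambda> * (F / (\<rho> - r) * (2 / real (u ^ 4))) \<le> 2 * \<Lambda> * F / (\<rho> - r) / U ^ 4"
      by (simp add: U_def mult_ac)
    have "8 * real (u ^ 4) * (U\<^sup>2)\<^sup>2 / (real (u ^ 16) * (1 / U ^ 4)) = 8 / U ^ 4"
    proof -
      have "U ^ 16 = U ^ 4 * U ^ 4 * U ^ 4 * U ^ 4" by (simp flip: power_add)
      thus ?thesis using U by (simp add: U_def[symmetric] field_simps flip: power_mult)
    qed
    thus "L0 * (1 / U ^ 4 + 8 * real (u ^ 4) * (U\<^sup>2)\<^sup>2 / (real (u ^ 16) * (1 / U ^ 4))) \<le> 9 * L0 / U ^ 4"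
      by (simp add: field_simps)
    have "32 * W0 * V2 / U ^ 4 \<le> 32 * W0 * V / U ^ 4"
      using V2V W0_nonneg U by (intro divide_right_mono mult_left_mono) auto
    thus "32 * W0 * V2 / (U\<^sup>2)\<^sup>2 \<le> 32 * W0 * V / U ^ 4" by (simp flip: power_mult)
    have "W0 * real (u ^ 16) ^ (2 * u ^ 4) * (4 * eta * (U ^ (b + 22)) ^ (2 * k) + fact k * (G\<^sup>2 * Zb \<rho>) ^ k / fact (2 * k))
      = W0 * (U ^ (32 * u ^ 4) * (4 * eta * U ^ ((b + 22) * (2 * k))) + U ^ (32 * u ^ 4) * (fact k * (G\<^sup>2 * Zb \<rho>) ^ k / fact (2 * k)))"
    proof -
      have 1: "real (u ^ 16) ^ (2 * u ^ 4) = U ^ (32 * u ^ 4)"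
        unfolding U_def of_nat_power power_mult[symmetric] by (rule arg_cong[where f = "\<lambda>e. real u ^ e"]) simp
      show ?thesis unfolding 1 power_mult[of U "b + 22" "2 * k"] by (simp only: distrib_left mult.assoc)
    qed
    also have "\<dots> \<le> W0 * (1 / U ^ 4 + 1 / U ^ 4)"
      by (intro mult_left_mono add_mono eta(2) tail W0_nonneg)
    also have "\<dots> = 2 * W0 / U ^ 4" by simp
    finally show "W0 * real (u ^ 16) ^ (2 * u ^ 4) * (4 * eta * (U ^ (b + 22)) ^ (2 * k) + fact k * (G\<^sup>2 * Zb \<rho>) ^ k / fact (2 * k))
      \<le> 2 * W0 / U ^ 4" .
  qed
  also have "\<dots> = (2 * L0 * (1 + V) / (r1 - r) + 2 * \<Lambda> * F / (\<rho> - r) + 9 * L0 + 32 * W0 * V + 2 * W0) / U ^ 4"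
    by (simp add: add_divide_distrib)
  finally show ?thesis .
qed

text \<open>The average \<open>I2\<close> over \<open>t\<close> and the expectation
  \<open>I3\<close> lie within \<open>E / u ^ 4\<close> of the same number \<open>J\<close>, the
  first because \<open>T\<close> is large enough for its \<open>eta\<close>, the second with
  \<open>eta = 0\<close>. The outer integrals are attached to these two by truncation at
  \<open>Y\<close>.\<close>

lemma (in universality) zeta_functional_random:
  fixes M :: "'b measure"
  assumes re: "random_euler M X"
  shows "\<exists>C u0 c. C \<ge> 0 \<and> (\<forall>u\<ge>u0. \<forall>T\<ge>real u ^ (c * u ^ 45).
    \<bar>(\<integral>t. \<omega> (SUP z\<in>cball 0 r. cmod (riemann_zeta (3 / 4 + \<i> * of_real t + z) - f z)) \<partial>tmeas T)
      - (\<integral>x. \<omega> (SUP z\<in>cball 0 r. cmod (random_zeta X x (3 / 4 + z) - f z)) \<partial>completion M)\<bar> \<le> C / real u ^ 4)"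
proof -
  interpret re: random_euler M X by (rule re)
  have \<rho>: "\<rho> > 0" "\<rho> < 1 / 4" using r by auto
  have \<beta>: "bet \<rho> > 0" using \<rho> by (simp add: bet_def)
  have Z0: "Zb \<rho> \<ge> 0" using Zb_nonneg \<rho> by simp
  obtain C1 T0 where C1: "C1 \<ge> 0" "T0 \<ge> 1" and C1': "\<forall>T Y K. T \<ge> T0 \<longrightarrow> Y \<ge> 1 \<longrightarrow> Y \<le> 2 ^ K \<longrightarrow> 2 * real Y ^ K \<le> T \<longrightarrow> K \<ge> 3 \<longrightarrow>
    \<bar>(\<integral>t. \<omega> (SUP z\<in>cball 0 r. cmod (riemann_zeta (3 / 4 + \<i> * of_real t + z) - f z)) \<partial>tmeas T)
      - (\<integral>t. Phi \<omega> f (cball 0 r) (rand_char.Q tch {1..Y} t) \<partial>tmeas T)\<bar>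
    \<le> C1 * (sqrt (real Y powr (- bet \<rho>) + T powr (- bet \<rho> / 2)) + exp (- real K / 4) + 1 / (real K)\<^sup>2)"
    using zeta_functional_approx by (elim exE conjE)
  \<comment> \<open>Then \<open>Y = u ^ b\<close> satisfies
    \<open>Y powr (- bet \<rho>) \<le> 1 / u ^ 8\<close>, whose square root is the desired
    \<open>1 / u ^ 4\<close>.\<close>
  define b where "b = nat \<lceil>8 / bet \<rho>\<rceil>"
  have b: "real b * bet \<rho> \<ge> 8"
  proof -
    have "8 / bet \<rho> \<le> real b" using \<beta> by (simp add: b_def real_nat_ceiling_ge)
    thus ?thesis using \<beta> by (simp add: field_simps)
  qed
  define V where "V = \<rho> / (\<rho> - r1) * (Zb \<rho> + 1)"
  have V: "V \<ge> 0" unfolding V_def using \<rho> r1 Z0 by (intro mult_nonneg_nonneg) auto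
  define E where "E = 2 * L0 * (1 + V) / (r1 - r) + 2 * \<Lambda> * F / (\<rho> - r) + 9 * L0 + 32 * W0 * V + 2 * W0"
  have E: "E \<ge> 0" unfolding E_def using L0 V r r1 Lam0 F0 W0_nonneg
    by (intro add_nonneg_nonneg mult_nonneg_nonneg divide_nonneg_nonneg) auto
  define R where "R = L0 * sqrt (\<rho> / (\<rho> - r) * Zb \<rho>)"
  have R: "R \<ge> 0" unfolding R_def using L0 r \<rho> Z0 by (intro mult_nonneg_nonneg) auto
  \<comment> \<open>The powers of \<open>u\<close> that \<open>T\<close> must absorb are
    \<open>2 * b * k\<close> from \<open>eta\<close>, \<open>(b + 22) * (2 * k)\<close> from the
    moments and \<open>32 * u ^ 4\<close> from the number of nodes, with a few units more; in
    multiples of \<open>k\<close> this stays below \<open>4 * b + 100\<close>.\<close>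
  define c where "c = 4 * b + 100"
  define u0 where "u0 = 16 + b + nat \<lceil>16 * pi\<^sup>2 * Zb \<rho>\<rceil> + nat \<lceil>T0\<rceil>"
  define I1 where "I1 T = (\<integral>t. \<omega> (SUP z\<in>cball 0 r. cmod (riemann_zeta (3 / 4 + \<i> * of_real t + z) - f z)) \<partial>tmeas T)" for T
  define I4 where "I4 = (\<integral>x. \<omega> (SUP z\<in>cball 0 r. cmod (random_zeta X x (3 / 4 + z) - f z)) \<partial>completion M)"
  have "\<bar>I1 T - I4\<bar> \<le> (4 * C1 + 2 * E + R) / real u ^ 4" if u0: "u \<ge> u0" and T: "T \<ge> real u ^ (c * u ^ 45)" for u :: nat and T :: real
  proof -
    define U where "U = real u"
    have u: "u \<ge> 16" "u \<ge> b" using u0 by (auto simp: u0_def)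
    have U: "U \<ge> 16" "U > 0" using u by (auto simp: U_def)
    have "real (nat \<lceil>16 * pi\<^sup>2 * Zb \<rho>\<rceil>) \<le> real u" "real (nat \<lceil>T0\<rceil>) \<le> real u"
      using u0 unfolding u0_def of_nat_le_iff by linarith+
    hence uZ: "real u \<ge> 16 * pi\<^sup>2 * Zb \<rho>" and UT0: "U \<ge> T0"
      using real_nat_ceiling_ge[of "16 * pi\<^sup>2 * Zb \<rho>"] real_nat_ceiling_ge[of T0] unfolding U_def by linarith+
    define k where "k = u ^ 45"
    define Y where "Y = u ^ b"
    have ku: "k \<ge> u ^ e" if "e \<le> 45" for e unfolding k_def using u that by (intro power_increasing) auto
    have k1: "k \<ge> 16" using ku[of 1] u by simp
    have TU: "U ^ e \<le> T" if "e \<le> c * k" for e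
    proof -
      have "U ^ e \<le> U ^ (c * k)" using U that by (intro power_increasing) auto
      thus ?thesis using T by (simp add: U_def k_def)
    qed
    have ck: "c * k = 4 * (b * k) + 100 * k" by (simp add: c_def algebra_simps)
    have bk: "b \<le> b * k" using k1 by simp
    have T1: "T \<ge> U" using TU[of 1] ck k1 by simp
    have Tpos: "T > 0" using T1 U by simp
    have Y1: "Y \<ge> 1" using u by (simp add: Y_def)
    have YU: "real Y = U ^ b" by (simp add: Y_def U_def)
    have Yb: "real Y powr (- bet \<rho>) \<le> 1 / U ^ 8"
    proof -
      have "real Y powr (- bet \<rho>) = U powr (- (real b * bet \<rho>))"
        using U by (simp add: YU powr_powr flip: powr_realpow)
      also have "\<dots> \<le> U powr (- real 8)" using U b by (intro powr_mono) auto
      also have "\<dots> = 1 / U ^ 8" using U powr_realpow[of U 8] by (simp only: powr_minus_divide)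
      finally show ?thesis .
    qed

    \<comment> \<open>The degree of the Taylor polynomial is also set to \<open>k\<close>: as
      \<open>b \<le> u\<close>, this gives \<open>Y \<le> 2 ^ (u * u) \<le> 2 ^ k\<close>, while
      \<open>2 * Y ^ k\<close> remains below \<open>T\<close>.\<close>
    have "\<bar>I1 T - (\<integral>t. Phi \<omega> f (cball 0 r) (rand_char.Q tch {1..Y} t) \<partial>tmeas T)\<bar>
      \<le> C1 * (sqrt (real Y powr (- bet \<rho>) + T powr (- bet \<rho> / 2)) + exp (- real k / 4) + 1 / (real k)\<^sup>2)"
      unfolding I1_def
    proof (rule C1'[rule_format])
      show "T0 \<le> T" using T1 UT0 by simp
      have "Y \<le> (2 ^ u) ^ b" unfolding Y_def by (intro power_mono) (auto intro: less_imp_le)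
      also have "\<dots> \<le> 2 ^ (u * u)" unfolding power_mult[symmetric] using u by (intro power_increasing) auto
      also have "\<dots> \<le> 2 ^ k" using ku[of 2] by (intro power_increasing) (auto simp: power2_eq_square)
      finally show "Y \<le> 2 ^ k" .
      have "2 * real Y ^ k \<le> U * U ^ (b * k)" unfolding YU power_mult[symmetric] using U by (intro mult_right_mono) auto
      also have "\<dots> = U ^ Suc (b * k)" by simp
      also have "\<dots> \<le> T" using k1 ck by (intro TU) linarith
      finally show "2 * real Y ^ k \<le> T" .
    qed (use Y1 k1 in auto)
    also have "\<dots> \<le> C1 * (2 / U ^ 4 + 1 / U ^ 4 + 1 / U ^ 4)"
    proof (intro mult_left_mono add_mono C1(1))
      have "T powr (- bet \<rho> / 2) \<le> (real Y ^ 2) powr (- bet \<rho> / 2)"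
      proof (rule powr_mono2')
        have "real Y ^ 2 = U ^ (2 * b)" by (simp add: YU power_mult[symmetric] mult.commute)
        also have "\<dots> \<le> T" using bk ck by (intro TU) linarith
        finally show "real Y ^ 2 \<le> T" .
      qed (use Y1 \<beta> in auto)
      also have "\<dots> = real Y powr (- bet \<rho>)"
      proof -
        have "(real Y)\<^sup>2 = real Y powr 2" by simp
        thus ?thesis by (simp only: powr_powr) simp
      qed
      finally have "real Y powr (- bet \<rho>) + T powr (- bet \<rho> / 2) \<le> 2 / U ^ 8" using Yb by simp
      also have "\<dots> \<le> (2 / U ^ 4)\<^sup>2"
        using U by (simp add: power_divide divide_right_mono flip: power_mult)
      finally have "sqrt (real Y powr (- bet \<rho>) + T powr (- bet \<rho> / 2)) \<le> sqrt ((2 / U ^ 4)\<^sup>2)"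
        by (rule real_sqrt_le_mono)
      also have "\<dots> = 2 / U ^ 4" using U by simp
      finally show "sqrt (real Y powr (- bet \<rho>) + T powr (- bet \<rho> / 2)) \<le> 2 / U ^ 4" .
      have kU: "U ^ e \<le> real k" if "e \<le> 45" for e
        using ku[OF that] unfolding U_def of_nat_power[symmetric] by (rule of_nat_mono)
      have "4 * U ^ 4 \<le> U * U ^ 4" using U by (intro mult_right_mono) auto
      also have "\<dots> = U ^ 5" by (simp flip: power_Suc)
      also have "\<dots> \<le> real k" by (rule kU) simp
      finally have "U ^ 4 \<le> real k / 4" by simp
      also have "\<dots> \<le> exp (real k / 4)" using exp_ge_add_one_self[of "real k / 4"] by linarith
      finally have "1 / exp (real k / 4) \<le> 1 / U ^ 4" using U by (intro divide_left_mono) auto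
      thus "exp (- real k / 4) \<le> 1 / U ^ 4" by (simp add: exp_minus field_simps)
      have "U ^ 4 = (U ^ 2) ^ 2" by (simp flip: power_mult)
      also have "\<dots> \<le> (real k)\<^sup>2" using kU[of 2] by (intro power_mono) auto
      finally show "1 / (real k)\<^sup>2 \<le> 1 / U ^ 4" using U k1 by (intro divide_left_mono) auto
    qed
    finally have 1: "\<bar>I1 T - (\<integral>t. Phi \<omega> f (cball 0 r) (rand_char.Q tch {1..Y} t) \<partial>tmeas T)\<bar> \<le> 4 * C1 / U ^ 4"
      by (simp add: field_simps)

    define I2 where "I2 = (\<integral>t. Phi \<omega> f (cball 0 r) (rand_char.Q tch {1..Y} t) \<partial>tmeas T)"
    define I3 where "I3 = (\<integral>x. Phi \<omega> f (cball 0 r) (rand_char.Q (multchar X) {1..Y} x) \<partial>M)"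
    define J where "J = ideal (u ^ 4) Y (u ^ 16) (U\<^sup>2) k"
    have J2: "norm (complex_of_real I2 - J) \<le> E / U ^ 4"
      unfolding I2_def J_def E_def U_def Y_def k_def
    proof (rule Phi_ideal_rate[OF _ u(1) uZ])
      define eta where "eta = 2 * real ((u ^ b) ^ (2 * u ^ 45)) / T"
      show "quasi_char (tmeas T) tch ((u ^ b) ^ (2 * u ^ 45)) eta"
        unfolding eta_def by (rule quasi_char_tch[OF Tpos])
      have eta_le: "eta \<le> U ^ (1 + 2 * (b * k)) / T"
      proof -
        have "2 * real ((u ^ b) ^ (2 * u ^ 45)) \<le> U * U ^ (2 * (b * k))"
        proof (intro mult_mono)
          have "real ((u ^ b) ^ (2 * u ^ 45)) = U ^ (b * (2 * k))" by (simp add: U_def k_def power_mult)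
          thus "real ((u ^ b) ^ (2 * u ^ 45)) \<le> U ^ (2 * (b * k))" by (simp add: mult.left_commute)
        qed (use U in auto)
        thus ?thesis unfolding eta_def using Tpos by (intro divide_right_mono) auto
      qed
      have "eta * (U ^ b)\<^sup>2 \<le> U ^ (1 + 2 * (b * k)) / T * (U ^ b)\<^sup>2"
        using eta_le by (intro mult_right_mono) auto
      also have "\<dots> = U ^ (1 + 2 * (b * k) + 2 * b) / T" by (simp add: power_add power_mult mult.commute flip: power_mult)
      also have "\<dots> \<le> 1" using Tpos ck bk k1 by (simp only: divide_le_eq_1_pos) (intro TU, linarith)
      finally show "eta * (real (u ^ b))\<^sup>2 \<le> 1" by (simp add: U_def)
      have "U ^ (32 * u ^ 4) * (4 * eta * U ^ ((b + 22) * (2 * k)))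
        \<le> U ^ (32 * u ^ 4) * (U * (U ^ (1 + 2 * (b * k)) / T) * U ^ ((b + 22) * (2 * k)))"
        using eta_le U Tpos by (intro mult_left_mono mult_right_mono mult_mono) (auto simp: eta_def)
      also have "\<dots> = U ^ (32 * u ^ 4 + 1 + (1 + 2 * (b * k)) + (b + 22) * (2 * k)) / T"
        by (simp add: power_add)
      also have "\<dots> = U ^ (32 * u ^ 4 + 1 + (1 + 2 * (b * k)) + (b + 22) * (2 * k) + 4) / T / U ^ 4"
        unfolding power_add[of U _ 4] using U by simp
      also have "\<dots> \<le> 1 / U ^ 4"
      proof (intro divide_right_mono)
        have "(b + 22) * (2 * k) = 2 * (b * k) + 44 * k" by (simp add: algebra_simps)
        moreover have "u ^ 4 \<le> k" by (rule ku) simp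
        ultimately have "32 * u ^ 4 + 1 + (1 + 2 * (b * k)) + (b + 22) * (2 * k) + 4 \<le> c * k"
          using ck k1 by linarith
        thus "U ^ (32 * u ^ 4 + 1 + (1 + 2 * (b * k)) + (b + 22) * (2 * k) + 4) / T \<le> 1"
          using TU Tpos by (simp only: divide_le_eq_1_pos)
      qed (use U in auto)
      finally show "real u ^ (32 * u ^ 4) * (4 * eta * real u ^ ((b + 22) * (2 * u ^ 45))) \<le> 1 / real u ^ 4"
        by (simp only: U_def k_def)
    qed (rule V_def)
    have J3: "norm (complex_of_real I3 - J) \<le> E / U ^ 4"
      unfolding I3_def J_def E_def U_def Y_def k_def
      by (rule Phi_ideal_rate[OF re.quasi u(1) uZ _ _ V_def]) auto
    have "\<bar>I2 - I3\<bar> = norm (complex_of_real I2 - complex_of_real I3)"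
      by (simp only: norm_of_real flip: of_real_diff)
    also have "\<dots> = norm ((complex_of_real I2 - J) - (complex_of_real I3 - J))" by simp
    also have "\<dots> \<le> E / U ^ 4 + E / U ^ 4"
      by (intro order.trans[OF norm_triangle_ineq4] add_mono J2 J3)
    finally have 2: "\<bar>I2 - I3\<bar> \<le> E / U ^ 4 + E / U ^ 4" .

    have "\<bar>I4 - (\<integral>x. Phi \<omega> f (cball 0 r) (rand_char.Q (multchar X) {1..Y} x) \<partial>M)\<bar>
      \<le> L0 * sqrt (\<rho> / (\<rho> - r) * (real Y powr (- bet \<rho>) * Zb \<rho>))"
      unfolding I4_def by (rule random_zeta_functional_approx[OF re Y1])
    also have "\<dots> \<le> L0 * sqrt (\<rho> / (\<rho> - r) * Zb \<rho> * (1 / U ^ 4)\<^sup>2)"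
    proof (intro mult_left_mono L0 real_sqrt_le_mono)
      have "real Y powr (- bet \<rho>) \<le> (1 / U ^ 4)\<^sup>2"
        using Yb by (simp add: power_divide flip: power_mult)
      hence "\<rho> / (\<rho> - r) * (real Y powr (- bet \<rho>) * Zb \<rho>) \<le> \<rho> / (\<rho> - r) * ((1 / U ^ 4)\<^sup>2 * Zb \<rho>)"
        using r Z0 by (intro mult_left_mono mult_right_mono) auto
      thus "\<rho> / (\<rho> - r) * (real Y powr (- bet \<rho>) * Zb \<rho>) \<le> \<rho> / (\<rho> - r) * Zb \<rho> * (1 / U ^ 4)\<^sup>2"
        by (simp only: mult_ac)
    qed
    also have "\<dots> = R / U ^ 4" unfolding R_def real_sqrt_mult using U by simp
    finally have 3: "\<bar>I4 - (\<integral>x. Phi \<omega> f (cball 0 r) (rand_char.Q (multchar X) {1..Y} x) \<partial>M)\<bar> \<le> R / U ^ 4" .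
    have "(4 * C1 + 2 * E + R) / U ^ 4 = 4 * C1 / U ^ 4 + (E / U ^ 4 + E / U ^ 4) + R / U ^ 4"
      by (simp add: add_divide_distrib)
    with 1[folded I2_def] 2 3[folded I3_def] show ?thesis unfolding U_def[symmetric] by linarith
  qed
  moreover have "4 * C1 + 2 * E + R \<ge> 0" using C1(1) E R by simp
  ultimately show ?thesis unfolding I1_def I4_def by blast
qed

section \<open>Test functions and the passage from \<open>u\<close> to \<open>T\<close>\<close>

lemma C1_compact_support_test_functional:
  fixes \<omega> :: "real \<Rightarrow> real"
  assumes C1: "\<omega> C1_differentiable_on UNIV" and cpt: "compact (closure {x. \<omega> x \<noteq> 0})"
  shows "\<exists>W0 \<Lambda> A. test_functional \<omega> W0 \<Lambda> A"
proof -
  from C1 obtain D where D: "\<And>x. (\<omega> has_vector_derivative D x) (at x)" "continuous_on UNIV D"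
    unfolding C1_differentiable_on_def by auto
  have "bounded {x. \<omega> x \<noteq> 0}"
    using compact_imp_bounded[OF cpt] closure_subset by (rule bounded_subset)
  then obtain B where B: "B > 0" "\<And>x. \<omega> x \<noteq> 0 \<Longrightarrow> norm x \<le> B"
    unfolding bounded_pos by auto
  define A where "A = B + 1"
  have zero: "\<omega> x = 0" if "\<bar>x\<bar> \<ge> A" for x using B(2)[of x] that by (auto simp: A_def)
  \<comment> \<open>Clamping to \<open>[-A, A]\<close> leaves \<omega> unchanged, since it vanishes
    at the endpoints and outside, and it does not increase distances. Bound and Lipschitz constant
    on the interval thus extend to the line.\<close>
  define \<pi> where "\<pi> x = max (- A) (min A x)" for x
  have \<pi>: "\<pi> x \<in> {- A..A}" "\<omega> (\<pi> x) = \<omega> x" "\<bar>\<pi> x - \<pi> y\<bar> \<le> \<bar>x - y\<bar>" for x y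
  proof -
    show "\<pi> x \<in> {- A..A}" using B(1) by (auto simp: \<pi>_def A_def)
    consider "\<bar>x\<bar> \<le> A" | "\<bar>x\<bar> \<ge> A" by linarith
    thus "\<omega> (\<pi> x) = \<omega> x"
    proof cases
      case 2
      hence "\<bar>\<pi> x\<bar> \<ge> A" using B(1) by (auto simp: \<pi>_def A_def)
      thus ?thesis using zero 2 by simp
    qed (auto simp: \<pi>_def)
    show "\<bar>\<pi> x - \<pi> y\<bar> \<le> \<bar>x - y\<bar>" by (auto simp: \<pi>_def min_def max_def)
  qed
  have "continuous_on {- A..A} \<omega>"
    using D(1) by (intro continuous_at_imp_continuous_on) (blast intro: has_vector_derivative_continuous)
  hence "bounded (\<omega> ` {- A..A})" by (intro compact_imp_bounded compact_continuous_image) auto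
  then obtain W0 where W0: "\<And>x. x \<in> {- A..A} \<Longrightarrow> \<bar>\<omega> x\<bar> \<le> W0"
    unfolding bounded_iff ball_simps real_norm_def by blast
  have "continuous_on {- A..A} D" using D(2) by (rule continuous_on_subset) auto
  hence "bounded (D ` {- A..A})" by (intro compact_imp_bounded compact_continuous_image) auto
  then obtain \<Lambda> where \<Lambda>: "\<Lambda> > 0" "\<And>x. x \<in> {- A..A} \<Longrightarrow> \<bar>D x\<bar> \<le> \<Lambda>"
    unfolding bounded_pos ball_simps real_norm_def by blast
  have lip: "\<bar>\<omega> x - \<omega> y\<bar> \<le> \<Lambda> * \<bar>x - y\<bar>" if "x \<in> {- A..A}" "y \<in> {- A..A}" for x y
  proof -
    have "norm (\<omega> x - \<omega> y) \<le> \<Lambda> * norm (x - y)"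
    proof (rule differentiable_bound[OF convex_real_interval(5) _ _ that])
      fix z assume z: "z \<in> {- A..A}"
      show "(\<omega> has_derivative (\<lambda>h. h *\<^sub>R D z)) (at z within {- A..A})"
        using D(1)[of z] unfolding has_vector_derivative_def by (rule has_derivative_at_withinI)
      show "onorm (\<lambda>h. h *\<^sub>R D z) \<le> \<Lambda>"
        using \<Lambda>(2)[OF z] \<Lambda>(1) by (intro onorm_le) (simp add: abs_mult mult.commute[of \<Lambda>] mult_left_mono)
    qed
    thus ?thesis by simp
  qed
  have "test_functional \<omega> W0 \<Lambda> A"
  proof
    show "\<bar>\<omega> x\<bar> \<le> W0" for x using W0[OF \<pi>(1)[of x]] \<pi>(2)[of x] by simp
    show "\<bar>\<omega> x - \<omega> y\<bar> \<le> \<Lambda> * \<bar>x - y\<bar>" for x y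
    proof -
      have "\<bar>\<omega> x - \<omega> y\<bar> \<le> \<Lambda> * \<bar>\<pi> x - \<pi> y\<bar>"
        using lip[OF \<pi>(1)[of x] \<pi>(1)[of y]] by (simp only: \<pi>(2))
      also have "\<dots> \<le> \<Lambda> * \<bar>x - y\<bar>" using \<Lambda>(1) by (intro mult_left_mono \<pi>(3)) auto
      finally show ?thesis .
    qed
    show "\<omega> x = 0" if "x \<ge> A" for x using that by (intro zero) auto
  qed (use \<Lambda>(1) B(1) in \<open>auto simp: A_def\<close>)
  thus ?thesis by blast
qed

text \<open>With \<open>u\<close> the integer part of \<open>ln T powr (1 / 50)\<close>, the
  requirement on \<open>T\<close> becomes \<open>c * u ^ 45 * ln u \<le> ln T\<close>. One factor
  \<open>u\<close> absorbs \<open>c\<close> and another \<open>ln u\<close>, which gives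
  \<open>u ^ 47 \<le> u ^ 50 \<le> ln T\<close>. Rounding down loses at most a factor 2 in
  \<open>u\<close>, hence the 16.\<close>

lemma bigo_of_power_rate:
  fixes h :: "real \<Rightarrow> real"
  assumes C: "C \<ge> 0" and h: "\<And>u T. u \<ge> u0 \<Longrightarrow> T \<ge> real u ^ (c * u ^ 45) \<Longrightarrow> T > 0 \<Longrightarrow> \<bar>h T\<bar> \<le> C / real u ^ 4"
    and a: "a \<le> 4 / 50"
  shows "h \<in> O[at_top](\<lambda>T. ln T powr (- a))"
proof (rule bigoI[where c = "16 * C"])
  define B where "B = real (2 + u0 + c)"
  have "filterlim (\<lambda>T::real. ln T powr (1 / 50)) at_top at_top" by real_asymp
  hence "\<forall>\<^sub>F T in at_top. ln T powr (1 / 50) \<ge> B" by (auto simp: filterlim_at_top)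
  moreover have "\<forall>\<^sub>F T::real in at_top. T \<ge> 3" by (rule eventually_ge_at_top)
  ultimately show "\<forall>\<^sub>F T in at_top. norm (h T) \<le> 16 * C * norm (ln T powr (- a))"
  proof eventually_elim
    case (elim T)
    have "exp 1 \<le> T" using exp_le elim(2) by linarith
    hence lnT: "ln T \<ge> 1" using elim(2) by (subst ln_ge_iff) auto
    define x where "x = ln T powr (1 / 50)"
    define u where "u = nat \<lfloor>x\<rfloor>"
    define U where "U = real u"
    have x: "x \<ge> real (2 + u0 + c)" using elim(1) by (simp add: x_def B_def)
    have "real u = of_int \<lfloor>x\<rfloor>" unfolding u_def using x by (intro of_nat_nat) linarith
    hence ux: "U \<le> x" "x < U + 1" unfolding U_def by linarith+
    have u: "u \<ge> 2 + u0 + c" unfolding u_def using x by (simp add: le_nat_floor)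
    have U: "U \<ge> 2" "U \<ge> real c" using u by (auto simp: U_def)
    have "real (c * u ^ 45) * ln U \<le> U * U ^ 45 * U"
      unfolding of_nat_mult of_nat_power U_def[symmetric] using U ln_le_minus_one[of U]
      by (intro mult_mono mult_right_mono) (auto simp: ln_ge_zero)
    also have "\<dots> = U ^ 47" by (simp flip: power_Suc power_Suc2)
    also have "\<dots> \<le> U ^ 50" using U by (intro power_increasing) auto
    also have "\<dots> \<le> x ^ 50" using U ux by (intro power_mono) auto
    also have "\<dots> = x powr real 50" using x by (subst powr_realpow) (auto simp: x_def)
    also have "\<dots> = ln T" using lnT unfolding x_def powr_powr by simp
    finally have "exp (real (c * u ^ 45) * ln U) \<le> exp (ln T)" by simp
    hence TU: "real u ^ (c * u ^ 45) \<le> T" using U elim(2) unfolding exp_of_nat_mult by (simp add: U_def)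
    have "\<bar>h T\<bar> \<le> C / U ^ 4" unfolding U_def using u elim(2) by (intro h TU) auto
    also have "\<dots> \<le> C / (x / 2) ^ 4"
    proof (intro divide_left_mono power_mono C)
      show "x / 2 \<le> U" using ux U by linarith
    qed (use x U in auto)
    also have "\<dots> = 16 * C / x ^ 4" by (simp add: power_divide)
    also have "\<dots> = 16 * C / x powr real 4" using x by (subst powr_realpow) (auto simp: x_def)
    also have "\<dots> = 16 * C * ln T powr (- (4 / 50))"
      unfolding x_def powr_powr powr_minus_divide by simp
    also have "\<dots> \<le> 16 * C * ln T powr (- a)"
      using C lnT a by (intro mult_left_mono powr_mono) auto
    finally show ?case by simp
  qed
qed

theorem theorem1p1:
  fixes M :: "'a measure" and X :: "nat \<Rightarrow> 'a \<Rightarrow> complex"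
    and r :: real and f :: "complex \<Rightarrow> complex" and \<omega> :: "real \<Rightarrow> real"
  assumes "prob_space M"
    and "prob_space.indep_vars M (\<lambda>_. borel) X {p. prime p}"
    and "\<And>p. prime p \<Longrightarrow> distr M borel (X p) = uniform_circle"
    and "0 < r" and "r < 1/4"
    and "continuous_on (cball 0 ((r + 1/4) / 2)) f"
    and "f holomorphic_on ball 0 ((r + 1/4) / 2)"
    and "\<And>z. z \<in> cball 0 ((r + 1/4) / 2) \<Longrightarrow> f z \<noteq> 0"
    and "\<omega> C1_differentiable_on UNIV"
    and "compact (closure {x. \<omega> x \<noteq> 0})"
  shows "\<exists>\<epsilon> :: real \<Rightarrow> real. (\<epsilon> \<longlongrightarrow> 0) at_top \<and>
    (\<lambda>T. 1 / T * (LBINT t:{T..2*T}.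
             \<omega> (SUP z\<in>cball 0 r. cmod (riemann_zeta (3/4 + \<i> * of_real t + z) - f z)))
          - (\<integral>x. \<omega> (SUP z\<in>cball 0 r. cmod (random_zeta X x (3/4 + z) - f z)) \<partial>completion M))
      \<in> O[at_top](\<lambda>T. ln T powr (- (3/4 - r) / 11 + \<epsilon> T))"
proof -
  define \<rho> where "\<rho> = (r + 1/4) / 2"
  have "bounded (f ` cball 0 \<rho>)" unfolding \<rho>_def
    by (intro compact_imp_bounded compact_continuous_image assms(6)) auto
  then obtain F where F: "\<forall>y\<in>f ` cball 0 \<rho>. norm y \<le> F"
    unfolding bounded_iff by blast
  obtain W0 \<Lambda> A where "test_functional \<omega> W0 \<Lambda> A"
    using C1_compact_support_test_functional[OF assms(9,10)] by blast
  then interpret test_functional \<omega> W0 \<Lambda> A .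
  interpret universality \<omega> W0 \<Lambda> A r \<rho> F f
    by unfold_locales (use assms(4-7) F in \<open>auto simp: \<rho>_def\<close>)
  have "random_euler M X"
    using assms(1-3) by (simp add: random_euler_def random_euler_axioms_def)
  from zeta_functional_random[OF this] obtain C u0 c where C: "C \<ge> 0" and bound: "\<forall>u\<ge>u0. \<forall>T\<ge>real u ^ (c * u ^ 45).
    \<bar>(\<integral>t. \<omega> (SUP z\<in>cball 0 r. cmod (riemann_zeta (3 / 4 + \<i> * of_real t + z) - f z)) \<partial>tmeas T)
      - (\<integral>x. \<omega> (SUP z\<in>cball 0 r. cmod (random_zeta X x (3 / 4 + z) - f z)) \<partial>completion M)\<bar> \<le> C / real u ^ 4"
    by (elim exE conjE)
  have "(\<lambda>T. 1 / T * (LBINT t:{T..2*T}.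
             \<omega> (SUP z\<in>cball 0 r. cmod (riemann_zeta (3/4 + \<i> * of_real t + z) - f z)))
          - (\<integral>x. \<omega> (SUP z\<in>cball 0 r. cmod (random_zeta X x (3/4 + z) - f z)) \<partial>completion M))
      \<in> O[at_top](\<lambda>T. ln T powr (- ((3/4 - r) / 11)))"
  proof (rule bigo_of_power_rate[OF C])
    show "\<bar>1 / T * (LBINT t:{T..2*T}.
             \<omega> (SUP z\<in>cball 0 r. cmod (riemann_zeta (3/4 + \<i> * of_real t + z) - f z)))
          - (\<integral>x. \<omega> (SUP z\<in>cball 0 r. cmod (random_zeta X x (3/4 + z) - f z)) \<partial>completion M)\<bar> \<le> C / real u ^ 4"
      if "u \<ge> u0" "T \<ge> real u ^ (c * u ^ 45)" "T > 0" for u :: nat and T :: real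
      using bound[rule_format, OF that(1,2)] unfolding tmeas_integral[OF that(3) zeta_functional_meas] by simp
  qed (use assms(4) in simp)
  \<comment> \<open>The rate used above is admissible because
    \<open>(3/4 - r) / 11 < 3/44 < 4/50\<close>; the witness for \<epsilon> is the zero
    function.\<close>
  thus ?thesis by (intro exI[of _ "\<lambda>_. 0"]) (simp add: minus_divide_left)
qed

end
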